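(* Let $m\in\mathbb{N}$, let $x_1,\dots,x_m\in\mathbb{R}^3$ be distinct, and let $H$ be the minimal Schr\"odinger operator $H=-\Delta$ in $L^2(\mathbb{R}^3)$, $\operatorname{dom}(H)=\{f\in W^{2,2}(\mathbb{R}^3):f(x_j)=0,\ j\in\{1,\dots,m\}\}$. Write $r_j=|x-x_j|$, $\xi_0=\{\xi_{0j}\}_{j=1}^m,\ \xi_1=\{\xi_{1j}\}_{j=1}^m\in\mathbb{C}^m$. Then: (i) $H$ is closed and symmetric with deficiency indices $n_\pm(H)=m$, and its defect subspace is $$\mathfrak{N}_z=\Bigl\{\sum_{j=1}^mc_j\frac{e^{i\sqrt z\,r_j}}{4\pi r_j}:\ c_j\in\mathbb{C},\ j\in\{1,\dots,m\}\Bigr\},\qquad z\in\mathbb{C}\setminus[0,\infty).$$ (ii) The adjoint operator $H^*$ is given by $$\operatorname{dom}(H^* )=\Bigl\{f=\sum_{j=1}^m\bigl(\xi_{0j}\tfrac{e^{-r_j}}{r_j}+\xi_{1j}e^{-r_j}\bigr)+f_H:\ \xi_0,\xi_1\in\mathbb{C}^m,\ f_H\in\operatorname{dom}(H)\Bigr\},$$ $$H^*f=-\sum_{j=1}^m\Bigl(\xi_{0j}\tfrac{e^{-r_j}}{r_j}+\xi_{1j}\bigl(e^{-r_j}-\tfrac{2e^{-r_j}}{r_j}\bigr)\Bigr)-\Delta f_H .$$ (iii) The triple $\Pi=\{\mathbb{C}^m,\Gamma_0,\Gamma_1\}$, where for $f\in\operatorname{dom}(H^* )$ decomposed as in (ii)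 $$\Gamma_0f=4\pi\bigl\{\lim_{x\to x_j}f(x)|x-x_j|\bigr\}_{j=1}^m=4\pi\{\xi_{0j}\}_{j=1}^m,\qquad \Gamma_1f=\Bigl\{\lim_{x\to x_j}\bigl(f(x)-\tfrac{\xi_{0j}}{|x-x_j|}\bigr)\Bigr\}_{j=1}^m,$$ forms a boundary triplet for $H^*$. (iv) The operator $H_0=H^*\upharpoonright\ker(\Gamma_0)\ (=H_0^* )$ coincides with the free Hamiltonian: $H_0=-\Delta$, $\operatorname{dom}(H_0)=W^{2,2}(\mathbb{R}^3)$.
   Context: $\sqrt{\cdot}$ is the branch of the square root with cut along $[0,\infty)$ with $\sqrt1=1$ (on the upper side of the cut), so that $\operatorname{Im}\sqrt z>0$ for $z\in\mathbb{C}\setminus[0,\infty)$. $\mathfrak{N}_z=\ker(H^*-z)$ is the defect subspace. A triple $\{\mathcal H,\Gamma_0,\Gamma_1\}$, with $\mathcal H$ an auxiliary Hilbert space and $\Gamma_0,\Gamma_1:\operatorname{dom}(A^* )\to\mathcal H$ linear, is a boundary triplet for the adjoint $A^*$ of a closed symmetric operator $A$ if $(A^*f,g)-(f,A^*g)=(\Gamma_1f,\Gamma_0g)_{\mathcal H}-(\Gamma_0f,\Gamma_1g)_{\mathcal H}$ for all $f,g\in\operatorname{dom}(A^* )$, and the mapping $(\Gamma_0,\Gamma_1)^\top:\operatorname{dom}(A^* )\to\mathcal H\oplus\mathcal H$ is surjective. *)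

theory Defs
  imports "HOL-Analysis.Analysis" "HOL-Library.Extended_Nat"
begin

section \<open>Complex Hilbert spaces\<close>

text \<open>
  The complex inner product is linear in its first argument; the norm and the topology are those of
  the underlying real Hilbert space, whose inner product is the real part.
\<close>

class complex_hilbert = real_inner + complete_space +
  fixes scaleC :: "complex \<Rightarrow> 'a \<Rightarrow> 'a" (infixr "*\<^sub>C" 75)
    and cinner :: "'a \<Rightarrow> 'a \<Rightarrow> complex"
  assumes scaleC_add_right: "a *\<^sub>C (x + y) = a *\<^sub>C x + a *\<^sub>C y"
    and scaleC_add_left: "(a + b) *\<^sub>C x = a *\<^sub>C x + b *\<^sub>C x"
    and scaleC_scaleC: "a *\<^sub>C b *\<^sub>C x = (a * b) *\<^sub>C x"
    and scaleC_of_real: "complex_of_real r *\<^sub>C x = r *\<^sub>R x"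
    and cinner_commute: "cinner x y = cnj (cinner y x)"
    and cinner_add_left: "cinner (x + y) z = cinner x z + cinner y z"
    and cinner_scaleC_left: "cinner (a *\<^sub>C x) y = a * cinner x y"
    and Re_cinner: "Re (cinner x y) = inner x y"

global_interpretation cvec: vector_space "scaleC :: complex \<Rightarrow> 'a::complex_hilbert \<Rightarrow> 'a"
proof
  show "1 *\<^sub>C x = x" for x :: 'a
    using scaleC_of_real[of 1 x] by simp
qed (simp_all add: scaleC_add_right scaleC_add_left scaleC_scaleC)

text \<open>
  The library's \<open>dim\<close> is 0 for subspaces without a finite basis; here their dimension is infinite.
\<close>

definition cdim :: "'a::complex_hilbert set \<Rightarrow> enat" where
  "cdim V = (if \<exists>B. finite B \<and> V \<subseteq> cvec.span B then enat (cvec.dim V) else \<infinity>)"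

instantiation vec :: (complex_hilbert, finite) complex_hilbert
begin
definition scaleC_vec :: "complex \<Rightarrow> 'a ^ 'b \<Rightarrow> 'a ^ 'b" where "a *\<^sub>C x = (\<chi> i. a *\<^sub>C x $ i)"
definition cinner_vec :: "'a ^ 'b \<Rightarrow> 'a ^ 'b \<Rightarrow> complex" where "cinner x y = (\<Sum>i\<in>UNIV. cinner (x $ i) (y $ i))"
instance
proof
  fix x y z :: "'a ^ 'b" and a b :: complex and r :: real
  show "cinner x y = cnj (cinner y x)"
    unfolding cinner_vec_def cnj_sum by (rule sum.cong) (auto intro: cinner_commute)
qed (simp_all add: scaleC_vec_def cinner_vec_def vec_eq_iff scaleC_add_right scaleC_add_left
   scaleC_scaleC scaleC_of_real cinner_add_left sum.distrib cinner_scaleC_left sum_distrib_left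
   Re_cinner inner_vec_def)
end

instantiation complex :: complex_hilbert
begin
definition scaleC_complex :: "complex \<Rightarrow> complex \<Rightarrow> complex" where "a *\<^sub>C x = a * x"
definition cinner_complex :: "complex \<Rightarrow> complex \<Rightarrow> complex" where "cinner x y = x * cnj y"
instance
  by standard (auto simp: scaleC_complex_def cinner_complex_def inner_complex_def algebra_simps scaleR_conv_of_real)
end

section \<open>The space \<open>L\<^sup>2\<close>\<close>

text \<open>
  Every class of Lebesgue measurable functions modulo null sets has a Borel measurable
  representative, so it suffices to consider Borel measurable functions.
\<close>

definition square_integrable :: "('a::euclidean_space \<Rightarrow> complex) \<Rightarrow> bool" where
  "square_integrable u \<longleftrightarrow> u \<in> borel_measurable lborel \<and> integrable lborel (\<lambda>x. (cmod (u x))\<^sup>2)"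

definition L2_eq :: "('a::euclidean_space \<Rightarrow> complex) \<Rightarrow> ('a \<Rightarrow> complex) \<Rightarrow> bool" where
  "L2_eq u v \<longleftrightarrow> square_integrable u \<and> square_integrable v \<and> (AE x in lborel. u x = v x)"

lemma square_integrable_zero: "square_integrable (\<lambda>x. 0)"
  by (simp add: square_integrable_def)

quotient_type (overloaded) 'a L2 = "'a::euclidean_space \<Rightarrow> complex" / partial: L2_eq
  morphisms L2_rep L2_class
proof (rule part_equivpI)
  show "\<exists>u. L2_eq u (u :: 'a \<Rightarrow> complex)"
    by (rule exI[of _ "\<lambda>x. 0"]) (simp add: L2_eq_def square_integrable_zero)
qed (auto simp: L2_eq_def symp_def transp_def elim: AE_mp)

lemma square_integrable_measurable [measurable_dest]:
  "square_integrable u \<Longrightarrow> u \<in> borel_measurable borel"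
  by (simp add: square_integrable_def)

lemma square_integrable_integrable_mult:
  assumes "square_integrable u" "square_integrable v"
  shows "integrable lborel (\<lambda>x. u x * v x)"
proof (rule Bochner_Integration.integrable_bound)
  show "integrable lborel (\<lambda>x. (cmod (u x))\<^sup>2 + (cmod (v x))\<^sup>2)"
    using assms by (auto simp: square_integrable_def)
  show "(\<lambda>x. u x * v x) \<in> borel_measurable lborel"
    using assms by (auto simp: square_integrable_def)
  show "AE x in lborel. norm (u x * v x) \<le> norm ((cmod (u x))\<^sup>2 + (cmod (v x))\<^sup>2)"
  proof (rule AE_I2)
    fix x
    have "2 * cmod (u x) * cmod (v x) \<le> (cmod (u x))\<^sup>2 + (cmod (v x))\<^sup>2"
      by (rule sum_squares_bound)
    moreover have "0 \<le> cmod (u x) * cmod (v x)" by simp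
    ultimately have "cmod (u x) * cmod (v x) \<le> (cmod (u x))\<^sup>2 + (cmod (v x))\<^sup>2" by linarith
    then show "norm (u x * v x) \<le> norm ((cmod (u x))\<^sup>2 + (cmod (v x))\<^sup>2)"
      by (simp add: norm_mult)
  qed
qed

lemma square_integrable_cnj: "square_integrable u \<Longrightarrow> square_integrable (\<lambda>x. cnj (u x))"
  by (auto simp: square_integrable_def
      intro: borel_measurable_continuous_on[of cnj] continuous_intros)

lemma square_integrable_scale: "square_integrable u \<Longrightarrow> square_integrable (\<lambda>x. a * u x)"
  by (auto simp: square_integrable_def norm_mult power_mult_distrib)

lemma square_integrable_add:
  assumes "square_integrable u" "square_integrable v"
  shows "square_integrable (\<lambda>x. u x + v x)"
  unfolding square_integrable_def
proof
  show [measurable]: "(\<lambda>x. u x + v x) \<in> borel_measurable lborel"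
    using assms by (auto simp: square_integrable_def)
  have "integrable lborel (\<lambda>x. 2 * ((cmod (u x))\<^sup>2 + (cmod (v x))\<^sup>2))"
    using assms by (auto simp: square_integrable_def)
  then show "integrable lborel (\<lambda>x. (cmod (u x + v x))\<^sup>2)"
  proof (rule Bochner_Integration.integrable_bound)
    show "AE x in lborel. norm ((cmod (u x + v x))\<^sup>2) \<le> norm (2 * ((cmod (u x))\<^sup>2 + (cmod (v x))\<^sup>2))"
    proof (rule AE_I2)
      fix x
      have "(cmod (u x + v x))\<^sup>2 \<le> (cmod (u x) + cmod (v x))\<^sup>2"
        by (intro power_mono norm_triangle_ineq) auto
      also have "\<dots> \<le> 2 * ((cmod (u x))\<^sup>2 + (cmod (v x))\<^sup>2)"
        using sum_squares_bound[of "cmod (u x)" "cmod (v x)"] by (simp add: power2_sum)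
      finally show "norm ((cmod (u x + v x))\<^sup>2) \<le> norm (2 * ((cmod (u x))\<^sup>2 + (cmod (v x))\<^sup>2))"
        by simp
    qed
  qed simp
qed

lemma square_integrable_uminus: "square_integrable u \<Longrightarrow> square_integrable (\<lambda>x. - u x)"
  by (auto simp: square_integrable_def)

lemma square_integrable_diff:
  "square_integrable u \<Longrightarrow> square_integrable v \<Longrightarrow> square_integrable (\<lambda>x. u x - v x)"
  using square_integrable_add[of u "\<lambda>x. - v x"] square_integrable_uminus[of v] by simp


lemma square_integrable_iff_nn_integral:
  "square_integrable u \<longleftrightarrow> u \<in> borel_measurable lborel \<and>
     (\<integral>\<^sup>+x. ennreal ((cmod (u x))\<^sup>2) \<partial>lborel) < \<infinity>"
  by (auto simp: square_integrable_def integrable_iff_bounded)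

lemma L2_eq_integral_cong:
  assumes "L2_eq u u'" "L2_eq v v'"
  shows "(\<integral>x. u x * cnj (v x) \<partial>lborel) = (\<integral>x. u' x * cnj (v' x) \<partial>lborel)"
proof (rule integral_cong_AE)
  show "(\<lambda>x. u x * cnj (v x)) \<in> borel_measurable lborel" "(\<lambda>x. u' x * cnj (v' x)) \<in> borel_measurable lborel"
    using assms square_integrable_cnj[of v] square_integrable_cnj[of v']
    by (auto simp: L2_eq_def square_integrable_def)
qed (use assms in \<open>auto simp: L2_eq_def\<close>)

instantiation L2 :: (euclidean_space) real_inner
begin

lift_definition zero_L2 :: "'a L2" is "\<lambda>x. 0"
  by (simp add: L2_eq_def square_integrable_zero)

lift_definition plus_L2 :: "'a L2 \<Rightarrow> 'a L2 \<Rightarrow> 'a L2" is "\<lambda>u v x. u x + v x"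
  by (auto simp: L2_eq_def square_integrable_add)

lift_definition minus_L2 :: "'a L2 \<Rightarrow> 'a L2 \<Rightarrow> 'a L2" is "\<lambda>u v x. u x - v x"
  by (auto simp: L2_eq_def square_integrable_diff)

lift_definition uminus_L2 :: "'a L2 \<Rightarrow> 'a L2" is "\<lambda>u x. - u x"
  by (auto simp: L2_eq_def square_integrable_uminus)

lift_definition scaleR_L2 :: "real \<Rightarrow> 'a L2 \<Rightarrow> 'a L2" is "\<lambda>r u x. complex_of_real r * u x"
  by (auto simp: L2_eq_def intro: square_integrable_scale)

lift_definition inner_L2 :: "'a L2 \<Rightarrow> 'a L2 \<Rightarrow> real"
  is "\<lambda>u v. Re (\<integral>x. u x * cnj (v x) \<partial>lborel)"
  by (simp add: L2_eq_integral_cong)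

definition norm_L2 :: "'a L2 \<Rightarrow> real" where "norm_L2 f = sqrt (inner f f)"
definition dist_L2 :: "'a L2 \<Rightarrow> 'a L2 \<Rightarrow> real" where "dist_L2 f g = norm (f - g)"
definition sgn_L2 :: "'a L2 \<Rightarrow> 'a L2" where "sgn_L2 f = scaleR (inverse (norm f)) f"
definition uniformity_L2 :: "('a L2 \<times> 'a L2) filter"
  where "uniformity_L2 = (INF e\<in>{0<..}. principal {(f, g). dist f g < e})"
definition open_L2 :: "'a L2 set \<Rightarrow> bool"
  where "open_L2 U \<longleftrightarrow> (\<forall>f\<in>U. eventually (\<lambda>(f', g). f' = f \<longrightarrow> g \<in> U) uniformity)"

instance
proof
  fix f g h :: "'a L2" and r s :: real
  show "f + g + h = f + (g + h)"
    by transfer (auto simp: L2_eq_def add.assoc intro!: square_integrable_add)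
  show "f + g = g + f"
    by transfer (auto simp: L2_eq_def add.commute intro!: square_integrable_add)
  show "0 + f = f"
    by transfer (auto simp: L2_eq_def)
  show "- f + f = 0"
    by transfer (auto simp: L2_eq_def square_integrable_zero)
  show "f - g = f + - g"
    by transfer (auto simp: L2_eq_def intro!: square_integrable_diff)
  show "r *\<^sub>R (f + g) = r *\<^sub>R f + r *\<^sub>R g"
    by transfer (auto simp: L2_eq_def distrib_left intro!: square_integrable_add square_integrable_scale)
  show "(r + s) *\<^sub>R f = r *\<^sub>R f + s *\<^sub>R f"
    by transfer (auto simp: L2_eq_def distrib_right intro!: square_integrable_add square_integrable_scale)
  show "r *\<^sub>R s *\<^sub>R f = (r * s) *\<^sub>R f"
    by transfer (auto simp: L2_eq_def mult.assoc intro!: square_integrable_scale)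
  show "1 *\<^sub>R f = f"
    by transfer (auto simp: L2_eq_def)
  show "dist f g = norm (f - g)" "sgn f = scaleR (inverse (norm f)) f" "norm f = sqrt (inner f f)"
    by (simp_all only: dist_L2_def sgn_L2_def norm_L2_def)
  show "uniformity = (INF e\<in>{0<..}. principal {(f, g :: 'a L2). dist f g < e})"
    by (rule uniformity_L2_def)
  show "open U \<longleftrightarrow> (\<forall>f\<in>U. eventually (\<lambda>(f', g). f' = f \<longrightarrow> g \<in> U) uniformity)" for U :: "'a L2 set"
    by (rule open_L2_def)
  show "inner f g = inner g f"
  proof transfer
    fix u v :: "'a \<Rightarrow> complex"
    have "(\<integral>x. u x * cnj (v x) \<partial>lborel) = (\<integral>x. cnj (v x * cnj (u x)) \<partial>lborel)"
      by (simp add: mult.commute)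
    also have "\<dots> = cnj (\<integral>x. v x * cnj (u x) \<partial>lborel)"
      by (rule Bochner_Integration.integral_cnj)
    finally show "Re (\<integral>x. u x * cnj (v x) \<partial>lborel) = Re (\<integral>x. v x * cnj (u x) \<partial>lborel)"
      by simp
  qed
  show "inner (f + g) h = inner f h + inner g h"
    by transfer (simp add: L2_eq_def distrib_right square_integrable_integrable_mult square_integrable_cnj)
  show "inner (r *\<^sub>R f) g = r * inner f g"
    by transfer (simp add: mult.assoc)
  have sq: "(\<integral>x. u x * cnj (u x) \<partial>lborel) = complex_of_real (\<integral>x. (cmod (u x))\<^sup>2 \<partial>lborel)"
    for u :: "'a \<Rightarrow> complex"
    by (simp only: complex_norm_square[symmetric] integral_complex_of_real)
  show "0 \<le> inner f f"
    by transfer (simp add: sq)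
  show "inner f f = 0 \<longleftrightarrow> f = 0"
  proof transfer
    fix u :: "'a \<Rightarrow> complex"
    assume "L2_eq u u"
    then have u: "square_integrable u" by (simp add: L2_eq_def)
    have "(\<integral>x. (cmod (u x))\<^sup>2 \<partial>lborel) = 0 \<longleftrightarrow> (AE x in lborel. (cmod (u x))\<^sup>2 = 0)"
      using u by (intro integral_nonneg_eq_0_iff_AE) (auto simp: square_integrable_def)
    then show "Re (\<integral>x. u x * cnj (u x) \<partial>lborel) = 0 \<longleftrightarrow> L2_eq u (\<lambda>x. 0)"
      using u by (simp add: sq L2_eq_def square_integrable_zero)
  qed
qed

end

lemma square_integrable_rep: "square_integrable (L2_rep f)"
  using Quotient3_rep_reflp[OF Quotient3_L2, of f] by (simp add: L2_eq_def)

lemma L2_class_rep: "L2_class (L2_rep f) = f"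
  by (rule Quotient3_abs_rep[OF Quotient3_L2])

lemma L2_class_eq_iff:
  "square_integrable u \<Longrightarrow> square_integrable v \<Longrightarrow>
     L2_class u = L2_class v \<longleftrightarrow> (AE x in lborel. u x = v x)"
  using Quotient3_rel[OF Quotient3_L2, of u v] by (auto simp: L2_eq_def)

lemma L2_class_diff:
  "square_integrable u \<Longrightarrow> square_integrable v \<Longrightarrow>
     L2_class u - L2_class v = L2_class (\<lambda>x. u x - v x)"
  by (rule minus_L2.abs_eq) (simp_all add: L2_eq_def)

lemma norm_L2_class:
  assumes "square_integrable u"
  shows "(norm (L2_class u))\<^sup>2 = (\<integral>x. (cmod (u x))\<^sup>2 \<partial>lborel)"
proof -
  have "(\<integral>x. u x * cnj (u x) \<partial>lborel) = complex_of_real (\<integral>x. (cmod (u x))\<^sup>2 \<partial>lborel)"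
    by (simp only: complex_norm_square[symmetric] integral_complex_of_real)
  moreover have "inner (L2_class u) (L2_class u) = Re (\<integral>x. u x * cnj (u x) \<partial>lborel)"
    using assms by (intro inner_L2.abs_eq) (simp_all add: L2_eq_def)
  ultimately show ?thesis
    by (simp add: power2_norm_eq_inner)
qed

lemma nn_integral_L2_class_diff:
  assumes "square_integrable u" "square_integrable v"
  shows "(\<integral>\<^sup>+x. ennreal ((cmod (u x - v x))\<^sup>2) \<partial>lborel) = ennreal ((norm (L2_class u - L2_class v))\<^sup>2)"
proof (subst nn_integral_eq_integral)
  note d = square_integrable_diff[OF assms]
  show "integrable lborel (\<lambda>x. (cmod (u x - v x))\<^sup>2)"
    using d by (simp add: square_integrable_def)
  show "ennreal (\<integral>x. (cmod (u x - v x))\<^sup>2 \<partial>lborel) = ennreal ((norm (L2_class u - L2_class v))\<^sup>2)"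
    by (simp only: L2_class_diff[OF assms] norm_L2_class[OF d])
qed simp

lemma ennreal_le_suminf: "f n \<le> (\<Sum>n. f n)" for f :: "nat \<Rightarrow> ennreal"
  using sum_le_suminf[of f "{n}"] by simp

text \<open>Riesz--Fischer.\<close>

instance L2 :: (euclidean_space) complete_space
proof
  fix X :: "nat \<Rightarrow> 'a L2"
  assume X: "Cauchy X"
  define w where "w n = L2_rep (X n)" for n
  have w: "square_integrable (w n)" and X_eq: "X n = L2_class (w n)" for n
    by (simp_all add: w_def square_integrable_rep L2_class_rep)
  have [measurable]: "w n \<in> borel_measurable borel" for n
    using w[of n] by (simp add: square_integrable_def)
  have "\<exists>N. \<forall>m\<ge>N. \<forall>n\<ge>N. norm (X m - X n) < (1/2) ^ k" for k
    using X unfolding Cauchy_iff by simp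
  then obtain N where N: "\<And>k m n. m \<ge> N k \<Longrightarrow> n \<ge> N k \<Longrightarrow> norm (X m - X n) < (1/2) ^ k"
    by metis
  define r where "r k = (\<Sum>i\<le>k. N i)" for k
  have r_ge: "N k \<le> r j" if "k \<le> j" for k j
    unfolding r_def using that by (intro member_le_sum) auto
  have d: "(\<integral>\<^sup>+x. ennreal ((cmod (w m x - w n x))\<^sup>2) \<partial>lborel) \<le> ennreal ((1/4) ^ k)"
    if "m \<ge> N k" "n \<ge> N k" for k m n
  proof -
    have "(norm (X m - X n))\<^sup>2 \<le> ((1/2) ^ k)\<^sup>2"
      using N[OF that] by (intro power_mono) auto
    also have "\<dots> = (1/4) ^ k"
      by (simp add: power_mult[symmetric] mult.commute power_mult power2_eq_square flip: power_mult_distrib)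
    finally show ?thesis
      by (simp add: nn_integral_L2_class_diff w X_eq ennreal_leI)
  qed
  define e where "e k x = cmod (w (r (Suc k)) x - w (r k) x)" for k x
  have [measurable]: "e k \<in> borel_measurable borel" for k
    unfolding e_def by measurable
  have "(\<integral>\<^sup>+x. (\<Sum>k. ennreal (2 ^ k * (e k x)\<^sup>2)) \<partial>lborel)
      = (\<Sum>k. \<integral>\<^sup>+x. ennreal (2 ^ k * (e k x)\<^sup>2) \<partial>lborel)"
    by (rule nn_integral_suminf) simp
  also have "\<dots> \<le> (\<Sum>k. ennreal ((1/2) ^ k))"
  proof (rule suminf_le)
    fix k
    have "(\<integral>\<^sup>+x. ennreal (2 ^ k * (e k x)\<^sup>2) \<partial>lborel) = ennreal (2 ^ k) * (\<integral>\<^sup>+x. ennreal ((e k x)\<^sup>2) \<partial>lborel)"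
      by (simp add: ennreal_mult nn_integral_cmult)
    also have "\<dots> \<le> ennreal (2 ^ k) * ennreal ((1/4) ^ k)"
      unfolding e_def by (intro mult_left_mono d r_ge) auto
    also have "\<dots> = ennreal ((1/2) ^ k)"
      by (simp add: ennreal_mult[symmetric] flip: power_mult_distrib)
    finally show "(\<integral>\<^sup>+x. ennreal (2 ^ k * (e k x)\<^sup>2) \<partial>lborel) \<le> ennreal ((1/2) ^ k)" .
  qed auto
  also have "\<dots> < \<infinity>"
    by (subst suminf_ennreal2) (auto intro: summable_geometric)
  finally have ae: "AE x in lborel. (\<Sum>k. ennreal (2 ^ k * (e k x)\<^sup>2)) \<noteq> \<infinity>"
    by (intro nn_integral_PInf_AE) auto
  have finite: "\<exists>C\<ge>0. S = ennreal C" if "S \<noteq> \<infinity>" for S :: ennreal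
    using that by (cases S) auto
  from ae have conv: "AE x in lborel. convergent (\<lambda>k. w (r k) x)"
  proof eventually_elim
    case (elim x)
    obtain C where C: "(\<Sum>k. ennreal (2 ^ k * (e k x)\<^sup>2)) = ennreal C" "C \<ge> 0"
      using elim finite by blast
    have bound: "e k x \<le> sqrt C * sqrt (1/2) ^ k" for k
    proof -
      have "ennreal (2 ^ k * (e k x)\<^sup>2) \<le> ennreal C"
        unfolding C(1)[symmetric] by (rule ennreal_le_suminf)
      then have "2 ^ k * (e k x)\<^sup>2 \<le> C"
        using C(2) by simp
      then have "(e k x)\<^sup>2 \<le> C * (1/2) ^ k"
        by (simp add: field_simps)
      then have "sqrt ((e k x)\<^sup>2) \<le> sqrt (C * (1/2) ^ k)"
        by (rule real_sqrt_le_mono)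
      then show ?thesis
        by (simp add: real_sqrt_mult real_sqrt_power e_def)
    qed
    have "norm (sqrt (1/2)) < 1"
      by (simp add: real_sqrt_divide)
    then have "summable (\<lambda>k. sqrt C * sqrt (1/2) ^ k)"
      by (intro summable_mult summable_geometric)
    then have "summable (\<lambda>k. w (r (Suc k)) x - w (r k) x)"
      by (rule summable_comparison_test') (rule bound[unfolded e_def])
    then have "convergent (\<lambda>n. \<Sum>k<n. w (r (Suc k)) x - w (r k) x)"
      by (simp add: summable_iff_convergent)
    then have "convergent (\<lambda>n. w (r n) x - w (r 0) x)"
      by (simp only: sum_lessThan_telescope[of "\<lambda>k. w (r k) x"])
    from convergent_add[OF this convergent_const[of "w (r 0) x"]] show ?case
      by simp
  qed
  define v where "v x = lim (\<lambda>k. w (r k) x)" for x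
  have [measurable]: "v \<in> borel_measurable borel"
    unfolding v_def by measurable
  have fatou: "(\<integral>\<^sup>+x. ennreal ((cmod (w n x - v x))\<^sup>2) \<partial>lborel) \<le> ennreal ((1/4) ^ k)" if n: "n \<ge> N k" for k n
  proof -
    have "(\<integral>\<^sup>+x. ennreal ((cmod (w n x - v x))\<^sup>2) \<partial>lborel)
        = (\<integral>\<^sup>+x. liminf (\<lambda>j. ennreal ((cmod (w n x - w (r j) x))\<^sup>2)) \<partial>lborel)"
    proof (rule nn_integral_cong_AE)
      show "AE x in lborel. ennreal ((cmod (w n x - v x))\<^sup>2) = liminf (\<lambda>j. ennreal ((cmod (w n x - w (r j) x))\<^sup>2))"
        using conv
      proof eventually_elim
        case (elim x)
        then have "(\<lambda>j. w (r j) x) \<longlonglongrightarrow> v x"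
          by (simp add: v_def convergent_LIMSEQ_iff)
        then have "(\<lambda>j. ennreal ((cmod (w n x - w (r j) x))\<^sup>2)) \<longlonglongrightarrow> ennreal ((cmod (w n x - v x))\<^sup>2)"
          by (intro tendsto_intros)
        from lim_imp_Liminf[OF _ this] show ?case
          by simp
      qed
    qed
    also have "\<dots> \<le> liminf (\<lambda>j. \<integral>\<^sup>+x. ennreal ((cmod (w n x - w (r j) x))\<^sup>2) \<partial>lborel)"
      by (rule nn_integral_liminf) simp
    also have "\<dots> \<le> liminf (\<lambda>j. ennreal ((1/4) ^ k))"
      by (rule Liminf_mono) (auto simp: eventually_sequentially intro!: exI[of _ k] d r_ge n)
    also have "\<dots> = ennreal ((1/4) ^ k)"
      by (simp add: Liminf_const)
    finally show ?thesis .
  qed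
  have diff: "square_integrable (\<lambda>x. w (N 0) x - v x)"
    using fatou[of 0 "N 0"] by (auto simp: square_integrable_iff_nn_integral intro: le_less_trans)
  have v: "square_integrable v"
    using square_integrable_diff[OF w[of "N 0"] diff] by simp
  have "X \<longlonglongrightarrow> L2_class v"
  proof (rule LIMSEQ_I)
    fix \<epsilon> :: real assume "\<epsilon> > 0"
    then obtain k where k: "(1/2) ^ k < \<epsilon>"
      using real_arch_pow_inv[of \<epsilon> "1/2"] by auto
    have "norm (X n - L2_class v) < \<epsilon>" if "n \<ge> N k" for n
    proof -
      have "ennreal ((norm (X n - L2_class v))\<^sup>2) \<le> ennreal ((1/4) ^ k)"
        using fatou[OF that] by (simp add: nn_integral_L2_class_diff w v X_eq)
      then have "(norm (X n - L2_class v))\<^sup>2 \<le> (1/4) ^ k"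
        by simp
      also have "\<dots> = ((1/2) ^ k)\<^sup>2"
        by (simp add: power_mult[symmetric] mult.commute power_mult power2_eq_square flip: power_mult_distrib)
      finally have "norm (X n - L2_class v) \<le> (1/2) ^ k"
        by (rule power2_le_imp_le) simp
      then show ?thesis using k by simp
    qed
    then show "\<exists>no. \<forall>n\<ge>no. norm (X n - L2_class v) < \<epsilon>" by blast
  qed
  then show "convergent X" by (rule convergentI)
qed

instantiation L2 :: (euclidean_space) complex_hilbert
begin

lift_definition scaleC_L2 :: "complex \<Rightarrow> 'a L2 \<Rightarrow> 'a L2" is "\<lambda>a u x. a * u x"
  by (auto simp: L2_eq_def intro: square_integrable_scale)

lift_definition cinner_L2 :: "'a L2 \<Rightarrow> 'a L2 \<Rightarrow> complex"
  is "\<lambda>u v. \<integral>x. u x * cnj (v x) \<partial>lborel"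
  by (rule L2_eq_integral_cong)

instance
proof
  fix f g h :: "'a L2" and a b :: complex and r :: real
  show "a *\<^sub>C (f + g) = a *\<^sub>C f + a *\<^sub>C g"
    by transfer (auto simp: L2_eq_def distrib_left intro!: square_integrable_add square_integrable_scale)
  show "(a + b) *\<^sub>C f = a *\<^sub>C f + b *\<^sub>C f"
    by transfer (auto simp: L2_eq_def distrib_right intro!: square_integrable_add square_integrable_scale)
  show "a *\<^sub>C b *\<^sub>C f = (a * b) *\<^sub>C f"
    by transfer (auto simp: L2_eq_def mult.assoc intro!: square_integrable_scale)
  show "complex_of_real r *\<^sub>C f = r *\<^sub>R f"
    by transfer (auto simp: L2_eq_def intro!: square_integrable_scale)
  show "cinner f g = cnj (cinner g f)"
  proof transfer
    fix u v :: "'a \<Rightarrow> complex"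
    have "(\<integral>x. u x * cnj (v x) \<partial>lborel) = (\<integral>x. cnj (v x * cnj (u x)) \<partial>lborel)"
      by (simp add: mult.commute)
    also have "\<dots> = cnj (\<integral>x. v x * cnj (u x) \<partial>lborel)"
      by (rule Bochner_Integration.integral_cnj)
    finally show "(\<integral>x. u x * cnj (v x) \<partial>lborel) = cnj (\<integral>x. v x * cnj (u x) \<partial>lborel)" .
  qed
  show "cinner (f + g) h = cinner f h + cinner g h"
    by transfer (simp add: L2_eq_def distrib_right square_integrable_integrable_mult square_integrable_cnj)
  show "cinner (a *\<^sub>C f) g = a * cinner f g"
    by transfer (simp add: mult.assoc)
  show "Re (cinner f g) = inner f g"
    by transfer simp
qed

end

definition L2_represents :: "('a::euclidean_space \<Rightarrow> complex) \<Rightarrow> 'a L2 \<Rightarrow> bool" where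
  "L2_represents u f \<longleftrightarrow> square_integrable u \<and> L2_class u = f"

section \<open>Sobolev spaces\<close>

definition partial_deriv :: "'a::euclidean_space \<Rightarrow> ('a \<Rightarrow> complex) \<Rightarrow> 'a \<Rightarrow> complex" where
  "partial_deriv b \<phi> = (\<lambda>y. frechet_derivative \<phi> (at y) b)"

text \<open>
  A list \<open>bs\<close> of elements of \<open>Basis\<close> stands for the iterated partial derivative in these
  coordinate directions. A function is smooth iff all its iterated partial derivatives exist and
  are differentiable.
\<close>

abbreviation partial_derivs :: "'a::euclidean_space list \<Rightarrow> ('a \<Rightarrow> complex) \<Rightarrow> 'a \<Rightarrow> complex" where
  "partial_derivs bs \<phi> \<equiv> foldr partial_deriv bs \<phi>"

definition test_function :: "('a::euclidean_space \<Rightarrow> complex) \<Rightarrow> bool" where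
  "test_function \<phi> \<longleftrightarrow>
     (\<forall>bs. set bs \<subseteq> Basis \<longrightarrow> (\<forall>y. partial_derivs bs \<phi> differentiable (at y))) \<and>
     compact (closure {y. \<phi> y \<noteq> 0})"

definition has_weak_deriv :: "'a::euclidean_space list \<Rightarrow> 'a L2 \<Rightarrow> 'a L2 \<Rightarrow> bool" where
  "has_weak_deriv bs f g \<longleftrightarrow>
     (\<forall>\<phi>. test_function \<phi> \<longrightarrow>
        (\<integral>y. L2_rep f y * partial_derivs bs \<phi> y \<partial>lborel) =
        (-1) ^ length bs * (\<integral>y. L2_rep g y * \<phi> y \<partial>lborel))"

text \<open>\<open>sobolev k\<close> is \<open>W\<^bsup>k,2\<^esup>\<close>.\<close>

definition sobolev :: "nat \<Rightarrow> 'a::euclidean_space L2 set" where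
  "sobolev k = {f. \<forall>bs. set bs \<subseteq> Basis \<and> length bs \<le> k \<longrightarrow> (\<exists>g. has_weak_deriv bs f g)}"

definition weak_deriv :: "'a::euclidean_space list \<Rightarrow> 'a L2 \<Rightarrow> 'a L2" where
  "weak_deriv bs f = (THE g. has_weak_deriv bs f g)"

definition laplacian :: "'a::euclidean_space L2 \<Rightarrow> 'a L2" where
  "laplacian f = (\<Sum>b\<in>Basis. weak_deriv [b, b] f)"

section \<open>Unbounded operators\<close>

text \<open>
  Operators are identified with their graphs. The adjoint is formed as a linear relation; it is
  (the graph of) an operator when the given operator is densely defined.
\<close>

type_synonym 'a operator = "('a \<times> 'a) set"

definition linear_operator :: "'a::complex_hilbert operator \<Rightarrow> bool" where
  "linear_operator A \<longleftrightarrow> single_valued A \<and> (0, 0) \<in> A \<and>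
     (\<forall>f f' g g'. (f, f') \<in> A \<and> (g, g') \<in> A \<longrightarrow> (f + g, f' + g') \<in> A) \<and>
     (\<forall>a f f'. (f, f') \<in> A \<longrightarrow> (a *\<^sub>C f, a *\<^sub>C f') \<in> A)"

definition symmetric_operator :: "'a::complex_hilbert operator \<Rightarrow> bool" where
  "symmetric_operator A \<longleftrightarrow> linear_operator A \<and> closure (Domain A) = UNIV \<and>
     (\<forall>f f' g g'. (f, f') \<in> A \<and> (g, g') \<in> A \<longrightarrow> cinner f' g = cinner f g')"

definition adjoint_op :: "'a::complex_hilbert operator \<Rightarrow> 'a operator" where
  "adjoint_op A = {(g, h). \<forall>(f, f') \<in> A. cinner f' g = cinner f h}"

definition defect_subspace :: "'a::complex_hilbert operator \<Rightarrow> complex \<Rightarrow> 'a set" where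
  "defect_subspace A z = {f. (f, z *\<^sub>C f) \<in> adjoint_op A}"

definition deficiency_index_plus :: "'a::complex_hilbert operator \<Rightarrow> enat" where
  "deficiency_index_plus A = cdim (defect_subspace A \<i>)"

definition deficiency_index_minus :: "'a::complex_hilbert operator \<Rightarrow> enat" where
  "deficiency_index_minus A = cdim (defect_subspace A (- \<i>))"

text \<open>\<open>\<Gamma>\<^sub>0\<close> and \<open>\<Gamma>\<^sub>1\<close> matter only on the domain of the adjoint of \<open>A\<close>.\<close>

definition boundary_triplet ::
  "'a::complex_hilbert operator \<Rightarrow> ('a \<Rightarrow> 'b::complex_hilbert) \<Rightarrow> ('a \<Rightarrow> 'b) \<Rightarrow> bool" where
  "boundary_triplet A \<Gamma>\<^sub>0 \<Gamma>\<^sub>1 \<longleftrightarrow>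
     closed A \<and> symmetric_operator A \<and>
     (\<forall>\<Gamma> \<in> {\<Gamma>\<^sub>0, \<Gamma>\<^sub>1}. \<forall>f \<in> Domain (adjoint_op A). \<forall>g \<in> Domain (adjoint_op A). \<forall>a.
        \<Gamma> (f + g) = \<Gamma> f + \<Gamma> g \<and> \<Gamma> (a *\<^sub>C f) = a *\<^sub>C \<Gamma> f) \<and>
     (\<forall>f f' g g'. (f, f') \<in> adjoint_op A \<and> (g, g') \<in> adjoint_op A \<longrightarrow>
        cinner f' g - cinner f g' = cinner (\<Gamma>\<^sub>1 f) (\<Gamma>\<^sub>0 g) - cinner (\<Gamma>\<^sub>0 f) (\<Gamma>\<^sub>1 g)) \<and>
     (\<lambda>f. (\<Gamma>\<^sub>0 f, \<Gamma>\<^sub>1 f)) ` Domain (adjoint_op A) = UNIV"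

section \<open>Point interactions\<close>

text \<open>
  The branch of the square root with cut \<open>[0, \<infinity>)\<close>, continuous from above on the cut; \<open>csqrt\<close> is
  the principal branch.
\<close>

definition sqrt_up :: "complex \<Rightarrow> complex" where
  "sqrt_up z = (if Im z \<ge> 0 then csqrt z else - csqrt z)"

lemma sqrt_up_square: "(sqrt_up z)\<^sup>2 = z"
  by (simp add: sqrt_up_def)

lemma sqrt_up_1: "sqrt_up 1 = 1"
  by (simp add: sqrt_up_def)

lemma Im_sqrt_up_pos:
  assumes "z \<notin> complex_of_real ` {0..}"
  shows "Im (sqrt_up z) > 0"
proof -
  have "\<not> (Im z = 0 \<and> 0 \<le> Re z)"
  proof
    assume "Im z = 0 \<and> 0 \<le> Re z"
    then have "z = complex_of_real (Re z)" "Re z \<in> {0..}" by (simp_all add: complex_eq_iff)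
    then show False using assms by blast
  qed
  then have *: "Im z \<noteq> 0 \<or> Re z < 0" by auto
  have "\<bar>Re z\<bar> < cmod z" if "Im z \<noteq> 0"
    by (rule power_less_imp_less_base[of _ 2]) (use that in \<open>simp_all add: cmod_power2\<close>)
  then have "Re z < cmod z"
    using * by (cases "Im z = 0") (auto simp: cmod_eq_Re)
  then show ?thesis
    using * by (auto simp: sqrt_up_def)
qed

text \<open>
  A point evaluation \<open>f(y)\<close> of \<open>f\<close> in \<open>W\<^bsup>2,2\<^esup>\<close> refers to the continuous representative.
\<close>

definition free_hamiltonian :: "(real ^ 3) L2 operator" where
  "free_hamiltonian = {(f, - laplacian f) | f. f \<in> sobolev 2}"

definition minimal_hamiltonian :: "('m \<Rightarrow> real ^ 3) \<Rightarrow> (real ^ 3) L2 operator" where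
  "minimal_hamiltonian x = {(f, - laplacian f) | f. f \<in> sobolev 2 \<and>
     (\<exists>u. L2_represents u f \<and> continuous_on UNIV u \<and> (\<forall>j. u (x j) = 0))}"

text \<open>
  A pointwise limit of an element \<open>f\<close> of the domain of the adjoint at one of the points \<open>x j\<close> refers
  to the representative that is continuous off these points. It is unique off them, and the limits
  below do not depend on its values at them.
\<close>

definition off_points_rep :: "('m \<Rightarrow> real ^ 3) \<Rightarrow> (real ^ 3) L2 \<Rightarrow> real ^ 3 \<Rightarrow> complex" where
  "off_points_rep x f = (SOME u. L2_represents u f \<and> continuous_on (- range x) u)"

definition singular_coeff :: "('m \<Rightarrow> real ^ 3) \<Rightarrow> (real ^ 3) L2 \<Rightarrow> 'm \<Rightarrow> complex" where
  "singular_coeff x f j = Lim (at (x j)) (\<lambda>y. off_points_rep x f y * of_real (norm (y - x j)))"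

definition Gamma0 :: "('m::finite \<Rightarrow> real ^ 3) \<Rightarrow> (real ^ 3) L2 \<Rightarrow> complex ^ 'm" where
  "Gamma0 x f = (\<chi> j. 4 * of_real pi * singular_coeff x f j)"

definition Gamma1 :: "('m::finite \<Rightarrow> real ^ 3) \<Rightarrow> (real ^ 3) L2 \<Rightarrow> complex ^ 'm" where
  "Gamma1 x f = (\<chi> j. Lim (at (x j))
     (\<lambda>y. off_points_rep x f y - singular_coeff x f j / of_real (norm (y - x j))))"

text \<open>
  \<open>L2_class\<close> is meaningful only on square integrable functions. The functions to which it is applied
  here are, by the following facts; that the quotients \<open>_ / 0\<close> at the points \<open>x j\<close> are 0 is
  immaterial.
\<close>

lemma exp_over_norm_bound:
  fixes k r :: real
  assumes "k > 0" "r > 0"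
  shows "(exp (- k * r) / r)\<^sup>2 \<le> 1 / r\<^sup>2" "(exp (- k * r) / r)\<^sup>2 \<le> (1 / k\<^sup>2) / r ^ 4"
proof -
  have "(exp (- k * r))\<^sup>2 \<le> 1\<^sup>2"
    using assms by (intro power_mono) auto
  then show "(exp (- k * r) / r)\<^sup>2 \<le> 1 / r\<^sup>2"
    using assms by (simp add: power_divide divide_right_mono)
  have "k * r \<le> exp (k * r)"
    using exp_ge_add_one_self[of "k * r"] by linarith
  then have "exp (- k * r) \<le> 1 / (k * r)"
    using assms by (simp add: exp_minus field_simps)
  then have "(exp (- k * r))\<^sup>2 \<le> (1 / (k * r))\<^sup>2"
    by (intro power_mono) auto
  then have "(exp (- k * r))\<^sup>2 / r\<^sup>2 \<le> (1 / (k * r))\<^sup>2 / r\<^sup>2"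
    by (intro divide_right_mono) auto
  also have "\<dots> = (1 / k\<^sup>2) / r ^ 4"
    by (simp add: power2_eq_square power4_eq_xxxx)
  finally show "(exp (- k * r) / r)\<^sup>2 \<le> (1 / k\<^sup>2) / r ^ 4"
    by (simp add: power_divide)
qed

lemma square_integrable_exp_over_norm:
  fixes p :: "real ^ 3"
  assumes k: "k > 0"
  shows "square_integrable (\<lambda>y. complex_of_real (exp (- k * norm (y - p)) / norm (y - p)))"
  unfolding square_integrable_iff_nn_integral
proof
  define V where "V = measure lborel (ball (0 :: real ^ 3) 1)"
  have vol: "emeasure lborel (ball p s) = ennreal (s ^ 3 * V)" if "s \<ge> 0" for s
  proof -
    have "emeasure lborel (ball p s) = ennreal (measure lborel (ball p s))"
      by (rule emeasure_eq_ennreal_measure) (use emeasure_lborel_ball_finite[of p s] in auto)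
    then show ?thesis
      using content_ball_conv_unit_ball[OF that, of p] by (simp add: V_def)
  qed
  show "(\<lambda>y. complex_of_real (exp (- k * norm (y - p)) / norm (y - p))) \<in> borel_measurable lborel"
    by simp
  have pw: "(a ^ n) ^ k = (a ^ k) ^ n" for a :: real and k n :: nat
    unfolding power_mult[symmetric] by (simp only: mult.commute)
  let ?A = "\<lambda>n y. ennreal (4 ^ (n + 1)) * indicator (ball p ((1/2) ^ n)) y"
  let ?B = "\<lambda>n y. ennreal ((1 / k\<^sup>2) * (1/16) ^ n) * indicator (ball p (2 ^ (n + 1))) y"
  have mA: "?A n \<in> borel_measurable lborel" and mB: "?B n \<in> borel_measurable lborel" for n
    by (intro borel_measurable_times_ennreal borel_measurable_indicator borel_measurable_const; simp)+
  have "(\<integral>\<^sup>+y. ennreal ((cmod (complex_of_real (exp (- k * norm (y - p)) / norm (y - p))))\<^sup>2) \<partial>lborel)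
      \<le> (\<integral>\<^sup>+y. (\<Sum>n. ?A n y) + (\<Sum>n. ?B n y) \<partial>lborel)"
  proof (rule nn_integral_mono)
    fix y :: "real ^ 3"
    define r where "r = norm (y - p)"
    have rp: "dist p y = r" by (simp add: r_def dist_norm norm_minus_commute)
    have "ennreal ((exp (- k * r) / r)\<^sup>2) \<le> (\<Sum>n. ?A n y) + (\<Sum>n. ?B n y)"
    proof -
      consider "r = 0" | "0 < r" "r < 1" | "r \<ge> 1" by (force simp: r_def)
      then show ?thesis
      proof cases
        case 2
        define n where "n = (LEAST n. (1/2 :: real) ^ (n + 1) \<le> r)"
        obtain N where "(1/2 :: real) ^ N < r" using real_arch_pow_inv[of r "1/2"] 2 by auto
        then have "(1/2 :: real) ^ (N + 1) \<le> r"
          using power_decreasing[of N "N + 1" "1/2 :: real"] by linarith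
        then have n1: "(1/2 :: real) ^ (n + 1) \<le> r"
          unfolding n_def by (rule LeastI)
        have n2: "r < (1/2) ^ n"
        proof (cases n)
          case (Suc m)
          then have "\<not> (1/2 :: real) ^ (m + 1) \<le> r"
            unfolding n_def by (intro not_less_Least) simp
          then show ?thesis using Suc by simp
        qed (use 2 in simp)
        have "1 / r\<^sup>2 \<le> 1 / ((1/2 :: real) ^ (n + 1))\<^sup>2"
          using n1 2 by (intro divide_left_mono power_mono mult_pos_pos zero_less_power) auto
        also have "\<dots> = 4 ^ (n + 1)"
        proof -
          have "((1/2 :: real) ^ (n + 1))\<^sup>2 = ((1/2) * (1/2)) ^ (n + 1)"
            unfolding power2_eq_square power_mult_distrib ..
          then show ?thesis by (simp add: power_divide)
        qed
        finally have "(exp (- k * r) / r)\<^sup>2 \<le> 4 ^ (n + 1)"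
          using exp_over_norm_bound(1)[of k r] k 2 by linarith
        then have "ennreal ((exp (- k * r) / r)\<^sup>2) \<le> ?A n y"
          using n2 rp by (simp add: ennreal_leI)
        also have "\<dots> \<le> (\<Sum>n. ?A n y)"
          by (rule ennreal_le_suminf)
        finally show ?thesis by (simp add: add_increasing2)
      next
        case 3
        define n where "n = (LEAST n. r < 2 ^ (n + 1))"
        obtain N where "r < 2 ^ N" using real_arch_pow[of 2 r] by auto
        then have "r < 2 ^ (N + 1)"
          using power_increasing[of N "N + 1" "2 :: real"] by linarith
        then have n1: "r < 2 ^ (n + 1)"
          unfolding n_def by (rule LeastI)
        have n2: "2 ^ n \<le> r"
        proof (cases n)
          case (Suc m)
          then have "\<not> r < 2 ^ (m + 1)"
            unfolding n_def by (intro not_less_Least) simp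
          then show ?thesis using Suc by simp
        qed (use 3 in simp)
        have "(2 ^ n) ^ 4 \<le> r ^ 4" using n2 by (intro power_mono) auto
        then have "(1 / k\<^sup>2) / r ^ 4 \<le> (1 / k\<^sup>2) / (2 ^ n) ^ 4"
          using k 3 by (intro divide_left_mono mult_pos_pos zero_less_power) auto
        also have "\<dots> = (1 / k\<^sup>2) * (1/16) ^ n"
          by (simp add: pw[of 2 n 4] power_divide)
        finally have "(exp (- k * r) / r)\<^sup>2 \<le> (1 / k\<^sup>2) * (1/16) ^ n"
          using exp_over_norm_bound(2)[of k r] k 3 by linarith
        then have "ennreal ((exp (- k * r) / r)\<^sup>2) \<le> ?B n y"
          using n1 rp by (simp add: ennreal_leI)
        also have "\<dots> \<le> (\<Sum>n. ?B n y)"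
          by (rule ennreal_le_suminf)
        finally show ?thesis by (simp add: add_increasing)
      qed simp
    qed
    then show "ennreal ((cmod (complex_of_real (exp (- k * norm (y - p)) / norm (y - p))))\<^sup>2)
        \<le> (\<Sum>n. ?A n y) + (\<Sum>n. ?B n y)"
      by (simp add: r_def norm_divide)
  qed
  also have "\<dots> = (\<Sum>n. \<integral>\<^sup>+y. ?A n y \<partial>lborel) + (\<Sum>n. \<integral>\<^sup>+y. ?B n y \<partial>lborel)"
    by (simp only: nn_integral_add[OF borel_measurable_suminf_order borel_measurable_suminf_order, OF mA mB]
        nn_integral_suminf[OF mA] nn_integral_suminf[OF mB])
  also have "(\<lambda>n. \<integral>\<^sup>+y. ?A n y \<partial>lborel) = (\<lambda>n. ennreal (4 * V * (1/2) ^ n))"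
  proof
    fix n
    have "(4 :: real) ^ n * ((1/2) ^ n) ^ 3 = (4 * (1/2) ^ 3) ^ n"
      unfolding pw[of "1/2" n 3] power_mult_distrib ..
    then have 1: "(4 :: real) ^ n * ((1/2) ^ n) ^ 3 = (1/2) ^ n"
      by (simp add: power3_eq_cube)
    have "4 ^ (n + 1) * (((1/2) ^ n) ^ 3 * V) = 4 * V * (4 ^ n * ((1/2) ^ n) ^ 3)"
      unfolding power_add by simp
    then have *: "4 ^ (n + 1) * (((1/2) ^ n) ^ 3 * V) = 4 * V * (1/2) ^ n"
      unfolding 1 .
    show "(\<integral>\<^sup>+y. ?A n y \<partial>lborel) = ennreal (4 * V * (1/2) ^ n)"
      unfolding *[symmetric]
      by (subst nn_integral_cmult_indicator) (simp_all add: vol V_def flip: ennreal_mult)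
  qed
  also have "(\<lambda>n. \<integral>\<^sup>+y. ?B n y \<partial>lborel) = (\<lambda>n. ennreal (8 / k\<^sup>2 * V * (1/2) ^ n))"
  proof
    fix n
    have "(1/16 :: real) ^ n * (2 ^ n) ^ 3 = (1/16 * 2 ^ 3) ^ n"
      unfolding pw[of 2 n 3] power_mult_distrib ..
    then have 1: "(1/16 :: real) ^ n * (2 ^ n) ^ 3 = (1/2) ^ n"
      by simp
    have "1 / k\<^sup>2 * (1/16) ^ n * ((2 ^ (n + 1)) ^ 3 * V) = 8 / k\<^sup>2 * V * ((1/16) ^ n * (2 ^ n) ^ 3)"
      unfolding power_add power_mult_distrib by simp
    then have *: "1 / k\<^sup>2 * (1/16) ^ n * ((2 ^ (n + 1)) ^ 3 * V) = 8 / k\<^sup>2 * V * (1/2) ^ n"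
      unfolding 1 .
    show "(\<integral>\<^sup>+y. ?B n y \<partial>lborel) = ennreal (8 / k\<^sup>2 * V * (1/2) ^ n)"
      unfolding *[symmetric]
      by (subst nn_integral_cmult_indicator) (simp_all add: vol V_def flip: ennreal_mult)
  qed
  also have "(\<Sum>n. ennreal (4 * V * (1/2) ^ n)) + (\<Sum>n. ennreal (8 / k\<^sup>2 * V * (1/2) ^ n)) < \<infinity>"
    by (subst (1 2) suminf_ennreal2) (auto simp: V_def intro!: summable_mult summable_geometric)
  finally show "(\<integral>\<^sup>+y. ennreal ((cmod (complex_of_real (exp (- k * norm (y - p)) / norm (y - p))))\<^sup>2) \<partial>lborel) < \<infinity>" .
qed

lemma square_integrable_exp_sqrt_over_norm:
  fixes p :: "real ^ 3"
  assumes "z \<notin> complex_of_real ` {0..}"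
  shows "square_integrable
    (\<lambda>y. exp (\<i> * sqrt_up z * of_real (norm (y - p))) / of_real (4 * pi * norm (y - p)))"
proof -
  let ?u = "\<lambda>y. exp (\<i> * sqrt_up z * of_real (norm (y - p))) / complex_of_real (4 * pi * norm (y - p))"
  have m: "?u \<in> borel_measurable borel"
    by (intro borel_measurable_divide borel_measurable_continuous_onI continuous_intros)
  let ?k = "Im (sqrt_up z)"
  have "square_integrable (\<lambda>y. of_real (1 / (4 * pi)) * of_real (exp (- ?k * norm (y - p)) / norm (y - p)))"
    by (intro square_integrable_scale square_integrable_exp_over_norm Im_sqrt_up_pos assms)
  moreover have "cmod (of_real (1 / (4 * pi)) * of_real (exp (- ?k * norm (y - p)) / norm (y - p))) = cmod (?u y)" for y
    by (simp add: norm_mult norm_divide abs_mult)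
  ultimately show ?thesis
    using m by (simp add: square_integrable_def)
qed

lemma square_integrable_exp_norm:
  fixes p :: "real ^ 3"
  shows "square_integrable (\<lambda>y. complex_of_real (exp (- norm (y - p))))"
proof -
  let ?v = "\<lambda>y. complex_of_real (exp (- (1/2) * norm (y - p)) / norm (y - p))"
  have v: "integrable lborel (\<lambda>y. 4 * (cmod (?v y))\<^sup>2)"
    using square_integrable_exp_over_norm[of "1/2" p] by (simp add: square_integrable_def)
  have "integrable lborel (\<lambda>y. (cmod (complex_of_real (exp (- norm (y - p)))))\<^sup>2)"
    using v
  proof (rule Bochner_Integration.integrable_bound)
    have *: "(exp (- r))\<^sup>2 \<le> 4 * (exp (- (1/2) * r) / r)\<^sup>2" if "r > 0" for r :: real
    proof -
      have "r \<le> 2 * exp (r / 2)"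
        using exp_ge_add_one_self[of "r / 2"] by linarith
      then have "exp (- r) * r \<le> exp (- r) * (2 * exp (r / 2))"
        by (intro mult_left_mono) auto
      also have "\<dots> = 2 * exp (- (1/2) * r)"
        by (simp flip: exp_add)
      finally have "exp (- r) \<le> 2 * (exp (- (1/2) * r) / r)"
        using that by (simp add: field_simps)
      then have "(exp (- r))\<^sup>2 \<le> (2 * (exp (- (1/2) * r) / r))\<^sup>2"
        by (intro power_mono) auto
      then show ?thesis unfolding power_mult_distrib by simp
    qed
    show "AE y in lborel. norm ((cmod (complex_of_real (exp (- norm (y - p)))))\<^sup>2) \<le> norm (4 * (cmod (?v y))\<^sup>2)"
      using AE_lborel_singleton[of p]
    proof eventually_elim
      case (elim y)
      then show ?case using *[of "norm (y - p)"] by (simp add: norm_divide)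
    qed
  qed simp
  then show ?thesis
    by (simp add: square_integrable_def)
qed

end

theory Submission
  imports Defs
begin

text \<open>
  Everything about the free operator \<open>H\<^sub>0 = -\<Delta>\<close> on \<open>W\<^bsup>2,2\<^esup>\<close> is derived from its restriction \<open>A\<close> to
  test functions. The regularised fundamental solution \<open>exp (- k s) / (4 \<pi> s)\<close>,
  \<open>s = sqrt (r\<^sup>2 + \<epsilon>\<^sup>2)\<close>, is smooth, and \<open>k\<^sup>2 - \<Delta>\<close> maps it to an approximate identity.
  Letting \<open>\<epsilon> \<rightarrow> 0\<close> gives \<open>\<psi>(p) = \<langle>(A + k\<^sup>2) \<psi>, exp (- k\<^sup>* r) / (4 \<pi> r)\<rangle>\<close>; the regularised
  solutions, cut off and used as test functions, show that \<open>A + 4\<close> has dense range. As \<open>A\<close> is nonnegative, the adjoint of \<open>A\<close> is its closure,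
  which is \<open>H\<^sub>0\<close> since \<open>\<parallel>\<partial>\<^sub>b\<partial>\<^sub>c\<psi>\<parallel> \<le> \<parallel>\<Delta>\<psi>\<parallel>\<close>. So \<open>H\<^sub>0\<close> is self-adjoint, and by uniform limits the elements
  of its domain have continuous representatives with the same evaluation formula.

  Hence \<open>H\<close> consists of the \<open>f\<close> with \<open>(H\<^sub>0 + 1) f\<close> orthogonal to \<open>G\<^sub>j = exp (- r\<^sub>j) / (4 \<pi> r\<^sub>j)\<close> for all \<open>j\<close>,
  and the rest is linear algebra: the elements of the domain of \<open>H\<^sup>*\<close> are \<open>w + \<Sum>\<^sub>j c\<^sub>j G\<^sub>j\<close> with \<open>w\<close> in the
  domain of \<open>H\<^sub>0\<close>, mapped to \<open>H\<^sub>0 w - \<Sum>\<^sub>j c\<^sub>j G\<^sub>j\<close>. Since \<open>(H\<^sub>0 + 1) exp (- r\<^sub>j) = 8 \<pi> G\<^sub>j\<close>, the values of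
  the \<open>exp (- r\<^sub>i)\<close> at the points \<open>x\<^sub>j\<close> form a Gram matrix of the \<open>G\<^sub>j\<close>, which is invertible; this splits off the part in the
  domain of \<open>H\<close>.
\<close>

section \<open>Smooth functions\<close>

text \<open>Weak derivatives and adjoints are tested with smooth functions of compact support,
  whereas a Green function is singular at its pole and has unbounded support. The regularised
  distance keeps the repair explicit: k^2 - \<Delta> maps the regularised solution to \<epsilon>^2 /
  (4 \<pi> s^5) times exp (- k s) (k^2 s^2 + 3 k s + 3). This scales like \<epsilon>^(-3) under y =
  p + \<epsilon> x, and its mass tends to 1 because (1 + |x|^2)^(- 5/2) has integral 4 \<pi> / 3.
  All integrals therefore run over the whole space, and all limits are taken by dominated
  convergence.

  The number 4 is k^2 for k = 2: when the polynomial factor has been absorbed, exp (- 2 s) still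
  leaves exp (- |y - p|), which is square integrable and can be paired with an arbitrary vector. The
  parameter k is complex elsewhere, so that k = - \<i> sqrt z yields the defect elements from the
  formula that also yields point values. Integration by parts rests on translation invariance
  through difference quotients.\<close>

lemma partial_deriv_eq:
  assumes "(f has_derivative f') (at y)"
  shows "partial_deriv b f y = f' b"
  unfolding partial_deriv_def using frechet_derivative_at[OF assms] by simp

text \<open>Separated from \<open>test_function\<close> because the partners of test functions in
  integrations by parts, such as the regularised radial functions, do not have compact
  support.\<close>

definition smooth :: "('a::euclidean_space \<Rightarrow> complex) \<Rightarrow> bool" where
  "smooth \<phi> \<longleftrightarrow> (\<forall>bs. set bs \<subseteq> Basis \<longrightarrow> (\<forall>y. partial_derivs bs \<phi> differentiable (at y)))"

lemma test_function_iff: "test_function \<phi> \<longleftrightarrow> smooth \<phi> \<and> compact (closure {y. \<phi> y \<noteq> 0})"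
  unfolding test_function_def smooth_def ..

text \<open>Smoothness is the largest property that implies differentiability and passes to partial
  derivatives. Exhibiting a class with these two properties replaces an induction over lists of
  directions in each application.\<close>

lemma smooth_coinduct:
  assumes "X \<phi>" and "\<And>\<psi> y. X \<psi> \<Longrightarrow> \<psi> differentiable (at y)"
    and "\<And>\<psi> b. X \<psi> \<Longrightarrow> b \<in> Basis \<Longrightarrow> X (partial_deriv b \<psi>)"
  shows "smooth \<phi>"
proof -
  have "X (partial_derivs bs \<phi>)" if "set bs \<subseteq> Basis" for bs
    using that by (induction bs) (auto intro: assms)
  then show ?thesis
    using assms(2) by (auto simp: smooth_def)
qed

lemma smooth_differentiable: "smooth \<phi> \<Longrightarrow> \<phi> differentiable (at y)"
  by (auto simp: smooth_def dest: spec[of _ "[]"])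

lemma smooth_has_derivative:
  "smooth \<phi> \<Longrightarrow> (\<phi> has_derivative frechet_derivative \<phi> (at y)) (at y)"
  using frechet_derivative_works smooth_differentiable by blast

lemma smooth_partial_deriv:
  assumes "smooth \<phi>" "b \<in> Basis"
  shows "smooth (partial_deriv b \<phi>)"
  unfolding smooth_def
proof (intro allI impI)
  fix bs :: "'a list" and y assume "set bs \<subseteq> Basis"
  then have "partial_derivs (bs @ [b]) \<phi> differentiable (at y)"
    using assms unfolding smooth_def by (metis Un_subset_iff set_append empty_set empty_subsetI insert_subset list.simps(15))
  then show "partial_derivs bs (partial_deriv b \<phi>) differentiable (at y)" by simp
qed

lemma smooth_continuous_on: "smooth \<phi> \<Longrightarrow> continuous_on S \<phi>"
  by (meson smooth_differentiable differentiable_at_withinI differentiable_imp_continuous_on differentiable_on_def)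

section \<open>Sums and products of smooth functions\<close>

lemma partial_deriv_add:
  assumes "\<And>y. f differentiable (at y)" "\<And>y. g differentiable (at y)"
  shows "partial_deriv b (\<lambda>y. f y + g y) = (\<lambda>y. partial_deriv b f y + partial_deriv b g y)"
proof
  fix y
  show "partial_deriv b (\<lambda>y. f y + g y) y = partial_deriv b f y + partial_deriv b g y"
    using assms[of y] unfolding frechet_derivative_works
    by (subst partial_deriv_eq[OF has_derivative_add]) (auto simp: partial_deriv_def)
qed

lemma partial_deriv_mult:
  assumes "\<And>y. f differentiable (at y)" "\<And>y. g differentiable (at y)"
  shows "partial_deriv b (\<lambda>y. f y * g y) = (\<lambda>y. f y * partial_deriv b g y + partial_deriv b f y * g y)"
proof
  fix y
  show "partial_deriv b (\<lambda>y. f y * g y) y = f y * partial_deriv b g y + partial_deriv b f y * g y"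
    using assms[of y] unfolding frechet_derivative_works
    by (subst partial_deriv_eq[OF has_derivative_mult]) (auto simp: partial_deriv_def)
qed

text \<open>Coefficients are not built in: if derivatives of generators carry constant factors, the
  constants must be generators too.\<close>

inductive polynomials_in :: "(('a::euclidean_space \<Rightarrow> complex) \<Rightarrow> bool) \<Rightarrow> ('a \<Rightarrow> complex) \<Rightarrow> bool"
  for X where
  base: "X f \<Longrightarrow> polynomials_in X f"
| add: "polynomials_in X f \<Longrightarrow> polynomials_in X g \<Longrightarrow> polynomials_in X (\<lambda>y. f y + g y)"
| mult: "polynomials_in X f \<Longrightarrow> polynomials_in X g \<Longrightarrow> polynomials_in X (\<lambda>y. f y * g y)"

text \<open>By the sum and product rules it suffices that the derivative of a generator is a
  polynomial in the generators, although it is rarely a generator. Smoothness of an explicit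
  function then follows from first derivatives alone.\<close>

lemma smooth_polynomials_in:
  assumes "polynomials_in X \<phi>" and diff: "\<And>\<psi> y. X \<psi> \<Longrightarrow> \<psi> differentiable (at y)"
    and pd: "\<And>\<psi> b. X \<psi> \<Longrightarrow> b \<in> Basis \<Longrightarrow> polynomials_in X (partial_deriv b \<psi>)"
  shows "smooth \<phi>"
  using assms(1)
proof (rule smooth_coinduct)
  show d: "\<psi> differentiable (at y)" if "polynomials_in X \<psi>" for \<psi> y
    using that by (induction) (auto intro: diff)
  show "polynomials_in X (partial_deriv b \<psi>)" if "polynomials_in X \<psi>" "b \<in> Basis" for \<psi> b
    using that(1)
  proof induction
    case (base f) then show ?case using pd that by blast
  next
    case (add f g) then show ?case
      by (subst partial_deriv_add) (auto intro: d polynomials_in.intros)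
  next
    case (mult f g) then show ?case
      by (subst partial_deriv_mult) (auto intro!: polynomials_in.add polynomials_in.mult intro: d)
  qed
qed

lemma smooth_add: "smooth f \<Longrightarrow> smooth g \<Longrightarrow> smooth (\<lambda>y. f y + g y)"
  by (rule smooth_polynomials_in[where X=smooth])
    (auto intro: polynomials_in.intros smooth_differentiable smooth_partial_deriv)

lemma smooth_mult: "smooth f \<Longrightarrow> smooth g \<Longrightarrow> smooth (\<lambda>y. f y * g y)"
  by (rule smooth_polynomials_in[where X=smooth])
    (auto intro: polynomials_in.intros smooth_differentiable smooth_partial_deriv)

lemma partial_deriv_const: "partial_deriv b (\<lambda>y. c) = (\<lambda>y. 0)"
  by (rule ext) (rule partial_deriv_eq, rule has_derivative_const)

lemma smooth_const: "smooth (\<lambda>y. c)"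
  by (rule smooth_coinduct[where X="\<lambda>f. \<exists>c. f = (\<lambda>y. c)"]) (auto simp: partial_deriv_const)

lemma smooth_cmult: "smooth f \<Longrightarrow> smooth (\<lambda>y. c * f y)"
  by (intro smooth_mult smooth_const)

lemma smooth_uminus: "smooth f \<Longrightarrow> smooth (\<lambda>y. - f y)"
  using smooth_cmult[of f "-1"] by simp

lemma smooth_diff: "smooth f \<Longrightarrow> smooth g \<Longrightarrow> smooth (\<lambda>y. f y - g y)"
  using smooth_add[OF _ smooth_uminus] by force

lemma smooth_sum: "(\<And>i. i \<in> I \<Longrightarrow> smooth (f i)) \<Longrightarrow> smooth (\<lambda>y. \<Sum>i\<in>I. f i y)"
  by (induction I rule: infinite_finite_induct) (auto simp: smooth_const intro: smooth_add)

lemma smooth_prod: "(\<And>i. i \<in> I \<Longrightarrow> smooth (f i)) \<Longrightarrow> smooth (\<lambda>y. \<Prod>i\<in>I. f i y)"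
  by (induction I rule: infinite_finite_induct) (auto simp: smooth_const intro: smooth_mult)

lemma partial_deriv_cmult:
  assumes "smooth f"
  shows "partial_deriv b (\<lambda>y. c * f y) = (\<lambda>y. c * partial_deriv b f y)"
  using smooth_differentiable[OF assms] by (subst partial_deriv_mult) (auto simp: partial_deriv_const)

lemma partial_deriv_uminus:
  "smooth f \<Longrightarrow> partial_deriv b (\<lambda>y. - f y) = (\<lambda>y. - partial_deriv b f y)"
  using partial_deriv_cmult[of f b "-1"] by simp

lemma partial_deriv_diff:
  assumes "smooth f" "smooth g"
  shows "partial_deriv b (\<lambda>y. f y - g y) = (\<lambda>y. partial_deriv b f y - partial_deriv b g y)"
  using partial_deriv_add[of f "\<lambda>y. - g y" b] assms
  by (simp add: partial_deriv_uminus smooth_differentiable smooth_uminus)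

section \<open>Conjugation, dilation and translation of smooth functions\<close>

lemma partial_deriv_cnj:
  assumes "smooth f"
  shows "partial_deriv b (\<lambda>y. cnj (f y)) = (\<lambda>y. cnj (partial_deriv b f y))"
proof
  fix y
  show "partial_deriv b (\<lambda>y. cnj (f y)) y = cnj (partial_deriv b f y)"
    by (subst partial_deriv_eq[OF bounded_linear.has_derivative[OF bounded_linear_cnj smooth_has_derivative[OF assms]]])
      (simp add: partial_deriv_def)
qed

lemma smooth_cnj:
  assumes "smooth f" shows "smooth (\<lambda>y. cnj (f y))"
proof (rule smooth_coinduct[where X="\<lambda>g. \<exists>f. smooth f \<and> g = (\<lambda>y. cnj (f y))"])
  fix \<psi> :: "'a \<Rightarrow> complex" and y assume "\<exists>f. smooth f \<and> \<psi> = (\<lambda>y. cnj (f y))"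
  then obtain f where "smooth f" "\<psi> = (\<lambda>y. cnj (f y))" by blast
  with bounded_linear.has_derivative[OF bounded_linear_cnj smooth_has_derivative] show "\<psi> differentiable (at y)"
    by (auto simp: differentiable_def)
qed (use assms in \<open>auto simp: partial_deriv_cnj intro: smooth_partial_deriv\<close>)

lemma partial_deriv_scale:
  assumes "smooth f"
  shows "partial_deriv b (\<lambda>y. f (r *\<^sub>R y)) = (\<lambda>y. of_real r * partial_deriv b f (r *\<^sub>R y))"
proof
  fix y
  have "((\<lambda>y. f (r *\<^sub>R y)) has_derivative (\<lambda>h. frechet_derivative f (at (r *\<^sub>R y)) (r *\<^sub>R h))) (at y)"
    by (rule has_derivative_compose[OF _ smooth_has_derivative[OF assms]]) (auto intro!: derivative_eq_intros)
  moreover have "linear (frechet_derivative f (at (r *\<^sub>R y)))"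
    using smooth_differentiable[OF assms] by (rule linear_frechet_derivative)
  ultimately show "partial_deriv b (\<lambda>y. f (r *\<^sub>R y)) y = of_real r * partial_deriv b f (r *\<^sub>R y)"
    by (subst partial_deriv_eq) (simp_all add: partial_deriv_def linear_cmul scaleR_conv_of_real)
qed

lemma smooth_scale:
  assumes "smooth f" shows "smooth (\<lambda>y. f (r *\<^sub>R y))"
proof (rule smooth_coinduct[where X="\<lambda>g. \<exists>f. smooth f \<and> g = (\<lambda>y. f (r *\<^sub>R y))"])
  fix \<psi> :: "'a \<Rightarrow> complex" and y assume "\<exists>f. smooth f \<and> \<psi> = (\<lambda>y. f (r *\<^sub>R y))"
  then obtain f where f: "smooth f" "\<psi> = (\<lambda>y. f (r *\<^sub>R y))" by blast
  have "((\<lambda>y. f (r *\<^sub>R y)) has_derivative (\<lambda>h. frechet_derivative f (at (r *\<^sub>R y)) (r *\<^sub>R h))) (at y)"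
    by (rule has_derivative_compose[OF _ smooth_has_derivative[OF f(1)]]) (auto intro!: derivative_eq_intros)
  then show "\<psi> differentiable (at y)" using f by (auto simp: differentiable_def)
next
  fix \<psi> :: "'a \<Rightarrow> complex" and b :: 'a assume "\<exists>f. smooth f \<and> \<psi> = (\<lambda>y. f (r *\<^sub>R y))" and b: "b \<in> Basis"
  then obtain f where f: "smooth f" "\<psi> = (\<lambda>y. f (r *\<^sub>R y))" by blast
  show "\<exists>f. smooth f \<and> partial_deriv b \<psi> = (\<lambda>y. f (r *\<^sub>R y))"
    unfolding f(2) partial_deriv_scale[OF f(1)]
    by (rule exI[of _ "\<lambda>y. of_real r * partial_deriv b f y"]) (auto intro: smooth_cmult smooth_partial_deriv f b)
qed (use assms in auto)

lemma has_derivative_translate: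
  assumes "smooth f"
  shows "((\<lambda>y. f (v + y)) has_derivative frechet_derivative f (at (v + y))) (at y)"
  by (rule has_derivative_compose[OF _ smooth_has_derivative[OF assms]]) (auto intro!: derivative_eq_intros)

lemma partial_deriv_translate:
  assumes "smooth f"
  shows "partial_deriv b (\<lambda>y. f (v + y)) = (\<lambda>y. partial_deriv b f (v + y))"
  by (rule ext, subst partial_deriv_eq[OF has_derivative_translate[OF assms]]) (simp add: partial_deriv_def)

lemma smooth_translate:
  assumes "smooth f" shows "smooth (\<lambda>y. f (v + y))"
proof (rule smooth_coinduct[where X="\<lambda>g. \<exists>f. smooth f \<and> g = (\<lambda>y. f (v + y))"])
  fix \<psi> :: "'a \<Rightarrow> complex" and y assume "\<exists>f. smooth f \<and> \<psi> = (\<lambda>y. f (v + y))"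
  with has_derivative_translate show "\<psi> differentiable (at y)" by (auto simp: differentiable_def)
next
  fix \<psi> :: "'a \<Rightarrow> complex" and b :: 'a assume "\<exists>f. smooth f \<and> \<psi> = (\<lambda>y. f (v + y))" and "b \<in> Basis"
  then show "\<exists>f. smooth f \<and> partial_deriv b \<psi> = (\<lambda>y. f (v + y))"
    using partial_deriv_translate smooth_partial_deriv by blast
qed (use assms in auto)

section \<open>Test functions\<close>

lemma test_functionI:
  assumes "smooth f" "bounded {y. f y \<noteq> 0}"
  shows "test_function f"
  using assms bounded_closure by (auto simp: test_function_iff compact_eq_bounded_closed)

lemma test_function_smooth: "test_function f \<Longrightarrow> smooth f"
  by (simp add: test_function_iff)

lemma test_function_bounded_support: "test_function f \<Longrightarrow> bounded {y. f y \<noteq> 0}"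
  using bounded_subset[OF compact_imp_bounded closure_subset] by (auto simp: test_function_iff)

lemma test_function_support:
  assumes "test_function f"
  obtains R where "R > 0" "\<And>y. f y \<noteq> 0 \<Longrightarrow> norm y \<le> R"
  using test_function_bounded_support[OF assms] unfolding bounded_pos by auto

text \<open>Outside the closed support the function vanishes on an open set, and so does its
  derivative.\<close>

lemma test_function_partial_deriv:
  assumes "test_function f" "b \<in> Basis"
  shows "test_function (partial_deriv b f)"
proof (rule test_functionI)
  have "partial_deriv b f y = 0" if "y \<notin> closure {y. f y \<noteq> 0}" for y
  proof -
    define U where "U = - closure {y. f y \<noteq> 0}"
    have "open U" unfolding U_def by (intro open_Compl closed_closure)
    moreover have "y \<in> U" using that by (simp add: U_def)
    moreover have "0 = f z" if "z \<in> U" for z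
    proof -
      have "z \<notin> closure {y. f y \<noteq> 0}" using that by (simp add: U_def)
      then have "z \<notin> {y. f y \<noteq> 0}" by (rule contrapos_nn) (rule closure_subset[THEN subsetD])
      then show ?thesis by simp
    qed
    ultimately have "(f has_derivative (\<lambda>h. 0)) (at y)"
      by (rule has_derivative_transform_within_open[OF has_derivative_const[of 0]])
    then show ?thesis by (rule partial_deriv_eq)
  qed
  then have "{y. partial_deriv b f y \<noteq> 0} \<subseteq> closure {y. f y \<noteq> 0}" by blast
  then show "bounded {y. partial_deriv b f y \<noteq> 0}"
    using bounded_subset[OF bounded_closure[OF test_function_bounded_support[OF assms(1)]]] by blast
qed (use assms in \<open>auto intro: smooth_partial_deriv simp: test_function_iff\<close>)

section \<open>Operations on test functions, bounds and integrability\<close>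

lemma test_function_add: "test_function f \<Longrightarrow> test_function g \<Longrightarrow> test_function (\<lambda>y. f y + g y)"
  by (rule test_functionI[OF smooth_add])
    (auto simp: test_function_smooth intro: bounded_subset[OF bounded_Un[THEN iffD2, OF conjI[OF test_function_bounded_support[of f] test_function_bounded_support[of g]]]])

lemma test_function_smooth_mult: "test_function f \<Longrightarrow> smooth g \<Longrightarrow> test_function (\<lambda>y. f y * g y)"
  by (rule test_functionI[OF smooth_mult])
    (auto simp: test_function_smooth intro: bounded_subset[OF test_function_bounded_support[of f]])

lemma test_function_cmult: "test_function f \<Longrightarrow> test_function (\<lambda>y. c * f y)"
  using test_function_smooth_mult[OF _ smooth_const, of f c] by (simp add: mult.commute)

lemma test_function_uminus: "test_function f \<Longrightarrow> test_function (\<lambda>y. - f y)"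
  using test_function_cmult[of f "-1"] by simp

lemma test_function_diff: "test_function f \<Longrightarrow> test_function g \<Longrightarrow> test_function (\<lambda>y. f y - g y)"
  using test_function_add[OF _ test_function_uminus, of f g] by simp

lemma test_function_cnj: "test_function f \<Longrightarrow> test_function (\<lambda>y. cnj (f y))"
  by (rule test_functionI[OF smooth_cnj]) (auto simp: test_function_smooth test_function_bounded_support)

lemma test_function_zero: "test_function (\<lambda>y. 0)"
  by (rule test_functionI[OF smooth_const]) simp

lemma test_function_sum: "(\<And>i. i \<in> I \<Longrightarrow> test_function (f i)) \<Longrightarrow> test_function (\<lambda>y. \<Sum>i\<in>I. f i y)"
  by (induction I rule: infinite_finite_induct) (auto simp: test_function_zero intro: test_function_add)

lemma test_function_continuous_on: "test_function f \<Longrightarrow> continuous_on S f"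
  by (simp add: test_function_smooth smooth_continuous_on)

lemma test_function_bounded:
  assumes "test_function f"
  obtains C where "C > 0" "\<And>y. cmod (f y) \<le> C"
proof -
  obtain R where R: "\<And>y. f y \<noteq> 0 \<Longrightarrow> norm y \<le> R" using test_function_support[OF assms] by blast
  have "bounded (f ` cball 0 R)"
    by (intro compact_imp_bounded compact_continuous_image test_function_continuous_on assms) simp
  then obtain C where C: "C > 0" "\<And>y. y \<in> cball 0 R \<Longrightarrow> cmod (f y) \<le> C"
    unfolding bounded_pos by auto
  have "cmod (f y) \<le> C" for y
    using C R[of y] by (cases "f y = 0") auto
  then show ?thesis using C(1) that by blast
qed

lemma test_function_measurable: "test_function f \<Longrightarrow> f \<in> borel_measurable borel"
  by (intro borel_measurable_continuous_onI test_function_continuous_on)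

text \<open>Supplies an integrable majorant: unlike a bare supremum bound it retains the bounded
  support.\<close>

lemma test_function_bound_indicator:
  assumes "test_function f"
  obtains C R where "C > 0" "R > 0" "\<And>y. cmod (f y) \<le> C * indicator (cball 0 R) y"
proof -
  obtain R where R: "R > 0" "\<And>y. f y \<noteq> 0 \<Longrightarrow> norm y \<le> R" using test_function_support[OF assms] by blast
  obtain C where C: "C > 0" "\<And>y. cmod (f y) \<le> C" using test_function_bounded[OF assms] by blast
  have "cmod (f y) \<le> C * indicator (cball 0 R) y" for y
    using R(2)[of y] C by (cases "f y = 0") (auto simp: indicator_def)
  then show ?thesis using that C(1) R(1) by blast
qed

lemma integrable_indicator_cball: "integrable lborel (\<lambda>y::'a::euclidean_space. C * indicator (cball p R) y :: real)"
  using emeasure_lborel_cball_finite[of p R] by (intro integrable_mult_right integrable_real_indicator) auto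

lemma test_function_integrable:
  assumes "test_function f" shows "integrable lborel f"
proof -
  obtain C R where CR: "\<And>y. cmod (f y) \<le> C * indicator (cball 0 R) y" using test_function_bound_indicator[OF assms] by blast
  show ?thesis
    by (rule Bochner_Integration.integrable_bound[OF integrable_indicator_cball[of C 0 R]])
      (use CR order_trans[OF CR abs_ge_self] in \<open>auto simp: test_function_measurable[OF assms]\<close>)
qed

lemma test_function_square_integrable:
  assumes "test_function f" shows "square_integrable f"
proof -
  have "integrable lborel (\<lambda>y. f y * cnj (f y))"
    by (intro test_function_integrable test_function_smooth_mult assms test_function_smooth[OF test_function_cnj])
  then have "integrable lborel (\<lambda>y. cmod (f y * cnj (f y)))" by (rule integrable_norm)
  then show ?thesis
    by (simp add: square_integrable_def test_function_measurable[OF assms] norm_mult power2_eq_square)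
qed

section \<open>Integration by parts\<close>

text \<open>The set in \<open>S\<close> where the two functions differ is open; being null, it is
  empty. This turns almost everywhere identities into pointwise ones, for derivatives as well as for
  continuous representatives.\<close>

lemma continuous_on_AE_eq:
  fixes u v :: "'a::euclidean_space \<Rightarrow> complex"
  assumes "open S" "continuous_on S u" "continuous_on S v" "AE y in lborel. u y = v y" "y \<in> S"
  shows "u y = v y"
proof (rule ccontr)
  assume *: "u y \<noteq> v y"
  define W where "W = S \<inter> (\<lambda>y. u y - v y) -` (- {0})"
  have o: "open W"
    unfolding W_def using assms by (intro continuous_open_preimage) (auto intro!: continuous_intros)
  have "AE x in lborel. x \<notin> W" using assms(4) by eventually_elim (auto simp: W_def)
  then have "W \<in> null_sets lborel" using o by (subst AE_iff_null_sets) auto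
  then have "negligible W"
    by (simp add: negligible_iff_null_sets null_sets_completionI)
  moreover have "y \<in> W" using * assms(5) by (simp add: W_def)
  ultimately show False using open_not_negligible[OF o] by auto
qed

lemma integral_translate:
  fixes f :: "'a::euclidean_space \<Rightarrow> complex"
  assumes "f \<in> borel_measurable borel"
  shows "(\<integral>y. f (c + y) \<partial>lborel) = (\<integral>y. f y \<partial>lborel)"
proof -
  have "(\<integral>y. f y \<partial>lborel) = (\<integral>y. f y \<partial>distr lborel borel ((+) c))" by (simp only: lborel_distr_plus)
  also have "\<dots> = (\<integral>y. f (c + y) \<partial>lborel)" by (rule integral_distr) (use assms in auto)
  finally show ?thesis ..
qed

text \<open>The increments form a sequence because dominated convergence is applied along sequences;
  they are at most 1, which keeps all supports in one ball.\<close>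

definition diff_quot :: "'a::euclidean_space \<Rightarrow> nat \<Rightarrow> ('a \<Rightarrow> complex) \<Rightarrow> 'a \<Rightarrow> complex" where
  "diff_quot b n f y = of_real (Suc n) * (f (inverse (real (Suc n)) *\<^sub>R b + y) - f y)"

lemma diff_quot_tendsto:
  assumes f: "smooth f" and b: "b \<in> Basis"
  shows "(\<lambda>n. diff_quot b n f y) \<longlonglongrightarrow> partial_deriv b f y"
proof -
  define s where "s n = inverse (real (Suc n))" for n
  have s: "s n > 0" for n by (simp add: s_def)
  have D: "(f has_derivative frechet_derivative f (at y)) (at y)" by (rule smooth_has_derivative[OF f])
  have lim: "filterlim (\<lambda>n. s n *\<^sub>R b + y) (at y) sequentially"
  proof (rule filterlim_atI)
    have "s \<longlonglongrightarrow> 0" unfolding s_def by (rule LIMSEQ_inverse_real_of_nat)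
    then have "(\<lambda>n. s n *\<^sub>R b + y) \<longlonglongrightarrow> 0 *\<^sub>R b + y" by (intro tendsto_intros)
    then show "(\<lambda>n. s n *\<^sub>R b + y) \<longlonglongrightarrow> y" by simp
    show "\<forall>\<^sub>F n in sequentially. s n *\<^sub>R b + y \<noteq> y" using s b by (auto simp: less_imp_neq[THEN not_sym])
  qed
  have "((\<lambda>z. (1 / norm (z - y)) *\<^sub>R (f z - (f y + frechet_derivative f (at y) (z - y)))) \<longlongrightarrow> 0) (at y)"
    using D unfolding has_derivative_at2 by blast
  from filterlim_compose[OF this lim]
  have l: "(\<lambda>n. (1 / norm (s n *\<^sub>R b)) *\<^sub>R (f (s n *\<^sub>R b + y) - (f y + frechet_derivative f (at y) (s n *\<^sub>R b)))) \<longlonglongrightarrow> 0"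
    by simp
  have lin: "linear (frechet_derivative f (at y))"
    using smooth_differentiable[OF f] by (rule linear_frechet_derivative)
  have "(1 / norm (s n *\<^sub>R b)) *\<^sub>R (f (s n *\<^sub>R b + y) - (f y + frechet_derivative f (at y) (s n *\<^sub>R b)))
    = diff_quot b n f y - partial_deriv b f y" for n
    using s[of n] b of_nat_neq_0[of n, where ?'a=complex]
    by (simp add: linear_cmul[OF lin] partial_deriv_def diff_quot_def s_def scaleR_conv_of_real field_simps)
  then have "(\<lambda>n. diff_quot b n f y - partial_deriv b f y) \<longlonglongrightarrow> 0" using l by simp
  then show ?thesis by (simp add: LIM_zero_iff)
qed

text \<open>The mean value inequality bounds every quotient by the supremum of the partial
  derivative, uniformly in \<open>n\<close>.\<close>

lemma diff_quot_bound:
  assumes f: "test_function f" and b: "b \<in> Basis"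
  obtains C R where "C > 0" "\<And>n y. cmod (diff_quot b n f y) \<le> C * indicator (cball 0 R) y"
proof -
  obtain R where R: "R > 0" "\<And>y. f y \<noteq> 0 \<Longrightarrow> norm y \<le> R" using test_function_support[OF f] by blast
  obtain C where C: "C > 0" "\<And>y. cmod (partial_deriv b f y) \<le> C"
    using test_function_bounded[OF test_function_partial_deriv[OF f b]] by blast
  \<comment> \<open>A shift has length at most 1, so the radius grows by at most 1.\<close>
  have "cmod (diff_quot b n f y) \<le> C * indicator (cball 0 (R + 1)) y" for n y
  proof -
    define s where "s = inverse (real (Suc n))"
    have s: "s > 0" "s \<le> 1" by (simp_all add: s_def field_simps)
    have "norm (f (s *\<^sub>R b + y) - f (0 *\<^sub>R b + y)) \<le> C * norm (s - 0)"
    proof (rule differentiable_bound[where S=UNIV and f'="\<lambda>t h. h *\<^sub>R partial_deriv b f (t *\<^sub>R b + y)"])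
      fix t
      have "((\<lambda>t. f (t *\<^sub>R b + y)) has_derivative (\<lambda>h. frechet_derivative f (at (t *\<^sub>R b + y)) (h *\<^sub>R b))) (at t)"
        by (rule has_derivative_compose[OF _ smooth_has_derivative[OF test_function_smooth[OF f]]])
          (auto intro!: derivative_eq_intros)
      moreover have "linear (frechet_derivative f (at (t *\<^sub>R b + y)))"
        using smooth_differentiable[OF test_function_smooth[OF f]] by (rule linear_frechet_derivative)
      ultimately show "((\<lambda>t. f (t *\<^sub>R b + y)) has_derivative (\<lambda>h. h *\<^sub>R partial_deriv b f (t *\<^sub>R b + y))) (at t within UNIV)"
        by (simp add: linear_cmul partial_deriv_def)
      show "onorm (\<lambda>h. h *\<^sub>R partial_deriv b f (t *\<^sub>R b + y)) \<le> C"
        using mult_left_mono[OF C(2)[of "t *\<^sub>R b + y"] abs_ge_zero] by (intro onorm_le) (simp add: mult.commute[of C])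
    qed auto
    moreover have "cmod (diff_quot b n f y) = cmod (f (s *\<^sub>R b + y) - f y) / s"
      unfolding diff_quot_def s_def norm_mult norm_of_real by (simp add: divide_inverse mult.commute del: of_nat_Suc)
    ultimately have *: "cmod (diff_quot b n f y) \<le> C"
      using s by (simp add: pos_divide_le_eq)
    show ?thesis
    proof (cases "y \<in> cball 0 (R + 1)")
      case False
      then have "norm y > R + 1" by simp
      moreover have "norm y \<le> norm (s *\<^sub>R b + y) + norm (s *\<^sub>R b)" using norm_triangle_ineq4[of "s *\<^sub>R b + y" "s *\<^sub>R b"] by simp
      ultimately have "norm y > R" "norm (s *\<^sub>R b + y) > R" using s b by simp_all
      then have "f y = 0" "f (s *\<^sub>R b + y) = 0" using R(2)[of y] R(2)[of "s *\<^sub>R b + y"] by force+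
      then show ?thesis using C(1) unfolding diff_quot_def s_def by (simp add: indicator_def)
    qed (use * in simp)
  qed
  then show ?thesis using that C(1) by blast
qed

lemma integral_diff_quot_tendsto:
  assumes f: "test_function f" and b: "b \<in> Basis" and g: "continuous_on UNIV g" "\<And>y. cmod (g y) \<le> D"
  shows "(\<lambda>n. \<integral>y. diff_quot b n f y * g y \<partial>lborel) \<longlonglongrightarrow> (\<integral>y. partial_deriv b f y * g y \<partial>lborel)"
proof -
  obtain C R where C: "C > 0" "\<And>n y. cmod (diff_quot b n f y) \<le> C * indicator (cball 0 R) y"
    using diff_quot_bound[OF f b] by blast
  have [measurable]: "f \<in> borel_measurable borel" "g \<in> borel_measurable borel" "partial_deriv b f \<in> borel_measurable borel"
    using f b g by (auto intro: test_function_measurable test_function_partial_deriv borel_measurable_continuous_onI)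
  show ?thesis
  proof (rule integral_dominated_convergence)
    show "integrable lborel (\<lambda>y::'a. (C * D) * indicator (cball 0 R) y :: real)" by (rule integrable_indicator_cball)
    show "(\<lambda>y. diff_quot b n f y * g y) \<in> borel_measurable lborel" for n
      unfolding diff_quot_def by measurable
    show "AE y in lborel. (\<lambda>n. diff_quot b n f y * g y) \<longlonglongrightarrow> partial_deriv b f y * g y"
      by (intro AE_I2 tendsto_intros diff_quot_tendsto test_function_smooth f b)
    show "AE y in lborel. norm (diff_quot b n f y * g y) \<le> (C * D) * indicator (cball 0 R) y" for n
    proof (rule AE_I2)
      fix y
      have "cmod (diff_quot b n f y) * cmod (g y) \<le> (C * indicator (cball 0 R) y) * D"
        using C by (intro mult_mono C g) (auto simp: indicator_def)
      then show "norm (diff_quot b n f y * g y) \<le> (C * D) * indicator (cball 0 R) y"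
        by (simp add: norm_mult ac_simps)
    qed
  qed auto
qed

text \<open>By translation invariance of the measure every difference quotient has integral 0, and
  the quotients converge under one majorant.\<close>

lemma integral_partial_deriv:
  assumes f: "test_function f" and b: "b \<in> Basis"
  shows "(\<integral>y. partial_deriv b f y \<partial>lborel) = 0"
proof -
  have "(\<integral>y. diff_quot b n f y * 1 \<partial>lborel) = 0" for n
  proof -
    have i: "integrable lborel (\<lambda>y. f (c + y))" for c
    proof -
      have "integrable (distr lborel borel ((+) c)) f" using test_function_integrable[OF f] by (simp only: lborel_distr_plus)
      then show ?thesis by (subst (asm) integrable_distr_eq) (use f test_function_measurable in auto)
    qed
    show ?thesis
      using i[of "inverse (real (Suc n)) *\<^sub>R b"] test_function_integrable[OF f]
      by (simp add: diff_quot_def integral_translate[OF test_function_measurable[OF f]] del: of_nat_Suc)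
  qed
  with integral_diff_quot_tendsto[OF f b, of "\<lambda>_. 1" 1] show ?thesis
    by (simp add: LIMSEQ_const_iff)
qed

lemma integral_by_parts:
  assumes f: "test_function f" and g: "smooth g" and b: "b \<in> Basis"
  shows "(\<integral>y. partial_deriv b f y * g y \<partial>lborel) = - (\<integral>y. f y * partial_deriv b g y \<partial>lborel)"
proof -
  have "partial_deriv b (\<lambda>y. f y * g y) = (\<lambda>y. f y * partial_deriv b g y + partial_deriv b f y * g y)"
    using test_function_smooth[OF f] g by (intro partial_deriv_mult smooth_differentiable)
  then have "(\<integral>y. f y * partial_deriv b g y + partial_deriv b f y * g y \<partial>lborel) = 0"
    using integral_partial_deriv[OF test_function_smooth_mult[OF f g] b] by simp
  moreover have "integrable lborel (\<lambda>y. f y * partial_deriv b g y)" "integrable lborel (\<lambda>y. partial_deriv b f y * g y)"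
    by (intro test_function_integrable test_function_smooth_mult test_function_partial_deriv smooth_partial_deriv assms)+
  ultimately show ?thesis by (simp add: eq_neg_iff_add_eq_0 add.commute)
qed

text \<open>Symmetry of second derivatives is proved weakly. A difference quotient in direction
  \<open>b\<close> is a combination of translates and so commutes with
  \<open>partial_deriv c\<close>. Integrating against test functions gives equal integrals for both
  orders, and testing the difference with its own conjugate forces it to vanish.\<close>

lemma partial_deriv_commute:
  assumes f: "test_function f" and b: "b \<in> Basis" and c: "c \<in> Basis"
  shows "partial_deriv b (partial_deriv c f) = partial_deriv c (partial_deriv b f)"
proof -
  note tf = test_function_partial_deriv
  have eq: "(\<integral>y. partial_deriv b (partial_deriv c f) y * g y \<partial>lborel) = (\<integral>y. partial_deriv c (partial_deriv b f) y * g y \<partial>lborel)"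
    if g: "test_function g" for g
  proof -
    obtain D where D: "\<And>y. cmod (g y) \<le> D" using test_function_bounded[OF g] by blast
    obtain D' where D': "\<And>y. cmod (partial_deriv c g y) \<le> D'" using test_function_bounded[OF tf[OF g c]] by blast
    have "(\<integral>y. diff_quot b n (partial_deriv c f) y * g y \<partial>lborel) = - (\<integral>y. diff_quot b n f y * partial_deriv c g y \<partial>lborel)" for n
    proof -
      let ?v = "inverse (real (Suc n)) *\<^sub>R b"
      have dq: "diff_quot b n f = (\<lambda>y. of_real (Suc n) * (f (?v + y) - f y))" unfolding diff_quot_def ..
      have sm': "smooth (\<lambda>y. f (?v + y))" by (rule smooth_translate[OF test_function_smooth[OF f]])
      have "partial_deriv c (diff_quot b n f) = diff_quot b n (partial_deriv c f)"
        unfolding dq partial_deriv_cmult[OF smooth_diff[OF sm' test_function_smooth[OF f]]]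
          partial_deriv_diff[OF sm' test_function_smooth[OF f]] partial_deriv_translate[OF test_function_smooth[OF f]]
        by (simp add: fun_eq_iff diff_quot_def)
      moreover have "smooth (diff_quot b n f)"
        unfolding dq by (intro smooth_cmult smooth_diff sm' test_function_smooth f)
      ultimately show ?thesis
        using integral_by_parts[OF g _ c, of "diff_quot b n f"] by (simp add: mult.commute)
    qed
    moreover have "(\<lambda>n. \<integral>y. diff_quot b n (partial_deriv c f) y * g y \<partial>lborel) \<longlonglongrightarrow> (\<integral>y. partial_deriv b (partial_deriv c f) y * g y \<partial>lborel)"
      by (rule integral_diff_quot_tendsto[OF tf[OF f c] b test_function_continuous_on[OF g] D])
    moreover have "(\<lambda>n. - (\<integral>y. diff_quot b n f y * partial_deriv c g y \<partial>lborel)) \<longlonglongrightarrow> - (\<integral>y. partial_deriv b f y * partial_deriv c g y \<partial>lborel)"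
      by (intro tendsto_minus integral_diff_quot_tendsto[OF f b test_function_continuous_on[OF tf[OF g c]] D'])
    \<comment> \<open>After one integration by parts either order leads to the same product of first
      derivatives.\<close>
    ultimately have "(\<integral>y. partial_deriv b (partial_deriv c f) y * g y \<partial>lborel) = - (\<integral>y. partial_deriv b f y * partial_deriv c g y \<partial>lborel)"
      using LIMSEQ_unique by force
    then show ?thesis using integral_by_parts[OF tf[OF f b] test_function_smooth[OF g] c] by simp
  qed
  define d where "d y = partial_deriv b (partial_deriv c f) y - partial_deriv c (partial_deriv b f) y" for y
  have d: "test_function d" unfolding d_def by (intro test_function_diff tf f b c)
  have "(\<integral>y. d y * cnj (d y) \<partial>lborel) = 0"
  proof -
    have "integrable lborel (\<lambda>y. partial_deriv b (partial_deriv c f) y * cnj (d y))"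
         "integrable lborel (\<lambda>y. partial_deriv c (partial_deriv b f) y * cnj (d y))"
      by (intro test_function_integrable test_function_smooth_mult tf f b c test_function_smooth[OF test_function_cnj[OF d]])+
    then have "(\<integral>y. d y * cnj (d y) \<partial>lborel) = (\<integral>y. partial_deriv b (partial_deriv c f) y * cnj (d y) \<partial>lborel) - (\<integral>y. partial_deriv c (partial_deriv b f) y * cnj (d y) \<partial>lborel)"
      unfolding d_def[of "_"] left_diff_distrib by (simp add: d_def)
    then show ?thesis using eq[OF test_function_cnj[OF d]] by simp
  qed
  then have "complex_of_real (\<integral>y. (cmod (d y))\<^sup>2 \<partial>lborel) = 0"
    by (simp only: complex_norm_square[symmetric] integral_complex_of_real)
  then have "(\<integral>y. (cmod (d y))\<^sup>2 \<partial>lborel) = 0" by simp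
  then have "AE y in lborel. (cmod (d y))\<^sup>2 = 0"
    using test_function_square_integrable[OF d]
    by (subst (asm) integral_nonneg_eq_0_iff_AE) (auto simp: square_integrable_def)
  then have "AE y in lborel. partial_deriv b (partial_deriv c f) y = partial_deriv c (partial_deriv b f) y"
    by eventually_elim (auto simp: d_def)
  then show ?thesis
    using continuous_on_AE_eq[OF open_UNIV test_function_continuous_on[OF tf[OF tf[OF f c] b]] test_function_continuous_on[OF tf[OF tf[OF f b] c]]]
    by blast
qed

lemma integral_by_parts2:
  assumes f: "test_function f" and g: "smooth g" and b: "b \<in> Basis" and c: "c \<in> Basis"
  shows "(\<integral>y. partial_deriv b (partial_deriv c f) y * g y \<partial>lborel) = (\<integral>y. f y * partial_deriv c (partial_deriv b g) y \<partial>lborel)"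
  using integral_by_parts[OF test_function_partial_deriv[OF f c] g b]
    integral_by_parts[OF f smooth_partial_deriv[OF g b] c] by simp

section \<open>Bump functions and the fundamental lemma\<close>

text \<open>The classical flat function exp (- 1/t) together with its products with powers of 1/t.
  These powers arise on differentiation, so the indexed family is closed under derivatives up to
  linear combinations.\<close>

definition bump :: "nat \<Rightarrow> real \<Rightarrow> real" where
  "bump n t = (if t > 0 then (1 / t) ^ n * exp (- (1 / t)) else 0)"

lemma bump_nonneg: "bump n t \<ge> 0"
  by (simp add: bump_def)

text \<open>A single term of the exponential series of 1/t dominates (1/t)^(n + k). The factor |t|^k
  expresses flatness at 0; k = 2 makes the difference quotient at 0 tend to 0.\<close>

lemma bump_le: "bump n t \<le> fact (n + k) * \<bar>t\<bar> ^ k"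
proof (cases "t > 0")
  case True
  have "(1 / t) ^ (n + k) / fact (n + k) \<le> exp (1 / t)"
  proof -
    have s: "(\<lambda>m. (1 / t) ^ m /\<^sub>R fact m) sums exp (1 / t)" by (rule exp_converges)
    have "(\<Sum>m\<in>{n + k}. (1 / t) ^ m /\<^sub>R fact m) \<le> (\<Sum>m. (1 / t) ^ m /\<^sub>R fact m)"
      using True by (intro sum_le_suminf sums_summable[OF s]) auto
    also have "\<dots> = exp (1 / t)" using s by (simp add: sums_iff)
    finally have "(\<Sum>m\<in>{n + k}. (1 / t) ^ m /\<^sub>R fact m) \<le> exp (1 / t)" .
    then show ?thesis by (simp add: divide_inverse mult.commute)
  qed
  moreover have "X / fact (n + k) \<le> Y \<Longrightarrow> X * inverse Y \<le> fact (n + k)" if "Y > 0" for X Y :: real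
    using that by (simp add: field_simps)
  ultimately have "(1 / t) ^ (n + k) * exp (- (1 / t)) \<le> fact (n + k)"
    by (simp only: exp_minus exp_gt_zero)
  then have "(1 / t) ^ (n + k) * exp (- (1 / t)) * t ^ k \<le> fact (n + k) * t ^ k"
    using True by (intro mult_right_mono) auto
  then show ?thesis
    using True by (simp add: bump_def power_add field_simps)
qed (simp add: bump_def)

lemma bump_le_1: "bump 0 t \<le> 1"
  by (simp add: bump_def)

lemma bump_deriv: "(bump n has_real_derivative (bump (n + 2) t - real n * bump (n + 1) t)) (at t)"
proof -
  consider "t > 0" | "t < 0" | "t = 0" by linarith
  then show ?thesis
  proof cases
    case 1
    have "((\<lambda>t. 1 / t) has_real_derivative - ((1 / t)\<^sup>2)) (at t)"
      using 1 by (auto intro!: derivative_eq_intros simp: power2_eq_square)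
    from DERIV_power[OF this, of n]
    have "((\<lambda>t. (1 / t) ^ n) has_real_derivative - (real n * (1 / t) ^ (n + 1))) (at t)"
      by (rule DERIV_cong) (cases n; simp add: power2_eq_square)
    moreover have "((\<lambda>t. exp (- (1 / t))) has_real_derivative (1 / t)\<^sup>2 * exp (- (1 / t))) (at t)"
      using 1 by (auto intro!: derivative_eq_intros simp: power2_eq_square)
    ultimately have "((\<lambda>t. (1 / t) ^ n * exp (- (1 / t))) has_real_derivative
        - (real n * (1 / t) ^ (n + 1)) * exp (- (1 / t)) + ((1 / t)\<^sup>2 * exp (- (1 / t))) * (1 / t) ^ n) (at t)"
      by (rule DERIV_mult)
    also have "- (real n * (1 / t) ^ (n + 1)) * exp (- (1 / t)) + ((1 / t)\<^sup>2 * exp (- (1 / t))) * (1 / t) ^ n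
        = bump (n + 2) t - real n * bump (n + 1) t"
      using 1 by (simp add: bump_def power2_eq_square algebra_simps)
    finally have "((\<lambda>t. (1 / t) ^ n * exp (- (1 / t))) has_real_derivative (bump (n + 2) t - real n * bump (n + 1) t)) (at t)" .
    then show ?thesis
      by (rule has_field_derivative_transform_within_open[of _ _ _ "{0<..}"]) (use 1 in \<open>auto simp: bump_def\<close>)
  next
    case 2
    have "((\<lambda>t. 0) has_real_derivative (bump (n + 2) t - real n * bump (n + 1) t)) (at t)"
      using 2 by (auto intro!: derivative_eq_intros simp: bump_def)
    then show ?thesis
      by (rule has_field_derivative_transform_within_open[of _ _ _ "{..<0}"]) (use 2 in \<open>auto simp: bump_def\<close>)
  next
    case 3
    have "((\<lambda>h. (bump n (0 + h) - bump n 0) / h) \<longlongrightarrow> 0) (at 0)"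
    proof (rule Lim_null_comparison)
      show "\<forall>\<^sub>F h in at 0. norm ((bump n (0 + h) - bump n 0) / h) \<le> fact (n + 2) * \<bar>h\<bar>"
      proof (rule eventuallyI)
        fix h :: real
        show "norm ((bump n (0 + h) - bump n 0) / h) \<le> fact (n + 2) * \<bar>h\<bar>"
          using bump_le[of n h 2] bump_nonneg[of n h] unfolding bump_def[of n 0]
          by (cases "h = 0") (simp_all add: abs_mult divide_le_eq power2_eq_square mult.assoc)
      qed
      show "((\<lambda>h. fact (n + 2) * \<bar>h\<bar>) \<longlongrightarrow> 0) (at (0::real))"
        by (auto intro!: tendsto_eq_intros)
    qed
    then show ?thesis using 3 by (simp add: DERIV_def bump_def)
  qed
qed

lemma smooth_bump:
  fixes i :: "'a::euclidean_space"
  shows "smooth (\<lambda>y. complex_of_real (bump n (a * (y \<bullet> i) + c)))"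
proof -
  let ?B = "\<lambda>n y. complex_of_real (bump n (a * (y \<bullet> i) + c))"
  let ?X = "\<lambda>g. (\<exists>n. g = ?B n) \<or> (\<exists>c. g = (\<lambda>y. c))"
  have D: "(?B n has_derivative (\<lambda>h. of_real ((bump (n + 2) (a * (y \<bullet> i) + c) - real n * bump (n + 1) (a * (y \<bullet> i) + c)) * (a * (h \<bullet> i))))) (at y)" for n y
  proof -
    have *: "(bump n has_derivative (*) (bump (n + 2) (a * (y \<bullet> i) + c) - real n * bump (n + 1) (a * (y \<bullet> i) + c))) (at (a * (y \<bullet> i) + c))"
      using bump_deriv[of n "a * (y \<bullet> i) + c"] by (simp only: has_field_derivative_def)
    have "((\<lambda>y. bump n (a * (y \<bullet> i) + c)) has_derivative (\<lambda>h. (bump (n + 2) (a * (y \<bullet> i) + c) - real n * bump (n + 1) (a * (y \<bullet> i) + c)) * (a * (h \<bullet> i)))) (at y)"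
      by (rule has_derivative_compose[where f="\<lambda>y. a * (y \<bullet> i) + c" and g="bump n", OF _ *]) (auto intro!: derivative_eq_intros)
    then show ?thesis by (rule has_derivative_of_real)
  qed
  show ?thesis
  proof (rule smooth_polynomials_in[where X="?X"])
    show "polynomials_in ?X (?B n)" by (intro polynomials_in.base) blast
    show "\<psi> differentiable (at y)" if "?X \<psi>" for \<psi> y
      using that D[THEN differentiableI] by auto
    show "polynomials_in ?X (partial_deriv b \<psi>)" if "?X \<psi>" for \<psi> b
      using that
    proof (elim disjE exE)
      fix n assume \<psi>: "\<psi> = ?B n"
      have "partial_deriv b \<psi> = (\<lambda>y. of_real (a * (b \<bullet> i)) * ?B (n + 2) y + of_real (- real n * a * (b \<bullet> i)) * ?B (n + 1) y)"
        unfolding \<psi> by (rule ext) (subst partial_deriv_eq[OF D], simp add: algebra_simps)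
      then show ?thesis
        by (simp only:) (intro polynomials_in.add polynomials_in.mult polynomials_in.base; blast)
    next
      fix c assume "\<psi> = (\<lambda>y. c)"
      then show ?thesis by (auto simp: partial_deriv_const intro!: polynomials_in.base)
    qed
  qed
qed

text \<open>Each face of the box contributes one factor and \<open>N\<close> is the steepness: exp
  (- 1 / (N t)) tends to 1 for t > 0, so the bumps approach the indicator of the open box from
  below.\<close>

definition box_bump :: "real \<Rightarrow> 'a::euclidean_space \<Rightarrow> 'a \<Rightarrow> 'a \<Rightarrow> real" where
  "box_bump N a b y = (\<Prod>i\<in>Basis. bump 0 (N * (y \<bullet> i - a \<bullet> i)) * bump 0 (N * (b \<bullet> i - y \<bullet> i)))"

lemma box_bump_bounds: "0 \<le> box_bump N a b y" "box_bump N a b y \<le> 1"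
  unfolding box_bump_def by (auto intro!: prod_nonneg prod_le_1 mult_nonneg_nonneg bump_nonneg mult_le_one bump_le_1)

lemma box_bump_eq_0:
  assumes "N > 0" "y \<notin> box a b" shows "box_bump N a b y = 0"
proof -
  obtain i where i: "i \<in> Basis" "y \<bullet> i \<le> a \<bullet> i \<or> b \<bullet> i \<le> y \<bullet> i"
    using assms(2) unfolding mem_box by force
  then have "bump 0 (N * (y \<bullet> i - a \<bullet> i)) * bump 0 (N * (b \<bullet> i - y \<bullet> i)) = 0"
    using assms(1) by (auto simp: bump_def zero_less_mult_iff)
  then show ?thesis unfolding box_bump_def using i(1) by (intro prod_zero) auto
qed

lemma box_bump_pos:
  assumes "N > 0" "y \<in> box a b" shows "box_bump N a b y > 0"
  using assms unfolding box_bump_def bump_def mem_box by (auto intro!: prod_pos)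

lemma test_function_box_bump:
  assumes "N > 0" shows "test_function (\<lambda>y::'a::euclidean_space. complex_of_real (box_bump N a b y))"
proof (rule test_functionI)
  have "smooth (\<lambda>y::'a. complex_of_real (bump 0 (N * (y \<bullet> i - a \<bullet> i))) * complex_of_real (bump 0 (N * (b \<bullet> i - y \<bullet> i))))" for i :: 'a
    using smooth_mult[OF smooth_bump[of 0 N i "- N * (a \<bullet> i)"] smooth_bump[of 0 "- N" i "N * (b \<bullet> i)"]]
    by (simp add: algebra_simps)
  then show "smooth (\<lambda>y::'a. complex_of_real (box_bump N a b y))"
    unfolding box_bump_def of_real_prod of_real_mult by (rule smooth_prod)
  show "bounded {y. complex_of_real (box_bump N a b y) \<noteq> 0}"
    by (rule bounded_subset[OF bounded_box[of a b]]) (use box_bump_eq_0[OF assms] in auto)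
qed

lemma box_bump_tendsto: "(\<lambda>n. box_bump (real (Suc n)) a b y) \<longlonglongrightarrow> indicator (box a b) y"
proof (cases "y \<in> box a b")
  case True
  have *: "(\<lambda>n. bump 0 (real (Suc n) * t)) \<longlonglongrightarrow> 1" if "t > 0" for t
  proof -
    have "(\<lambda>n. exp (- (inverse (real (Suc n)) * (1 / t)))) \<longlonglongrightarrow> exp (- (0 * (1 / t)))"
      by (intro tendsto_intros LIMSEQ_inverse_real_of_nat)
    moreover have "exp (- (inverse (real (Suc n)) * (1 / t))) = bump 0 (real (Suc n) * t)" for n
      using that by (simp add: bump_def inverse_eq_divide del: of_nat_Suc)
    ultimately show ?thesis by simp
  qed
  have "(\<lambda>n. box_bump (real (Suc n)) a b y) \<longlonglongrightarrow> (\<Prod>i\<in>(Basis::'a set). 1 * 1)"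
    unfolding box_bump_def using True by (intro tendsto_prod tendsto_mult *) (auto simp: mem_box)
  then show ?thesis using True by simp
qed (simp add: box_bump_eq_0)

section \<open>The fundamental lemma of the calculus of variations\<close>

lemma sets_borel_eq_box: "sets borel = sigma_sets UNIV (range (\<lambda>(a, b). box a b :: 'a::euclidean_space set))"
  unfolding borel_eq_box by (rule sets_measure_of) auto

text \<open>Open boxes are an intersection stable generator of the Borel sets. A Dynkin class
  argument extends the vanishing of the integrals to all Borel sets, and a density with that
  property is 0 almost everywhere.\<close>

lemma AE_eq_0_if_box_integrals:
  fixes g :: "'a::euclidean_space \<Rightarrow> real"
  assumes int: "\<And>a b. integrable lborel (\<lambda>y. indicator (box a b) y * g y)"
    and zero: "\<And>a b. (\<integral>y. indicator (box a b) y * g y \<partial>lborel) = 0"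
  shows "AE y in lborel. g y = 0"
proof -
  \<comment> \<open>\<open>g\<close> is integrable over boxes but perhaps not globally, hence the
    truncation to cubes that exhaust the space.\<close>
  have "AE y in lborel. indicator (box (- real n *\<^sub>R One) (real n *\<^sub>R One)) y * g y = 0" for n
  proof (rule density_unique_real)
    let ?Q = "box (- real n *\<^sub>R One) (real n *\<^sub>R (One::'a))"
    let ?f = "\<lambda>y. indicator ?Q y * g y"
    show fi: "integrable lborel ?f" by (rule int)
    show "integrable lborel (\<lambda>y::'a. 0::real)" by simp
    have si: "set_integrable lborel A ?f" if "A \<in> sets borel" for A
      unfolding set_integrable_def using that fi by (intro integrable_mult_indicator) auto
    fix A :: "'a set" assume "A \<in> sets lborel"
    then have "A \<in> sigma_sets UNIV (range (\<lambda>(a, b). box a b))"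
      by (simp add: sets_borel_eq_box)
    note A = this
    have G: "Int_stable (range (\<lambda>(a, b). box a (b::'a)))" "range (\<lambda>(a, b). box a (b::'a)) \<subseteq> Pow UNIV"
      by (auto simp: Int_stable_def box_Int_box)
    have "(LINT y:A|lborel. ?f y) = 0"
    proof (rule sigma_sets_induct_disjoint[OF G A])
      fix A assume "A \<in> range (\<lambda>(a, b). box a (b::'a))"
      then obtain a b where A: "A = box a b" by auto
      obtain a' b' where ab: "box a b \<inter> ?Q = box a' b'" unfolding box_Int_box by blast
      have "(LINT y:A|lborel. ?f y) = (\<integral>y. indicator (box a b \<inter> ?Q) y * g y \<partial>lborel)"
        unfolding A set_lebesgue_integral_def by (simp add: indicator_inter_arith mult.assoc)
      also have "\<dots> = 0" unfolding ab by (rule zero)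
      finally show "(LINT y:A|lborel. ?f y) = 0" .
    next
      fix A assume A: "A \<in> sigma_sets UNIV (range (\<lambda>(a, b). box a (b::'a)))" "(LINT y:A|lborel. ?f y) = 0"
      then have Ab: "A \<in> sets borel" by (simp add: sets_borel_eq_box)
      have "(LINT y:A \<union> (UNIV - A)|lborel. ?f y) = (LINT y:A|lborel. ?f y) + (LINT y:UNIV - A|lborel. ?f y)"
        by (rule set_integral_Un) (use Ab si in auto)
      \<comment> \<open>The whole space contributes 0 because \<open>?f\<close> lives on the box
        \<open>?Q\<close>.\<close>
      moreover have "(LINT y:A \<union> (UNIV - A)|lborel. ?f y) = 0"
        using zero by (simp add: set_lebesgue_integral_def Un_commute)
      ultimately show "(LINT y:UNIV - A|lborel. ?f y) = 0" using A by simp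
    next
      fix A :: "nat \<Rightarrow> 'a set"
      assume A: "disjoint_family A" "range A \<subseteq> sigma_sets UNIV (range (\<lambda>(a, b). box a (b::'a)))" "\<And>i. (LINT y:A i|lborel. ?f y) = 0"
      then have Ab: "A i \<in> sets borel" for i by (auto simp: sets_borel_eq_box)
      then have U: "(\<Union>i. A i) \<in> sets borel" by auto
      show "(LINT y:\<Union> (range A)|lborel. ?f y) = 0"
        using A Ab si[OF U]
        by (subst lebesgue_integral_countable_add) (auto simp: disjoint_family_on_def)
    qed (simp add: set_lebesgue_integral_def)
    then show "(LINT y:A|lborel. ?f y) = (LINT y:A|lborel. 0)" by (simp add: set_lebesgue_integral_def)
  qed
  then have "AE y in lborel. \<forall>n. indicator (box (- real n *\<^sub>R One) (real n *\<^sub>R One)) y * g y = 0"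
    unfolding AE_all_countable by blast
  then show ?thesis
  proof eventually_elim
    case (elim y)
    obtain n :: nat where n: "norm y < real n" using reals_Archimedean2 by blast
    have "y \<in> box (- real n *\<^sub>R One) (real n *\<^sub>R One)"
      unfolding mem_box using n Basis_le_norm[of _ y] by (fastforce simp: abs_le_iff)
    then show ?case using elim[rule_format, of n] by simp
  qed
qed

text \<open>Smooth bumps converge to indicators of boxes, with the indicator itself as majorant, so
  the claim reduces to boxes. Real and imaginary parts are treated separately.\<close>

lemma AE_eq_0_if_test_integrals:
  fixes g :: "'a::euclidean_space \<Rightarrow> complex"
  assumes g: "square_integrable g" and zero: "\<And>\<phi>. test_function \<phi> \<Longrightarrow> (\<integral>y. g y * \<phi> y \<partial>lborel) = 0"
  shows "AE y in lborel. g y = 0"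
proof -
  have [measurable]: "g \<in> borel_measurable borel" using g by (rule square_integrable_measurable)
  have int: "integrable lborel (\<lambda>y. of_real (indicator (box a b) y) * g y)" for a b
  proof (rule square_integrable_integrable_mult[OF _ g])
    have "integrable lborel (indicator (box a b) :: 'a \<Rightarrow> real)"
      using emeasure_lborel_box_finite[of a b] by (intro integrable_real_indicator) auto
    moreover have "(cmod (of_real (indicator (box a b) y)))\<^sup>2 = indicator (box a b) y" for y :: 'a
      by (simp add: indicator_def)
    ultimately show "square_integrable (\<lambda>y. of_real (indicator (box a b) y))"
      by (simp add: square_integrable_def)
  qed
  have box: "(\<integral>y. of_real (indicator (box a b) y) * g y \<partial>lborel) = 0" for a b
  proof (rule LIMSEQ_unique)
    show "(\<lambda>n. \<integral>y. of_real (box_bump (real (Suc n)) a b y) * g y \<partial>lborel) \<longlonglongrightarrow> (\<integral>y. of_real (indicator (box a b) y) * g y \<partial>lborel)"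
    proof (rule integral_dominated_convergence)
      show "(\<lambda>y. of_real (indicator (box a b) y) * g y) \<in> borel_measurable lborel" by measurable
      show "(\<lambda>y. of_real (box_bump (real (Suc n)) a b y) * g y) \<in> borel_measurable lborel" for n
        using test_function_measurable[OF test_function_box_bump[of "real (Suc n)" a b]] by simp
      show "integrable lborel (\<lambda>y. norm (of_real (indicator (box a b) y) * g y))" by (rule integrable_norm[OF int])
      show "AE y in lborel. (\<lambda>n. of_real (box_bump (real (Suc n)) a b y) * g y) \<longlonglongrightarrow> of_real (indicator (box a b) y) * g y"
        by (intro AE_I2 tendsto_intros box_bump_tendsto)
      have "cmod (of_real (box_bump (real (Suc n)) a b y)) \<le> cmod (of_real (indicator (box a b) y))" for n y
        using box_bump_bounds[of "real (Suc n)" a b y] box_bump_eq_0[of "real (Suc n)" y a b] by (simp add: indicator_def)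
      then show "AE y in lborel. norm (of_real (box_bump (real (Suc n)) a b y) * g y) \<le> norm (of_real (indicator (box a b) y) * g y)" for n
        unfolding norm_mult by (intro AE_I2 mult_right_mono) auto
    qed
    show "(\<lambda>n. \<integral>y. of_real (box_bump (real (Suc n)) a b y) * g y \<partial>lborel) \<longlonglongrightarrow> 0"
      using zero[OF test_function_box_bump[of "real (Suc _)" a b]] by (simp add: mult.commute)
  qed
  have "integrable lborel (\<lambda>y. indicator (box a b) y * Re (g y))" "(\<integral>y. indicator (box a b) y * Re (g y) \<partial>lborel) = 0" for a b
    using integrable_Re[OF int[of a b]] integral_Re[OF int[of a b]] box[of a b] by simp_all
  then have "AE y in lborel. Re (g y) = 0" by (rule AE_eq_0_if_box_integrals)
  moreover have "integrable lborel (\<lambda>y. indicator (box a b) y * Im (g y))" "(\<integral>y. indicator (box a b) y * Im (g y) \<partial>lborel) = 0" for a b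
    using integrable_Im[OF int[of a b]] integral_Im[OF int[of a b]] box[of a b] by simp_all
  then have "AE y in lborel. Im (g y) = 0" by (rule AE_eq_0_if_box_integrals)
  ultimately show ?thesis by eventually_elim (simp add: complex_eq_iff)
qed

section \<open>Complex Hilbert spaces and closed relations\<close>

lemma cinner_add_right: "cinner x (y + z) = cinner x y + cinner x z"
  by (metis cinner_add_left cinner_commute complex_cnj_add)

lemma cinner_scaleC_right: "cinner x (a *\<^sub>C y) = cnj a * cinner x y"
  by (metis cinner_scaleC_left cinner_commute complex_cnj_mult)

lemma cinner_diff_left: "cinner (x - y) z = cinner x z - cinner y z"
  using cinner_add_left[of "x - y" y z] by simp

lemma cinner_diff_right: "cinner x (y - z) = cinner x y - cinner x z"
  using cinner_add_right[of x "y - z" z] by simp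

lemma cinner_zero [simp]: "cinner 0 x = 0" "cinner x 0 = 0"
  using cinner_diff_left[of x x x] cinner_diff_right[of x x x] cinner_diff_left[of 0 0 x] cinner_diff_right[of x 0 0] by simp_all

lemma cinner_uminus: "cinner (- x) y = - cinner x y" "cinner x (- y) = - cinner x y"
  using cinner_diff_left[of 0 x y] cinner_diff_right[of x 0 y] by simp_all

lemma cinner_sum_left: "cinner (\<Sum>i\<in>I. f i) x = (\<Sum>i\<in>I. cinner (f i) x)"
  by (induction I rule: infinite_finite_induct) (simp_all add: cinner_add_left)

lemma cinner_sum_right: "cinner x (\<Sum>i\<in>I. f i) = (\<Sum>i\<in>I. cinner x (f i))"
  by (induction I rule: infinite_finite_induct) (simp_all add: cinner_add_right)

lemma cinner_self: "cinner x x = of_real ((norm x)\<^sup>2)"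
proof (rule complex_eqI)
  show "Re (cinner x x) = Re (of_real ((norm x)\<^sup>2))" by (simp add: Re_cinner power2_norm_eq_inner)
  show "Im (cinner x x) = Im (of_real ((norm x)\<^sup>2))"
    using arg_cong[OF cinner_commute[of x x], of Im] by simp
qed

lemma cinner_self_eq_0: "cinner x x = 0 \<longleftrightarrow> x = 0"
  by (simp add: cinner_self)

lemma norm_scaleC: "norm (a *\<^sub>C x) = cmod a * norm x"
proof -
  have "complex_of_real ((norm (a *\<^sub>C x))\<^sup>2) = of_real ((cmod a * norm x)\<^sup>2)"
    unfolding cinner_self[symmetric] cinner_scaleC_left cinner_scaleC_right
    by (simp add: cinner_self power_mult_distrib complex_mult_cnj cmod_power2 mult.commute[of "cnj a"] del: of_real_power of_real_add)
  then have "(norm (a *\<^sub>C x))\<^sup>2 = (cmod a * norm x)\<^sup>2" by (simp only: of_real_eq_iff)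
  then show ?thesis by (rule power2_eq_imp_eq) auto
qed

lemma cinner_norm_le: "cmod (cinner x y) \<le> norm x * norm y"
proof (cases "cinner x y = 0")
  case False
  \<comment> \<open>A unimodular factor that rotates the inner product onto the nonnegative reals,
    where it equals its real part and the real Cauchy-Schwarz inequality applies.\<close>
  define a where "a = cnj (cinner x y) / cmod (cinner x y)"
  have "cinner (a *\<^sub>C x) y = cmod (cinner x y)"
    using False complex_norm_square[of "cinner x y", symmetric]
    by (simp add: cinner_scaleC_left a_def power2_eq_square mult.commute[of "cnj _"])
  then have "cmod (cinner x y) = inner (a *\<^sub>C x) y"
    using Re_cinner[of "a *\<^sub>C x" y] by simp
  also have "\<dots> \<le> norm (a *\<^sub>C x) * norm y" by (rule norm_cauchy_schwarz)
  also have "norm (a *\<^sub>C x) = norm x" using False by (simp add: norm_scaleC a_def norm_divide)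
  finally show ?thesis .
qed simp

lemma bounded_bilinear_cinner: "bounded_bilinear (cinner :: 'a::complex_hilbert \<Rightarrow> 'a \<Rightarrow> complex)"
proof
  show "\<exists>K. \<forall>a b :: 'a. norm (cinner a b) \<le> norm a * norm b * K"
    by (intro exI[of _ 1]) (simp add: cinner_norm_le)
qed (simp_all add: cinner_add_left cinner_add_right cinner_scaleC_left cinner_scaleC_right scaleR_conv_of_real flip: scaleC_of_real)

lemmas tendsto_cinner = bounded_bilinear.tendsto[OF bounded_bilinear_cinner]

lemma tendsto_scaleC:
  fixes f :: "'b \<Rightarrow> 'a::complex_hilbert"
  shows "(f \<longlongrightarrow> l) F \<Longrightarrow> ((\<lambda>x. a *\<^sub>C f x) \<longlongrightarrow> a *\<^sub>C l) F"
proof -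
  have "bounded_linear (\<lambda>x::'a. a *\<^sub>C x)"
    by (rule bounded_linear_intro[of _ "cmod a"])
      (simp_all add: scaleC_add_right norm_scaleC mult.commute scaleC_scaleC flip: scaleC_of_real)
  then show "(f \<longlongrightarrow> l) F \<Longrightarrow> ((\<lambda>x. a *\<^sub>C f x) \<longlongrightarrow> a *\<^sub>C l) F"
    by (rule bounded_linear.tendsto)
qed

section \<open>Orthogonal complements of closed subspaces\<close>

text \<open>A minimising sequence for the distance from \<open>y\<close> to \<open>M\<close> is
  Cauchy by the parallelogram law, and the residual at its limit is orthogonal to \<open>M\<close>.
  Serves to show that ranges and domains fill the space.\<close>

lemma orthogonal_vector_exists:
  fixes y :: "'a::complex_hilbert"
  assumes M: "closed M" "0 \<in> M" and add: "\<And>u v. u \<in> M \<Longrightarrow> v \<in> M \<Longrightarrow> u + v \<in> M"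
    and scale: "\<And>a u. u \<in> M \<Longrightarrow> a *\<^sub>C u \<in> M" and y: "y \<notin> M"
  obtains v where "v \<noteq> 0" "\<And>u. u \<in> M \<Longrightarrow> cinner u v = 0"
proof -
  have scaleR: "r *\<^sub>R u \<in> M" if "u \<in> M" for r u
    using scale[OF that, of "of_real r"] by (simp add: scaleC_of_real)
  define d where "d = infdist y M"
  have ne: "M \<noteq> {}" using M by blast
  have d_le: "d \<le> norm (y - u)" if "u \<in> M" for u
    unfolding d_def using infdist_le[OF that, of y] by (simp add: dist_norm)
  have d0: "d \<ge> 0" by (simp add: d_def infdist_nonneg)
  have "\<exists>u\<in>M. (norm (y - u))\<^sup>2 < d\<^sup>2 + inverse (real (Suc n))" for n
  proof -
    have "d < sqrt (d\<^sup>2 + inverse (real (Suc n)))"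
      using d0 by (intro real_less_rsqrt) simp
    then obtain u where u: "u \<in> M" "dist y u < sqrt (d\<^sup>2 + inverse (real (Suc n)))"
      using cINF_less_iff[OF ne, of "dist y"] unfolding d_def infdist_notempty[OF ne] by auto
    then have "(norm (y - u))\<^sup>2 < (sqrt (d\<^sup>2 + inverse (real (Suc n))))\<^sup>2"
      by (intro power_strict_mono) (auto simp: dist_norm)
    then show ?thesis using u(1) d0 by auto
  qed
  then obtain m where m: "\<And>n. m n \<in> M" "\<And>n. (norm (y - m n))\<^sup>2 < d\<^sup>2 + inverse (real (Suc n))" by metis
  have cauchy_bound: "(norm (m n - m k))\<^sup>2 \<le> 2 * inverse (real (Suc n)) + 2 * inverse (real (Suc k))" for n k
  proof -
    \<comment> \<open>Parallelogram law. The midpoint of two elements of \<open>M\<close> lies in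
      \<open>M\<close>, so its distance from \<open>y\<close> is at least \<open>d\<close>.\<close>
    have "(norm ((y - m k) - (y - m n)))\<^sup>2 + (norm ((y - m k) + (y - m n)))\<^sup>2 = 2 * (norm (y - m k))\<^sup>2 + 2 * (norm (y - m n))\<^sup>2"
      by (simp add: power2_norm_eq_inner inner_add_left inner_add_right inner_diff_left inner_diff_right algebra_simps)
    moreover have "(y - m k) + (y - m n) = 2 *\<^sub>R (y - (1/2) *\<^sub>R (m k + m n))"
      by (simp add: scaleR_2 algebra_simps)
    moreover have "d\<^sup>2 \<le> (norm (y - (1/2) *\<^sub>R (m k + m n)))\<^sup>2"
      by (intro power_mono d_le scaleR add m d0)
    ultimately have "(norm (m n - m k))\<^sup>2 + 4 * d\<^sup>2 \<le> 2 * (norm (y - m k))\<^sup>2 + 2 * (norm (y - m n))\<^sup>2"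
      by (simp add: power_mult_distrib)
    then show ?thesis using m(2)[of n] m(2)[of k] by linarith
  qed
  have "Cauchy m"
  proof (rule metric_CauchyI)
    fix e :: real assume e: "e > 0"
    obtain N where N: "inverse (real (Suc N)) < e\<^sup>2 / 4" using reals_Archimedean[of "e\<^sup>2 / 4"] e by auto
    have "dist (m n) (m k) < e" if "n \<ge> N" "k \<ge> N" for n k
    proof -
      have "inverse (real (Suc n)) \<le> inverse (real (Suc N))" "inverse (real (Suc k)) \<le> inverse (real (Suc N))"
        using that by (simp_all add: le_imp_inverse_le)
      then have "(norm (m n - m k))\<^sup>2 < e\<^sup>2" using cauchy_bound[of n k] N by linarith
      then show ?thesis using e by (simp add: dist_norm power_less_imp_less_base)
    qed
    then show "\<exists>N. \<forall>n\<ge>N. \<forall>k\<ge>N. dist (m n) (m k) < e" by blast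
  qed
  then obtain l where l: "m \<longlonglongrightarrow> l" by (auto simp: Cauchy_convergent_iff convergent_def)
  have lM: "l \<in> M" using closed_sequentially[OF M(1)] m(1) l by blast
  define v where "v = y - l"
  have v0: "v \<noteq> 0" using lM y by (auto simp: v_def)
  have "(norm v)\<^sup>2 \<le> d\<^sup>2"
  proof (rule LIMSEQ_le)
    show "(\<lambda>n. (norm (y - m n))\<^sup>2) \<longlonglongrightarrow> (norm v)\<^sup>2" unfolding v_def by (intro tendsto_intros l)
    have "(\<lambda>n. d\<^sup>2 + inverse (real (Suc n))) \<longlonglongrightarrow> d\<^sup>2 + 0" by (intro tendsto_intros LIMSEQ_inverse_real_of_nat)
    then show "(\<lambda>n. d\<^sup>2 + inverse (real (Suc n))) \<longlonglongrightarrow> d\<^sup>2" by simp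
  qed (use m(2) less_imp_le in blast)
  have inner0: "inner u v = 0" if u: "u \<in> M" for u
  proof (cases "u = 0")
    case False
    \<comment> \<open>The step that minimises the distance along the direction \<open>u\<close>; a
      nonzero inner product would then beat the infimum.\<close>
    define t where "t = inner u v / (norm u)\<^sup>2"
    have "l + t *\<^sub>R u \<in> M" by (intro add lM scaleR u)
    then have "d\<^sup>2 \<le> (norm (v - t *\<^sub>R u))\<^sup>2"
      using d_le[of "l + t *\<^sub>R u"] d0 by (intro power_mono) (simp_all add: v_def algebra_simps)
    also have "\<dots> = (norm v)\<^sup>2 - 2 * t * inner u v + t * t * (norm u)\<^sup>2"
      by (simp add: power2_norm_eq_inner inner_diff_left inner_diff_right inner_commute algebra_simps)
    also have "\<dots> = (norm v)\<^sup>2 - (inner u v)\<^sup>2 / (norm u)\<^sup>2"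
      using False by (simp add: t_def power2_eq_square)
    finally have "(inner u v)\<^sup>2 / (norm u)\<^sup>2 \<le> 0" using \<open>(norm v)\<^sup>2 \<le> d\<^sup>2\<close> by linarith
    then show ?thesis using False by (simp add: divide_le_0_iff)
  qed simp
  have "cinner u v = 0" if u: "u \<in> M" for u
  proof (rule complex_eqI)
    show "Re (cinner u v) = Re 0" using inner0[OF u] by (simp add: Re_cinner)
    \<comment> \<open>The imaginary part for \<open>u\<close> is the real part for
      \<open>- \<i>\<close> times \<open>u\<close>, which also lies in \<open>M\<close>.\<close>
    show "Im (cinner u v) = Im 0"
      using inner0[OF scale[OF u, of "- \<i>"]] by (simp add: Re_cinner[symmetric] cinner_scaleC_left cinner_uminus)
  qed
  then show ?thesis using that v0 by blast
qed

section \<open>Linear relations, adjoints and closures\<close>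

text \<open>Single-valuedness is left out, since closures and adjoints are at first only
  relations.\<close>

definition linear_relation :: "('a::complex_hilbert \<times> 'a) set \<Rightarrow> bool" where
  "linear_relation T \<longleftrightarrow> (0, 0) \<in> T \<and>
     (\<forall>f f' g g'. (f, f') \<in> T \<and> (g, g') \<in> T \<longrightarrow> (f + g, f' + g') \<in> T) \<and>
     (\<forall>a f f'. (f, f') \<in> T \<longrightarrow> (a *\<^sub>C f, a *\<^sub>C f') \<in> T)"

lemma linear_relation_diff:
  assumes "linear_relation T" "(f, f') \<in> T" "(g, g') \<in> T"
  shows "(f - g, f' - g') \<in> T"
proof -
  have "((-1) *\<^sub>C g, (-1) *\<^sub>C g') \<in> T" using assms unfolding linear_relation_def by blast
  then have "(- g, - g') \<in> T" by simp
  then have "(f + - g, f' + - g') \<in> T" using assms unfolding linear_relation_def by blast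
  then show ?thesis by simp
qed

text \<open>The lower bound makes the preimages of a convergent sequence Cauchy, so the range of T -
  z is closed; a vector outside it would produce a nonzero vector orthogonal to the range, against
  the last hypothesis.\<close>

lemma range_eq_UNIV:
  fixes T :: "('a::complex_hilbert \<times> 'a) set"
  assumes T: "closed T" "linear_relation T" and c: "c > 0"
    and bound: "\<And>f g. (f, g) \<in> T \<Longrightarrow> c * norm f \<le> norm (g - z *\<^sub>C f)"
    and orth: "\<And>v. (\<And>f g. (f, g) \<in> T \<Longrightarrow> cinner (g - z *\<^sub>C f) v = 0) \<Longrightarrow> v = 0"
  shows "\<exists>f g. (f, g) \<in> T \<and> g - z *\<^sub>C f = h"
proof -
  define R where "R = {g - z *\<^sub>C f | f g. (f, g) \<in> T}"
  have "closed R"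
    unfolding closed_sequential_limits
  proof (intro allI impI, elim conjE)
    fix r l assume "\<forall>n. r n \<in> R" and l: "r \<longlonglongrightarrow> l"
    then have "\<forall>n. \<exists>f g. (f, g) \<in> T \<and> r n = g - z *\<^sub>C f" unfolding R_def by blast
    then obtain f g where fg: "\<And>n. (f n, g n) \<in> T" "\<And>n. r n = g n - z *\<^sub>C f n" by metis
    have fb: "c * norm (f n - f k) \<le> norm (r n - r k)" for n k
      using bound[OF linear_relation_diff[OF T(2) fg(1)[of n] fg(1)[of k]]]
      by (simp add: fg(2) cvec.scale_right_diff_distrib algebra_simps)
    have "Cauchy f"
    proof (rule metric_CauchyI)
      fix e :: real assume e: "e > 0"
      have "Cauchy r" using l by (rule LIMSEQ_imp_Cauchy)
      moreover have "c * e > 0" using c e by simp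
      ultimately obtain N where N: "\<And>n k. n \<ge> N \<Longrightarrow> k \<ge> N \<Longrightarrow> dist (r n) (r k) < c * e"
        using metric_CauchyD by blast
      have "dist (f n) (f k) < e" if "n \<ge> N" "k \<ge> N" for n k
      proof -
        have "c * norm (f n - f k) < c * e" using fb[of n k] N[OF that] by (simp add: dist_norm)
        then show ?thesis using c by (simp add: dist_norm)
      qed
      then show "\<exists>N. \<forall>n\<ge>N. \<forall>k\<ge>N. dist (f n) (f k) < e" by blast
    qed
    then obtain a where a: "f \<longlonglongrightarrow> a" by (auto simp: Cauchy_convergent_iff convergent_def)
    have "g = (\<lambda>n. r n + z *\<^sub>C f n)" by (simp add: fg(2))
    then have "g \<longlonglongrightarrow> l + z *\<^sub>C a" using tendsto_add[OF l tendsto_scaleC[OF a]] by simp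
    then have "(\<lambda>n. (f n, g n)) \<longlonglongrightarrow> (a, l + z *\<^sub>C a)" by (rule tendsto_Pair[OF a])
    then have "(a, l + z *\<^sub>C a) \<in> T" by (rule closed_sequentially[OF T(1) fg(1)])
    then show "l \<in> R" unfolding R_def by force
  qed
  have "h \<in> R"
  proof (rule ccontr)
    assume h: "h \<notin> R"
    have "(0, 0) \<in> T" using T(2) unfolding linear_relation_def by blast
    then have zero: "0 \<in> R" unfolding R_def by (auto intro!: exI[of _ 0])
    have add: "u + v \<in> R" if "u \<in> R" "v \<in> R" for u v
    proof -
      obtain f g f' g' where "(f, g) \<in> T" "u = g - z *\<^sub>C f" "(f', g') \<in> T" "v = g' - z *\<^sub>C f'" using \<open>u \<in> R\<close> \<open>v \<in> R\<close> unfolding R_def by blast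
      moreover then have "(f + f', g + g') \<in> T" using T(2) unfolding linear_relation_def by blast
      moreover have "(g - z *\<^sub>C f) + (g' - z *\<^sub>C f') = (g + g') - z *\<^sub>C (f + f')" by (simp add: scaleC_add_right)
      ultimately show ?thesis unfolding R_def by blast
    qed
    have scale: "a *\<^sub>C u \<in> R" if "u \<in> R" for a u
    proof -
      obtain f g where "(f, g) \<in> T" "u = g - z *\<^sub>C f" using \<open>u \<in> R\<close> unfolding R_def by blast
      moreover then have "(a *\<^sub>C f, a *\<^sub>C g) \<in> T" using T(2) unfolding linear_relation_def by blast
      moreover have "a *\<^sub>C (g - z *\<^sub>C f) = a *\<^sub>C g - z *\<^sub>C a *\<^sub>C f" by (simp add: cvec.scale_right_diff_distrib mult.commute)
      ultimately show ?thesis unfolding R_def by blast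
    qed
    show False
    proof (rule orthogonal_vector_exists[OF \<open>closed R\<close> zero add scale h])
      fix v assume v: "v \<noteq> 0" "\<And>u. u \<in> R \<Longrightarrow> cinner u v = 0"
      have "v = 0"
      proof (rule orth)
        fix f g assume "(f, g) \<in> T"
        then show "cinner (g - z *\<^sub>C f) v = 0" by (intro v(2)) (auto simp: R_def)
      qed
      then show False using v(1) by simp
    qed
  qed
  then show ?thesis unfolding R_def by blast
qed

lemma adjoint_op_iff: "(g, h) \<in> adjoint_op A \<longleftrightarrow> (\<forall>f f'. (f, f') \<in> A \<longrightarrow> cinner f' g = cinner f h)"
  by (auto simp: adjoint_op_def)

lemma linear_relation_adjoint: "linear_relation (adjoint_op A)"
  unfolding linear_relation_def adjoint_op_iff
  by (auto simp: cinner_add_right cinner_scaleC_right)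

lemma closed_adjoint: "closed (adjoint_op A)"
  unfolding closed_sequential_limits
proof (intro allI impI, elim conjE)
  fix r l assume r: "\<forall>n. r n \<in> adjoint_op A" "r \<longlonglongrightarrow> l"
  have lim: "(\<lambda>n. fst (r n)) \<longlonglongrightarrow> fst l" "(\<lambda>n. snd (r n)) \<longlonglongrightarrow> snd l"
    by (rule tendsto_fst[OF r(2)], rule tendsto_snd[OF r(2)])
  have "cinner f' (fst l) = cinner f (snd l)" if "(f, f') \<in> A" for f f'
  proof (rule LIMSEQ_unique)
    show "(\<lambda>n. cinner f' (fst (r n))) \<longlonglongrightarrow> cinner f' (fst l)" by (intro tendsto_cinner lim tendsto_const)
    have "cinner f' (fst (r n)) = cinner f (snd (r n))" for n
      using r(1)[rule_format, of n] that adjoint_op_iff[of "fst (r n)" "snd (r n)" A] by simp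
    then show "(\<lambda>n. cinner f' (fst (r n))) \<longlonglongrightarrow> cinner f (snd l)"
      by (simp add: tendsto_cinner lim)
  qed
  then have "(fst l, snd l) \<in> adjoint_op A" unfolding adjoint_op_iff by blast
  then show "l \<in> adjoint_op A" by simp
qed

lemma adjoint_closure: "adjoint_op (closure A) = adjoint_op A"
proof
  show "adjoint_op (closure A) \<subseteq> adjoint_op A"
    by (rule subrelI) (use closure_subset[of A] in \<open>simp add: adjoint_op_iff subset_iff\<close>)
  have "cinner f' g = cinner f h" if gh: "(g, h) \<in> adjoint_op A" and "(f, f') \<in> closure A" for f f' g h
  proof -
    obtain r where r: "\<forall>n. r n \<in> A" "r \<longlonglongrightarrow> (f, f')" using \<open>(f, f') \<in> closure A\<close> unfolding closure_sequential by blast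
    have lim: "(\<lambda>n. fst (r n)) \<longlonglongrightarrow> f" "(\<lambda>n. snd (r n)) \<longlonglongrightarrow> f'"
      using tendsto_fst[OF r(2)] tendsto_snd[OF r(2)] by simp_all
    have "cinner (snd (r n)) g = cinner (fst (r n)) h" for n
      using r(1)[rule_format, of n] gh adjoint_op_iff[of g h A] by (metis prod.collapse)
    moreover have "(\<lambda>n. cinner (snd (r n)) g) \<longlonglongrightarrow> cinner f' g" "(\<lambda>n. cinner (fst (r n)) h) \<longlonglongrightarrow> cinner f h"
      by (intro tendsto_cinner lim tendsto_const)+
    ultimately show ?thesis using LIMSEQ_unique by simp
  qed
  then show "adjoint_op A \<subseteq> adjoint_op (closure A)" by (intro subrelI) (simp add: adjoint_op_iff[of _ _ "closure A"])
qed

lemma linear_relation_closure: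
  assumes "linear_relation A" shows "linear_relation (closure A)"
  unfolding linear_relation_def
proof (intro conjI allI impI)
  show "(0, 0) \<in> closure A" using assms closure_subset unfolding linear_relation_def by blast
  fix f f' g g' assume "(f, f') \<in> closure A \<and> (g, g') \<in> closure A"
  then obtain r s where r: "\<forall>n. r n \<in> A" "r \<longlonglongrightarrow> (f, f')" and s: "\<forall>n. s n \<in> A" "s \<longlonglongrightarrow> (g, g')" unfolding closure_sequential by blast
  have "r n + s n \<in> A" for n
    using assms r(1)[rule_format, of n] s(1)[rule_format, of n] unfolding linear_relation_def by (cases "r n", cases "s n") auto
  moreover have "(\<lambda>n. r n + s n) \<longlonglongrightarrow> (f + g, f' + g')" using tendsto_add[OF r(2) s(2)] by simp
  ultimately show "(f + g, f' + g') \<in> closure A"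
    unfolding closure_sequential by (intro exI[of _ "\<lambda>n. r n + s n"]) simp
next
  fix a f f' assume "(f, f') \<in> closure A"
  then obtain r where r: "\<forall>n. r n \<in> A" "r \<longlonglongrightarrow> (f, f')" unfolding closure_sequential by blast
  have "(a *\<^sub>C fst (r n), a *\<^sub>C snd (r n)) \<in> A" for n
    using assms r(1)[rule_format, of n] unfolding linear_relation_def by (cases "r n") auto
  moreover have "(\<lambda>n. (a *\<^sub>C fst (r n), a *\<^sub>C snd (r n))) \<longlonglongrightarrow> (a *\<^sub>C f, a *\<^sub>C f')"
    using tendsto_fst[OF r(2)] tendsto_snd[OF r(2)] by (intro tendsto_Pair tendsto_scaleC) simp_all
  ultimately show "(a *\<^sub>C f, a *\<^sub>C f') \<in> closure A"
    unfolding closure_sequential by (intro exI[of _ "\<lambda>n. (a *\<^sub>C fst (r n), a *\<^sub>C snd (r n))"]) simp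
qed

section \<open>Finite families and Gram matrices\<close>

text \<open>Stated for an indexed family, so that a repeated vector counts as a dependence and the
  number of indices is the dimension of the span.\<close>

definition clin_indep :: "('m::finite \<Rightarrow> 'a::complex_hilbert) \<Rightarrow> bool" where
  "clin_indep G \<longleftrightarrow> (\<forall>c :: complex ^ 'm. (\<Sum>j\<in>UNIV. c $ j *\<^sub>C G j) = 0 \<longrightarrow> c = 0)"

text \<open>If the Gram map kills \<open>c\<close>, the combination is orthogonal to each
  \<open>G j\<close>, hence to itself, hence 0. An injective linear map of a finite-dimensional
  space into itself is onto.\<close>

lemma gram_interpolation:
  fixes G :: "'m::finite \<Rightarrow> 'a::complex_hilbert" and d :: "complex ^ 'm"
  assumes "clin_indep G"
  obtains c :: "complex ^ 'm" where "\<And>j. cinner (\<Sum>i\<in>UNIV. c $ i *\<^sub>C G i) (G j) = d $ j"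
proof -
  define L where "L c = (\<chi> j. cinner (\<Sum>i\<in>UNIV. c $ i *\<^sub>C G i) (G j))" for c :: "complex ^ 'm"
  have "linear L"
  proof (rule linearI)
    show "L (a + b) = L a + L b" for a b
      by (simp add: L_def vec_eq_iff scaleC_add_left sum.distrib cinner_add_left)
    show "L (r *\<^sub>R a) = r *\<^sub>R L a" for r a
      by (simp add: L_def vec_eq_iff cinner_sum_left cinner_scaleC_left scaleR_sum_right)
  qed
  moreover have "inj L"
  proof (subst linear_injective_0[OF \<open>linear L\<close>], intro allI impI)
    fix c assume c: "L c = 0"
    let ?S = "\<Sum>i\<in>UNIV. c $ i *\<^sub>C G i"
    have "cinner ?S (G j) = 0" for j using c by (simp add: L_def vec_eq_iff)
    then have "cinner ?S ?S = 0" by (simp only: cinner_sum_right cinner_scaleC_right mult_zero_right sum.neutral_const)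
    then show "c = 0" using assms by (simp add: cinner_self_eq_0 clin_indep_def)
  qed
  ultimately have "surj L" by (rule linear_inj_imp_surj)
  then obtain c where "d = L c" by (rule surjE)
  then show ?thesis using that[of c] by (simp add: L_def)
qed

text \<open>Subtract from \<open>g\<close> its projection onto the span: the rest is orthogonal to
  all \<open>G j\<close>, thus by hypothesis to \<open>g\<close>, and finally to itself.\<close>

lemma orthogonal_to_annihilator:
  fixes G :: "'m::finite \<Rightarrow> 'a::complex_hilbert"
  assumes G: "clin_indep G" and g: "\<And>f. (\<And>j. cinner f (G j) = 0) \<Longrightarrow> cinner f g = 0"
  obtains c :: "complex ^ 'm" where "g = (\<Sum>i\<in>UNIV. c $ i *\<^sub>C G i)"
proof -
  obtain c :: "complex ^ 'm" where c: "\<And>j. cinner (\<Sum>i\<in>UNIV. c $ i *\<^sub>C G i) (G j) = (\<chi> j. cinner g (G j)) $ j"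
    using gram_interpolation[OF G] by blast
  let ?S = "\<Sum>i\<in>UNIV. c $ i *\<^sub>C G i"
  have 0: "cinner (g - ?S) (G j) = 0" for j using c[of j] by (simp add: cinner_diff_left)
  then have "cinner (g - ?S) g = 0" by (rule g)
  moreover have "cinner (g - ?S) ?S = 0" using 0 by (subst cinner_sum_right) (simp add: cinner_scaleC_right)
  ultimately have "cinner (g - ?S) (g - ?S) = 0" by (simp only: cinner_diff_right diff_0_right)
  then show ?thesis using that by (simp add: cinner_self_eq_0)
qed

lemma cdim_combinations:
  fixes G :: "'m::finite \<Rightarrow> 'a::complex_hilbert"
  assumes G: "clin_indep G"
  shows "cdim {\<Sum>j\<in>UNIV. c $ j *\<^sub>C G j | c :: complex ^ 'm. True} = enat CARD('m)"
proof -
  have inj: "inj G"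
  proof (rule injI, rule ccontr)
    fix i j assume ij: "G i = G j" "i \<noteq> j"
    \<comment> \<open>Two equal members of the family would give a dependence with coefficients 1
      and - 1.\<close>
    let ?c = "(\<chi> k. if k = i then 1 else if k = j then -1 else 0) :: complex ^ 'm"
    have "(\<Sum>k\<in>UNIV. ?c $ k *\<^sub>C G k) = (\<Sum>k\<in>{i, j}. ?c $ k *\<^sub>C G k)"
      by (rule sum.mono_neutral_right) auto
    also have "\<dots> = 0" using ij by simp
    finally have "?c = 0" using G unfolding clin_indep_def by blast
    then have "?c $ i = 0" by (simp only: zero_index)
    then show False by simp
  qed
  have ind: "\<not> cvec.dependent (range G)"
  proof
    assume "cvec.dependent (range G)"
    then obtain u v where u: "v \<in> range G" "u v \<noteq> 0" "(\<Sum>v\<in>range G. u v *\<^sub>C v) = 0"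
      by (subst (asm) cvec.dependent_finite) auto
    have "(\<Sum>k\<in>UNIV. (\<chi> k. u (G k)) $ k *\<^sub>C G k) = 0"
      using u(3) by (simp add: sum.reindex[OF inj])
    then have "(\<chi> k. u (G k)) = (0 :: complex ^ 'm)" using G unfolding clin_indep_def by blast
    then show False using u(1,2) by (auto simp: vec_eq_iff)
  qed
  have span: "{\<Sum>j\<in>UNIV. c $ j *\<^sub>C G j | c :: complex ^ 'm. True} = cvec.span (range G)"
  proof (intro equalityI subsetI)
    fix v assume "v \<in> {\<Sum>j\<in>UNIV. c $ j *\<^sub>C G j | c :: complex ^ 'm. True}"
    then show "v \<in> cvec.span (range G)"
      by (elim CollectE exE conjE, hypsubst) (intro cvec.span_sum cvec.span_scale cvec.span_base rangeI)
  next
    fix v assume "v \<in> cvec.span (range G)"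
    then obtain u where "v = (\<Sum>w\<in>range G. u w *\<^sub>C w)"
      by (subst (asm) cvec.span_finite) auto
    then have "v = (\<Sum>k\<in>UNIV. (\<chi> k. u (G k)) $ k *\<^sub>C G k)" by (simp add: sum.reindex[OF inj])
    then show "v \<in> {\<Sum>j\<in>UNIV. c $ j *\<^sub>C G j | c :: complex ^ 'm. True}" by blast
  qed
  have "cvec.dim (cvec.span (range G)) = card (range G)" by (rule cvec.dim_span_eq_card_independent[OF ind])
  moreover have "\<exists>B. finite B \<and> cvec.span (range G) \<subseteq> cvec.span B" by (intro exI[of _ "range G"]) simp
  ultimately show ?thesis unfolding span cdim_def using card_image[OF inj] by simp
qed

section \<open>The Laplacian of regularised radial functions\<close>

definition lap :: "('a::euclidean_space \<Rightarrow> complex) \<Rightarrow> 'a \<Rightarrow> complex" where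
  "lap f y = (\<Sum>b\<in>Basis. partial_deriv b (partial_deriv b f) y)"

lemma test_function_lap: "test_function f \<Longrightarrow> test_function (lap f)"
  unfolding lap_def[abs_def] by (intro test_function_sum test_function_partial_deriv)

lemma smooth_lap: "smooth f \<Longrightarrow> smooth (lap f)"
  unfolding lap_def[abs_def] by (intro smooth_sum smooth_partial_deriv)

lemma integral_lap_by_parts:
  assumes f: "test_function f" and g: "smooth g"
  shows "(\<integral>y. lap f y * g y \<partial>lborel) = (\<integral>y. f y * lap g y \<partial>lborel)"
proof -
  have "(\<integral>y. lap f y * g y \<partial>lborel) = (\<Sum>b\<in>Basis. \<integral>y. partial_deriv b (partial_deriv b f) y * g y \<partial>lborel)"
    unfolding lap_def sum_distrib_right
    by (rule Bochner_Integration.integral_sum) (intro test_function_integrable test_function_smooth_mult test_function_partial_deriv f g)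
  also have "\<dots> = (\<Sum>b\<in>Basis. \<integral>y. f y * partial_deriv b (partial_deriv b g) y \<partial>lborel)"
    by (intro sum.cong refl integral_by_parts2 f g)
  also have "\<dots> = (\<integral>y. f y * lap g y \<partial>lborel)"
    unfolding lap_def sum_distrib_left
    by (rule Bochner_Integration.integral_sum[symmetric]) (intro test_function_integrable test_function_smooth_mult smooth_partial_deriv f g)
  finally show ?thesis .
qed

section \<open>The regularised distance and functions of it\<close>

definition reg :: "'a::euclidean_space \<Rightarrow> real \<Rightarrow> 'a \<Rightarrow> real" where
  "reg p \<epsilon> y = sqrt ((norm (y - p))\<^sup>2 + \<epsilon>\<^sup>2)"

lemma reg_ge: "reg p \<epsilon> y \<ge> norm (y - p)" "\<epsilon> \<ge> 0 \<Longrightarrow> reg p \<epsilon> y \<ge> \<epsilon>"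
  unfolding reg_def by (rule real_le_rsqrt; simp)+

lemma reg_pos: "\<epsilon> > 0 \<Longrightarrow> reg p \<epsilon> y > 0"
  using reg_ge(2)[of \<epsilon> p y] by simp

lemma reg_square: "(reg p \<epsilon> y)\<^sup>2 = (norm (y - p))\<^sup>2 + \<epsilon>\<^sup>2"
  unfolding reg_def by simp

lemma reg_commute: "reg p \<epsilon> y = reg y \<epsilon> p"
  by (simp add: reg_def norm_minus_commute)

lemma reg_measurable [measurable]: "reg p \<epsilon> \<in> borel_measurable borel"
  unfolding reg_def[abs_def] by measurable

lemma reg_has_derivative:
  assumes "\<epsilon> > 0"
  shows "(reg p \<epsilon> has_derivative (\<lambda>h. ((y - p) \<bullet> h) / reg p \<epsilon> y)) (at y)"
proof -
  have pos: "(y - p) \<bullet> (y - p) + \<epsilon>\<^sup>2 > 0" using assms by (intro add_nonneg_pos) auto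
  have eq: "reg p \<epsilon> = (\<lambda>y. sqrt ((y - p) \<bullet> (y - p) + \<epsilon>\<^sup>2))"
    by (simp add: reg_def fun_eq_iff power2_norm_eq_inner)
  have "((\<lambda>y. (y - p) \<bullet> (y - p) + \<epsilon>\<^sup>2) has_derivative (\<lambda>h. 2 * ((y - p) \<bullet> h))) (at y)"
    by (auto intro!: derivative_eq_intros simp: inner_commute)
  from has_derivative_compose[where g=sqrt, OF this DERIV_real_sqrt[OF pos, unfolded has_field_derivative_def]]
  have D: "((\<lambda>y. sqrt ((y - p) \<bullet> (y - p) + \<epsilon>\<^sup>2)) has_derivative
    (\<lambda>h. inverse (sqrt ((y - p) \<bullet> (y - p) + \<epsilon>\<^sup>2)) / 2 * (2 * ((y - p) \<bullet> h)))) (at y)" .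
  have "inverse S / 2 * (2 * z) = z / S" for S z :: real by (simp add: field_simps)
  from D[unfolded this] show ?thesis unfolding eq .
qed

lemma radial_has_derivative:
  assumes \<epsilon>: "\<epsilon> > 0" and F: "(F has_field_derivative F') (at (complex_of_real (reg p \<epsilon> y)))"
  shows "((\<lambda>y. F (of_real (reg p \<epsilon> y))) has_derivative (\<lambda>h. F' * of_real (((y - p) \<bullet> h) / reg p \<epsilon> y))) (at y)"
  by (rule has_derivative_compose[where f="\<lambda>y. complex_of_real (reg p \<epsilon> y)" and g=F,
        OF has_derivative_of_real[OF reg_has_derivative[OF \<epsilon>]] F[unfolded has_field_derivative_def]])

lemma smooth_radial:
  fixes p :: "'a::euclidean_space"
  assumes \<epsilon>: "\<epsilon> > 0"
  shows "smooth (\<lambda>y. 1 / complex_of_real (reg p \<epsilon> y))" "smooth (\<lambda>y. exp (- k * complex_of_real (reg p \<epsilon> y)))"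
proof -
  \<comment> \<open>The gradient of s is (y - p) / s, so derivatives of these generators are
    products of constants, coordinates, powers of 1/s and the exponential.\<close>
  let ?X = "\<lambda>g. (\<exists>c. g = (\<lambda>y. c)) \<or> (\<exists>b. g = (\<lambda>y. complex_of_real ((y - p) \<bullet> b)))
    \<or> g = (\<lambda>y. 1 / complex_of_real (reg p \<epsilon> y)) \<or> g = (\<lambda>y. exp (- k * complex_of_real (reg p \<epsilon> y)))"
  have D1: "((\<lambda>y. complex_of_real ((y - p) \<bullet> b)) has_derivative (\<lambda>h. of_real (h \<bullet> b))) (at y)" for y b
    by (intro has_derivative_of_real) (auto intro!: derivative_eq_intros)
  have D2: "((\<lambda>y. 1 / complex_of_real (reg p \<epsilon> y)) has_derivative (\<lambda>h. - (1 / (of_real (reg p \<epsilon> y))\<^sup>2) * of_real (((y - p) \<bullet> h) / reg p \<epsilon> y))) (at y)" for y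
    by (rule radial_has_derivative[OF \<epsilon>, of "\<lambda>z. 1 / z"])
      (use reg_pos[OF \<epsilon>, of p y] in \<open>auto intro!: derivative_eq_intros simp: power2_eq_square\<close>)
  have D3: "((\<lambda>y. exp (- k * complex_of_real (reg p \<epsilon> y))) has_derivative (\<lambda>h. - k * exp (- k * of_real (reg p \<epsilon> y)) * of_real (((y - p) \<bullet> h) / reg p \<epsilon> y))) (at y)" for y
    by (rule radial_has_derivative[OF \<epsilon>, of "\<lambda>z. exp (- k * z)"]) (auto intro!: derivative_eq_intros)
  have diff: "\<psi> differentiable (at y)" if "?X \<psi>" for \<psi> y
    using that D1[THEN differentiableI] D2[THEN differentiableI] D3[THEN differentiableI] by auto
  have pd: "polynomials_in ?X (partial_deriv b \<psi>)" if "?X \<psi>" for \<psi> b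
    using that
  proof (elim disjE exE)
    fix c assume "\<psi> = (\<lambda>y. c)"
    then show ?thesis by (auto simp: partial_deriv_const intro!: polynomials_in.base)
  next
    fix b' assume \<psi>: "\<psi> = (\<lambda>y. complex_of_real ((y - p) \<bullet> b'))"
    have "partial_deriv b \<psi> = (\<lambda>y. of_real (b \<bullet> b'))"
      unfolding \<psi> by (rule ext, rule partial_deriv_eq[OF D1])
    then show ?thesis by (auto intro!: polynomials_in.base)
  next
    assume \<psi>: "\<psi> = (\<lambda>y. 1 / complex_of_real (reg p \<epsilon> y))"
    have "partial_deriv b \<psi> = (\<lambda>y. (-1) * (of_real ((y - p) \<bullet> b) * ((1 / of_real (reg p \<epsilon> y)) * ((1 / of_real (reg p \<epsilon> y)) * (1 / of_real (reg p \<epsilon> y))))))"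
      unfolding \<psi> by (rule ext) (subst partial_deriv_eq[OF D2], simp add: power2_eq_square)
    then show ?thesis
      by (simp only:) (intro polynomials_in.mult; intro polynomials_in.base; blast)
  next
    assume \<psi>: "\<psi> = (\<lambda>y. exp (- k * complex_of_real (reg p \<epsilon> y)))"
    have "partial_deriv b \<psi> = (\<lambda>y. (- k) * (of_real ((y - p) \<bullet> b) * ((1 / of_real (reg p \<epsilon> y)) * exp (- k * complex_of_real (reg p \<epsilon> y)))))"
      unfolding \<psi> by (rule ext) (subst partial_deriv_eq[OF D3], simp)
    then show ?thesis
      by (simp only:) (intro polynomials_in.mult; intro polynomials_in.base; blast)
  qed
  show "smooth (\<lambda>y. 1 / complex_of_real (reg p \<epsilon> y))"
    by (rule smooth_polynomials_in[where X="?X", OF _ diff pd]) (rule polynomials_in.base; blast)+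
  show "smooth (\<lambda>y. exp (- k * complex_of_real (reg p \<epsilon> y)))"
    by (rule smooth_polynomials_in[where X="?X", OF _ diff pd]) (rule polynomials_in.base; blast)+
qed

text \<open>\<open>F\<^sub>1(s) = F'(s) / s\<close>, so that the gradient of \<open>F(s)\<close> is \<open>F\<^sub>1(s) (y - p)\<close>.\<close>

lemma partial_deriv_radial:
  fixes F F\<^sub>1 :: "complex \<Rightarrow> complex"
  assumes \<epsilon>: "\<epsilon> > 0" and F: "\<forall>t>0. (F has_field_derivative of_real t * F\<^sub>1 (of_real t)) (at (complex_of_real t))"
  shows "partial_deriv b (\<lambda>y. F (of_real (reg p \<epsilon> y))) = (\<lambda>y. F\<^sub>1 (of_real (reg p \<epsilon> y)) * of_real ((y - p) \<bullet> b))"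
  using reg_pos[OF \<epsilon>, of p]
  by (intro ext) (subst partial_deriv_eq[OF radial_has_derivative[OF \<epsilon> F[rule_format]]], auto simp: less_imp_neq[THEN not_sym])

text \<open>The squared distance is s^2 - \<epsilon>^2, so the Laplacian is again a function of s
  alone. The factor 3 is the dimension: it comes from differentiating the vector y - p.\<close>

lemma lap_radial:
  fixes F F\<^sub>1 F\<^sub>2 :: "complex \<Rightarrow> complex" and p :: "real ^ 3"
  assumes \<epsilon>: "\<epsilon> > 0" and F: "\<forall>t>0. (F has_field_derivative of_real t * F\<^sub>1 (of_real t)) (at (complex_of_real t))"
    and F1: "\<forall>t>0. (F\<^sub>1 has_field_derivative F\<^sub>2 (of_real t)) (at (complex_of_real t))"
  shows "lap (\<lambda>y. F (of_real (reg p \<epsilon> y))) y =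
    F\<^sub>2 (of_real (reg p \<epsilon> y)) * of_real (((reg p \<epsilon> y)\<^sup>2 - \<epsilon>\<^sup>2) / reg p \<epsilon> y) + 3 * F\<^sub>1 (of_real (reg p \<epsilon> y))"
proof -
  let ?s = "reg p \<epsilon> y"
  have "partial_deriv b (partial_deriv b (\<lambda>y. F (of_real (reg p \<epsilon> y)))) y
    = F\<^sub>2 (of_real ?s) * of_real ((((y - p) \<bullet> b) * ((y - p) \<bullet> b)) / ?s) + F\<^sub>1 (of_real ?s) * of_real (b \<bullet> b)" for b
  proof -
    have 1: "((\<lambda>y. F\<^sub>1 (of_real (reg p \<epsilon> y))) has_derivative (\<lambda>h. F\<^sub>2 (of_real ?s) * of_real (((y - p) \<bullet> h) / ?s))) (at y)"
      by (rule radial_has_derivative[OF \<epsilon> F1[rule_format, OF reg_pos[OF \<epsilon>]]])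
    have 2: "((\<lambda>y. complex_of_real ((y - p) \<bullet> b)) has_derivative (\<lambda>h. of_real (h \<bullet> b))) (at y)"
      by (intro has_derivative_of_real) (auto intro!: derivative_eq_intros)
    show ?thesis
      unfolding partial_deriv_radial[OF \<epsilon> F]
      by (subst partial_deriv_eq[OF has_derivative_mult[OF 1 2]]) simp_all
  qed
  then have "lap (\<lambda>y. F (of_real (reg p \<epsilon> y))) y
    = (\<Sum>b\<in>(Basis :: (real^3) set). F\<^sub>2 (of_real ?s) * of_real ((((y - p) \<bullet> b) * ((y - p) \<bullet> b)) / ?s) + F\<^sub>1 (of_real ?s))"
    unfolding lap_def by (intro sum.cong) (auto simp: inner_same_Basis)
  also have "\<dots> = F\<^sub>2 (of_real ?s) * of_real ((\<Sum>b\<in>(Basis :: (real^3) set). ((y - p) \<bullet> b) * ((y - p) \<bullet> b)) / ?s) + 3 * F\<^sub>1 (of_real ?s)"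
    by (simp add: sum.distrib sum_distrib_left sum_divide_distrib)
  also have "(\<Sum>b\<in>(Basis :: (real^3) set). ((y - p) \<bullet> b) * ((y - p) \<bullet> b)) = ?s\<^sup>2 - \<epsilon>\<^sup>2"
    using euclidean_inner[of "y - p" "y - p"] by (simp add: reg_square power2_norm_eq_inner)
  finally show ?thesis .
qed

section \<open>The regularised Green function and its image under k^2 - \<Delta>\<close>

text \<open>What k^2 - \<Delta> leaves of exp (- k s) / (4 \<pi> s), apart from the factor
  \<epsilon>^2 / (4 \<pi> s^5). Its value 3 at 0 matches the integral 4 \<pi> / 3 of \<epsilon>^2 /
  s^5, so that the mass tends to 1.\<close>

definition mollifier_profile :: "complex \<Rightarrow> real \<Rightarrow> complex" where
  "mollifier_profile k t = exp (- k * of_real t) * (k\<^sup>2 * of_real t ^ 2 + 3 * k * of_real t + 3)"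

definition green_reg :: "complex \<Rightarrow> real \<Rightarrow> real ^ 3 \<Rightarrow> real ^ 3 \<Rightarrow> complex" where
  "green_reg k \<epsilon> p y = exp (- k * of_real (reg p \<epsilon> y)) / of_real (4 * pi * reg p \<epsilon> y)"

definition mollifier :: "complex \<Rightarrow> real \<Rightarrow> real ^ 3 \<Rightarrow> real ^ 3 \<Rightarrow> complex" where
  "mollifier k \<epsilon> p y = of_real (\<epsilon>\<^sup>2 / (4 * pi * reg p \<epsilon> y ^ 5)) * mollifier_profile k (reg p \<epsilon> y)"

lemma smooth_green_reg:
  assumes "\<epsilon> > 0" shows "smooth (green_reg k \<epsilon> p)"
  unfolding green_reg_def[abs_def]
  using smooth_mult[OF smooth_radial(2)[OF assms] smooth_cmult[OF smooth_radial(1)[OF assms], of "1 / of_real (4 * pi)"], of k p p]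
  by (simp add: field_simps)

text \<open>The profile F of the Green function; below, \<open>green_F\<^sub>1\<close> is F'(z) / z
  and \<open>green_F\<^sub>2\<close> is the derivative of \<open>green_F\<^sub>1\<close>, as
  \<open>lap_radial\<close> expects. Writing powers of \<open>inverse z\<close> keeps the algebra
  polynomial.\<close>

definition green_F :: "complex \<Rightarrow> complex \<Rightarrow> complex" where
  "green_F k z = exp (- k * z) * inverse z / of_real (4 * pi)"

definition green_F\<^sub>1 :: "complex \<Rightarrow> complex \<Rightarrow> complex" where
  "green_F\<^sub>1 k z = - exp (- k * z) * (k * inverse z ^ 2 + inverse z ^ 3) / of_real (4 * pi)"

definition green_F\<^sub>2 :: "complex \<Rightarrow> complex \<Rightarrow> complex" where
  "green_F\<^sub>2 k z = exp (- k * z) * (k\<^sup>2 * inverse z ^ 2 + 3 * k * inverse z ^ 3 + 3 * inverse z ^ 4) / of_real (4 * pi)"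

lemma green_reg_radial: "green_reg k \<epsilon> p = (\<lambda>y. green_F k (of_real (reg p \<epsilon> y)))"
  by (simp add: green_reg_def green_F_def fun_eq_iff field_simps)

lemma green_F_derivs:
  shows "\<forall>t>0. (green_F k has_field_derivative of_real t * green_F\<^sub>1 k (of_real t)) (at (complex_of_real t))"
    and "\<forall>t>0. (green_F\<^sub>1 k has_field_derivative green_F\<^sub>2 k (of_real t)) (at (complex_of_real t))"
proof -
  have "(green_F k has_field_derivative of_real t * green_F\<^sub>1 k (of_real t)) (at (complex_of_real t)) \<and>
    (green_F\<^sub>1 k has_field_derivative green_F\<^sub>2 k (of_real t)) (at (complex_of_real t))" if "t > 0" for t
  proof -
  define z w where "z = complex_of_real t" and "w = inverse z"
  have z: "z \<noteq> 0" using that by (simp add: z_def)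
  have zw: "z * w ^ Suc n = w ^ n" for n using z by (simp add: w_def)
  have dw: "((\<lambda>z. inverse z ^ n) has_field_derivative - (of_nat n * w ^ Suc n)) (at z)" for n
    using DERIV_power[OF DERIV_inverse[OF z], of n] by (rule DERIV_cong) (cases n; simp add: w_def)
  have de: "((\<lambda>z. exp (- k * z)) has_field_derivative - k * exp (- k * z)) (at z)"
    by (auto intro!: derivative_eq_intros)
  have "(green_F k has_field_derivative (exp (- k * z) * - (of_nat 1 * w ^ Suc 1) + - k * exp (- k * z) * inverse z ^ 1) / of_real (4 * pi)) (at z)"
    unfolding green_F_def[abs_def] using DERIV_cdivide[OF DERIV_mult'[OF de dw[of 1]], of "of_real (4 * pi)"] by simp
  moreover have "(exp (- k * z) * - (of_nat 1 * w ^ Suc 1) + - k * exp (- k * z) * inverse z ^ 1) / of_real (4 * pi) = z * green_F\<^sub>1 k z"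
  proof -
    have "z * green_F\<^sub>1 k z = - exp (- k * z) * (k * (z * w ^ Suc 1) + z * w ^ Suc 2) / of_real (4 * pi)"
      by (simp add: green_F\<^sub>1_def[abs_def] w_def algebra_simps eval_nat_numeral)
    then show ?thesis unfolding zw by (simp add: w_def algebra_simps power2_eq_square)
  qed
  ultimately have 1: "(green_F k has_field_derivative of_real t * green_F\<^sub>1 k (of_real t)) (at (complex_of_real t))"
    by (simp add: z_def)
  have "((\<lambda>z. k * inverse z ^ 2 + inverse z ^ 3) has_field_derivative k * - (of_nat 2 * w ^ Suc 2) + - (of_nat 3 * w ^ Suc 3)) (at z)"
    by (intro DERIV_add DERIV_cmult dw)
  from DERIV_cdivide[OF DERIV_mult'[OF DERIV_minus[OF de] this], of "of_real (4 * pi)"]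
  have "(green_F\<^sub>1 k has_field_derivative (- exp (- k * z) * (k * - (of_nat 2 * w ^ Suc 2) + - (of_nat 3 * w ^ Suc 3)) +
    - (- k * exp (- k * z)) * (k * inverse z ^ 2 + inverse z ^ 3)) / of_real (4 * pi)) (at z)"
    unfolding green_F\<^sub>1_def[abs_def] .
  moreover have "(- exp (- k * z) * (k * - (of_nat 2 * w ^ Suc 2) + - (of_nat 3 * w ^ Suc 3)) +
    - (- k * exp (- k * z)) * (k * inverse z ^ 2 + inverse z ^ 3)) / of_real (4 * pi) = green_F\<^sub>2 k z"
    unfolding green_F\<^sub>2_def w_def[symmetric] by (simp add: algebra_simps eval_nat_numeral)
  ultimately have 2: "(green_F\<^sub>1 k has_field_derivative green_F\<^sub>2 k (of_real t)) (at (complex_of_real t))"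
    by (simp add: z_def)
    from 1 2 show ?thesis by blast
  qed
  then show "\<forall>t>0. (green_F k has_field_derivative of_real t * green_F\<^sub>1 k (of_real t)) (at (complex_of_real t))"
    "\<forall>t>0. (green_F\<^sub>1 k has_field_derivative green_F\<^sub>2 k (of_real t)) (at (complex_of_real t))"
    by blast+
qed

lemma lap_green_reg:
  assumes \<epsilon>: "\<epsilon> > 0"
  shows "k\<^sup>2 * green_reg k \<epsilon> p y - lap (green_reg k \<epsilon> p) y = mollifier k \<epsilon> p y"
proof -
  \<comment> \<open>With s w = 1 the claim becomes polynomial in s, w and E. Among the terms without
    \<epsilon> those in w^2 and w^3 cancel, which is the classical equation off the pole; everything
    else carries \<epsilon>^2.\<close>
  define s w where "s = complex_of_real (reg p \<epsilon> y)" and "w = inverse s"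
  define E where "E = exp (- k * s) / of_real (4 * pi)"
  have s: "s \<noteq> 0" unfolding s_def using reg_pos[OF \<epsilon>, of p y] by simp
  have sw: "s * w ^ Suc n = w ^ n" for n using s by (simp add: w_def)
  have "lap (green_reg k \<epsilon> p) y = E * (k\<^sup>2 * w ^ 2 + 3 * k * w ^ 3 + 3 * w ^ 4) * ((s ^ 2 - of_real (\<epsilon>\<^sup>2)) * w) - 3 * E * (k * w ^ 2 + w ^ 3)"
  proof -
    have R: "complex_of_real (((reg p \<epsilon> y)\<^sup>2 - \<epsilon>\<^sup>2) / reg p \<epsilon> y) = (s ^ 2 - of_real (\<epsilon>\<^sup>2)) * w"
      by (simp add: w_def s_def field_simps)
    have "X * P / c * Y + 3 * (- X * Z / c) = X / c * P * Y - 3 * (X / c) * Z" for X P c Y Z :: complex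
      by (simp add: mult_ac)
    then show ?thesis
      unfolding green_reg_radial lap_radial[OF \<epsilon> green_F_derivs] R E_def green_F\<^sub>1_def green_F\<^sub>2_def s_def[symmetric] w_def[symmetric]
      by (simp only:)
  qed
  also have "\<dots> = E * (k\<^sup>2 * (s * (s * w ^ 3)) + 3 * k * (s * (s * w ^ 4)) + 3 * (s * (s * w ^ 5)))
      - E * of_real (\<epsilon>\<^sup>2) * (k\<^sup>2 * w ^ 3 + 3 * k * w ^ 4 + 3 * w ^ 5) - 3 * E * (k * w ^ 2 + w ^ 3)"
    by (simp add: algebra_simps eval_nat_numeral)
  also have "\<dots> = k\<^sup>2 * (E * w) - E * of_real (\<epsilon>\<^sup>2) * (k\<^sup>2 * w ^ 3 + 3 * k * w ^ 4 + 3 * w ^ 5)"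
  proof -
    have "s * (s * w ^ 3) = w" "s * (s * w ^ 4) = w ^ 2" "s * (s * w ^ 5) = w ^ 3"
    proof -
      have "s * (s * w ^ Suc (Suc n)) = w ^ n" for n by (simp only: sw)
      from this[of 1] this[of 2] this[of 3]
      show "s * (s * w ^ 3) = w" "s * (s * w ^ 4) = w ^ 2" "s * (s * w ^ 5) = w ^ 3"
        by (simp_all add: numeral_eq_Suc del: power_Suc)
    qed
    then show ?thesis by (simp only:) (simp add: algebra_simps eval_nat_numeral)
  qed
  also have "E * w = green_reg k \<epsilon> p y"
    using s by (simp add: E_def w_def s_def green_reg_def field_simps)
  also have "E * of_real (\<epsilon>\<^sup>2) * (k\<^sup>2 * w ^ 3 + 3 * k * w ^ 4 + 3 * w ^ 5) = mollifier k \<epsilon> p y"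
  proof -
    have "k\<^sup>2 * w ^ 3 + 3 * k * w ^ 4 + 3 * w ^ 5 = w ^ 5 * (k\<^sup>2 * s ^ 2 + 3 * k * s + 3)"
    proof -
      have "s * (s * w ^ Suc (Suc n)) = w ^ n" for n by (simp only: sw)
      from this[of 3] sw[of 4] have "s * (s * w ^ 5) = w ^ 3" "s * w ^ 5 = w ^ 4"
        by (simp_all add: numeral_eq_Suc del: power_Suc)
      moreover have "w ^ 5 * (k\<^sup>2 * s ^ 2 + 3 * k * s + 3) = k\<^sup>2 * (s * (s * w ^ 5)) + 3 * k * (s * w ^ 5) + 3 * w ^ 5"
        by (simp add: algebra_simps power2_eq_square)
      ultimately show ?thesis by (simp only:)
    qed
    moreover have "mollifier k \<epsilon> p y = of_real (\<epsilon>\<^sup>2) * w ^ 5 / of_real (4 * pi) * (exp (- k * s) * (k\<^sup>2 * s ^ 2 + 3 * k * s + 3))"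
      using s unfolding mollifier_def mollifier_profile_def w_def power_inverse by (simp add: s_def field_simps)
    ultimately show ?thesis by (simp add: E_def)
  qed
  finally show ?thesis by simp
qed

lemma partial_deriv_green_reg:
  assumes \<epsilon>: "\<epsilon> > 0"
  shows "partial_deriv b (green_reg k \<epsilon> p) y =
    - exp (- k * of_real (reg p \<epsilon> y)) * (k * inverse (of_real (reg p \<epsilon> y)) ^ 2 + inverse (of_real (reg p \<epsilon> y)) ^ 3) / of_real (4 * pi) * of_real ((y - p) \<bullet> b)"
  unfolding green_reg_radial partial_deriv_radial[OF \<epsilon> green_F_derivs(1)] green_F\<^sub>1_def ..

text \<open>As \<epsilon> tends to 0 the right-hand side tends to 2 exp (- r) / r, that is 8 \<pi>
  times the Green function for k = 1. This is the origin of the constant 8 \<pi>.\<close>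

lemma lap_exp_reg:
  fixes p y :: "real ^ 3" and \<epsilon> :: real
  assumes \<epsilon>: "\<epsilon> > 0"
  defines "s \<equiv> reg p \<epsilon> y"
  shows "exp (- of_real s) - lap (\<lambda>y. exp (- complex_of_real (reg p \<epsilon> y))) y = of_real (exp (- s) * (2 / s + \<epsilon>\<^sup>2 / s\<^sup>2 + \<epsilon>\<^sup>2 / s ^ 3))"
proof -
  have s: "complex_of_real s \<noteq> 0" unfolding s_def using reg_pos[OF \<epsilon>, of p y] by simp
  have "lap (\<lambda>y. (\<lambda>z. exp (- z)) (complex_of_real (reg p \<epsilon> y))) y
    = (\<lambda>z. exp (- z) * (1 / z + 1 / z\<^sup>2)) (of_real (reg p \<epsilon> y)) * of_real (((reg p \<epsilon> y)\<^sup>2 - \<epsilon>\<^sup>2) / reg p \<epsilon> y)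
      + 3 * (\<lambda>z. - exp (- z) / z) (of_real (reg p \<epsilon> y))"
  proof (rule lap_radial[OF \<epsilon>]; intro allI impI)
    fix t :: real assume "t > 0"
    then have t: "complex_of_real t \<noteq> 0" by simp
    show "((\<lambda>z. exp (- z)) has_field_derivative of_real t * (- exp (- of_real t) / of_real t)) (at (complex_of_real t))"
      using t by (auto intro!: derivative_eq_intros)
    show "((\<lambda>z. - exp (- z) / z) has_field_derivative exp (- of_real t) * (1 / of_real t + 1 / (of_real t)\<^sup>2)) (at (complex_of_real t))"
      using t by (auto intro!: derivative_eq_intros simp: divide_simps) (simp add: algebra_simps power2_eq_square)
  qed
  note L = this
  have id: "E - (E * (1 / z + 1 / z\<^sup>2) * ((z\<^sup>2 - e) / z) + 3 * (- E / z)) = E * (2 / z + e / z\<^sup>2 + e / z ^ 3)"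
    if "z \<noteq> 0" for E z e :: complex
  proof -
    define w where "w = inverse z"
    have zw: "z * w ^ Suc n = w ^ n" for n using that by (simp add: w_def)
    have "E - (E * (w + w ^ 2) * ((z\<^sup>2 - e) * w) + 3 * (- E * w)) = E - E * (z * (z * w ^ 2)) - E * (z * (z * w ^ 3)) + E * e * (w ^ 2 + w ^ 3) + 3 * E * w"
      by (simp add: algebra_simps eval_nat_numeral)
    also have "\<dots> = E * (2 * w + e * w ^ 2 + e * w ^ 3)"
      using zw[of 0] zw[of 1] zw[of 2] by (simp add: algebra_simps eval_nat_numeral)
    finally show ?thesis by (simp add: w_def field_simps)
  qed
  have c: "complex_of_real ((s\<^sup>2 - \<epsilon>\<^sup>2) / s) = (of_real s ^ 2 - of_real (\<epsilon>\<^sup>2)) / of_real s"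
    by simp
  show ?thesis
    using L unfolding s_def[symmetric] c
    by (simp only: id[OF s]) (simp flip: exp_of_real)
qed

section \<open>The fundamental solution\<close>

lemma reg01: "reg 0 1 x = sqrt (1 + (norm x)\<^sup>2)"
  by (simp add: reg_def add.commute)

text \<open>The integrand is the integral over [|x|, \<infinity>) of minus its radial derivative.
  Exchanging the integrals leaves the volume of balls and a one-dimensional integral with an
  elementary antiderivative.\<close>

lemma nn_integral_reg01:
  "(\<integral>\<^sup>+x. ennreal (1 / reg 0 1 (x :: real ^ 3) ^ 5) \<partial>lborel) = ennreal (4 * pi / 3)"
proof -
  \<comment> \<open>Minus the derivative of (1 + t^2)^(- 5/2).\<close>
  define g where "g t = 5 * t / sqrt (1 + t\<^sup>2) ^ 7" for t :: real
  have [measurable]: "g \<in> borel_measurable borel" unfolding g_def by measurable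
  have pos: "1 + t\<^sup>2 > 0" "sqrt (1 + t\<^sup>2) > 0" for t :: real by (simp_all add: add_pos_nonneg)
  have sq: "sqrt (1 + t\<^sup>2) * sqrt (1 + t\<^sup>2) = 1 + t * t" for t :: real
    using pos(1)[of t] by (simp add: power2_eq_square flip: real_sqrt_mult)
  have lim: "((\<lambda>t::real. 1 / sqrt (1 + t\<^sup>2)) \<longlongrightarrow> 0) at_top"
  proof (rule tendsto_sandwich[of "\<lambda>_. 0" _ _ "\<lambda>t. 1 / t"])
    show "\<forall>\<^sub>F t in at_top. 1 / sqrt (1 + t\<^sup>2) \<le> 1 / t"
      using eventually_gt_at_top[of 0]
      by eventually_elim (auto intro!: divide_left_mono real_le_rsqrt mult_pos_pos pos)
    show "((\<lambda>t::real. 1 / t) \<longlongrightarrow> 0) at_top" by (rule tendsto_divide_0[OF tendsto_const]) (rule filterlim_at_top_imp_at_infinity[OF filterlim_ident])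
  qed auto
  have lim': "((\<lambda>t::real. t / sqrt (1 + t\<^sup>2)) \<longlongrightarrow> 1) at_top"
  proof -
    have "((\<lambda>t::real. 1 / t) \<longlongrightarrow> 0) at_top" by (rule tendsto_divide_0[OF tendsto_const]) (rule filterlim_at_top_imp_at_infinity[OF filterlim_ident])
    then have "((\<lambda>t::real. 1 / sqrt (1 + (1 / t)\<^sup>2)) \<longlongrightarrow> 1 / sqrt (1 + 0\<^sup>2)) at_top" by (intro tendsto_intros) simp_all
    moreover have "\<forall>\<^sub>F t::real in at_top. 1 / sqrt (1 + (1 / t)\<^sup>2) = t / sqrt (1 + t\<^sup>2)"
      using eventually_gt_at_top[of 0]
    proof eventually_elim
      case (elim t)
      have "1 + (1 / t)\<^sup>2 = (1 + t\<^sup>2) / t\<^sup>2" using elim by (simp add: field_simps)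
      then show ?case using elim by (simp add: real_sqrt_divide)
    qed
    ultimately show ?thesis by (simp add: tendsto_cong)
  qed
  have "ennreal (1 / reg 0 1 x ^ 5) = (\<integral>\<^sup>+t. (if norm x \<le> t then ennreal (g t) else 0) \<partial>lborel)" for x :: "real ^ 3"
  proof -
    have "(\<integral>\<^sup>+t. ennreal (g t) * indicator {norm x..} t \<partial>lborel) = ennreal (0 - (- ((1 / sqrt (1 + (norm x)\<^sup>2)) ^ 5)))"
    proof (rule nn_integral_FTC_atLeast)
      fix t assume t: "norm x \<le> t"
      then have "0 \<le> t" using norm_ge_zero order_trans by blast
      then show "0 \<le> g t" using pos(2)[of t] by (simp add: g_def)
      have "((\<lambda>t. 1 / sqrt (1 + t\<^sup>2)) has_real_derivative - (t / sqrt (1 + t\<^sup>2) ^ 3)) (at t)"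
        using pos[of t] by (auto intro!: derivative_eq_intros simp: divide_simps sq power3_eq_cube)
      from DERIV_minus[OF DERIV_power[OF this, of 5]]
      show "((\<lambda>t. - ((1 / sqrt (1 + t\<^sup>2)) ^ 5)) has_real_derivative g t) (at t)"
        by (rule DERIV_cong) (simp add: g_def power_divide field_simps flip: power_add)
    next
      show "((\<lambda>t::real. - ((1 / sqrt (1 + t\<^sup>2)) ^ 5)) \<longlongrightarrow> 0) at_top"
        using tendsto_minus[OF tendsto_power[OF lim, of 5]] by simp
    qed simp
    moreover have "(\<integral>\<^sup>+t. ennreal (g t) * indicator {norm x..} t \<partial>lborel) = (\<integral>\<^sup>+t. (if norm x \<le> t then ennreal (g t) else 0) \<partial>lborel)"
      by (intro nn_integral_cong) (simp add: indicator_def)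
    ultimately show ?thesis by (simp add: reg01 power_divide)
  qed
  then have "(\<integral>\<^sup>+x. ennreal (1 / reg 0 1 (x :: real ^ 3) ^ 5) \<partial>lborel)
    = (\<integral>\<^sup>+x. \<integral>\<^sup>+t. (if norm (x :: real ^ 3) \<le> t then ennreal (g t) else 0) \<partial>lborel \<partial>lborel)"
    by simp
  also have "\<dots> = (\<integral>\<^sup>+t. \<integral>\<^sup>+x. (if norm (x :: real ^ 3) \<le> t then ennreal (g t) else 0) \<partial>lborel \<partial>lborel)"
    by (rule lborel_pair.Fubini') measurable
  also have "\<dots> = (\<integral>\<^sup>+t. ennreal (g t * (4 / 3 * pi * t ^ 3)) * indicator {0..} t \<partial>lborel)"
  proof (rule nn_integral_cong)
    fix t :: real
    show "(\<integral>\<^sup>+x. (if norm (x :: real ^ 3) \<le> t then ennreal (g t) else 0) \<partial>lborel) = ennreal (g t * (4 / 3 * pi * t ^ 3)) * indicator {0..} t"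
    proof (cases "t \<ge> 0")
      case True
      have "(\<integral>\<^sup>+x. (if norm (x :: real ^ 3) \<le> t then ennreal (g t) else 0) \<partial>lborel) = (\<integral>\<^sup>+x. ennreal (g t) * indicator (cball 0 t) (x :: real ^ 3) \<partial>lborel)"
        by (intro nn_integral_cong) (simp add: indicator_def)
      also have "\<dots> = ennreal (g t) * ennreal (4 / 3 * pi * t ^ 3)"
        using True by (simp add: nn_integral_cmult_indicator emeasure_cball unit_ball_vol_3 mult_ac)
      also have "\<dots> = ennreal (g t * (4 / 3 * pi * t ^ 3))"
        using True pos(2)[of t] by (intro ennreal_mult[symmetric]) (simp_all add: g_def)
      finally show ?thesis using True by simp
    next
      case False
      then have "\<not> norm (x :: real ^ 3) \<le> t" for x using norm_ge_zero[of x] by linarith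
      then show ?thesis using False by (simp add: indicator_def)
    qed
  qed
  \<comment> \<open>The antiderivative is (4/3) \<pi> (t / sqrt (1 + t^2))^5, which grows from 0 at
    0 to (4/3) \<pi> at infinity.\<close>
  also have "\<dots> = ennreal (4 / 3 * pi * 1 ^ 5 - 4 / 3 * pi * (0 / sqrt (1 + 0\<^sup>2)) ^ 5)"
  proof (rule nn_integral_FTC_atLeast)
    fix t :: real assume t: "0 \<le> t"
    then show "0 \<le> g t * (4 / 3 * pi * t ^ 3)" using pos(2)[of t] by (simp add: g_def)
    have "((\<lambda>t. t / sqrt (1 + t\<^sup>2)) has_real_derivative 1 / sqrt (1 + t\<^sup>2) ^ 3) (at t)"
      using pos[of t] by (auto intro!: derivative_eq_intros simp: divide_simps sq power3_eq_cube) (simp add: power2_eq_square)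
    from DERIV_cmult[OF DERIV_power[OF this, of 5], of "4 / 3 * pi"]
    show "((\<lambda>t. 4 / 3 * pi * (t / sqrt (1 + t\<^sup>2)) ^ 5) has_real_derivative g t * (4 / 3 * pi * t ^ 3)) (at t)"
      by (rule DERIV_cong) (simp add: g_def power_divide field_simps eval_nat_numeral)
  next
    show "((\<lambda>t::real. 4 / 3 * pi * (t / sqrt (1 + t\<^sup>2)) ^ 5) \<longlongrightarrow> 4 / 3 * pi * 1 ^ 5) at_top"
      by (intro tendsto_mult tendsto_power lim' tendsto_const)
  qed measurable
  finally show ?thesis by simp
qed

lemma nn_integral_affine:
  fixes f :: "'a::euclidean_space \<Rightarrow> ennreal"
  assumes [measurable]: "f \<in> borel_measurable borel" and c: "c > 0"
  shows "(\<integral>\<^sup>+y. f y \<partial>lborel) = (\<integral>\<^sup>+y. ennreal (c ^ DIM('a)) * f (p + c *\<^sub>R y) \<partial>lborel)"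
proof -
  have "(\<integral>\<^sup>+y. f y \<partial>lborel) = (\<integral>\<^sup>+y. f y \<partial>density (distr lborel borel (\<lambda>y. p + c *\<^sub>R y)) (\<lambda>_. \<bar>c\<bar> ^ DIM('a)))"
    using c by (subst lborel_affine[of c p]) auto
  also have "\<dots> = (\<integral>\<^sup>+y. ennreal (c ^ DIM('a)) * f (p + c *\<^sub>R y) \<partial>lborel)"
    using c by (subst nn_integral_density) (auto simp: nn_integral_distr)
  finally show ?thesis .
qed

lemma integral_affine:
  fixes f :: "'a::euclidean_space \<Rightarrow> complex"
  assumes [measurable]: "f \<in> borel_measurable borel" and c: "c > 0"
  shows "(\<integral>y. f y \<partial>lborel) = (\<integral>y. of_real (c ^ DIM('a)) * f (p + c *\<^sub>R y) \<partial>lborel)"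
proof -
  have "(\<integral>y. f y \<partial>lborel) = (\<integral>y. f y \<partial>density (distr lborel borel (\<lambda>y. p + c *\<^sub>R y)) (\<lambda>_. ennreal (\<bar>c\<bar> ^ DIM('a))))"
    using c by (subst lborel_affine[of c p]) (auto simp: ennreal_power)
  also have "\<dots> = (\<integral>y. of_real (c ^ DIM('a)) * f (p + c *\<^sub>R y) \<partial>lborel)"
    using c by (subst integral_density) (auto simp: integral_distr scaleR_conv_of_real)
  finally show ?thesis .
qed

lemma reg_affine: "\<epsilon> > 0 \<Longrightarrow> reg p \<epsilon> (p + \<epsilon> *\<^sub>R x) = \<epsilon> * reg 0 1 x"
  by (simp add: reg_def real_sqrt_mult power_mult_distrib flip: distrib_left[of "\<epsilon>\<^sup>2" _ 1, simplified])

text \<open>In the substitution y = p + \<epsilon> x the Jacobian \<epsilon>^3 and the factor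
  \<epsilon>^2 cancel the \<epsilon>^5 of the denominator.\<close>

lemma nn_integral_reg:
  assumes \<epsilon>: "\<epsilon> > 0"
  shows "(\<integral>\<^sup>+y. ennreal (\<epsilon>\<^sup>2 / reg p \<epsilon> (y :: real ^ 3) ^ 5) \<partial>lborel) = ennreal (4 * pi / 3)"
proof -
  have "(\<integral>\<^sup>+y. ennreal (\<epsilon>\<^sup>2 / reg p \<epsilon> (y :: real ^ 3) ^ 5) \<partial>lborel)
      = (\<integral>\<^sup>+x. ennreal (\<epsilon> ^ 3) * ennreal (\<epsilon>\<^sup>2 / reg p \<epsilon> (p + \<epsilon> *\<^sub>R x) ^ 5) \<partial>lborel)"
    by (subst nn_integral_affine[OF _ \<epsilon>, of _ p]) simp_all
  also have "\<dots> = (\<integral>\<^sup>+x. ennreal (1 / reg 0 1 (x :: real ^ 3) ^ 5) \<partial>lborel)"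
  proof (rule nn_integral_cong)
    fix x :: "real ^ 3"
    have "\<epsilon> ^ 3 * (\<epsilon>\<^sup>2 / (\<epsilon> * reg 0 1 x) ^ 5) = 1 / reg 0 1 x ^ 5"
      using \<epsilon> by (simp add: power_mult_distrib eval_nat_numeral)
    then show "ennreal (\<epsilon> ^ 3) * ennreal (\<epsilon>\<^sup>2 / reg p \<epsilon> (p + \<epsilon> *\<^sub>R x) ^ 5) = ennreal (1 / reg 0 1 x ^ 5)"
      using \<epsilon> reg_pos[of 1 0 x] by (simp add: reg_affine flip: ennreal_mult)
  qed
  finally show ?thesis by (simp add: nn_integral_reg01)
qed

lemma integral_reg:
  assumes \<epsilon>: "\<epsilon> > 0"
  shows "integrable lborel (\<lambda>y. \<epsilon>\<^sup>2 / reg p \<epsilon> (y :: real ^ 3) ^ 5)"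
    "(\<integral>y. \<epsilon>\<^sup>2 / reg p \<epsilon> (y :: real ^ 3) ^ 5 \<partial>lborel) = 4 * pi / 3"
proof -
  have nonneg: "0 \<le> \<epsilon>\<^sup>2 / reg p \<epsilon> y ^ 5" for y using reg_pos[OF \<epsilon>, of p y] by simp
  show "integrable lborel (\<lambda>y. \<epsilon>\<^sup>2 / reg p \<epsilon> (y :: real ^ 3) ^ 5)"
    by (rule integrableI_nonneg) (use nonneg in \<open>auto simp: nn_integral_reg[OF \<epsilon>]\<close>)
  show "(\<integral>y. \<epsilon>\<^sup>2 / reg p \<epsilon> (y :: real ^ 3) ^ 5 \<partial>lborel) = 4 * pi / 3"
    by (subst integral_eq_nn_integral) (use nonneg in \<open>auto simp: nn_integral_reg[OF \<epsilon>]\<close>)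
qed

section \<open>The mollifier as an approximate identity\<close>

text \<open>Any positive part of the exponential rate can be sacrificed to absorb the quadratic
  polynomial. Used with a = 0 for convergence, and with k = 2 and a = 1 where decay has to
  survive.\<close>

lemma mollifier_profile_bound:
  assumes "a < Re k"
  obtains C where "C > 0" "\<And>t. t \<ge> 0 \<Longrightarrow> cmod (mollifier_profile k t) \<le> C * exp (- a * t)"
proof -
  define d where "d = Re k - a"
  have d: "d > 0" using assms by (simp add: d_def)
  \<comment> \<open>From t \<le> exp (d t) / d and t^2 \<le> 2 exp (d t) / d^2, where d is the
    sacrificed rate.\<close>
  define C where "C = 2 * (cmod k)\<^sup>2 / d\<^sup>2 + 3 * cmod k / d + 3"
  have "C > 0" unfolding C_def using d by (intro add_nonneg_pos add_nonneg_nonneg) auto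
  moreover have "cmod (mollifier_profile k t) \<le> C * exp (- a * t)" if t: "t \<ge> 0" for t
  proof -
    have e1: "d * t \<le> exp (d * t)" using exp_ge_add_one_self[of "d * t"] by linarith
    have e2: "(d * t)\<^sup>2 / 2 \<le> exp (d * t)" using exp_lower_Taylor_quadratic[of "d * t"] mult_nonneg_nonneg[of d t] d t by linarith
    have e3: "1 \<le> exp (d * t)" using d t by simp
    have t1: "t \<le> exp (d * t) / d" using e1 d by (simp add: field_simps)
    have t2: "t\<^sup>2 \<le> 2 * exp (d * t) / d\<^sup>2" using e2 d by (simp add: field_simps power_mult_distrib)
    have "cmod (k\<^sup>2 * of_real t ^ 2 + 3 * k * of_real t + 3) \<le> cmod (k\<^sup>2 * of_real t ^ 2) + cmod (3 * k * of_real t) + cmod 3"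
      by (intro norm_triangle_le add_mono norm_triangle_ineq) auto
    also have "\<dots> = (cmod k)\<^sup>2 * t\<^sup>2 + 3 * cmod k * t + 3" using t by (simp add: norm_mult norm_power)
    also have "\<dots> \<le> (cmod k)\<^sup>2 * (2 * exp (d * t) / d\<^sup>2) + 3 * cmod k * (exp (d * t) / d) + 3 * exp (d * t)"
      using t1 t2 e3 by (intro add_mono mult_left_mono) auto
    also have "\<dots> = C * exp (d * t)" by (simp add: C_def algebra_simps)
    finally have "cmod (mollifier_profile k t) \<le> exp (- Re k * t) * (C * exp (d * t))"
      unfolding mollifier_profile_def norm_mult by (simp add: mult_left_mono)
    also have "\<dots> = C * exp (- a * t)" by (simp add: d_def left_diff_distrib flip: exp_add)
    finally show ?thesis .
  qed
  ultimately show ?thesis using that by blast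
qed

lemma mollifier_profile_measurable [measurable]: "mollifier_profile k \<in> borel_measurable borel"
  unfolding mollifier_profile_def[abs_def] by (intro borel_measurable_continuous_onI continuous_intros)

lemma mollifier_measurable [measurable]: "mollifier k \<epsilon> p \<in> borel_measurable borel"
  unfolding mollifier_def[abs_def] by measurable

text \<open>Rescaling by \<epsilon> turns the mollifier into a fixed integrable density times the
  profile at \<epsilon> \<open>reg 0 1 x\<close>, which tends to 3. For complex \<open>k\<close> the
  mollifier has no sign, so the limit comes from dominated convergence.\<close>

lemma mollifier_tendsto:
  assumes k: "Re k > 0" and [measurable]: "\<phi> \<in> borel_measurable borel"
    and M: "\<And>y. cmod (\<phi> y) \<le> M" and cont: "isCont \<phi> p"
  shows "(\<lambda>n. \<integral>y. \<phi> y * mollifier k (inverse (real (Suc n))) p y \<partial>lborel) \<longlonglongrightarrow> \<phi> p"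
proof -
  obtain C where C: "C > 0" "\<And>t. t \<ge> 0 \<Longrightarrow> cmod (mollifier_profile k t) \<le> C * exp (- 0 * t)" using mollifier_profile_bound[OF k] by blast
  define \<epsilon> where "\<epsilon> n = inverse (real (Suc n))" for n
  have \<epsilon>: "\<epsilon> n > 0" for n by (simp add: \<epsilon>_def)
  have \<epsilon>0: "\<epsilon> \<longlonglongrightarrow> 0" unfolding \<epsilon>_def by (rule LIMSEQ_inverse_real_of_nat)
  have w: "reg 0 1 x > 0" for x :: "real ^ 3" by (rule reg_pos) simp
  have eq: "(\<integral>y. \<phi> y * mollifier k (\<epsilon> n) p y \<partial>lborel)
    = (\<integral>x. \<phi> (p + \<epsilon> n *\<^sub>R x) * (of_real (1 / (4 * pi) * (1 / reg 0 1 x ^ 5)) * mollifier_profile k (\<epsilon> n * reg 0 1 x)) \<partial>lborel)" for n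
  proof (subst integral_affine[OF _ \<epsilon>[of n], of _ p])
    show "(\<integral>x. of_real (\<epsilon> n ^ DIM(real ^ 3)) * (\<phi> (p + \<epsilon> n *\<^sub>R x) * mollifier k (\<epsilon> n) p (p + \<epsilon> n *\<^sub>R x)) \<partial>lborel)
      = (\<integral>x. \<phi> (p + \<epsilon> n *\<^sub>R x) * (of_real (1 / (4 * pi) * (1 / reg 0 1 x ^ 5)) * mollifier_profile k (\<epsilon> n * reg 0 1 x)) \<partial>lborel)"
    proof (rule Bochner_Integration.integral_cong[OF refl])
      fix x :: "real ^ 3"
      have "\<epsilon> n ^ 3 * ((\<epsilon> n)\<^sup>2 / (4 * pi * (\<epsilon> n * reg 0 1 x) ^ 5)) = 1 / (4 * pi) * (1 / reg 0 1 x ^ 5)"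
        using \<epsilon>[of n] by (simp add: power_mult_distrib eval_nat_numeral)
      then have "complex_of_real (\<epsilon> n ^ 3) * of_real ((\<epsilon> n)\<^sup>2 / (4 * pi * (\<epsilon> n * reg 0 1 x) ^ 5)) = of_real (1 / (4 * pi) * (1 / reg 0 1 x ^ 5))"
        by (simp only: flip: of_real_mult)
      note A = this
      have D3: "DIM(real ^ 3) = 3" by simp
      show "of_real (\<epsilon> n ^ DIM(real ^ 3)) * (\<phi> (p + \<epsilon> n *\<^sub>R x) * mollifier k (\<epsilon> n) p (p + \<epsilon> n *\<^sub>R x))
        = \<phi> (p + \<epsilon> n *\<^sub>R x) * (of_real (1 / (4 * pi) * (1 / reg 0 1 x ^ 5)) * mollifier_profile k (\<epsilon> n * reg 0 1 x))"
        unfolding mollifier_def reg_affine[OF \<epsilon>] D3 A[symmetric] by (simp only: mult_ac)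
    qed
  qed measurable
  have "(\<lambda>n. \<integral>x. \<phi> (p + \<epsilon> n *\<^sub>R x) * (of_real (1 / (4 * pi) * (1 / reg 0 1 x ^ 5)) * mollifier_profile k (\<epsilon> n * reg 0 1 x)) \<partial>lborel)
    \<longlonglongrightarrow> (\<integral>x. \<phi> p * (of_real (1 / (4 * pi) * (1 / reg 0 1 (x :: real ^ 3) ^ 5)) * 3) \<partial>lborel)"
  proof (rule integral_dominated_convergence)
    show "integrable lborel (\<lambda>x. M * C / (4 * pi) * (1\<^sup>2 / reg 0 1 (x :: real ^ 3) ^ 5))"
      by (intro integrable_mult_right integral_reg) simp
    show "AE x in lborel. (\<lambda>n. \<phi> (p + \<epsilon> n *\<^sub>R x) * (of_real (1 / (4 * pi) * (1 / reg 0 1 x ^ 5)) * mollifier_profile k (\<epsilon> n * reg 0 1 x)))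
      \<longlonglongrightarrow> \<phi> p * (of_real (1 / (4 * pi) * (1 / reg 0 1 x ^ 5)) * 3)"
    proof (rule AE_I2)
      fix x :: "real ^ 3"
      have "(\<lambda>n. p + \<epsilon> n *\<^sub>R x) \<longlonglongrightarrow> p + 0 *\<^sub>R x" by (intro tendsto_intros \<epsilon>0)
      then have 1: "(\<lambda>n. \<phi> (p + \<epsilon> n *\<^sub>R x)) \<longlonglongrightarrow> \<phi> p" using cont by (intro isCont_tendsto_compose[OF cont]) simp
      have "(\<lambda>n. mollifier_profile k (\<epsilon> n * reg 0 1 x)) \<longlonglongrightarrow> exp (- k * of_real (0 * reg 0 1 x)) * (k\<^sup>2 * of_real (0 * reg 0 1 x) ^ 2 + 3 * k * of_real (0 * reg 0 1 x) + 3)"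
        unfolding mollifier_profile_def by (intro tendsto_intros \<epsilon>0)
      then have 2: "(\<lambda>n. mollifier_profile k (\<epsilon> n * reg 0 1 x)) \<longlonglongrightarrow> 3" by simp
      show "(\<lambda>n. \<phi> (p + \<epsilon> n *\<^sub>R x) * (of_real (1 / (4 * pi) * (1 / reg 0 1 x ^ 5)) * mollifier_profile k (\<epsilon> n * reg 0 1 x)))
        \<longlonglongrightarrow> \<phi> p * (of_real (1 / (4 * pi) * (1 / reg 0 1 x ^ 5)) * 3)"
        by (intro tendsto_mult 1 2 tendsto_const)
    qed
    show "AE x in lborel. norm (\<phi> (p + \<epsilon> n *\<^sub>R x) * (of_real (1 / (4 * pi) * (1 / reg 0 1 x ^ 5)) * mollifier_profile k (\<epsilon> n * reg 0 1 x)))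
      \<le> M * C / (4 * pi) * (1\<^sup>2 / reg 0 1 x ^ 5)" for n
    proof (rule AE_I2)
      fix x :: "real ^ 3"
      let ?w = "1 / (4 * pi) * (1 / reg 0 1 x ^ 5)"
      have "cmod (\<phi> (p + \<epsilon> n *\<^sub>R x)) * (?w * cmod (mollifier_profile k (\<epsilon> n * reg 0 1 x))) \<le> M * (?w * C)"
        using C(2)[of "\<epsilon> n * reg 0 1 x"] \<epsilon>[of n] w[of x] order_trans[OF norm_ge_zero M]
        by (intro mult_mono M mult_nonneg_nonneg mult_left_mono) (auto intro!: mult_nonneg_nonneg)
      then show "norm (\<phi> (p + \<epsilon> n *\<^sub>R x) * (of_real (1 / (4 * pi) * (1 / reg 0 1 x ^ 5)) * mollifier_profile k (\<epsilon> n * reg 0 1 x)))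
        \<le> M * C / (4 * pi) * (1\<^sup>2 / reg 0 1 x ^ 5)"
        unfolding norm_mult norm_of_real using w[of x] by (simp add: mult_ac)
    qed
  qed measurable
  also have "(\<integral>x. \<phi> p * (of_real (1 / (4 * pi) * (1 / reg 0 1 (x :: real ^ 3) ^ 5)) * 3) \<partial>lborel) = \<phi> p"
  proof -
    have "(\<integral>x. complex_of_real (1 / (4 * pi) * (1 / reg 0 1 (x :: real ^ 3) ^ 5)) \<partial>lborel) = of_real (1 / (4 * pi) * (4 * pi / 3))"
    proof -
      have r: "(\<integral>x. 1 / reg 0 1 (x :: real ^ 3) ^ 5 \<partial>lborel) = 4 * pi / 3"
        using integral_reg(2)[of 1 "0 :: real ^ 3"] by simp
      show ?thesis unfolding integral_complex_of_real integral_mult_right_zero r ..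
    qed
    then have "(\<integral>x. complex_of_real (1 / (4 * pi) * (1 / reg 0 1 (x :: real ^ 3) ^ 5)) \<partial>lborel) = 1 / 3" by simp
    then show ?thesis unfolding integral_mult_right_zero integral_mult_left_zero by simp
  qed
  finally show ?thesis unfolding eq[unfolded \<epsilon>_def, symmetric] \<epsilon>_def eq[symmetric] .
qed

lemma mollifier_le:
  assumes \<epsilon>: "\<epsilon> > 0" and C: "\<And>t. t \<ge> 0 \<Longrightarrow> cmod (mollifier_profile k t) \<le> C * exp (- a * t)"
  shows "cmod (mollifier k \<epsilon> p y) \<le> C / (4 * pi) * (\<epsilon>\<^sup>2 / reg p \<epsilon> y ^ 5) * exp (- a * reg p \<epsilon> y)"
proof -
  have s: "reg p \<epsilon> y > 0" by (rule reg_pos[OF \<epsilon>])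
  have "cmod (mollifier k \<epsilon> p y) = \<epsilon>\<^sup>2 / (4 * pi * reg p \<epsilon> y ^ 5) * cmod (mollifier_profile k (reg p \<epsilon> y))"
    unfolding mollifier_def norm_mult norm_of_real using s by simp
  also have "\<dots> \<le> \<epsilon>\<^sup>2 / (4 * pi * reg p \<epsilon> y ^ 5) * (C * exp (- a * reg p \<epsilon> y))"
    using s C[of "reg p \<epsilon> y"] by (intro mult_left_mono) auto
  finally show ?thesis by (simp add: mult_ac)
qed

section \<open>The Green function and its representation formula\<close>

text \<open>\<open>k\<close> is complex: k = 1 carries the boundary data, k = - \<i> sqrt z the
  defect elements. At the pole the quotient is 0 by convention.\<close>

definition green :: "complex \<Rightarrow> real ^ 3 \<Rightarrow> real ^ 3 \<Rightarrow> complex" where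
  "green k p y = exp (- k * of_real (norm (y - p))) / of_real (4 * pi * norm (y - p))"

lemma green_measurable [measurable]: "green k p \<in> borel_measurable borel"
  unfolding green_def[abs_def]
  by (intro borel_measurable_divide borel_measurable_continuous_onI continuous_intros)

lemma cmod_green: "cmod (green k p y) = exp (- Re k * norm (y - p)) / (4 * pi * norm (y - p))"
  by (simp add: green_def norm_divide norm_mult)

lemma square_integrable_green:
  assumes "Re k > 0" shows "square_integrable (green k p)"
proof -
  have "square_integrable (\<lambda>y. of_real (1 / (4 * pi)) * of_real (exp (- Re k * norm (y - p)) / norm (y - p)))"
    by (intro square_integrable_scale square_integrable_exp_over_norm assms)
  moreover have "cmod (of_real (1 / (4 * pi)) * of_real (exp (- Re k * norm (y - p)) / norm (y - p))) = cmod (green k p y)" for y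
    by (simp add: cmod_green norm_mult norm_divide abs_mult)
  ultimately show ?thesis by (simp add: square_integrable_def)
qed

text \<open>The regularised distance is at least the distance, and exp (- Re k t) / t decreases in
  t. This is the majorant for \<epsilon> \<rightarrow> 0; it fails at the pole, where
  \<open>green\<close> takes its conventional value 0.\<close>

lemma cmod_green_reg_le:
  assumes "Re k > 0" "\<epsilon> > 0" "y \<noteq> p"
  shows "cmod (green_reg k \<epsilon> p y) \<le> cmod (green k p y)"
proof -
  have s: "norm (y - p) \<le> reg p \<epsilon> y" "norm (y - p) > 0" "reg p \<epsilon> y > 0"
    using reg_ge(1)[of y p \<epsilon>] assms(3) reg_pos[OF assms(2), of p y] by simp_all
  then have "exp (- Re k * reg p \<epsilon> y) / (4 * pi * reg p \<epsilon> y) \<le> exp (- Re k * norm (y - p)) / (4 * pi * norm (y - p))"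
    using assms(1) by (intro frac_le) auto
  then show ?thesis using s by (simp add: cmod_green green_reg_def norm_divide norm_mult)
qed

lemma green_reg_tendsto:
  assumes "y \<noteq> p"
  shows "(\<lambda>n. green_reg k (inverse (real (Suc n))) p y) \<longlonglongrightarrow> green k p y"
proof -
  have "(\<lambda>n. reg p (inverse (real (Suc n))) y) \<longlonglongrightarrow> sqrt ((norm (y - p))\<^sup>2 + 0\<^sup>2)"
    unfolding reg_def by (intro tendsto_intros LIMSEQ_inverse_real_of_nat)
  then have "(\<lambda>n. reg p (inverse (real (Suc n))) y) \<longlonglongrightarrow> norm (y - p)" by simp
  then show ?thesis
    unfolding green_reg_def green_def using assms by (intro tendsto_intros) auto
qed

text \<open>At positive \<epsilon> the operator moves across by parts onto the smooth regularised
  solution and leaves the mollifier. One sequence of integrals thus has both sides as its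
  limit.\<close>

lemma green_representation:
  assumes k: "Re k > 0" and \<psi>: "test_function \<psi>"
  shows "(\<integral>y. (k\<^sup>2 * \<psi> y - lap \<psi> y) * green k p y \<partial>lborel) = \<psi> p"
proof (rule LIMSEQ_unique)
  define \<phi> where "\<phi> y = k\<^sup>2 * \<psi> y - lap \<psi> y" for y
  have \<phi>: "test_function \<phi>"
    unfolding \<phi>_def[abs_def] by (intro test_function_diff test_function_cmult test_function_lap \<psi>)
  note [measurable] = test_function_measurable[OF \<phi>]
  obtain M where M: "\<And>y. cmod (\<psi> y) \<le> M" using test_function_bounded[OF \<psi>] by blast
  show "(\<lambda>n. \<integral>y. \<phi> y * green_reg k (inverse (real (Suc n))) p y \<partial>lborel) \<longlonglongrightarrow> (\<integral>y. (k\<^sup>2 * \<psi> y - lap \<psi> y) * green k p y \<partial>lborel)"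
    unfolding \<phi>_def[symmetric]
  proof (rule integral_dominated_convergence)
    show "integrable lborel (\<lambda>y. cmod (\<phi> y * green k p y))"
      by (intro integrable_norm square_integrable_integrable_mult test_function_square_integrable \<phi> square_integrable_green k)
    show "(\<lambda>y. \<phi> y * green_reg k (inverse (real (Suc n))) p y) \<in> borel_measurable lborel" for n
      using borel_measurable_continuous_onI[OF smooth_continuous_on[OF smooth_green_reg[of "inverse (real (Suc n))" k p]]] by simp
    show "AE y in lborel. (\<lambda>n. \<phi> y * green_reg k (inverse (real (Suc n))) p y) \<longlonglongrightarrow> \<phi> y * green k p y"
      using AE_lborel_singleton[of p] by eventually_elim (intro tendsto_intros green_reg_tendsto)
    show "AE y in lborel. cmod (\<phi> y * green_reg k (inverse (real (Suc n))) p y) \<le> cmod (\<phi> y * green k p y)" for n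
      using AE_lborel_singleton[of p]
      by eventually_elim (auto simp: norm_mult intro!: mult_left_mono cmod_green_reg_le k simp del: of_nat_Suc)
  qed measurable
  have "(\<integral>y. \<phi> y * green_reg k \<epsilon> p y \<partial>lborel) = (\<integral>y. \<psi> y * mollifier k \<epsilon> p y \<partial>lborel)" if \<epsilon>: "\<epsilon> > 0" for \<epsilon>
  proof -
    note g = smooth_green_reg[OF \<epsilon>, of k p]
    have i: "integrable lborel (\<lambda>y. k\<^sup>2 * \<psi> y * green_reg k \<epsilon> p y)" "integrable lborel (\<lambda>y. lap \<psi> y * green_reg k \<epsilon> p y)"
      "integrable lborel (\<lambda>y. \<psi> y * lap (green_reg k \<epsilon> p) y)"
      by (intro test_function_integrable test_function_smooth_mult test_function_cmult test_function_lap \<psi> g smooth_lap)+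
    have "(\<integral>y. \<phi> y * green_reg k \<epsilon> p y \<partial>lborel) = (\<integral>y. k\<^sup>2 * \<psi> y * green_reg k \<epsilon> p y \<partial>lborel) - (\<integral>y. lap \<psi> y * green_reg k \<epsilon> p y \<partial>lborel)"
      unfolding \<phi>_def left_diff_distrib by (rule Bochner_Integration.integral_diff[OF i(1,2)])
    also have "(\<integral>y. lap \<psi> y * green_reg k \<epsilon> p y \<partial>lborel) = (\<integral>y. \<psi> y * lap (green_reg k \<epsilon> p) y \<partial>lborel)"
      by (rule integral_lap_by_parts[OF \<psi> g])
    also have "(\<integral>y. k\<^sup>2 * \<psi> y * green_reg k \<epsilon> p y \<partial>lborel) - (\<integral>y. \<psi> y * lap (green_reg k \<epsilon> p) y \<partial>lborel)
      = (\<integral>y. k\<^sup>2 * \<psi> y * green_reg k \<epsilon> p y - \<psi> y * lap (green_reg k \<epsilon> p) y \<partial>lborel)"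
      by (rule Bochner_Integration.integral_diff[OF i(1,3), symmetric])
    also have "\<dots> = (\<integral>y. \<psi> y * mollifier k \<epsilon> p y \<partial>lborel)"
      unfolding lap_green_reg[OF \<epsilon>, symmetric] by (simp add: algebra_simps)
    finally show ?thesis .
  qed
  then show "(\<lambda>n. \<integral>y. \<phi> y * green_reg k (inverse (real (Suc n))) p y \<partial>lborel) \<longlonglongrightarrow> \<psi> p"
    using mollifier_tendsto[OF k test_function_measurable[OF \<psi>] M, of p] test_function_continuous_on[OF \<psi>, of UNIV]
    by (simp add: continuous_on_eq_continuous_at del: of_nat_Suc)
qed

section \<open>Density of the range of \<open>4 - \<Delta>\<close> on test functions\<close>

lemma lap_mult:
  assumes f: "smooth f" and g: "smooth g"
  shows "lap (\<lambda>y. f y * g y) y = f y * lap g y + 2 * (\<Sum>b\<in>Basis. partial_deriv b f y * partial_deriv b g y) + lap f y * g y"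
proof -
  have "partial_deriv b (partial_deriv b (\<lambda>y. f y * g y)) y
    = f y * partial_deriv b (partial_deriv b g) y + 2 * (partial_deriv b f y * partial_deriv b g y) + partial_deriv b (partial_deriv b f) y * g y"
    if b: "b \<in> Basis" for b
  proof -
    note d = smooth_differentiable
    note sf = smooth_partial_deriv[OF f b] and sg = smooth_partial_deriv[OF g b]
    have 1: "partial_deriv b (\<lambda>y. f y * g y) = (\<lambda>y. f y * partial_deriv b g y + partial_deriv b f y * g y)"
      by (rule partial_deriv_mult) (intro d f g)+
    show ?thesis
      unfolding 1
      by (subst partial_deriv_add[OF d[OF smooth_mult[OF f sg]] d[OF smooth_mult[OF sf g]]])
        (simp add: partial_deriv_mult[OF d[OF f] d[OF sg]] partial_deriv_mult[OF d[OF sf] d[OF g]])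
  qed
  then show ?thesis by (simp add: lap_def sum.distrib sum_distrib_left sum_distrib_right)
qed

lemma lap_scale:
  assumes f: "smooth f"
  shows "lap (\<lambda>y. f (r *\<^sub>R y)) y = of_real (r\<^sup>2) * lap f (r *\<^sub>R y)"
proof -
  have "partial_deriv b (partial_deriv b (\<lambda>y. f (r *\<^sub>R y))) y = of_real (r\<^sup>2) * partial_deriv b (partial_deriv b f) (r *\<^sub>R y)"
    if b: "b \<in> Basis" for b
  proof -
    note sf = smooth_partial_deriv[OF f b]
    show ?thesis
      unfolding partial_deriv_scale[OF f] partial_deriv_cmult[OF smooth_scale[OF sf]] partial_deriv_scale[OF sf]
      by (simp add: power2_eq_square)
  qed
  then show ?thesis by (simp add: lap_def sum_distrib_left)
qed

text \<open>Normalised at 0 because the dilated cutoffs tend pointwise to that value.\<close>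

lemma cutoff_exists:
  obtains \<eta> :: "'a::euclidean_space \<Rightarrow> complex" where "test_function \<eta>" "\<eta> 0 = 1"
proof -
  let ?b = "\<lambda>y::'a. complex_of_real (box_bump 1 (- One) One y)"
  have "box_bump 1 (- One) One (0::'a) > 0" by (rule box_bump_pos) (auto simp: mem_box)
  then have 1: "1 / ?b 0 * ?b 0 = 1" by simp
  have "test_function (\<lambda>y. 1 / ?b 0 * ?b y)" by (intro test_function_cmult test_function_box_bump) simp
  from this 1 show ?thesis by (rule that)
qed

text \<open>Extends orthogonality of \<open>v\<close> from test functions to decaying smooth
  functions. Multiply \<open>u\<close> by a dilated cutoff: each derivative that falls on the cutoff
  brings a factor \<open>r n\<close>, which tends to 0, and the product of the square integrable
  \<open>v\<close> and \<open>w\<close> provides the majorant.\<close>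

lemma integral_decaying_eq_0:
  fixes v u :: "'a::euclidean_space \<Rightarrow> complex"
  assumes v: "square_integrable v" and w: "square_integrable w" and u: "smooth u"
    and zero: "\<And>\<psi>. test_function \<psi> \<Longrightarrow> (\<integral>y. v y * (k\<^sup>2 * \<psi> y - lap \<psi> y) \<partial>lborel) = 0"
    and bu: "\<And>y. cmod (u y) \<le> cmod (w y)" and bd: "\<And>b y. b \<in> Basis \<Longrightarrow> cmod (partial_deriv b u y) \<le> cmod (w y)"
    and bl: "\<And>y. cmod (k\<^sup>2 * u y - lap u y) \<le> cmod (w y)"
  shows "(\<integral>y. v y * (k\<^sup>2 * u y - lap u y) \<partial>lborel) = 0"
proof -
  obtain \<eta> :: "'a \<Rightarrow> complex" where \<eta>: "test_function \<eta>" "\<eta> 0 = 1" by (rule cutoff_exists)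
  note sm = test_function_smooth[OF \<eta>(1)]
  define r where "r n = inverse (real (Suc n))" for n
  have r: "r n > 0" "r n \<le> 1" for n by (simp_all add: r_def field_simps)
  have r0: "r \<longlonglongrightarrow> 0" unfolding r_def by (rule LIMSEQ_inverse_real_of_nat)
  obtain M0 where M0: "\<And>y. cmod (\<eta> y) \<le> M0" using test_function_bounded[OF \<eta>(1)] by blast
  obtain M2 where M2: "\<And>y. cmod (lap \<eta> y) \<le> M2" using test_function_bounded[OF test_function_lap[OF \<eta>(1)]] by blast
  have "\<forall>b\<in>Basis. \<exists>M. \<forall>y. cmod (partial_deriv b \<eta> y) \<le> M"
    using test_function_bounded[OF test_function_partial_deriv[OF \<eta>(1)]] by metis
  then obtain M1 where M1: "\<And>b y. b \<in> Basis \<Longrightarrow> cmod (partial_deriv b \<eta> y) \<le> M1 b" by metis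
  let ?\<psi> = "\<lambda>n y. \<eta> (r n *\<^sub>R y) * u y"
  let ?L = "\<lambda>n y. k\<^sup>2 * ?\<psi> n y - lap (?\<psi> n) y"
  have \<psi>: "test_function (?\<psi> n)" for n
  proof (rule test_function_smooth_mult[OF _ u], rule test_functionI[OF smooth_scale[OF sm]])
    obtain R where R: "\<And>y. \<eta> y \<noteq> 0 \<Longrightarrow> norm y \<le> R" using test_function_support[OF \<eta>(1)] by blast
    show "bounded {y. \<eta> (r n *\<^sub>R y) \<noteq> 0}"
      by (rule boundedI[of _ "R / r n"]) (use R[of "r n *\<^sub>R _"] r(1)[of n] in \<open>auto simp: field_simps\<close>)
  qed
  have L: "?L n y = \<eta> (r n *\<^sub>R y) * (k\<^sup>2 * u y - lap u y)
      - 2 * (\<Sum>b\<in>Basis. of_real (r n) * partial_deriv b \<eta> (r n *\<^sub>R y) * partial_deriv b u y)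
      - of_real ((r n)\<^sup>2) * lap \<eta> (r n *\<^sub>R y) * u y" for n y
    unfolding lap_mult[OF smooth_scale[OF sm] u] lap_scale[OF sm] partial_deriv_scale[OF sm]
    by (simp add: algebra_simps)
  have m: "?L n \<in> borel_measurable borel" for n
    using test_function_measurable[OF \<psi>] test_function_measurable[OF test_function_lap[OF \<psi>]] by measurable
  have mu: "(\<lambda>y. k\<^sup>2 * u y - lap u y) \<in> borel_measurable borel"
    by (intro borel_measurable_continuous_onI smooth_continuous_on smooth_diff smooth_cmult smooth_lap u)
  have [measurable]: "v \<in> borel_measurable borel" using v by (rule square_integrable_measurable)
  \<comment> \<open>Bounds for the cutoff, its first derivatives and its Laplacian, one for each
    term of \<open>L\<close>; the dilation factors are at most 1.\<close>
  define M where "M = M0 + 2 * (\<Sum>b\<in>(Basis::'a set). M1 b) + M2"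
  have "(\<lambda>n. \<integral>y. v y * ?L n y \<partial>lborel) \<longlonglongrightarrow> (\<integral>y. v y * (k\<^sup>2 * u y - lap u y) \<partial>lborel)"
  proof (rule integral_dominated_convergence)
    show "integrable lborel (\<lambda>y. M * cmod (v y * w y))"
      by (intro integrable_mult_right integrable_norm square_integrable_integrable_mult v w)
    show "(\<lambda>y. v y * (k\<^sup>2 * u y - lap u y)) \<in> borel_measurable lborel" "(\<lambda>y. v y * ?L n y) \<in> borel_measurable lborel" for n
      using m[of n] mu by measurable
    show "AE y in lborel. (\<lambda>n. v y * ?L n y) \<longlonglongrightarrow> v y * (k\<^sup>2 * u y - lap u y)"
    proof (rule AE_I2)
      fix y
      have lim: "(\<lambda>n. f (r n *\<^sub>R y)) \<longlonglongrightarrow> f 0" if "test_function f" for f :: "'a \<Rightarrow> complex"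
      proof (rule isCont_tendsto_compose[of _ f])
        show "isCont f 0" using test_function_continuous_on[OF that, of UNIV] by (simp add: continuous_on_eq_continuous_at)
        have "(\<lambda>n. r n *\<^sub>R y) \<longlonglongrightarrow> 0 *\<^sub>R y" by (intro tendsto_intros r0)
        then show "(\<lambda>n. r n *\<^sub>R y) \<longlonglongrightarrow> 0" by simp
      qed
      have "(\<lambda>n. ?L n y) \<longlonglongrightarrow> \<eta> 0 * (k\<^sup>2 * u y - lap u y)
        - 2 * (\<Sum>b\<in>Basis. of_real 0 * partial_deriv b \<eta> 0 * partial_deriv b u y) - of_real (0\<^sup>2) * lap \<eta> 0 * u y"
        unfolding L by (intro tendsto_intros lim r0 test_function_partial_deriv test_function_lap \<eta>)
      then have "(\<lambda>n. ?L n y) \<longlonglongrightarrow> k\<^sup>2 * u y - lap u y" by (simp add: \<eta>)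
      then show "(\<lambda>n. v y * ?L n y) \<longlonglongrightarrow> v y * (k\<^sup>2 * u y - lap u y)" by (rule tendsto_mult[OF tendsto_const])
    qed
    show "AE y in lborel. norm (v y * ?L n y) \<le> M * cmod (v y * w y)" for n
    proof (rule AE_I2)
      fix y
      have r2: "(r n)\<^sup>2 \<le> 1" using r[of n] by (simp add: power_le_one)
      have 1: "cmod (\<eta> (r n *\<^sub>R y) * (k\<^sup>2 * u y - lap u y)) \<le> M0 * cmod (w y)"
        unfolding norm_mult by (intro mult_mono M0 bl order_trans[OF norm_ge_zero M0]) simp
      have 2: "cmod (2 * (\<Sum>b\<in>Basis. of_real (r n) * partial_deriv b \<eta> (r n *\<^sub>R y) * partial_deriv b u y)) \<le> 2 * (\<Sum>b\<in>Basis. M1 b * cmod (w y))"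
      proof -
        have "cmod (of_real (r n) * partial_deriv b \<eta> (r n *\<^sub>R y) * partial_deriv b u y) \<le> (1 * M1 b) * cmod (w y)" if b: "b \<in> Basis" for b
          unfolding norm_mult
          by (intro mult_mono M1 bd b mult_nonneg_nonneg order_trans[OF norm_ge_zero M1[OF b]]) (use r[of n] in auto)
        then show ?thesis by (auto simp: norm_mult intro!: order_trans[OF norm_sum] sum_mono)
      qed
      have 3: "cmod (of_real ((r n)\<^sup>2) * lap \<eta> (r n *\<^sub>R y) * u y) \<le> (1 * M2) * cmod (w y)"
        unfolding norm_mult by (intro mult_mono M2 bu mult_nonneg_nonneg order_trans[OF norm_ge_zero M2]) (use r2 in \<open>auto simp: norm_power\<close>)
      have "cmod (?L n y) \<le> M0 * cmod (w y) + 2 * (\<Sum>b\<in>Basis. M1 b * cmod (w y)) + (1 * M2) * cmod (w y)"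
        unfolding L by (intro order_trans[OF norm_triangle_ineq4] add_mono 1 2 3)
      also have "\<dots> = M * cmod (w y)" by (simp add: M_def algebra_simps flip: sum_distrib_left sum_distrib_right)
      finally have "cmod (v y) * cmod (?L n y) \<le> cmod (v y) * (M * cmod (w y))" by (intro mult_left_mono) auto
      then show "norm (v y * ?L n y) \<le> M * cmod (v y * w y)" by (simp add: norm_mult mult_ac)
    qed
  qed
  moreover have "(\<lambda>n. \<integral>y. v y * ?L n y \<partial>lborel) \<longlonglongrightarrow> 0"
    using zero[OF \<psi>] by simp
  ultimately show ?thesis by (rule LIMSEQ_unique)
qed

text \<open>\<epsilon> is fixed, and \<open>M\<close> blows up as \<epsilon> tends to 0. The gain is
  that all three quantities inherit the decay exp (- |y - p|), a square integrable majorant.\<close>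

lemma green_reg_bounds:
  assumes \<epsilon>: "\<epsilon> > 0" and k: "Re k = 2" "cmod k = 2"
  obtains M where "M > 0" "\<And>y. cmod (green_reg k \<epsilon> p y) \<le> M * exp (- norm (y - p))"
    "\<And>b y. b \<in> Basis \<Longrightarrow> cmod (partial_deriv b (green_reg k \<epsilon> p) y) \<le> M * exp (- norm (y - p))"
    "\<And>y. cmod (mollifier k \<epsilon> p y) \<le> M * exp (- norm (y - p))"
proof -
  obtain C where C: "C > 0" "\<And>t. t \<ge> 0 \<Longrightarrow> cmod (mollifier_profile k t) \<le> C * exp (- 1 * t)" using mollifier_profile_bound[of 1 k] k by auto
  \<comment> \<open>One summand for each of the three bounds, with s \<ge> \<epsilon> inserted in
    the denominators.\<close>
  define M where "M = 1 / (4 * pi * \<epsilon>) + (2 / \<epsilon> + 1 / \<epsilon>\<^sup>2) / (4 * pi) + C / (4 * pi) * (1 / \<epsilon> ^ 3)"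
  have Mp: "1 / (4 * pi * \<epsilon>) > 0" "(2 / \<epsilon> + 1 / \<epsilon>\<^sup>2) / (4 * pi) > 0" "C / (4 * pi) * (1 / \<epsilon> ^ 3) > 0"
    using \<epsilon> C(1) by (auto intro!: divide_pos_pos add_pos_pos)
  then have MM: "1 / (4 * pi * \<epsilon>) \<le> M" "(2 / \<epsilon> + 1 / \<epsilon>\<^sup>2) / (4 * pi) \<le> M" "C / (4 * pi) * (1 / \<epsilon> ^ 3) \<le> M" "M > 0"
    unfolding M_def by linarith+
  have s: "reg p \<epsilon> y > 0" "reg p \<epsilon> y \<ge> \<epsilon>" "reg p \<epsilon> y \<ge> norm (y - p)" for y
    using reg_pos[OF \<epsilon>, of p y] reg_ge(1)[of y p \<epsilon>] reg_ge(2)[of \<epsilon> p y] \<epsilon> by auto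
  have e: "exp (- 2 * reg p \<epsilon> y) \<le> exp (- norm (y - p))" "exp (- 1 * reg p \<epsilon> y) \<le> exp (- norm (y - p))" for y
    using s[of y] by auto
  show ?thesis
  proof (rule that[OF MM(4)])
    fix y
    have "cmod (green_reg k \<epsilon> p y) = exp (- 2 * reg p \<epsilon> y) * (1 / (4 * pi * reg p \<epsilon> y))"
      using s(1)[of y] k by (simp add: green_reg_def norm_divide norm_mult)
    also have "\<dots> \<le> exp (- norm (y - p)) * (1 / (4 * pi * \<epsilon>))"
      using s[of y] \<epsilon> by (intro mult_mono e divide_left_mono) auto
    also have "\<dots> \<le> exp (- norm (y - p)) * M" by (intro mult_left_mono MM) simp
    finally show "cmod (green_reg k \<epsilon> p y) \<le> M * exp (- norm (y - p))" by (simp add: mult.commute)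
  next
    fix b y :: "real ^ 3" assume b: "b \<in> Basis"
    let ?s = "reg p \<epsilon> y"
    have "cmod (k * inverse (of_real ?s) ^ 2 + inverse (of_real ?s) ^ 3) \<le> cmod (k * inverse (of_real ?s) ^ 2) + cmod (inverse (of_real ?s) ^ 3)"
      by (rule norm_triangle_ineq)
    also have "\<dots> = 2 / ?s ^ 2 + 1 / ?s ^ 3"
      using s(1)[of y] k by (simp add: norm_mult norm_power norm_inverse norm_divide inverse_eq_divide power_divide)
    finally have 1: "cmod (k * inverse (of_real ?s) ^ 2 + inverse (of_real ?s) ^ 3) \<le> 2 / ?s ^ 2 + 1 / ?s ^ 3" .
    have 2: "\<bar>(y - p) \<bullet> b\<bar> \<le> ?s" using Basis_le_norm[OF b, of "y - p"] s(3)[of y] by linarith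
    have "cmod (partial_deriv b (green_reg k \<epsilon> p) y) = exp (- 2 * ?s) * cmod (k * inverse (of_real ?s) ^ 2 + inverse (of_real ?s) ^ 3) / (4 * pi) * \<bar>(y - p) \<bullet> b\<bar>"
      unfolding partial_deriv_green_reg[OF \<epsilon>] using k by (simp add: norm_mult norm_divide)
    also have "\<dots> \<le> exp (- norm (y - p)) * (2 / ?s ^ 2 + 1 / ?s ^ 3) / (4 * pi) * ?s"
      using s[of y] by (intro mult_mono divide_right_mono e 1 2) (auto intro!: divide_nonneg_nonneg mult_nonneg_nonneg)
    also have "\<dots> = exp (- norm (y - p)) * ((2 / ?s + 1 / ?s\<^sup>2) / (4 * pi))"
      using s(1)[of y] by (simp add: field_simps eval_nat_numeral)
    also have "\<dots> \<le> exp (- norm (y - p)) * ((2 / \<epsilon> + 1 / \<epsilon>\<^sup>2) / (4 * pi))"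
      using s[of y] \<epsilon> by (intro mult_left_mono divide_right_mono add_mono divide_left_mono power_mono) auto
    also have "\<dots> \<le> exp (- norm (y - p)) * M" by (intro mult_left_mono MM) simp
    finally show "cmod (partial_deriv b (green_reg k \<epsilon> p) y) \<le> M * exp (- norm (y - p))" by (simp add: mult.commute)
  next
    fix y
    let ?s = "reg p \<epsilon> y"
    have "\<epsilon>\<^sup>2 / ?s ^ 5 \<le> \<epsilon>\<^sup>2 / \<epsilon> ^ 5" using s[of y] \<epsilon> by (intro divide_left_mono power_mono) auto
    also have "\<dots> = 1 / \<epsilon> ^ 3" using \<epsilon> by (simp add: field_simps eval_nat_numeral)
    finally have "C / (4 * pi) * (\<epsilon>\<^sup>2 / ?s ^ 5) * exp (- 1 * ?s) \<le> C / (4 * pi) * (1 / \<epsilon> ^ 3) * exp (- norm (y - p))"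
      using C(1) \<epsilon> s(1)[of y] by (intro mult_mono mult_left_mono e) auto
    also have "\<dots> \<le> M * exp (- norm (y - p))" by (intro mult_right_mono MM) simp
    finally show "cmod (mollifier k \<epsilon> p y) \<le> M * exp (- norm (y - p))"
      using mollifier_le[OF \<epsilon> C(2), of p y] by linarith
  qed
qed

text \<open>The mollifier is 4 - \<Delta> of the regularised Green function with k = 2, whose decay
  admits it in place of a test function.\<close>

lemma integral_mollifier_eq_0:
  assumes v: "square_integrable v" and \<epsilon>: "\<epsilon> > 0"
    and zero: "\<And>\<psi>. test_function \<psi> \<Longrightarrow> (\<integral>y. v y * (2\<^sup>2 * \<psi> y - lap \<psi> y) \<partial>lborel) = 0"
  shows "(\<integral>y. v y * mollifier 2 \<epsilon> p y \<partial>lborel) = 0"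
proof -
  obtain M where M: "M > 0" "\<And>y. cmod (green_reg 2 \<epsilon> p y) \<le> M * exp (- norm (y - p))"
    "\<And>b y. b \<in> Basis \<Longrightarrow> cmod (partial_deriv b (green_reg 2 \<epsilon> p) y) \<le> M * exp (- norm (y - p))"
    "\<And>y. cmod (mollifier 2 \<epsilon> p y) \<le> M * exp (- norm (y - p))"
    by (rule green_reg_bounds[OF \<epsilon>, of 2 p]) auto
  have "(\<integral>y. v y * (2\<^sup>2 * green_reg 2 \<epsilon> p y - lap (green_reg 2 \<epsilon> p) y) \<partial>lborel) = 0"
  proof (rule integral_decaying_eq_0[OF v])
    show "square_integrable (\<lambda>y. of_real M * of_real (exp (- norm (y - p))))"
      by (intro square_integrable_scale square_integrable_exp_norm)
  qed (use M zero in \<open>auto simp: lap_green_reg[OF \<epsilon>, of 2, simplified] norm_mult intro: smooth_green_reg[OF \<epsilon>]\<close>)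
  then show ?thesis unfolding lap_green_reg[OF \<epsilon>] .
qed

text \<open>The bound \<open>exp (- |y|)\<close>, uniform in \<open>\<epsilon>\<close>, makes up for \<open>v\<close> not being integrable in the limit \<open>\<epsilon> \<rightarrow> 0\<close>.\<close>

lemma AE_eq_0_if_orthogonal_range:
  fixes v :: "real ^ 3 \<Rightarrow> complex"
  assumes v: "square_integrable v"
    and zero: "\<And>\<psi>. test_function \<psi> \<Longrightarrow> (\<integral>y. v y * (2\<^sup>2 * \<psi> y - lap \<psi> y) \<partial>lborel) = 0"
  shows "AE y in lborel. v y = 0"
proof (rule AE_eq_0_if_test_integrals[OF v])
  fix \<phi> :: "real ^ 3 \<Rightarrow> complex" assume \<phi>: "test_function \<phi>"
  note [measurable] = test_function_measurable[OF \<phi>] square_integrable_measurable[OF v]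
  obtain C where C: "C > 0" "\<And>t. t \<ge> 0 \<Longrightarrow> cmod (mollifier_profile 2 t) \<le> C * exp (- 1 * t)" using mollifier_profile_bound[of 1 2] by auto
  obtain B R where BR: "B > 0" "R > 0" "\<And>y. cmod (\<phi> y) \<le> B * indicator (cball 0 R) y"
    using test_function_bound_indicator[OF \<phi>] by blast
  \<comment> \<open>With \<open>tri\<close> below, this trades decay in y - p for decay in y at a
    bounded cost, since \<open>p\<close> stays in the support of \<open>\<phi>\<close>.\<close>
  have B: "cmod (\<phi> p) * exp (norm p) \<le> B * exp R" for p
  proof (cases "p \<in> cball 0 R")
    case True
    then show ?thesis using BR by (intro mult_mono order_trans[OF BR(3)]) auto
  next
    case False
    then have "cmod (\<phi> p) = 0" using BR(3)[of p] by (simp add: indicator_def)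
    then show ?thesis using BR(1) by simp
  qed
  have tri: "exp (- norm (y - p)) \<le> exp (norm p) * exp (- norm y)" for y p :: "real ^ 3"
    using norm_triangle_ineq2[of y p] by (simp flip: exp_add)
  \<comment> \<open>C / (4 \<pi>) from \<open>mollifier_le\<close> times the integral 4 \<pi> / 3
    gives C / 3; B exp R is the cost of moving the decay.\<close>
  define K where "K = B * exp R * (C / 3)"
  \<comment> \<open>\<open>F \<epsilon>\<close> smears \<open>\<phi>\<close> with the mollifier. By
    Fubini its pairing with \<open>v\<close> is an average of the vanishing integrals of
    \<open>v\<close> against mollifiers, while \<open>F \<epsilon>\<close> tends to
    \<open>\<phi>\<close>.\<close>
  define F where "F \<epsilon> y = (\<integral>p. \<phi> p * mollifier 2 \<epsilon> p y \<partial>lborel)" for \<epsilon> y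
  have [measurable]: "(\<lambda>(y, p). mollifier 2 \<epsilon> p y) \<in> borel_measurable (borel \<Otimes>\<^sub>M borel)" for \<epsilon>
    unfolding mollifier_def reg_def[abs_def] case_prod_beta by measurable
  have F0: "(\<integral>y. v y * F \<epsilon> y \<partial>lborel) = 0" if \<epsilon>: "\<epsilon> > 0" for \<epsilon>
  proof -
    \<comment> \<open>One constant for all poles, by translation to the pole 0. Its dependence on
      \<epsilon> is harmless, since Fubini is applied at fixed \<epsilon>.\<close>
    obtain M where M: "M > 0" "\<And>p y. cmod (mollifier 2 \<epsilon> p y) \<le> M * exp (- norm (y - p))"
    proof -
      obtain M where M: "M > 0" "\<And>y. cmod (green_reg 2 \<epsilon> 0 y) \<le> M * exp (- norm (y - 0))"
        "\<And>b y. b \<in> Basis \<Longrightarrow> cmod (partial_deriv b (green_reg 2 \<epsilon> 0) y) \<le> M * exp (- norm (y - 0))"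
        "\<And>y. cmod (mollifier 2 \<epsilon> 0 y) \<le> M * exp (- norm (y - 0))"
        by (rule green_reg_bounds[OF \<epsilon>, of 2 0]) auto
      have eq: "mollifier 2 \<epsilon> p y = mollifier 2 \<epsilon> 0 (y - p)" for p y by (simp add: mollifier_def reg_def)
      have "cmod (mollifier 2 \<epsilon> p y) \<le> M * exp (- norm (y - p))" for p y
        using M(4)[of "y - p"] unfolding eq[of p y] by simp
      with M(1) show ?thesis by (rule that)
    qed
    have int: "integrable (lborel \<Otimes>\<^sub>M lborel) (\<lambda>(y, p). v y * (\<phi> p * mollifier 2 \<epsilon> p y))"
    proof (rule Bochner_Integration.integrable_bound)
      have "integrable lborel (\<lambda>y. v y * of_real (exp (- norm (y - 0))))"
        by (intro square_integrable_integrable_mult v square_integrable_exp_norm)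
      then have "integrable lborel (\<lambda>y. cmod (v y * of_real (exp (- norm (y - 0)))))" by (rule integrable_norm)
      moreover have "integrable lborel (\<lambda>p::real ^ 3. M * (B * exp R) * indicator (cball 0 R) p :: real)"
        by (rule integrable_indicator_cball)
      ultimately show "integrable (lborel \<Otimes>\<^sub>M lborel) (\<lambda>(y, p::real ^ 3). cmod (v y * of_real (exp (- norm (y - 0)))) * (M * (B * exp R) * indicator (cball 0 R) p))"
        by (intro lborel_pair.Fubini_integrable) (auto simp: abs_mult norm_mult)
      show "(\<lambda>(y, p). v y * (\<phi> p * mollifier 2 \<epsilon> p y)) \<in> borel_measurable (lborel \<Otimes>\<^sub>M lborel)" by measurable
      have "cmod (v y * (\<phi> p * mollifier 2 \<epsilon> p y)) \<le> cmod (v y * of_real (exp (- norm (y - 0)))) * (M * (B * exp R) * indicator (cball 0 R) p)" for y p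
      proof (cases "p \<in> cball 0 R")
        case True
        have "cmod (\<phi> p) * cmod (mollifier 2 \<epsilon> p y) \<le> cmod (\<phi> p) * (M * (exp (norm p) * exp (- norm y)))"
          using M(1) by (intro mult_left_mono order_trans[OF M(2)] tri) auto
        also have "\<dots> = M * exp (- norm y) * (cmod (\<phi> p) * exp (norm p))" by (simp add: mult_ac)
        also have "\<dots> \<le> M * exp (- norm y) * (B * exp R)" using M(1) by (intro mult_left_mono B) auto
        finally have "cmod (v y) * (cmod (\<phi> p) * cmod (mollifier 2 \<epsilon> p y)) \<le> cmod (v y) * (M * exp (- norm y) * (B * exp R))"
          by (intro mult_left_mono) auto
        then show ?thesis using True by (simp add: norm_mult mult_ac)
      next
        case False
        then have "\<phi> p = 0" using BR(3)[of p] by (simp add: indicator_def)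
        then show ?thesis using M(1) BR by simp
      qed
      then show "AE x in lborel \<Otimes>\<^sub>M lborel. norm (case x of (y, p) \<Rightarrow> v y * (\<phi> p * mollifier 2 \<epsilon> p y))
        \<le> norm (case x of (y, p) \<Rightarrow> cmod (v y * of_real (exp (- norm (y - 0)))) * (M * (B * exp R) * indicator (cball 0 R) p))"
        by (intro AE_I2) (auto simp: case_prod_beta intro: order_trans[OF _ abs_ge_self])
    qed
    have "(\<integral>y. v y * F \<epsilon> y \<partial>lborel) = (\<integral>y. \<integral>p. v y * (\<phi> p * mollifier 2 \<epsilon> p y) \<partial>lborel \<partial>lborel)"
      unfolding F_def integral_mult_right_zero ..
    also have "\<dots> = (\<integral>p. \<integral>y. v y * (\<phi> p * mollifier 2 \<epsilon> p y) \<partial>lborel \<partial>lborel)"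
      by (rule lborel_pair.Fubini_integral[OF int, symmetric])
    also have "\<dots> = (\<integral>p. \<phi> p * (\<integral>y. v y * mollifier 2 \<epsilon> p y \<partial>lborel) \<partial>lborel)"
      unfolding integral_mult_right_zero[symmetric] by (simp only: mult_ac)
    also have "\<dots> = 0" using integral_mollifier_eq_0[OF v \<epsilon> zero] by simp
    finally show ?thesis .
  qed
  \<comment> \<open>The regularised distance is symmetric in pole and argument, so \<epsilon>^2 /
    s^5 can be integrated over the pole; its integral is independent of \<epsilon>, and so is the
    bound.\<close>
  have F_bound: "cmod (F \<epsilon> y) \<le> K * exp (- norm y)" if \<epsilon>: "\<epsilon> > 0" for \<epsilon> y
  proof -
    have sym: "reg p \<epsilon> y = reg y \<epsilon> p" for p by (rule reg_commute)
    have "cmod (F \<epsilon> y) \<le> (\<integral>p. B * exp R * exp (- norm y) * (C / (4 * pi)) * (\<epsilon>\<^sup>2 / reg y \<epsilon> p ^ 5) \<partial>lborel)"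
      unfolding F_def
    proof (rule Bochner_Integration.integral_norm_bound_integral)
      show "integrable lborel (\<lambda>p. B * exp R * exp (- norm y) * (C / (4 * pi)) * (\<epsilon>\<^sup>2 / reg y \<epsilon> p ^ 5))"
        by (intro integrable_mult_right integral_reg \<epsilon>)
      fix p :: "real ^ 3"
      have "cmod (mollifier 2 \<epsilon> p y) \<le> C / (4 * pi) * (\<epsilon>\<^sup>2 / reg p \<epsilon> y ^ 5) * exp (- 1 * reg p \<epsilon> y)"
        by (rule mollifier_le[OF \<epsilon> C(2)])
      also have "\<dots> \<le> C / (4 * pi) * (\<epsilon>\<^sup>2 / reg p \<epsilon> y ^ 5) * (exp (norm p) * exp (- norm y))"
        using C(1) reg_pos[OF \<epsilon>, of p y] reg_ge(1)[of y p \<epsilon>]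
        by (intro mult_left_mono order_trans[OF _ tri]) auto
      finally have "cmod (\<phi> p) * cmod (mollifier 2 \<epsilon> p y) \<le> cmod (\<phi> p) * (C / (4 * pi) * (\<epsilon>\<^sup>2 / reg p \<epsilon> y ^ 5) * (exp (norm p) * exp (- norm y)))"
        by (intro mult_left_mono) auto
      also have "\<dots> = (cmod (\<phi> p) * exp (norm p)) * (C / (4 * pi) * (\<epsilon>\<^sup>2 / reg p \<epsilon> y ^ 5) * exp (- norm y))" by (simp only: mult_ac)
      also have "\<dots> \<le> (B * exp R) * (C / (4 * pi) * (\<epsilon>\<^sup>2 / reg p \<epsilon> y ^ 5) * exp (- norm y))"
        using C(1) reg_pos[OF \<epsilon>, of p y] by (intro mult_right_mono B) auto
      finally show "norm (\<phi> p * mollifier 2 \<epsilon> p y) \<le> B * exp R * exp (- norm y) * (C / (4 * pi)) * (\<epsilon>\<^sup>2 / reg y \<epsilon> p ^ 5)"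
        unfolding norm_mult sym[symmetric] by (simp only: mult_ac)
    next
      show "integrable lborel (\<lambda>p. \<phi> p * mollifier 2 \<epsilon> p y)"
      proof (rule Bochner_Integration.integrable_bound)
        have "mollifier 2 \<epsilon> p y = mollifier 2 \<epsilon> y p" for p by (simp add: mollifier_def sym)
        then show "(\<lambda>p. \<phi> p * mollifier 2 \<epsilon> p y) \<in> borel_measurable lborel" by simp
        show "integrable lborel (\<lambda>p. B * (C / (4 * pi)) * (\<epsilon>\<^sup>2 / reg y \<epsilon> p ^ 5))" by (intro integrable_mult_right integral_reg \<epsilon>)
        show "AE p in lborel. norm (\<phi> p * mollifier 2 \<epsilon> p y) \<le> norm (B * (C / (4 * pi)) * (\<epsilon>\<^sup>2 / reg y \<epsilon> p ^ 5))"
        proof (rule AE_I2)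
          fix p :: "real ^ 3"
          have "cmod (mollifier 2 \<epsilon> p y) \<le> C / (4 * pi) * (\<epsilon>\<^sup>2 / reg p \<epsilon> y ^ 5) * exp (- 1 * reg p \<epsilon> y)"
            by (rule mollifier_le[OF \<epsilon> C(2)])
          also have "\<dots> \<le> C / (4 * pi) * (\<epsilon>\<^sup>2 / reg p \<epsilon> y ^ 5) * 1"
            using C(1) reg_pos[OF \<epsilon>, of p y] by (intro mult_left_mono) auto
          finally have "cmod (\<phi> p) * cmod (mollifier 2 \<epsilon> p y) \<le> B * (C / (4 * pi) * (\<epsilon>\<^sup>2 / reg p \<epsilon> y ^ 5))"
            using order_trans[OF BR(3)[of p], of B] BR(1) C(1) reg_pos[OF \<epsilon>, of p y]
            by (intro mult_mono) (auto simp: indicator_def)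
          then show "norm (\<phi> p * mollifier 2 \<epsilon> p y) \<le> norm (B * (C / (4 * pi)) * (\<epsilon>\<^sup>2 / reg y \<epsilon> p ^ 5))"
            unfolding norm_mult sym[symmetric] real_norm_def by (intro order_trans[OF _ abs_ge_self]) (simp add: mult_ac)
        qed
      qed
    qed
    also have "\<dots> = K * exp (- norm y)"
      unfolding integral_mult_right_zero integral_reg(2)[OF \<epsilon>] K_def by simp
    finally show ?thesis .
  qed
  have [measurable]: "F \<epsilon> \<in> borel_measurable borel" for \<epsilon>
    unfolding F_def[abs_def] by measurable
  obtain B' where B': "\<And>y. cmod (\<phi> y) \<le> B'" using test_function_bounded[OF \<phi>] by blast
  show "(\<integral>y. v y * \<phi> y \<partial>lborel) = 0"
  proof (rule LIMSEQ_unique)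
    show "(\<lambda>n. \<integral>y. v y * F (inverse (real (Suc n))) y \<partial>lborel) \<longlonglongrightarrow> 0"
      using F0[of "inverse (real (Suc _))"] by (simp del: of_nat_Suc)
    show "(\<lambda>n. \<integral>y. v y * F (inverse (real (Suc n))) y \<partial>lborel) \<longlonglongrightarrow> (\<integral>y. v y * \<phi> y \<partial>lborel)"
    proof (rule integral_dominated_convergence)
      have "integrable lborel (\<lambda>y. v y * of_real (exp (- norm (y - 0))))"
        by (intro square_integrable_integrable_mult v square_integrable_exp_norm)
      then show "integrable lborel (\<lambda>y. K * cmod (v y * of_real (exp (- norm (y - 0)))))"
        by (intro integrable_mult_right integrable_norm)
      show "AE y in lborel. norm (v y * F (inverse (real (Suc n))) y) \<le> K * cmod (v y * of_real (exp (- norm (y - 0))))" for n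
      proof (rule AE_I2)
        fix y :: "real ^ 3"
        have "cmod (v y) * cmod (F (inverse (real (Suc n))) y) \<le> cmod (v y) * (K * exp (- norm y))"
          by (intro mult_left_mono F_bound) (auto simp del: of_nat_Suc)
        then show "norm (v y * F (inverse (real (Suc n))) y) \<le> K * cmod (v y * of_real (exp (- norm (y - 0))))"
          by (simp add: norm_mult mult_ac del: of_nat_Suc)
      qed
      \<comment> \<open>By the same symmetry \<open>F\<close> is an integral against the approximate
        identity with pole \<open>y\<close>.\<close>
      show "AE y in lborel. (\<lambda>n. v y * F (inverse (real (Suc n))) y) \<longlonglongrightarrow> v y * \<phi> y"
      proof (intro AE_I2 tendsto_mult tendsto_const)
        fix y :: "real ^ 3"
        have "isCont \<phi> y" using test_function_continuous_on[OF \<phi>, of UNIV] by (simp add: continuous_on_eq_continuous_at)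
        then have "(\<lambda>n. \<integral>p. \<phi> p * mollifier 2 (inverse (real (Suc n))) y p \<partial>lborel) \<longlonglongrightarrow> \<phi> y"
          by (intro mollifier_tendsto[OF _ _ B']) auto
        moreover have "mollifier 2 \<epsilon> p y = mollifier 2 \<epsilon> y p" for p \<epsilon> by (simp add: mollifier_def reg_commute[of p])
        ultimately show "(\<lambda>n. F (inverse (real (Suc n))) y) \<longlonglongrightarrow> \<phi> y" unfolding F_def by simp
      qed
    qed measurable
  qed
qed

section \<open>The free Hamiltonian\<close>

lemma L2_class_add:
  "square_integrable u \<Longrightarrow> square_integrable v \<Longrightarrow> L2_class u + L2_class v = L2_class (\<lambda>x. u x + v x)"
  by (rule plus_L2.abs_eq) (simp_all add: L2_eq_def)

lemma L2_class_scaleC: "square_integrable u \<Longrightarrow> a *\<^sub>C L2_class u = L2_class (\<lambda>x. a * u x)"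
  by (rule scaleC_L2.abs_eq) (simp_all add: L2_eq_def)

lemma L2_class_zero: "L2_class (\<lambda>x. 0) = 0"
  by (simp add: zero_L2_def)

lemma square_integrable_sum:
  "(\<And>i. i \<in> I \<Longrightarrow> square_integrable (u i)) \<Longrightarrow> square_integrable (\<lambda>x. \<Sum>i\<in>I. u i x)"
  by (induction I rule: infinite_finite_induct) (auto simp: square_integrable_zero intro: square_integrable_add)

lemma L2_class_sum:
  "(\<And>i. i \<in> I \<Longrightarrow> square_integrable (u i)) \<Longrightarrow> L2_class (\<lambda>x. \<Sum>i\<in>I. u i x) = (\<Sum>i\<in>I. L2_class (u i))"
  by (induction I rule: infinite_finite_induct) (auto simp: L2_class_zero square_integrable_sum simp flip: L2_class_add)

lemma cinner_L2_class:
  "square_integrable u \<Longrightarrow> square_integrable v \<Longrightarrow> cinner (L2_class u) (L2_class v) = (\<integral>x. u x * cnj (v x) \<partial>lborel)"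
  by (rule cinner_L2.abs_eq) (simp_all add: L2_eq_def)

lemma integral_L2_rep:
  assumes "square_integrable u"
  shows "(\<integral>y. L2_rep f y * u y \<partial>lborel) = cinner f (L2_class (\<lambda>y. cnj (u y)))"
  using cinner_L2_class[OF square_integrable_rep[of f] square_integrable_cnj[OF assms]] by (simp add: L2_class_rep)

lemma cinner_L2_class_left:
  assumes "square_integrable u"
  shows "cinner (L2_class u) f = (\<integral>y. cnj (L2_rep f y) * u y \<partial>lborel)"
  using cinner_L2_class[OF assms square_integrable_rep[of f]] by (simp add: L2_class_rep mult.commute)

text \<open>The fundamental lemma read in the Hilbert space. It yields uniqueness of weak
  derivatives and single-valuedness of the adjoint of \<open>test_op\<close>.\<close>

lemma L2_eq_0_if_orthogonal_test:
  fixes f :: "'a::euclidean_space L2"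
  assumes "\<And>\<psi>. test_function \<psi> \<Longrightarrow> cinner (L2_class \<psi>) f = 0"
  shows "f = 0"
proof -
  have "AE y in lborel. cnj (L2_rep f y) = 0"
  proof (rule AE_eq_0_if_test_integrals)
    show "square_integrable (\<lambda>y. cnj (L2_rep f y))" by (intro square_integrable_cnj square_integrable_rep)
    show "(\<integral>y. cnj (L2_rep f y) * \<phi> y \<partial>lborel) = 0" if "test_function \<phi>" for \<phi>
      using assms[OF that] cinner_L2_class_left[OF test_function_square_integrable[OF that], of f] by simp
  qed
  then have "AE y in lborel. L2_rep f y = 0" by simp
  then have "L2_class (L2_rep f) = L2_class (\<lambda>y. 0)"
    by (simp add: L2_class_eq_iff square_integrable_rep square_integrable_zero)
  then show ?thesis by (simp add: L2_class_rep L2_class_zero)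
qed

text \<open>The definition pairs without conjugation, the inner product conjugates. Conjugating the
  test function mediates, since this commutes with derivatives and leaves the sign (-1)^n
  alone.\<close>

lemma has_weak_deriv_iff:
  fixes f g :: "'a::euclidean_space L2"
  assumes "set bs \<subseteq> Basis"
  shows "has_weak_deriv bs f g \<longleftrightarrow>
    (\<forall>\<phi>. test_function \<phi> \<longrightarrow> cinner (L2_class (partial_derivs bs \<phi>)) f = (-1) ^ length bs * cinner (L2_class \<phi>) g)"
proof -
  have t: "test_function (partial_derivs bs \<phi>)" if "test_function \<phi>" for \<phi> :: "'a \<Rightarrow> complex"
    using assms that by (induction bs) (auto intro: test_function_partial_deriv)
  have c: "partial_derivs bs (\<lambda>y. cnj (\<phi> y)) = (\<lambda>y. cnj (partial_derivs bs \<phi> y))" if "test_function \<phi>" for \<phi> :: "'a \<Rightarrow> complex"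
    using assms
  proof (induction bs)
    case (Cons b bs)
    have "test_function (partial_derivs bs \<phi>)"
      using Cons.prems that by (induction bs) (auto intro: test_function_partial_deriv)
    then show ?case using Cons by (simp add: partial_deriv_cnj test_function_smooth)
  qed simp
  have e: "(\<integral>y. L2_rep h y * cnj (u y) \<partial>lborel) = cnj (cinner (L2_class u) h)" if "test_function u" for h :: "'a L2" and u
    using integral_L2_rep[OF square_integrable_cnj[OF test_function_square_integrable[OF that]], of h] cinner_commute[of h]
    by simp
  have m: "cnj ((- 1) ^ n) = (- 1) ^ n" for n :: nat by simp
  show ?thesis
  proof
    assume w: "has_weak_deriv bs f g"
    show "\<forall>\<phi>. test_function \<phi> \<longrightarrow> cinner (L2_class (partial_derivs bs \<phi>)) f = (-1) ^ length bs * cinner (L2_class \<phi>) g"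
    proof (intro allI impI)
      fix \<phi> :: "'a \<Rightarrow> complex" assume \<phi>: "test_function \<phi>"
      have "cnj (cinner (L2_class (partial_derivs bs \<phi>)) f) = (-1) ^ length bs * cnj (cinner (L2_class \<phi>) g)"
        using w[unfolded has_weak_deriv_def, rule_format, OF test_function_cnj[OF \<phi>]] by (simp add: c[OF \<phi>] e t \<phi>)
      then show "cinner (L2_class (partial_derivs bs \<phi>)) f = (-1) ^ length bs * cinner (L2_class \<phi>) g"
        by (metis complex_cnj_cnj complex_cnj_mult m)
    qed
  next
    assume w: "\<forall>\<phi>. test_function \<phi> \<longrightarrow> cinner (L2_class (partial_derivs bs \<phi>)) f = (-1) ^ length bs * cinner (L2_class \<phi>) g"
    show "has_weak_deriv bs f g"
      unfolding has_weak_deriv_def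
    proof (intro allI impI)
      fix \<phi> :: "'a \<Rightarrow> complex" assume \<phi>: "test_function \<phi>"
      let ?\<phi> = "\<lambda>y. cnj (\<phi> y)"
      have \<phi>': "test_function ?\<phi>" by (rule test_function_cnj[OF \<phi>])
      have 1: "partial_derivs bs \<phi> = (\<lambda>y. cnj (partial_derivs bs ?\<phi> y))" using c[OF \<phi>'] by simp
      have "(\<integral>y. L2_rep f y * partial_derivs bs \<phi> y \<partial>lborel) = cnj (cinner (L2_class (partial_derivs bs ?\<phi>)) f)"
        unfolding 1 by (rule e[OF t[OF \<phi>']])
      also have "\<dots> = cnj ((-1) ^ length bs * cinner (L2_class ?\<phi>) g)" using w \<phi>' by simp
      also have "\<dots> = (-1) ^ length bs * (\<integral>y. L2_rep g y * \<phi> y \<partial>lborel)" using e[OF \<phi>', of g] by simp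
      finally show "(\<integral>y. L2_rep f y * partial_derivs bs \<phi> y \<partial>lborel) = (-1) ^ length bs * (\<integral>y. L2_rep g y * \<phi> y \<partial>lborel)" .
    qed
  qed
qed

lemma has_weak_deriv_unique:
  assumes "set bs \<subseteq> Basis" "has_weak_deriv bs f g" "has_weak_deriv bs f h"
  shows "g = h"
proof -
  have "cinner (L2_class \<psi>) (g - h) = 0" if "test_function \<psi>" for \<psi>
  proof -
    have "(-1) ^ length bs * cinner (L2_class \<psi>) g = (-1) ^ length bs * cinner (L2_class \<psi>) h"
      using assms(2,3) that unfolding has_weak_deriv_iff[OF assms(1)] by metis
    then show ?thesis by (simp add: cinner_diff_right)
  qed
  then show ?thesis using L2_eq_0_if_orthogonal_test[of "g - h"] by simp
qed

lemma has_weak_deriv_weak_deriv: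
  assumes "f \<in> sobolev k" "set bs \<subseteq> Basis" "length bs \<le> k"
  shows "has_weak_deriv bs f (weak_deriv bs f)"
proof -
  obtain g where g: "has_weak_deriv bs f g" using assms unfolding sobolev_def by blast
  then show ?thesis
    unfolding weak_deriv_def by (rule theI[of "has_weak_deriv bs f"]) (rule has_weak_deriv_unique[OF assms(2) _ g])
qed

section \<open>The Laplacian on test functions\<close>

definition test_op :: "'a::euclidean_space L2 operator" where
  "test_op = {(L2_class \<psi>, - L2_class (lap \<psi>)) | \<psi>. test_function \<psi>}"

lemma test_op_adjoint_iff:
  "(g, h) \<in> adjoint_op test_op \<longleftrightarrow> (\<forall>\<psi>. test_function \<psi> \<longrightarrow> cinner (- L2_class (lap \<psi>)) g = cinner (L2_class \<psi>) h)"
  by (auto simp: adjoint_op_iff test_op_def)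

lemma lap_add:
  assumes "smooth f" "smooth g"
  shows "lap (\<lambda>y. f y + g y) = (\<lambda>y. lap f y + lap g y)"
proof -
  have "partial_deriv b (partial_deriv b (\<lambda>y. f y + g y)) = (\<lambda>y. partial_deriv b (partial_deriv b f) y + partial_deriv b (partial_deriv b g) y)"
    if "b \<in> Basis" for b
    using assms that by (simp add: partial_deriv_add smooth_differentiable smooth_partial_deriv)
  then show ?thesis by (simp add: lap_def fun_eq_iff sum.distrib)
qed

lemma lap_cmult:
  assumes "smooth f"
  shows "lap (\<lambda>y. c * f y) = (\<lambda>y. c * lap f y)"
proof -
  have "partial_deriv b (partial_deriv b (\<lambda>y. c * f y)) = (\<lambda>y. c * partial_deriv b (partial_deriv b f) y)"
    if "b \<in> Basis" for b
    using assms that by (simp add: partial_deriv_cmult smooth_partial_deriv)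
  then show ?thesis by (simp add: lap_def fun_eq_iff sum_distrib_left)
qed

lemma lap_cnj:
  assumes "smooth f"
  shows "lap (\<lambda>y. cnj (f y)) = (\<lambda>y. cnj (lap f y))"
proof -
  have "partial_deriv b (partial_deriv b (\<lambda>y. cnj (f y))) = (\<lambda>y. cnj (partial_deriv b (partial_deriv b f) y))"
    if "b \<in> Basis" for b
    using assms that by (simp add: partial_deriv_cnj smooth_partial_deriv)
  then show ?thesis by (simp add: lap_def fun_eq_iff)
qed

lemma linear_relation_test_op: "linear_relation (test_op :: 'a::euclidean_space L2 operator)"
  unfolding linear_relation_def
proof (intro conjI allI impI)
  have "lap (\<lambda>y. 0) = (\<lambda>y::'a. 0::complex)" by (simp add: lap_def fun_eq_iff partial_deriv_const)
  then show "(0, 0) \<in> (test_op :: 'a L2 operator)"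
    unfolding test_op_def
    by (intro CollectI exI[of _ "\<lambda>y. 0"]) (simp add: test_function_zero L2_class_zero)
next
  fix f f' g g' :: "'a L2" assume "(f, f') \<in> test_op \<and> (g, g') \<in> test_op"
  then obtain \<psi> \<phi> where *: "test_function \<psi>" "f = L2_class \<psi>" "f' = - L2_class (lap \<psi>)"
    "test_function \<phi>" "g = L2_class \<phi>" "g' = - L2_class (lap \<phi>)"
    unfolding test_op_def by blast
  have "(f + g, f' + g') = (L2_class (\<lambda>y. \<psi> y + \<phi> y), - L2_class (lap (\<lambda>y. \<psi> y + \<phi> y)))"
    using * by (simp add: lap_add test_function_smooth test_function_square_integrable test_function_lap flip: L2_class_add)
  then show "(f + g, f' + g') \<in> test_op" using * unfolding test_op_def by (blast intro: test_function_add)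
next
  fix a and f f' :: "'a L2" assume "(f, f') \<in> test_op"
  then obtain \<psi> where *: "test_function \<psi>" "f = L2_class \<psi>" "f' = - L2_class (lap \<psi>)"
    unfolding test_op_def by blast
  have "(a *\<^sub>C f, a *\<^sub>C f') = (L2_class (\<lambda>y. a * \<psi> y), - L2_class (lap (\<lambda>y. a * \<psi> y)))"
    using * by (simp add: lap_cmult test_function_smooth test_function_square_integrable test_function_lap flip: L2_class_scaleC)
  then show "(a *\<^sub>C f, a *\<^sub>C f') \<in> test_op" using * unfolding test_op_def by (blast intro: test_function_cmult)
qed

section \<open>A priori estimates for test functions\<close>

lemma cinner_partial_deriv:
  assumes "test_function \<psi>" "test_function \<phi>" "b \<in> Basis"
  shows "cinner (L2_class (partial_deriv b \<psi>)) (L2_class \<phi>) = - cinner (L2_class \<psi>) (L2_class (partial_deriv b \<phi>))"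
  using integral_by_parts[OF assms(1) test_function_smooth[OF test_function_cnj[OF assms(2)]] assms(3)] assms
  by (simp add: cinner_L2_class test_function_square_integrable test_function_partial_deriv partial_deriv_cnj test_function_smooth)

lemma L2_class_lap:
  assumes "test_function \<psi>"
  shows "L2_class (lap \<psi>) = (\<Sum>b\<in>Basis. L2_class (partial_deriv b (partial_deriv b \<psi>)))"
  unfolding lap_def[abs_def]
  by (rule L2_class_sum) (intro test_function_square_integrable test_function_partial_deriv assms)

text \<open>\<open>\<parallel>\<Delta>\<psi>\<parallel>\<^sup>2\<close> is the sum of \<open>\<parallel>\<partial>\<^sub>b\<partial>\<^sub>c\<psi>\<parallel>\<^sup>2\<close> over all \<open>b\<close> and \<open>c\<close>.\<close>

lemma norm_second_derivative_le:
  assumes \<psi>: "test_function \<psi>" and b: "b \<in> Basis" and c: "c \<in> Basis"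
  shows "norm (L2_class (partial_deriv b (partial_deriv c \<psi>))) \<le> norm (L2_class (lap \<psi>))"
proof -
  note t = test_function_partial_deriv
  let ?N = "\<lambda>b c. (norm (L2_class (partial_deriv b (partial_deriv c \<psi>))))\<^sup>2"
  have *: "cinner (L2_class (partial_deriv b (partial_deriv b \<psi>))) (L2_class (partial_deriv c (partial_deriv c \<psi>))) = of_real (?N b c)"
    if b: "b \<in> Basis" and c: "c \<in> Basis" for b c
  proof -
    \<comment> \<open>One derivative in direction \<open>b\<close> moves to the right and one in
      direction \<open>c\<close> to the left; in between, the mixed derivatives are
      commuted.\<close>
    have "cinner (L2_class (partial_deriv b (partial_deriv b \<psi>))) (L2_class (partial_deriv c (partial_deriv c \<psi>)))
      = - cinner (L2_class (partial_deriv b \<psi>)) (L2_class (partial_deriv b (partial_deriv c (partial_deriv c \<psi>))))"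
      by (intro cinner_partial_deriv t \<psi> b c)
    also have "partial_deriv b (partial_deriv c (partial_deriv c \<psi>)) = partial_deriv c (partial_deriv b (partial_deriv c \<psi>))"
      by (intro partial_deriv_commute t \<psi> b c)
    also have "- cinner (L2_class (partial_deriv b \<psi>)) (L2_class (partial_deriv c (partial_deriv b (partial_deriv c \<psi>))))
      = cinner (L2_class (partial_deriv c (partial_deriv b \<psi>))) (L2_class (partial_deriv b (partial_deriv c \<psi>)))"
      by (subst cinner_partial_deriv[OF t[OF \<psi> b] t[OF t[OF \<psi> c] b] c]) simp
    also have "partial_deriv c (partial_deriv b \<psi>) = partial_deriv b (partial_deriv c \<psi>)"
      by (intro partial_deriv_commute \<psi> b c)
    finally show ?thesis by (simp add: cinner_self)
  qed
  have "complex_of_real ((norm (L2_class (lap \<psi>)))\<^sup>2) = of_real (\<Sum>c\<in>Basis. \<Sum>b\<in>Basis. ?N b c)"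
    unfolding cinner_self[symmetric] L2_class_lap[OF \<psi>] cinner_sum_left cinner_sum_right of_real_sum
    by (intro sum.cong refl) (simp only: * cinner_self)
  then have "(norm (L2_class (lap \<psi>)))\<^sup>2 = (\<Sum>c\<in>Basis. \<Sum>b\<in>Basis. ?N b c)" by (simp only: of_real_eq_iff)
  moreover have "?N b c \<le> (\<Sum>c\<in>Basis. \<Sum>b\<in>Basis. ?N b c)"
    by (rule order_trans[OF member_le_sum[of b Basis "\<lambda>b. ?N b c"] member_le_sum[of c Basis "\<lambda>c. \<Sum>b\<in>Basis. ?N b c"]])
      (use b c in \<open>auto intro!: sum_nonneg\<close>)
  ultimately have "?N b c \<le> (norm (L2_class (lap \<psi>)))\<^sup>2" by simp
  then show ?thesis by (rule power2_le_imp_le) simp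
qed

text \<open>Integration by parts and Cauchy-Schwarz bound the square by the product of the norms of
  \<psi> and of a second derivative, which the Laplacian controls.\<close>

lemma norm_first_derivative_le:
  assumes \<psi>: "test_function \<psi>" and b: "b \<in> Basis"
  shows "norm (L2_class (partial_deriv b \<psi>)) \<le> norm (L2_class \<psi>) + norm (L2_class (lap \<psi>))"
proof -
  let ?x = "norm (L2_class \<psi>)" and ?y = "norm (L2_class (lap \<psi>))"
  have "(norm (L2_class (partial_deriv b \<psi>)))\<^sup>2 = cmod (cinner (L2_class (partial_deriv b \<psi>)) (L2_class (partial_deriv b \<psi>)))"
    by (simp add: cinner_self norm_power)
  also have "\<dots> = cmod (cinner (L2_class \<psi>) (L2_class (partial_deriv b (partial_deriv b \<psi>))))"
    by (subst cinner_partial_deriv[OF \<psi> test_function_partial_deriv[OF \<psi> b] b]) simp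
  also have "\<dots> \<le> ?x * norm (L2_class (partial_deriv b (partial_deriv b \<psi>)))" by (rule cinner_norm_le)
  also have "\<dots> \<le> ?x * ?y" by (intro mult_left_mono norm_second_derivative_le \<psi> b) simp
  also have "\<dots> \<le> (?x + ?y)\<^sup>2" by (simp add: power2_eq_square algebra_simps)
  finally show ?thesis by (rule power2_le_imp_le) simp
qed

section \<open>The closure of \<open>test_op\<close> and its Sobolev regularity\<close>

lemma free_hamiltonian_subset_adjoint: "free_hamiltonian \<subseteq> adjoint_op test_op"
proof (rule subrelI)
  fix f h :: "(real ^ 3) L2" assume "(f, h) \<in> free_hamiltonian"
  then have f: "f \<in> sobolev 2" and h: "h = - laplacian f" unfolding free_hamiltonian_def by auto
  show "(f, h) \<in> adjoint_op test_op"
    unfolding test_op_adjoint_iff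
  proof (intro allI impI)
    fix \<psi> :: "real ^ 3 \<Rightarrow> complex" assume \<psi>: "test_function \<psi>"
    have "cinner (L2_class (partial_deriv b (partial_deriv b \<psi>))) f = cinner (L2_class \<psi>) (weak_deriv [b, b] f)" if "b \<in> Basis" for b
      using has_weak_deriv_weak_deriv[OF f, of "[b, b]"] that \<psi> by (simp add: has_weak_deriv_iff)
    then have "cinner (L2_class (lap \<psi>)) f = cinner (L2_class \<psi>) (laplacian f)"
      unfolding L2_class_lap[OF \<psi>] laplacian_def cinner_sum_left cinner_sum_right by simp
    then show "cinner (- L2_class (lap \<psi>)) f = cinner (L2_class \<psi>) h" by (simp add: h cinner_uminus)
  qed
qed

lemma test_op_symmetric: "test_op \<subseteq> adjoint_op test_op"
proof (rule subrelI)
  fix f h :: "'a L2" assume "(f, h) \<in> test_op"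
  then obtain \<phi> where \<phi>: "test_function \<phi>" "f = L2_class \<phi>" "h = - L2_class (lap \<phi>)" unfolding test_op_def by blast
  have "cinner (L2_class (lap \<psi>)) (L2_class \<phi>) = cinner (L2_class \<psi>) (L2_class (lap \<phi>))" if \<psi>: "test_function \<psi>" for \<psi>
    using integral_lap_by_parts[OF \<psi> test_function_smooth[OF test_function_cnj[OF \<phi>(1)]]] \<phi> \<psi>
    by (simp add: cinner_L2_class test_function_square_integrable test_function_lap lap_cnj test_function_smooth)
  then show "(f, h) \<in> adjoint_op test_op"
    unfolding test_op_adjoint_iff \<phi>(2,3) by (simp add: cinner_uminus)
qed

lemma closure_test_op_subset_adjoint: "closure test_op \<subseteq> adjoint_op test_op"
  by (rule closure_minimal[OF test_op_symmetric closed_adjoint])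

lemma adjoint_test_op_unique:
  assumes "(f, g) \<in> adjoint_op test_op" "(f, h) \<in> adjoint_op test_op"
  shows "g = h"
proof -
  have "cinner (L2_class \<psi>) (g - h) = 0" if "test_function \<psi>" for \<psi>
    using assms that unfolding test_op_adjoint_iff by (simp add: cinner_diff_right)
  then show ?thesis using L2_eq_0_if_orthogonal_test[of "g - h"] by simp
qed

lemma closure_test_op_approx:
  assumes "(f, h) \<in> closure test_op"
  obtains \<psi> where "\<And>n. test_function (\<psi> n)" "(\<lambda>n. L2_class (\<psi> n)) \<longlonglongrightarrow> f" "(\<lambda>n. - L2_class (lap (\<psi> n))) \<longlonglongrightarrow> h"
proof -
  obtain r where r: "\<forall>n::nat. r n \<in> test_op" "r \<longlonglongrightarrow> (f, h)" using assms unfolding closure_sequential by blast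
  then have "\<forall>n. \<exists>\<psi>. test_function \<psi> \<and> r n = (L2_class \<psi>, - L2_class (lap \<psi>))" unfolding test_op_def by blast
  then obtain \<psi> where \<psi>: "\<And>n. test_function (\<psi> n)" "\<And>n. r n = (L2_class (\<psi> n), - L2_class (lap (\<psi> n)))" by metis
  show ?thesis
    using tendsto_fst[OF r(2)] tendsto_snd[OF r(2)] by (intro that[of \<psi>]) (simp_all add: \<psi>)
qed

text \<open>Weak differentiation is closed: the integration by parts identity survives convergence
  of both sides. \<open>bound\<close> makes the derivatives Cauchy from convergence of the functions
  and their Laplacians, which is what membership in the closure supplies.\<close>

lemma weak_deriv_of_limit:
  fixes f :: "'a::euclidean_space L2"
  assumes bs: "set bs \<subseteq> Basis" and \<psi>: "\<And>n. test_function (\<psi> n)" and lim: "(\<lambda>n. L2_class (\<psi> n)) \<longlonglongrightarrow> f"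
    and D: "\<And>n. test_function (D n)"
    and parts: "\<And>n \<phi>. test_function \<phi> \<Longrightarrow> cinner (L2_class (partial_derivs bs \<phi>)) (L2_class (\<psi> n)) = (-1) ^ length bs * cinner (L2_class \<phi>) (L2_class (D n))"
    and bound: "\<And>n k. norm (L2_class (D n) - L2_class (D k)) \<le> norm (L2_class (\<psi> n) - L2_class (\<psi> k)) + norm (L2_class (lap (\<psi> n)) - L2_class (lap (\<psi> k)))"
    and limlap: "(\<lambda>n. - L2_class (lap (\<psi> n))) \<longlonglongrightarrow> h"
  shows "\<exists>g. has_weak_deriv bs f g"
proof -
  have "Cauchy (\<lambda>n. L2_class (D n))"
  proof (rule metric_CauchyI)
    fix e :: real assume e: "e > 0"
    have c1: "Cauchy (\<lambda>n. L2_class (\<psi> n))" using lim by (rule LIMSEQ_imp_Cauchy)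
    have c2: "Cauchy (\<lambda>n. - L2_class (lap (\<psi> n)))" using limlap by (rule LIMSEQ_imp_Cauchy)
    from c1 e obtain N1 where N1: "\<And>n k. n \<ge> N1 \<Longrightarrow> k \<ge> N1 \<Longrightarrow> dist (L2_class (\<psi> n)) (L2_class (\<psi> k)) < e / 2"
      using metric_CauchyD[OF c1, of "e / 2"] by auto
    from c2 e obtain N2 where N2: "\<And>n k. n \<ge> N2 \<Longrightarrow> k \<ge> N2 \<Longrightarrow> dist (- L2_class (lap (\<psi> n))) (- L2_class (lap (\<psi> k))) < e / 2"
      using metric_CauchyD[OF c2, of "e / 2"] by auto
    have "dist (L2_class (D n)) (L2_class (D k)) < e" if "n \<ge> max N1 N2" "k \<ge> max N1 N2" for n k
      using bound[of n k] N1[of n k] N2[of n k] that by (simp add: dist_norm norm_minus_commute)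
    then show "\<exists>N. \<forall>n\<ge>N. \<forall>k\<ge>N. dist (L2_class (D n)) (L2_class (D k)) < e" by blast
  qed
  then obtain g where g: "(\<lambda>n. L2_class (D n)) \<longlonglongrightarrow> g" by (auto simp: Cauchy_convergent_iff convergent_def)
  have "has_weak_deriv bs f g"
    unfolding has_weak_deriv_iff[OF bs]
  proof (intro allI impI, rule LIMSEQ_unique)
    fix \<phi> :: "'a \<Rightarrow> complex" assume \<phi>: "test_function \<phi>"
    show "(\<lambda>n. cinner (L2_class (partial_derivs bs \<phi>)) (L2_class (\<psi> n))) \<longlonglongrightarrow> cinner (L2_class (partial_derivs bs \<phi>)) f"
      by (intro tendsto_cinner tendsto_const lim)
    show "(\<lambda>n. cinner (L2_class (partial_derivs bs \<phi>)) (L2_class (\<psi> n))) \<longlonglongrightarrow> (-1) ^ length bs * cinner (L2_class \<phi>) g"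
      unfolding parts[OF \<phi>] by (intro tendsto_mult tendsto_cinner tendsto_const g)
  qed
  then show ?thesis by blast
qed

lemma closure_test_op_sobolev:
  assumes "(f, h) \<in> closure test_op"
  shows "f \<in> sobolev 2"
  unfolding sobolev_def
proof (intro CollectI allI impI, elim conjE)
  fix bs :: "'a list" assume bs: "set bs \<subseteq> Basis" "length bs \<le> 2"
  note t = test_function_partial_deriv and s = test_function_smooth and sq = test_function_square_integrable
  obtain \<psi> where \<psi>: "\<And>n. test_function (\<psi> n)" "(\<lambda>n. L2_class (\<psi> n)) \<longlonglongrightarrow> f" "(\<lambda>n. - L2_class (lap (\<psi> n))) \<longlonglongrightarrow> h"
    using closure_test_op_approx[OF assms] by blast
  let ?d = "\<lambda>n k y. \<psi> n y - \<psi> k y"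
  have d: "test_function (?d n k)" for n k by (intro test_function_diff \<psi>)
  have ld: "lap (?d n k) = (\<lambda>y. lap (\<psi> n) y - lap (\<psi> k) y)" for n k
    using lap_add[OF s[OF \<psi>(1)[of n]] smooth_cmult[OF s[OF \<psi>(1)[of k]], of "-1"]] lap_cmult[OF s[OF \<psi>(1)[of k]], of "-1"]
    by simp
  have ld': "L2_class (lap (?d n k)) = L2_class (lap (\<psi> n)) - L2_class (lap (\<psi> k))" for n k
    unfolding ld by (rule L2_class_diff[symmetric]) (intro sq test_function_lap \<psi>)+
  have dd: "L2_class (?d n k) = L2_class (\<psi> n) - L2_class (\<psi> k)" for n k
    by (rule L2_class_diff[symmetric]) (intro sq \<psi>)+
  consider "bs = []" | b where "bs = [b]" "b \<in> Basis" | b c where "bs = [b, c]" "b \<in> Basis" "c \<in> Basis"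
    using bs by (cases bs; cases "tl bs"; auto)
  then show "\<exists>g. has_weak_deriv bs f g"
  proof cases
    case 1
    then have "has_weak_deriv bs f f" by (simp add: has_weak_deriv_def)
    then show ?thesis by blast
  next
    case 2
    show ?thesis
    proof (rule weak_deriv_of_limit[OF bs(1) \<psi>(1,2) _ _ _ \<psi>(3), of "\<lambda>n. partial_deriv b (\<psi> n)"])
      show "test_function (partial_deriv b (\<psi> n))" for n by (intro t \<psi> 2)
      show "cinner (L2_class (partial_derivs bs \<phi>)) (L2_class (\<psi> n)) = (-1) ^ length bs * cinner (L2_class \<phi>) (L2_class (partial_deriv b (\<psi> n)))"
        if "test_function \<phi>" for n \<phi>
        using cinner_partial_deriv[OF that \<psi>(1)[of n] 2(2)] by (simp add: 2)
      show "norm (L2_class (partial_deriv b (\<psi> n)) - L2_class (partial_deriv b (\<psi> k)))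
        \<le> norm (L2_class (\<psi> n) - L2_class (\<psi> k)) + norm (L2_class (lap (\<psi> n)) - L2_class (lap (\<psi> k)))" for n k
      proof -
        have "L2_class (partial_deriv b (?d n k)) = L2_class (partial_deriv b (\<psi> n)) - L2_class (partial_deriv b (\<psi> k))"
          unfolding partial_deriv_diff[OF s[OF \<psi>(1)] s[OF \<psi>(1)]] by (rule L2_class_diff[symmetric]) (intro sq t \<psi> 2)+
        then show ?thesis using norm_first_derivative_le[OF d 2(2), of n k] by (simp only: ld' dd)
      qed
    qed
  next
    case 3
    show ?thesis
    \<comment> \<open>Each integration by parts removes the outermost direction, so the order is
      reversed on the other side.\<close>
    proof (rule weak_deriv_of_limit[OF bs(1) \<psi>(1,2) _ _ _ \<psi>(3), of "\<lambda>n. partial_deriv c (partial_deriv b (\<psi> n))"])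
      show "test_function (partial_deriv c (partial_deriv b (\<psi> n)))" for n by (intro t \<psi> 3)
      show "cinner (L2_class (partial_derivs bs \<phi>)) (L2_class (\<psi> n)) = (-1) ^ length bs * cinner (L2_class \<phi>) (L2_class (partial_deriv c (partial_deriv b (\<psi> n))))"
        if \<phi>: "test_function \<phi>" for n \<phi>
        using cinner_partial_deriv[OF t[OF \<phi> 3(3)] \<psi>(1)[of n] 3(2)] cinner_partial_deriv[OF \<phi> t[OF \<psi>(1)[of n] 3(2)] 3(3)]
        by (simp add: 3)
      show "norm (L2_class (partial_deriv c (partial_deriv b (\<psi> n))) - L2_class (partial_deriv c (partial_deriv b (\<psi> k))))
        \<le> norm (L2_class (\<psi> n) - L2_class (\<psi> k)) + norm (L2_class (lap (\<psi> n)) - L2_class (lap (\<psi> k)))" for n k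
      proof -
        have 1: "partial_deriv c (partial_deriv b (?d n k)) = (\<lambda>y. partial_deriv c (partial_deriv b (\<psi> n)) y - partial_deriv c (partial_deriv b (\<psi> k)) y)"
          unfolding partial_deriv_diff[OF s[OF \<psi>(1)] s[OF \<psi>(1)]]
          by (rule partial_deriv_diff) (intro s t \<psi> 3)+
        have "L2_class (partial_deriv c (partial_deriv b (?d n k))) = L2_class (partial_deriv c (partial_deriv b (\<psi> n))) - L2_class (partial_deriv c (partial_deriv b (\<psi> k)))"
          unfolding 1 by (rule L2_class_diff[symmetric]) (intro sq t \<psi> 3)+
        then have "norm (L2_class (partial_deriv c (partial_deriv b (\<psi> n))) - L2_class (partial_deriv c (partial_deriv b (\<psi> k))))
          \<le> norm (L2_class (lap (\<psi> n)) - L2_class (lap (\<psi> k)))"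
          using norm_second_derivative_le[OF d 3(3,2), of n k] by (simp only: ld')
        then show ?thesis by (rule order_trans) simp
      qed
    qed
  qed
qed

text \<open>On test functions the form is the sum of the squared norms of the first derivatives, and
  the sign survives the limit.\<close>

lemma cinner_test_op_nonneg:
  assumes "(f, h) \<in> closure test_op"
  shows "Re (cinner h f) \<ge> 0"
proof -
  note t = test_function_partial_deriv
  obtain \<psi> where \<psi>: "\<And>n. test_function (\<psi> n)" "(\<lambda>n. L2_class (\<psi> n)) \<longlonglongrightarrow> f" "(\<lambda>n. - L2_class (lap (\<psi> n))) \<longlonglongrightarrow> h"
    using closure_test_op_approx[OF assms] by blast
  have "Re (cinner (- L2_class (lap (\<psi> n))) (L2_class (\<psi> n))) \<ge> 0" for n
  proof -
    have "cinner (L2_class (partial_deriv b (partial_deriv b (\<psi> n)))) (L2_class (\<psi> n)) = - of_real ((norm (L2_class (partial_deriv b (\<psi> n))))\<^sup>2)"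
      if "b \<in> Basis" for b
      using cinner_partial_deriv[OF t[OF \<psi>(1)[of n] that] \<psi>(1)[of n] that] by (simp add: cinner_self)
    then show ?thesis
      by (simp add: L2_class_lap[OF \<psi>(1)] cinner_uminus cinner_sum_left sum_nonpos)
  qed
  moreover have "(\<lambda>n. Re (cinner (- L2_class (lap (\<psi> n))) (L2_class (\<psi> n)))) \<longlonglongrightarrow> Re (cinner h f)"
    by (intro tendsto_intros tendsto_cinner \<psi>)
  ultimately show ?thesis by (intro LIMSEQ_le_const) auto
qed

section \<open>Essential self-adjointness\<close>

lemma orthogonal_range_test_op:
  fixes v :: "(real ^ 3) L2"
  assumes "\<And>\<psi>. test_function \<psi> \<Longrightarrow> cinner (- L2_class (lap \<psi>) - (- 4) *\<^sub>C L2_class \<psi>) v = 0"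
  shows "v = 0"
proof -
  have "AE y in lborel. cnj (L2_rep v y) = 0"
  proof (rule AE_eq_0_if_orthogonal_range)
    show "square_integrable (\<lambda>y. cnj (L2_rep v y))" by (intro square_integrable_cnj square_integrable_rep)
    fix \<psi> :: "real ^ 3 \<Rightarrow> complex" assume \<psi>: "test_function \<psi>"
    note sq = test_function_square_integrable[OF \<psi>] test_function_square_integrable[OF test_function_lap[OF \<psi>]]
    have "- L2_class (lap \<psi>) - (- 4) *\<^sub>C L2_class \<psi> = L2_class (\<lambda>y. 2\<^sup>2 * \<psi> y - lap \<psi> y)"
      using sq by (simp add: L2_class_scaleC L2_class_diff square_integrable_scale)
    moreover have "square_integrable (\<lambda>y. 2\<^sup>2 * \<psi> y - lap \<psi> y)"
      by (intro square_integrable_diff square_integrable_scale sq)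
    ultimately show "(\<integral>y. cnj (L2_rep v y) * (2\<^sup>2 * \<psi> y - lap \<psi> y) \<partial>lborel) = 0"
      using assms[OF \<psi>] cinner_L2_class_left[of "\<lambda>y. 2\<^sup>2 * \<psi> y - lap \<psi> y" v] by simp
  qed
  then have "AE y in lborel. L2_rep v y = 0" by simp
  then have "L2_class (L2_rep v) = L2_class (\<lambda>y. 0)"
    by (simp add: L2_class_eq_iff square_integrable_rep square_integrable_zero)
  then show ?thesis by (simp add: L2_class_rep L2_class_zero)
qed

text \<open>The standard criterion: solve in the closure the equation with 4 added that the given
  pair satisfies. The difference of the two first components is an eigenvector of the adjoint for -
  4, hence orthogonal to the dense range, hence 0.\<close>

lemma adjoint_test_op_subset_closure: "adjoint_op test_op \<subseteq> (closure test_op :: (real ^ 3) L2 operator)"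
proof (rule subrelI)
  fix g h :: "(real ^ 3) L2" assume gh: "(g, h) \<in> adjoint_op test_op"
  have "\<exists>f f'. (f, f') \<in> closure test_op \<and> f' - (- 4) *\<^sub>C f = h - (- 4) *\<^sub>C g"
  proof (rule range_eq_UNIV)
    show "closed (closure test_op :: (real ^ 3) L2 operator)" by (rule closed_closure)
    show "linear_relation (closure test_op :: (real ^ 3) L2 operator)" by (rule linear_relation_closure[OF linear_relation_test_op])
    show "(4 :: real) > 0" by simp
    fix f f' :: "(real ^ 3) L2" assume f: "(f, f') \<in> closure test_op"
    show "4 * norm f \<le> norm (f' - (- 4) *\<^sub>C f)"
    proof (cases "f = 0")
      case False
      have "4 * (norm f)\<^sup>2 \<le> Re (cinner (f' - (- 4) *\<^sub>C f) f)"
        using cinner_test_op_nonneg[OF f] by (simp add: cinner_add_left cinner_scaleC_left cinner_self)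
      also have "\<dots> \<le> cmod (cinner (f' - (- 4) *\<^sub>C f) f)" by (rule complex_Re_le_cmod)
      also have "\<dots> \<le> norm (f' - (- 4) *\<^sub>C f) * norm f" by (rule cinner_norm_le)
      finally have "(4 * norm f) * norm f \<le> norm (f' - (- 4) *\<^sub>C f) * norm f" by (simp add: power2_eq_square)
      then show ?thesis using False by (simp add: mult_le_cancel_right)
    qed simp
  next
    fix v :: "(real ^ 3) L2" assume v: "\<And>f g. (f, g) \<in> closure test_op \<Longrightarrow> cinner (g - (- 4) *\<^sub>C f) v = 0"
    show "v = 0"
    proof (rule orthogonal_range_test_op)
      fix \<psi> :: "real ^ 3 \<Rightarrow> complex" assume "test_function \<psi>"
      then have "(L2_class \<psi>, - L2_class (lap \<psi>)) \<in> closure test_op"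
        using closure_subset[of test_op] unfolding test_op_def by blast
      then show "cinner (- L2_class (lap \<psi>) - (- 4) *\<^sub>C L2_class \<psi>) v = 0" by (rule v)
    qed
  qed
  then obtain f f' where f: "(f, f') \<in> closure test_op" "f' - (- 4) *\<^sub>C f = h - (- 4) *\<^sub>C g" by blast
  have "(f, f') \<in> adjoint_op test_op" using closure_test_op_subset_adjoint f(1) by blast
  then have d: "(g - f, h - f') \<in> adjoint_op test_op"
    by (rule linear_relation_diff[OF linear_relation_adjoint gh])
  have hd: "h - f' = (- 4) *\<^sub>C (g - f)"
    using f(2) by (simp add: cvec.scale_right_diff_distrib algebra_simps)
  have "g - f = 0"
  proof (rule orthogonal_range_test_op)
    fix \<psi> :: "real ^ 3 \<Rightarrow> complex" assume \<psi>: "test_function \<psi>"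
    then have "cinner (- L2_class (lap \<psi>)) (g - f) = cinner (L2_class \<psi>) (h - f')"
      using d unfolding test_op_adjoint_iff by blast
    then show "cinner (- L2_class (lap \<psi>) - (- 4) *\<^sub>C L2_class \<psi>) (g - f) = 0"
      unfolding hd by (simp only: cinner_diff_left cinner_scaleC_left cinner_scaleC_right) simp
  qed
  then have "f = g" "f' = h" using hd by simp_all
  then show "(g, h) \<in> closure test_op" using f(1) by simp
qed

lemma adjoint_test_op: "adjoint_op test_op = (closure test_op :: (real ^ 3) L2 operator)"
  using adjoint_test_op_subset_closure closure_test_op_subset_adjoint by blast

text \<open>A sandwich: the a priori estimates put the domain of the closure into the Sobolev space,
  the operator on that space lies in the adjoint, and the adjoint equals the closure.\<close>

lemma free_hamiltonian_eq_closure: "free_hamiltonian = closure test_op"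
proof
  show "free_hamiltonian \<subseteq> closure test_op"
    using free_hamiltonian_subset_adjoint unfolding adjoint_test_op .
  show "closure test_op \<subseteq> free_hamiltonian"
  proof (rule subrelI)
    fix f h :: "(real ^ 3) L2" assume fh: "(f, h) \<in> closure test_op"
    have "(f, - laplacian f) \<in> free_hamiltonian"
      using closure_test_op_sobolev[OF fh] unfolding free_hamiltonian_def by blast
    moreover from this have "h = - laplacian f"
      using adjoint_test_op_unique fh free_hamiltonian_subset_adjoint closure_test_op_subset_adjoint by blast
    ultimately show "(f, h) \<in> free_hamiltonian" by simp
  qed
qed

lemma adjoint_free_hamiltonian: "adjoint_op free_hamiltonian = free_hamiltonian"
  unfolding free_hamiltonian_eq_closure adjoint_closure by (rule adjoint_test_op)

lemma free_hamiltonian_closed: "closed free_hamiltonian"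
  unfolding free_hamiltonian_eq_closure by simp

lemma linear_relation_free_hamiltonian: "linear_relation free_hamiltonian"
  unfolding free_hamiltonian_eq_closure by (rule linear_relation_closure[OF linear_relation_test_op])

lemma free_hamiltonian_symmetric:
  "(f, h) \<in> free_hamiltonian \<Longrightarrow> (g, k) \<in> free_hamiltonian \<Longrightarrow> cinner h g = cinner f k"
  using adjoint_free_hamiltonian adjoint_op_iff[of g k free_hamiltonian] by blast

section \<open>Solvability off the half line [0, \<infinity>)\<close>

lemma free_hamiltonian_lower_bound:
  assumes z: "z \<notin> complex_of_real ` {0..}"
  obtains c where "c > 0" "\<And>f h. (f, h) \<in> free_hamiltonian \<Longrightarrow> c * norm f \<le> norm (h - z *\<^sub>C f)"
proof -
  \<comment> \<open>The form is real and nonnegative, so the imaginary part gives the bound off the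
    real axis and the real part on the negative axis.\<close>
  define c where "c = (if Im z = 0 then - Re z else \<bar>Im z\<bar>)"
  have "Im z = 0 \<Longrightarrow> Re z < 0"
  proof (rule ccontr)
    assume "Im z = 0" "\<not> Re z < 0"
    then have "z = complex_of_real (Re z)" "Re z \<in> {0..}" by (simp_all add: complex_eq_iff)
    then show False using z by blast
  qed
  then have c: "c > 0" by (auto simp: c_def)
  have "c * norm f \<le> norm (h - z *\<^sub>C f)" if fh: "(f, h) \<in> free_hamiltonian" for f h
  proof (cases "f = 0")
    case False
    have re: "Re (cinner h f) \<ge> 0" using cinner_test_op_nonneg fh unfolding free_hamiltonian_eq_closure by blast
    have "cinner h f = cnj (cinner h f)"
      using free_hamiltonian_symmetric[OF fh fh] cinner_commute[of f h] by simp
    then have im: "Im (cinner h f) = 0" by (simp add: complex_eq_iff)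
    have e: "cinner (h - z *\<^sub>C f) f = cinner h f - z * of_real ((norm f)\<^sup>2)"
      by (simp add: cinner_diff_left cinner_scaleC_left cinner_self)
    have "c * (norm f)\<^sup>2 \<le> cmod (cinner (h - z *\<^sub>C f) f)"
    proof (cases "Im z = 0")
      case True
      have "c * (norm f)\<^sup>2 \<le> Re (cinner (h - z *\<^sub>C f) f)"
        unfolding e using re True by (simp add: c_def)
      then show ?thesis using complex_Re_le_cmod order_trans by blast
    next
      case F: False
      have "c * (norm f)\<^sup>2 = \<bar>Im (cinner (h - z *\<^sub>C f) f)\<bar>"
        unfolding e using im F by (simp add: c_def abs_mult)
      then show ?thesis using abs_Im_le_cmod by metis
    qed
    also have "\<dots> \<le> norm (h - z *\<^sub>C f) * norm f" by (rule cinner_norm_le)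
    finally have "(c * norm f) * norm f \<le> norm (h - z *\<^sub>C f) * norm f" by (simp add: power2_eq_square mult.assoc)
    then show ?thesis using False by (simp add: mult_le_cancel_right)
  qed simp
  with c show ?thesis by (rule that)
qed

lemma cnj_not_nonneg:
  assumes "z \<notin> complex_of_real ` {0..}"
  shows "cnj z \<notin> complex_of_real ` {0..}"
proof
  assume "cnj z \<in> complex_of_real ` {0..}"
  then obtain r where "r \<ge> 0" "cnj z = of_real r" by auto
  then have "z = of_real r" by (metis complex_cnj_cnj complex_cnj_complex_of_real)
  then show False using assms \<open>r \<ge> 0\<close> by auto
qed

text \<open>A vector orthogonal to the range is an eigenvector of the adjoint, that is of the
  operator itself, for \<open>cnj z\<close>; the lower bound at \<open>cnj z\<close> excludes
  nonzero ones.\<close>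

lemma free_hamiltonian_surjective:
  assumes z: "z \<notin> complex_of_real ` {0..}"
  obtains f h where "(f, h) \<in> free_hamiltonian" "h - z *\<^sub>C f = g"
proof -
  note z' = cnj_not_nonneg[OF z]
  obtain c where c: "c > 0" "\<And>f h. (f, h) \<in> free_hamiltonian \<Longrightarrow> c * norm f \<le> norm (h - z *\<^sub>C f)"
    using free_hamiltonian_lower_bound[OF z] by blast
  obtain c' where c': "c' > 0" "\<And>f h. (f, h) \<in> free_hamiltonian \<Longrightarrow> c' * norm f \<le> norm (h - cnj z *\<^sub>C f)"
    using free_hamiltonian_lower_bound[OF z'] by blast
  have "\<exists>f h. (f, h) \<in> free_hamiltonian \<and> h - z *\<^sub>C f = g"
  proof (rule range_eq_UNIV[OF free_hamiltonian_closed linear_relation_free_hamiltonian c])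
    fix v assume v: "\<And>f h. (f, h) \<in> free_hamiltonian \<Longrightarrow> cinner (h - z *\<^sub>C f) v = 0"
    have "(v, cnj z *\<^sub>C v) \<in> adjoint_op free_hamiltonian"
      unfolding adjoint_op_iff using v by (simp add: cinner_diff_left cinner_scaleC_left cinner_scaleC_right)
    then have "c' * norm v \<le> 0" using c'(2)[of v "cnj z *\<^sub>C v"] unfolding adjoint_free_hamiltonian by simp
    then show "v = 0" using c'(1) by (simp add: mult_le_0_iff)
  qed
  then show ?thesis using that by blast
qed

section \<open>Point evaluations\<close>

lemma cnj_green: "cnj (green k p y) = green (cnj k) p y"
  by (simp add: green_def exp_cnj)

text \<open>Translation invariance. The common norm bounds all point evaluations at once, which
  makes the convergence of representatives uniform.\<close>

lemma norm_L2_class_green: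
  assumes "Re k > 0" shows "norm (L2_class (green k p)) = norm (L2_class (green k 0))"
proof -
  have eq: "complex_of_real ((cmod (green k 0 (- p + y)))\<^sup>2) = of_real ((cmod (green k p y))\<^sup>2)" for y
    by (simp add: green_def)
  have "(\<integral>y. complex_of_real ((cmod (green k 0 (- p + y)))\<^sup>2) \<partial>lborel) = (\<integral>y. complex_of_real ((cmod (green k 0 y))\<^sup>2) \<partial>lborel)"
    by (rule integral_translate[of "\<lambda>y. complex_of_real ((cmod (green k 0 y))\<^sup>2)" "- p"]) measurable
  then have "(\<integral>y. (cmod (green k p y))\<^sup>2 \<partial>lborel) = (\<integral>y. (cmod (green k 0 y))\<^sup>2 \<partial>lborel)"
    unfolding eq integral_complex_of_real of_real_eq_iff .
  then have "(norm (L2_class (green k p)))\<^sup>2 = (norm (L2_class (green k 0)))\<^sup>2"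
    by (simp only: norm_L2_class[OF square_integrable_green[OF assms]])
  then show ?thesis by (rule power2_eq_imp_eq) auto
qed

text \<open>The representation formula as an inner product. The second slot is conjugated, hence
  \<open>cnj k\<close>.\<close>

lemma test_function_eval:
  assumes k: "Re k > 0" and \<psi>: "test_function \<psi>"
  shows "\<psi> p = cinner (- L2_class (lap \<psi>) + k\<^sup>2 *\<^sub>C L2_class \<psi>) (L2_class (green (cnj k) p))"
proof -
  note sq = test_function_square_integrable[OF \<psi>] test_function_square_integrable[OF test_function_lap[OF \<psi>]]
  have 1: "- L2_class (lap \<psi>) + k\<^sup>2 *\<^sub>C L2_class \<psi> = L2_class (\<lambda>y. k\<^sup>2 * \<psi> y - lap \<psi> y)"
    using sq by (simp add: L2_class_scaleC L2_class_diff[symmetric] square_integrable_scale)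
  have "cinner (L2_class (\<lambda>y. k\<^sup>2 * \<psi> y - lap \<psi> y)) (L2_class (green (cnj k) p)) = (\<integral>y. (k\<^sup>2 * \<psi> y - lap \<psi> y) * cnj (green (cnj k) p y) \<partial>lborel)"
    using k by (intro cinner_L2_class square_integrable_diff square_integrable_scale sq square_integrable_green) simp
  then show ?thesis unfolding 1 cnj_green using green_representation[OF k \<psi>, of p] by simp
qed

text \<open>Fatou's lemma bounds the distance of the pointwise limit from \<open>f\<close> by the
  lower limit of the norms, which is 0.\<close>

lemma L2_represents_uniform_limit:
  fixes f :: "'a::euclidean_space L2"
  assumes \<psi>: "\<And>n. square_integrable (\<psi> n)" and lim: "(\<lambda>n. L2_class (\<psi> n)) \<longlonglongrightarrow> f"
    and pt: "\<And>y. (\<lambda>n. \<psi> n y) \<longlonglongrightarrow> u y" and u: "continuous_on UNIV u"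
  shows "L2_represents u f"
proof -
  define v where "v = L2_rep f"
  have v: "square_integrable v" "L2_class v = f" by (simp_all add: v_def square_integrable_rep L2_class_rep)
  have [measurable]: "u \<in> borel_measurable borel" "v \<in> borel_measurable borel" "\<psi> n \<in> borel_measurable borel" for n
    using u \<psi> v by (auto intro: borel_measurable_continuous_onI square_integrable_measurable)
  have "(\<integral>\<^sup>+y. ennreal ((cmod (u y - v y))\<^sup>2) \<partial>lborel) = (\<integral>\<^sup>+y. liminf (\<lambda>n. ennreal ((cmod (\<psi> n y - v y))\<^sup>2)) \<partial>lborel)"
  proof (rule nn_integral_cong)
    fix y
    have "(\<lambda>n. ennreal ((cmod (\<psi> n y - v y))\<^sup>2)) \<longlonglongrightarrow> ennreal ((cmod (u y - v y))\<^sup>2)"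
      by (intro tendsto_intros pt)
    from lim_imp_Liminf[OF _ this]
    show "ennreal ((cmod (u y - v y))\<^sup>2) = liminf (\<lambda>n. ennreal ((cmod (\<psi> n y - v y))\<^sup>2))" by simp
  qed
  also have "\<dots> \<le> liminf (\<lambda>n. \<integral>\<^sup>+y. ennreal ((cmod (\<psi> n y - v y))\<^sup>2) \<partial>lborel)"
    by (rule nn_integral_liminf) simp
  also have "\<dots> = liminf (\<lambda>n. ennreal ((norm (L2_class (\<psi> n) - f))\<^sup>2))"
    by (simp add: nn_integral_L2_class_diff \<psi> v)
  also have "\<dots> = 0"
  proof (rule lim_imp_Liminf)
    have "(\<lambda>n. ennreal ((norm (L2_class (\<psi> n) - f))\<^sup>2)) \<longlonglongrightarrow> ennreal ((norm (f - f))\<^sup>2)"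
      by (intro tendsto_intros lim)
    then show "(\<lambda>n. ennreal ((norm (L2_class (\<psi> n) - f))\<^sup>2)) \<longlonglongrightarrow> 0" by simp
  qed simp
  finally have "(\<integral>\<^sup>+y. ennreal ((cmod (u y - v y))\<^sup>2) \<partial>lborel) = 0" by simp
  then have "AE y in lborel. ennreal ((cmod (u y - v y))\<^sup>2) = 0"
    by (subst (asm) nn_integral_0_iff_AE) auto
  then have ae: "AE y in lborel. u y = v y" by eventually_elim (simp add: ennreal_eq_0_iff)
  have "integrable lborel (\<lambda>y. (cmod (u y))\<^sup>2) \<longleftrightarrow> integrable lborel (\<lambda>y. (cmod (v y))\<^sup>2)"
    using ae by (intro integrable_cong_AE) auto
  then have su: "square_integrable u" using v(1) by (simp add: square_integrable_def)
  then have "L2_class u = L2_class v" using ae by (simp add: L2_class_eq_iff v(1))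
  then show ?thesis using su v(2) by (simp add: L2_represents_def)
qed

text \<open>Point evaluation is bounded by the graph norm uniformly in the point, so the
  approximating test functions converge uniformly. The quantifier over \<open>k\<close> stands
  inside because one representative has to serve every \<open>k\<close>.\<close>

lemma free_hamiltonian_continuous_rep:
  assumes "(f, h) \<in> free_hamiltonian"
  obtains u where "L2_represents u f" "continuous_on UNIV u"
    "\<forall>k p. Re k > 0 \<longrightarrow> u p = cinner (h + k\<^sup>2 *\<^sub>C f) (L2_class (green (cnj k) p))"
proof -
  obtain \<psi> where \<psi>: "\<And>n. test_function (\<psi> n)" "(\<lambda>n. L2_class (\<psi> n)) \<longlonglongrightarrow> f" "(\<lambda>n. - L2_class (lap (\<psi> n))) \<longlonglongrightarrow> h"
    using closure_test_op_approx assms unfolding free_hamiltonian_eq_closure by blast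
  define F where "F n = - L2_class (lap (\<psi> n)) + 1\<^sup>2 *\<^sub>C L2_class (\<psi> n)" for n
  \<comment> \<open>The formula for k = 1 defines the function; the other \<open>k\<close> follow by
    uniqueness of pointwise limits.\<close>
  define u where "u p = cinner (h + 1\<^sup>2 *\<^sub>C f) (L2_class (green 1 p))" for p
  have lim: "(\<lambda>n. \<psi> n p) \<longlonglongrightarrow> cinner (h + k\<^sup>2 *\<^sub>C f) (L2_class (green (cnj k) p))" if k: "Re k > 0" for k p
    unfolding test_function_eval[OF k \<psi>(1), of _ p]
    by (intro tendsto_cinner tendsto_add tendsto_scaleC \<psi> tendsto_const)
  have lim1: "(\<lambda>n. \<psi> n p) \<longlonglongrightarrow> u p" for p using lim[of 1 p] by (simp add: u_def)
  have eval: "u p = cinner (h + k\<^sup>2 *\<^sub>C f) (L2_class (green (cnj k) p))" if "Re k > 0" for k p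
    using LIMSEQ_unique[OF lim1 lim[OF that]] .
  have F: "F \<longlonglongrightarrow> h + 1\<^sup>2 *\<^sub>C f" unfolding F_def by (intro tendsto_add tendsto_scaleC \<psi>)
  have cont: "continuous_on UNIV u"
  proof (rule uniform_limit_theorem)
    show "\<forall>\<^sub>F n in sequentially. continuous_on UNIV (\<psi> n)" using \<psi>(1) by (simp add: test_function_continuous_on)
    show "uniform_limit UNIV \<psi> u sequentially"
    proof (rule uniform_limitI)
      fix e :: real assume e: "e > 0"
      let ?g = "norm (L2_class (green 1 0))"
      have "(\<lambda>n. norm (F n - (h + 1\<^sup>2 *\<^sub>C f)) * ?g) \<longlonglongrightarrow> norm ((h + 1\<^sup>2 *\<^sub>C f) - (h + 1\<^sup>2 *\<^sub>C f)) * ?g"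
        by (intro tendsto_intros F)
      then have "\<forall>\<^sub>F n in sequentially. norm (F n - (h + 1\<^sup>2 *\<^sub>C f)) * ?g < e"
        using e by (intro order_tendstoD(2)) auto
      then show "\<forall>\<^sub>F n in sequentially. \<forall>p\<in>UNIV. dist (\<psi> n p) (u p) < e"
      proof eventually_elim
        case (elim n)
        have "dist (\<psi> n p) (u p) < e" for p
        proof -
          have "\<psi> n p - u p = cinner (F n - (h + 1\<^sup>2 *\<^sub>C f)) (L2_class (green 1 p))"
            using test_function_eval[of 1 "\<psi> n" p] \<psi>(1) by (simp add: u_def F_def cinner_diff_left)
          then have "dist (\<psi> n p) (u p) \<le> norm (F n - (h + 1\<^sup>2 *\<^sub>C f)) * norm (L2_class (green 1 p))"
            by (simp add: dist_norm cinner_norm_le)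
          also have "norm (L2_class (green 1 p)) = ?g" by (rule norm_L2_class_green) simp
          finally show ?thesis using elim by simp
        qed
        then show ?case by blast
      qed
    qed
  qed simp
  have "L2_represents u f"
    by (rule L2_represents_uniform_limit[OF test_function_square_integrable[OF \<psi>(1)] \<psi>(2) lim1 cont])
  then show ?thesis using cont eval by (intro that) auto
qed

lemma L2_represents_unique:
  assumes "L2_represents u f" "L2_represents v f" "open S" "continuous_on S u" "continuous_on S v" "y \<in> S"
  shows "u y = v y"
proof -
  have "AE y in lborel. u y = v y"
    using assms(1,2) unfolding L2_represents_def by (metis L2_class_eq_iff)
  then show ?thesis using continuous_on_AE_eq[OF assms(3-5) _ assms(6)] by blast
qed

section \<open>The functions exp (- r) in the free domain\<close>

lemma square_integrable_exp_div_norm: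
  "square_integrable (\<lambda>y::real ^ 3. complex_of_real (exp (- norm (y - p)) / norm (y - p)))"
  using square_integrable_exp_over_norm[of 1 p] by simp

text \<open>The distributional identity (1 - \<Delta>) exp (- r) = 2 exp (- r) / r. The regularised
  distance smooths the kink at the pole, so that integration by parts precedes the limit.\<close>

lemma integral_exp_distribution:
  fixes p :: "real ^ 3"
  assumes \<psi>: "test_function \<psi>"
  shows "(\<integral>y. (\<psi> y - lap \<psi> y) * of_real (exp (- norm (y - p))) \<partial>lborel)
    = (\<integral>y. \<psi> y * (2 * of_real (exp (- norm (y - p)) / norm (y - p))) \<partial>lborel)"
proof -
  define \<epsilon> where "\<epsilon> n = inverse (real (Suc n))" for n
  have \<epsilon>: "\<epsilon> n > 0" for n by (simp add: \<epsilon>_def)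
  have \<epsilon>0: "\<epsilon> \<longlonglongrightarrow> 0" unfolding \<epsilon>_def by (rule LIMSEQ_inverse_real_of_nat)
  define \<phi> where "\<phi> y = \<psi> y - lap \<psi> y" for y
  have \<phi>: "test_function \<phi>" unfolding \<phi>_def[abs_def] by (intro test_function_diff test_function_lap \<psi>)
  note [measurable] = test_function_measurable[OF \<phi>] test_function_measurable[OF \<psi>]
  have reg_lim: "(\<lambda>n. reg p (\<epsilon> n) y) \<longlonglongrightarrow> norm (y - p)" for y
  proof -
    have "(\<lambda>n. reg p (\<epsilon> n) y) \<longlonglongrightarrow> sqrt ((norm (y - p))\<^sup>2 + 0\<^sup>2)" unfolding reg_def by (intro tendsto_intros \<epsilon>0)
    then show ?thesis by simp
  qed
  let ?K = "\<lambda>n y. exp (- reg p (\<epsilon> n) y) * (2 / reg p (\<epsilon> n) y + (\<epsilon> n)\<^sup>2 / (reg p (\<epsilon> n) y)\<^sup>2 + (\<epsilon> n)\<^sup>2 / reg p (\<epsilon> n) y ^ 3)"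
  have eq: "(\<integral>y. \<phi> y * of_real (exp (- reg p (\<epsilon> n) y)) \<partial>lborel) = (\<integral>y. \<psi> y * of_real (?K n y) \<partial>lborel)" for n
  proof -
    let ?E = "\<lambda>y. exp (- complex_of_real (reg p (\<epsilon> n) y))"
    have E: "smooth ?E" using smooth_radial(2)[OF \<epsilon>[of n], where k=1 and p=p] by simp
    have i: "integrable lborel (\<lambda>y. \<psi> y * ?E y)" "integrable lborel (\<lambda>y. lap \<psi> y * ?E y)" "integrable lborel (\<lambda>y. \<psi> y * lap ?E y)"
      by (intro test_function_integrable test_function_smooth_mult test_function_lap \<psi> E smooth_lap)+
    have "(\<integral>y. \<phi> y * ?E y \<partial>lborel) = (\<integral>y. \<psi> y * ?E y \<partial>lborel) - (\<integral>y. lap \<psi> y * ?E y \<partial>lborel)"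
      unfolding \<phi>_def left_diff_distrib by (rule Bochner_Integration.integral_diff[OF i(1,2)])
    also have "\<dots> = (\<integral>y. \<psi> y * ?E y - \<psi> y * lap ?E y \<partial>lborel)"
      unfolding integral_lap_by_parts[OF \<psi> E] by (rule Bochner_Integration.integral_diff[OF i(1,3), symmetric])
    also have "\<dots> = (\<integral>y. \<psi> y * of_real (?K n y) \<partial>lborel)"
      unfolding right_diff_distrib[symmetric] lap_exp_reg[OF \<epsilon>] ..
    finally show ?thesis by (simp add: exp_of_real[symmetric] del: exp_of_real)
  qed
  have "(\<lambda>n. \<integral>y. \<phi> y * of_real (exp (- reg p (\<epsilon> n) y)) \<partial>lborel) \<longlonglongrightarrow> (\<integral>y. \<phi> y * of_real (exp (- norm (y - p))) \<partial>lborel)"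
  proof (rule integral_dominated_convergence)
    show "integrable lborel (\<lambda>y. cmod (\<phi> y))" by (intro integrable_norm test_function_integrable \<phi>)
    show "AE y in lborel. (\<lambda>n. \<phi> y * of_real (exp (- reg p (\<epsilon> n) y))) \<longlonglongrightarrow> \<phi> y * of_real (exp (- norm (y - p)))"
      by (intro AE_I2 tendsto_intros reg_lim)
    have "exp (- reg p (\<epsilon> n) y) \<le> 1" for n y using reg_pos[OF \<epsilon>[of n], of p y] by simp
    then show "AE y in lborel. norm (\<phi> y * of_real (exp (- reg p (\<epsilon> n) y))) \<le> cmod (\<phi> y)" for n
      by (intro AE_I2) (simp add: norm_mult mult_left_le)
  qed measurable
  moreover have "(\<lambda>n. \<integral>y. \<psi> y * of_real (?K n y) \<partial>lborel) \<longlonglongrightarrow> (\<integral>y. \<psi> y * (2 * of_real (exp (- norm (y - p)) / norm (y - p))) \<partial>lborel)"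
  proof (rule integral_dominated_convergence)
    let ?w = "\<lambda>y. cmod (\<psi> y * of_real (exp (- norm (y - p)) / norm (y - p)))" and ?w' = "\<lambda>y. cmod (\<psi> y)"
    show "integrable lborel (\<lambda>y. 3 * ?w y + ?w' y)"
      by (intro Bochner_Integration.integrable_add integrable_mult_right integrable_norm test_function_integrable \<psi>
          square_integrable_integrable_mult test_function_square_integrable square_integrable_exp_div_norm)
    show "AE y in lborel. (\<lambda>n. \<psi> y * of_real (?K n y)) \<longlonglongrightarrow> \<psi> y * (2 * of_real (exp (- norm (y - p)) / norm (y - p)))"
      using AE_lborel_singleton[of p]
    proof eventually_elim
      case (elim y)
      have "(\<lambda>n. \<psi> y * of_real (?K n y)) \<longlonglongrightarrow> \<psi> y * of_real (exp (- norm (y - p)) * (2 / norm (y - p) + 0\<^sup>2 / (norm (y - p))\<^sup>2 + 0\<^sup>2 / norm (y - p) ^ 3))"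
        using elim by (intro tendsto_intros reg_lim \<epsilon>0) auto
      then show ?case by (simp add: mult_ac)
    qed
    show "AE y in lborel. norm (\<psi> y * of_real (?K n y)) \<le> 3 * ?w y + ?w' y" for n
      using AE_lborel_singleton[of p]
    proof eventually_elim
      case (elim y)
      define s r where "s = reg p (\<epsilon> n) y" and "r = norm (y - p)"
      have s: "s > 0" "s \<ge> r" "s \<ge> \<epsilon> n" "r > 0"
        using reg_pos[OF \<epsilon>[of n], of p y] reg_ge(1)[of y p "\<epsilon> n"] reg_ge(2)[of "\<epsilon> n" p y] \<epsilon>[of n] elim by (simp_all add: s_def r_def)
      have e2: "(\<epsilon> n)\<^sup>2 / s\<^sup>2 \<le> 1" using s \<epsilon>[of n] by (simp add: power_mono)
      have e3: "(\<epsilon> n)\<^sup>2 / s ^ 3 \<le> 1 / s"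
      proof -
        have "(\<epsilon> n)\<^sup>2 / s ^ 3 = ((\<epsilon> n)\<^sup>2 / s\<^sup>2) / s" by (simp add: power3_eq_cube power2_eq_square)
        also have "\<dots> \<le> 1 / s" using e2 s by (intro divide_right_mono) auto
        finally show ?thesis .
      qed
      \<comment> \<open>Since \<epsilon> \<le> s, the two extra terms are at most 1 and 1/s. Then s
        \<ge> r brings in exp (- r) / r, which is square integrable.\<close>
      have "exp (- s) * (2 / s + (\<epsilon> n)\<^sup>2 / s\<^sup>2 + (\<epsilon> n)\<^sup>2 / s ^ 3) \<le> exp (- s) * (2 / s + 1 + 1 / s)"
        using e2 e3 by (intro mult_left_mono) auto
      also have "\<dots> = 3 * (exp (- s) / s) + exp (- s)" by (simp add: field_simps)
      also have "\<dots> \<le> 3 * (exp (- r) / r) + 1"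
        using s by (intro add_mono mult_left_mono frac_le) auto
      finally have b: "exp (- s) * (2 / s + (\<epsilon> n)\<^sup>2 / s\<^sup>2 + (\<epsilon> n)\<^sup>2 / s ^ 3) \<le> 3 * (exp (- r) / r) + 1" .
      have nn: "0 \<le> exp (- s) * (2 / s + (\<epsilon> n)\<^sup>2 / s\<^sup>2 + (\<epsilon> n)\<^sup>2 / s ^ 3)"
        using s by (intro mult_nonneg_nonneg add_nonneg_nonneg divide_nonneg_nonneg) auto
      have "norm (\<psi> y * of_real (?K n y)) = cmod (\<psi> y) * (exp (- s) * (2 / s + (\<epsilon> n)\<^sup>2 / s\<^sup>2 + (\<epsilon> n)\<^sup>2 / s ^ 3))"
        unfolding s_def[symmetric] norm_mult norm_of_real using nn by simp
      also have "\<dots> \<le> cmod (\<psi> y) * (3 * (exp (- r) / r) + 1)" using b by (intro mult_left_mono) auto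
      also have "\<dots> = 3 * ?w y + ?w' y" using s by (simp add: norm_mult norm_divide r_def algebra_simps)
      finally show ?case .
    qed
  qed measurable
  ultimately show ?thesis
    unfolding eq \<phi>_def[symmetric] by (rule LIMSEQ_unique)
qed

text \<open>Membership in the adjoint of \<open>test_op\<close> is a matter of integrals alone, and
  that adjoint is the free operator; the individual second derivatives of exp (- r) come out as a
  consequence.\<close>

lemma exp_norm_in_free_hamiltonian:
  fixes p :: "real ^ 3"
  defines "E \<equiv> L2_class (\<lambda>y. complex_of_real (exp (- norm (y - p))))"
  shows "(E, (8 * of_real pi) *\<^sub>C L2_class (green 1 p) - E) \<in> free_hamiltonian"
proof -
  let ?e = "\<lambda>y. complex_of_real (exp (- norm (y - p)))" and ?d = "\<lambda>y. complex_of_real (exp (- norm (y - p)) / norm (y - p))"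
  note sq = square_integrable_exp_norm[of p] square_integrable_exp_div_norm[of p]
  have d: "?d y = (4 * of_real pi) * green 1 p y" for y
    by (simp add: green_def exp_of_real[symmetric] del: exp_of_real)
  have G: "L2_class (\<lambda>y. 2 * ?d y) = (8 * of_real pi) *\<^sub>C L2_class (green 1 p)"
    unfolding d by (subst L2_class_scaleC) (simp_all add: square_integrable_green mult.assoc[symmetric])
  have sq2: "square_integrable (\<lambda>y. 2 * ?d y)" by (rule square_integrable_scale[OF sq(2)])
  have "cinner (- L2_class (lap \<psi>)) E = cinner (L2_class \<psi>) (L2_class (\<lambda>y. 2 * ?d y) - E)" if \<psi>: "test_function \<psi>" for \<psi>
  proof -
    note s\<psi> = test_function_square_integrable[OF \<psi>] test_function_square_integrable[OF test_function_lap[OF \<psi>]]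
    have "cinner (L2_class (\<lambda>y. \<psi> y - lap \<psi> y)) E = cinner (L2_class \<psi>) (L2_class (\<lambda>y. 2 * ?d y))"
      unfolding E_def cinner_L2_class[OF square_integrable_diff[OF s\<psi>] sq(1)] cinner_L2_class[OF s\<psi>(1) sq2]
      using integral_exp_distribution[OF \<psi>, of p] by simp
    then show ?thesis
      unfolding L2_class_diff[OF s\<psi>, symmetric] cinner_diff_left cinner_diff_right cinner_uminus by (simp add: algebra_simps)
  qed
  then have "(E, L2_class (\<lambda>y. 2 * ?d y) - E) \<in> adjoint_op test_op" unfolding test_op_adjoint_iff by blast
  then show ?thesis unfolding G adjoint_test_op free_hamiltonian_eq_closure .
qed

section \<open>The minimal operator and its adjoint\<close>

lemma free_hamiltonian_continuous_rep_exists: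
  assumes "(f, h) \<in> free_hamiltonian"
  obtains u where "L2_represents u f" "continuous_on UNIV u"
  using assms by (rule free_hamiltonian_continuous_rep)

lemma free_hamiltonian_value:
  assumes "(f, h) \<in> free_hamiltonian" "L2_represents u f" "continuous_on UNIV u" "Re k > 0"
  shows "u p = cinner (h + k\<^sup>2 *\<^sub>C f) (L2_class (green (cnj k) p))"
proof -
  obtain v where v: "L2_represents v f" "continuous_on UNIV v"
    "\<forall>k p. Re k > 0 \<longrightarrow> v p = cinner (h + k\<^sup>2 *\<^sub>C f) (L2_class (green (cnj k) p))"
    using assms(1) by (rule free_hamiltonian_continuous_rep)
  then show ?thesis
    using L2_represents_unique[OF assms(2) v(1) open_UNIV assms(3) v(2)] assms(4) by simp
qed

text \<open>Vanishing at the centres is expressed with any admissible \<open>k\<close>: k = 1 serves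
  the adjoint, a \<open>k\<close> depending on z the defect subspace at z.\<close>

lemma minimal_hamiltonian_iff:
  assumes k: "Re k > 0"
  shows "(f, h) \<in> minimal_hamiltonian x \<longleftrightarrow>
    (f, h) \<in> free_hamiltonian \<and> (\<forall>j. cinner (h + k\<^sup>2 *\<^sub>C f) (L2_class (green (cnj k) (x j))) = 0)"
proof -
  have "(f, h) \<in> minimal_hamiltonian x \<longleftrightarrow>
    (f, h) \<in> free_hamiltonian \<and> (\<exists>u. L2_represents u f \<and> continuous_on UNIV u \<and> (\<forall>j. u (x j) = 0))"
    by (auto simp: minimal_hamiltonian_def free_hamiltonian_def)
  also have "\<dots> \<longleftrightarrow>
    (f, h) \<in> free_hamiltonian \<and> (\<forall>j. cinner (h + k\<^sup>2 *\<^sub>C f) (L2_class (green (cnj k) (x j))) = 0)"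
  proof (intro conj_cong refl iffI)
    assume fh: "(f, h) \<in> free_hamiltonian"
    {
      assume "\<exists>u. L2_represents u f \<and> continuous_on UNIV u \<and> (\<forall>j. u (x j) = 0)"
      then obtain u where u: "L2_represents u f" "continuous_on UNIV u" "\<And>j. u (x j) = 0" by auto
      show "\<forall>j. cinner (h + k\<^sup>2 *\<^sub>C f) (L2_class (green (cnj k) (x j))) = 0"
        using free_hamiltonian_value[OF fh u(1,2) k, of "x _"] u(3) by simp
    next
      assume 0: "\<forall>j. cinner (h + k\<^sup>2 *\<^sub>C f) (L2_class (green (cnj k) (x j))) = 0"
      obtain u where u: "L2_represents u f" "continuous_on UNIV u"
        by (rule free_hamiltonian_continuous_rep_exists[OF fh])
      have "u (x j) = 0" for j using free_hamiltonian_value[OF fh u k, of "x j"] 0 by simp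
      then show "\<exists>u. L2_represents u f \<and> continuous_on UNIV u \<and> (\<forall>j. u (x j) = 0)" using u by auto
    }
  qed
  finally show ?thesis .
qed

definition green_class :: "('m \<Rightarrow> real ^ 3) \<Rightarrow> 'm \<Rightarrow> (real ^ 3) L2" where
  "green_class x j = L2_class (green 1 (x j))"

lemma minimal_hamiltonian_iff_green_class:
  "(f, h) \<in> minimal_hamiltonian x \<longleftrightarrow> (f, h) \<in> free_hamiltonian \<and> (\<forall>j. cinner (h + f) (green_class x j) = 0)"
  using minimal_hamiltonian_iff[of 1 f h x] by (simp add: green_class_def)

lemma minimal_hamiltonian_subset: "minimal_hamiltonian x \<subseteq> free_hamiltonian"
  using minimal_hamiltonian_iff_green_class by (auto simp: subset_iff)

text \<open>\<open>\<Sum>\<^sub>i c\<^sub>i * green_regular_part x i j\<close> is the limit at \<open>x\<^sub>j\<close> of \<open>\<Sum>\<^sub>i c\<^sub>i * green 1 x\<^sub>i\<close> without its singularity \<open>c\<^sub>j / (4 * pi * r\<^sub>j)\<close>.\<close>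

definition green_regular_part :: "('m \<Rightarrow> real ^ 3) \<Rightarrow> 'm \<Rightarrow> 'm \<Rightarrow> real" where
  "green_regular_part x i j = (if i = j then - 1 / (4 * pi) else exp (- norm (x j - x i)) / (4 * pi * norm (x j - x i)))"

lemma green_regular_part_commute: "green_regular_part x i j = green_regular_part x j i"
  by (simp add: green_regular_part_def norm_minus_commute)

section \<open>Behaviour of Green functions at the centres\<close>

lemma green_tendsto:
  assumes "p \<noteq> a" shows "(green k p \<longlongrightarrow> green k p a) (at a)"
  unfolding green_def[abs_def] using assms by (intro tendsto_intros) auto

lemma continuous_on_green: "p \<notin> S \<Longrightarrow> continuous_on S (green k p)"
  unfolding green_def[abs_def] by (intro continuous_intros) auto

lemma norm_at_tendsto_0: "((\<lambda>y. of_real (norm (y - a)) :: complex) \<longlongrightarrow> 0) (at a)"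
proof -
  have "((\<lambda>y. of_real (norm (y - a)) :: complex) \<longlongrightarrow> of_real (norm (a - a))) (at a)" by (intro tendsto_intros)
  then show ?thesis by simp
qed

lemma green_times_norm_tendsto:
  "((\<lambda>y. green k a y * of_real (norm (y - a))) \<longlongrightarrow> of_real (1 / (4 * pi))) (at a)"
proof -
  have "((\<lambda>y. exp (- k * of_real (norm (y - a))) / of_real (4 * pi)) \<longlongrightarrow> exp (- k * 0) / of_real (4 * pi)) (at a)"
    by (intro tendsto_intros norm_at_tendsto_0) simp
  moreover have "\<forall>\<^sub>F y in at a. exp (- k * of_real (norm (y - a))) / of_real (4 * pi) = green k a y * of_real (norm (y - a))"
    unfolding green_def by (rule eventually_at_filter[THEN iffD2]) (auto intro!: always_eventually)
  ultimately show ?thesis by (simp add: tendsto_cong)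
qed

lemma green_regular_part_tendsto:
  "((\<lambda>y. green 1 a y - of_real (1 / (4 * pi)) / of_real (norm (y - a))) \<longlongrightarrow> of_real (- 1 / (4 * pi))) (at a)"
proof -
  \<comment> \<open>The limit - 1 / (4 \<pi>) is the slope of exp (- t) at 0 divided by 4
    \<pi>.\<close>
  have D: "((\<lambda>t. exp (- t)) has_real_derivative - 1) (at (0::real))" by (auto intro!: derivative_eq_intros)
  then have "((\<lambda>t. (exp (- t) - 1) / t) \<longlongrightarrow> - 1) (at (0::real))" by (simp add: has_field_derivative_iff)
  moreover have "filterlim (\<lambda>y. norm (y - a)) (at 0) (at a)"
    by (rule filterlim_atI) (auto intro!: tendsto_eq_intros simp: eventually_at_filter)
  ultimately have "((\<lambda>y. (exp (- norm (y - a)) - 1) / norm (y - a)) \<longlongrightarrow> - 1) (at a)"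
    by (rule filterlim_compose)
  then have "((\<lambda>y. complex_of_real (1 / (4 * pi) * ((exp (- norm (y - a)) - 1) / norm (y - a)))) \<longlongrightarrow> of_real (1 / (4 * pi) * - 1)) (at a)"
    by (intro tendsto_intros)
  moreover have "complex_of_real (1 / (4 * pi) * ((exp (- norm (y - a)) - 1) / norm (y - a))) = green 1 a y - of_real (1 / (4 * pi)) / of_real (norm (y - a))" for y
    by (simp add: green_def exp_of_real[symmetric] diff_divide_distrib right_diff_distrib del: exp_of_real)
  ultimately show ?thesis by simp
qed

text \<open>Near \<open>x j\<close> only the summand i = j is singular; by injectivity of
  \<open>x\<close> the others are continuous there, as is \<open>u\<close>.\<close>

lemma singular_tendsto:
  fixes x :: "'m::finite \<Rightarrow> real ^ 3" and c :: "complex ^ 'm"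
  assumes "inj x" and u: "continuous_on UNIV u"
  shows "((\<lambda>y. (u y + (\<Sum>i\<in>UNIV. c $ i * green k (x i) y)) * of_real (norm (y - x j))) \<longlongrightarrow> c $ j / of_real (4 * pi)) (at (x j))"
    and "((\<lambda>y. u y + (\<Sum>i\<in>UNIV. c $ i * green 1 (x i) y) - c $ j / of_real (4 * pi) / of_real (norm (y - x j)))
      \<longlongrightarrow> u (x j) + (\<Sum>i\<in>UNIV. c $ i * of_real (green_regular_part x i j))) (at (x j))"
proof -
  have uj: "(u \<longlongrightarrow> u (x j)) (at (x j))" using u by (simp add: continuous_on_eq_continuous_at continuous_at)
  have "((\<lambda>y. u y * of_real (norm (y - x j)) + (\<Sum>i\<in>UNIV. c $ i * (green k (x i) y * of_real (norm (y - x j)))))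
    \<longlongrightarrow> u (x j) * 0 + (\<Sum>i\<in>UNIV. c $ i * (if i = j then of_real (1 / (4 * pi)) else green k (x i) (x j) * 0))) (at (x j))"
  proof (intro tendsto_add tendsto_mult uj norm_at_tendsto_0 tendsto_sum tendsto_const)
    fix i
    show "((\<lambda>y. green k (x i) y * of_real (norm (y - x j))) \<longlongrightarrow> (if i = j then of_real (1 / (4 * pi)) else green k (x i) (x j) * 0)) (at (x j))"
    proof (cases "i = j")
      case False
      then have "x i \<noteq> x j" using assms(1) by (auto dest: injD)
      from tendsto_mult[OF green_tendsto[OF this] norm_at_tendsto_0] False show ?thesis by simp
    qed (use green_times_norm_tendsto in auto)
  qed
  then show "((\<lambda>y. (u y + (\<Sum>i\<in>UNIV. c $ i * green k (x i) y)) * of_real (norm (y - x j))) \<longlongrightarrow> c $ j / of_real (4 * pi)) (at (x j))"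
    by (simp add: distrib_right sum_distrib_right mult.assoc if_distrib cong: if_cong)
  \<comment> \<open>The singular term is attached to the summand i = j, so that the limit can be
    taken term by term.\<close>
  have "((\<lambda>y. u y + (\<Sum>i\<in>UNIV. c $ i * (green 1 (x i) y - (if i = j then of_real (1 / (4 * pi)) / of_real (norm (y - x j)) else 0))))
    \<longlongrightarrow> u (x j) + (\<Sum>i\<in>UNIV. c $ i * of_real (green_regular_part x i j))) (at (x j))"
  proof (intro tendsto_add tendsto_mult uj tendsto_sum tendsto_const)
    fix i
    show "((\<lambda>y. green 1 (x i) y - (if i = j then of_real (1 / (4 * pi)) / of_real (norm (y - x j)) else 0)) \<longlongrightarrow> of_real (green_regular_part x i j)) (at (x j))"
    proof (cases "i = j")
      case True
      then show ?thesis using green_regular_part_tendsto[of "x j"] by (simp add: green_regular_part_def)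
    next
      case False
      then have "x i \<noteq> x j" using assms(1) by (auto dest: injD)
      have "complex_of_real (green_regular_part x i j) = green 1 (x i) (x j)"
        using False by (simp add: green_regular_part_def green_def exp_of_real[symmetric] del: exp_of_real)
      then show ?thesis using green_tendsto[OF \<open>x i \<noteq> x j\<close>, of 1] False by simp
    qed
  qed
  moreover have "u y + (\<Sum>i\<in>UNIV. c $ i * (green 1 (x i) y - (if i = j then of_real (1 / (4 * pi)) / of_real (norm (y - x j)) else 0)))
    = u y + (\<Sum>i\<in>UNIV. c $ i * green 1 (x i) y) - c $ j / of_real (4 * pi) / of_real (norm (y - x j))" for y
  proof -
    have "(\<Sum>i\<in>UNIV. c $ i * (if i = j then K else 0)) = c $ j * K" for K
      by (simp add: if_distrib[of "(*) _"] cong: if_cong)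
    then show ?thesis unfolding right_diff_distrib sum_subtractf by simp
  qed
  ultimately show "((\<lambda>y. u y + (\<Sum>i\<in>UNIV. c $ i * green 1 (x i) y) - c $ j / of_real (4 * pi) / of_real (norm (y - x j)))
      \<longlongrightarrow> u (x j) + (\<Sum>i\<in>UNIV. c $ i * of_real (green_regular_part x i j))) (at (x j))"
    by simp
qed

lemma L2_class_green_sum:
  fixes x :: "'m::finite \<Rightarrow> real ^ 3" and c :: "complex ^ 'm"
  assumes "Re k > 0"
  shows "square_integrable (\<lambda>y. \<Sum>i\<in>UNIV. c $ i * green k (x i) y)"
    "(\<Sum>i\<in>UNIV. c $ i *\<^sub>C L2_class (green k (x i))) = L2_class (\<lambda>y. \<Sum>i\<in>UNIV. c $ i * green k (x i) y)"
  using assms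
  by (auto intro!: square_integrable_sum square_integrable_scale square_integrable_green
      simp: L2_class_sum L2_class_scaleC square_integrable_scale square_integrable_green)

lemma L2_represents_add_green:
  fixes x :: "'m::finite \<Rightarrow> real ^ 3" and c :: "complex ^ 'm"
  assumes "Re k > 0" "L2_represents u w" "continuous_on UNIV u"
  shows "L2_represents (\<lambda>y. u y + (\<Sum>i\<in>UNIV. c $ i * green k (x i) y)) (w + (\<Sum>i\<in>UNIV. c $ i *\<^sub>C L2_class (green k (x i))))"
    "continuous_on (- range x) (\<lambda>y. u y + (\<Sum>i\<in>UNIV. c $ i * green k (x i) y))"
proof -
  show "L2_represents (\<lambda>y. u y + (\<Sum>i\<in>UNIV. c $ i * green k (x i) y)) (w + (\<Sum>i\<in>UNIV. c $ i *\<^sub>C L2_class (green k (x i))))"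
    using assms(2) L2_class_green_sum[OF assms(1), of c x]
    by (auto simp: L2_represents_def L2_class_add intro: square_integrable_add)
  show "continuous_on (- range x) (\<lambda>y. u y + (\<Sum>i\<in>UNIV. c $ i * green k (x i) y))"
    by (intro continuous_intros continuous_on_green continuous_on_subset[OF assms(3)]) auto
qed

lemma eventually_off_points:
  fixes x :: "'m::finite \<Rightarrow> real ^ 3"
  shows "\<forall>\<^sub>F y in at (x j). y \<notin> range x"
proof -
  have "open (- (range x - {x j}))" by (intro open_Compl finite_imp_closed) simp
  then have "\<forall>\<^sub>F y in nhds (x j). y \<in> - (range x - {x j})" by (rule eventually_nhds_in_open) simp
  then show ?thesis unfolding eventually_at_filter by eventually_elim auto
qed

text \<open>By continuity the sum vanishes everywhere off the centres; multiplied by the distance to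
  \<open>x j\<close> it tends to c_j / (4 \<pi>). So the Green functions are independent even modulo
  classes with continuous representatives.\<close>

lemma green_sum_coefficients_zero:
  fixes x :: "'m::finite \<Rightarrow> real ^ 3" and c :: "complex ^ 'm"
  assumes x: "inj x" and k: "Re k > 0" and u: "L2_represents u w" "continuous_on UNIV u"
    and 0: "w + (\<Sum>i\<in>UNIV. c $ i *\<^sub>C L2_class (green k (x i))) = 0"
  shows "c = 0"
proof -
  let ?v = "\<lambda>y. u y + (\<Sum>i\<in>UNIV. c $ i * green k (x i) y)"
  note v = L2_represents_add_green[OF k u, where c=c and x=x, unfolded 0]
  have z: "L2_represents (\<lambda>y. 0) (0 :: (real ^ 3) L2)"
    by (simp add: L2_represents_def square_integrable_zero L2_class_zero)
  have op: "open (- range x)" by (intro open_Compl finite_imp_closed) simp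
  have v0: "?v y = 0" if "y \<notin> range x" for y
    using L2_represents_unique[OF v(1) z op v(2)] that by simp
  have "c $ j = 0" for j
  proof -
    have ev: "\<forall>\<^sub>F y in at (x j). ?v y * of_real (norm (y - x j)) = 0"
      using eventually_off_points[of x j] by eventually_elim (simp add: v0)
    have "((\<lambda>y. 0) \<longlongrightarrow> c $ j / of_real (4 * pi)) (at (x j))"
      by (rule Lim_transform_eventually[OF singular_tendsto(1)[OF x u(2)] ev])
    then have "c $ j / of_real (4 * pi) = 0"
      by (rule tendsto_unique[OF at_neq_bot _ tendsto_const])
    then show ?thesis by simp
  qed
  then show ?thesis by (simp add: vec_eq_iff)
qed

lemma clin_indep_green:
  fixes x :: "'m::finite \<Rightarrow> real ^ 3"
  assumes "inj x" "Re k > 0"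
  shows "clin_indep (\<lambda>j. L2_class (green k (x j)))"
proof -
  have z: "L2_represents (\<lambda>y. 0) (0 :: (real ^ 3) L2)"
    by (simp add: L2_represents_def square_integrable_zero L2_class_zero)
  show ?thesis
    unfolding clin_indep_def using green_sum_coefficients_zero[OF assms z] by simp
qed

lemma clin_indep_green_class: "inj x \<Longrightarrow> clin_indep (green_class x)" for x :: "'m::finite \<Rightarrow> real ^ 3"
  using clin_indep_green[of x 1] by (simp add: green_class_def[abs_def])

section \<open>The adjoint of the minimal operator; closedness, density and symmetry\<close>

lemma minus_1_not_nonneg: "(- 1 :: complex) \<notin> complex_of_real ` {0..}"
proof
  assume "(- 1 :: complex) \<in> complex_of_real ` {0..}"
  then obtain r where "r \<ge> 0" "(- 1 :: complex) = of_real r" by auto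
  then have "Re (- 1) = r" by (metis Re_complex_of_real)
  then show False using \<open>r \<ge> 0\<close> by simp
qed

lemma adjoint_minimal_iff:
  fixes x :: "'m::finite \<Rightarrow> real ^ 3"
  assumes x: "inj x"
  shows "(g, h) \<in> adjoint_op (minimal_hamiltonian x) \<longleftrightarrow>
    (\<exists>w w' (c :: complex ^ 'm). (w, w') \<in> free_hamiltonian \<and>
       g = w + (\<Sum>j\<in>UNIV. c $ j *\<^sub>C green_class x j) \<and> h = w' - (\<Sum>j\<in>UNIV. c $ j *\<^sub>C green_class x j))"
proof
  assume gh: "(g, h) \<in> adjoint_op (minimal_hamiltonian x)"
  \<comment> \<open>The free operator plus 1 is onto; this \<open>w\<close> reproduces h + g, and
    what is left of \<open>g\<close> should be a combination of Green functions.\<close>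
  obtain w w' where w: "(w, w') \<in> free_hamiltonian" "w' - (- 1) *\<^sub>C w = h + g"
    by (rule free_hamiltonian_surjective[OF minus_1_not_nonneg])
  obtain c :: "complex ^ 'm" where c: "g - w = (\<Sum>j\<in>UNIV. c $ j *\<^sub>C green_class x j)"
  proof (rule orthogonal_to_annihilator[OF clin_indep_green_class[OF x], of "g - w"])
    \<comment> \<open>Again by surjectivity, every \<open>a\<close> orthogonal to the Green
      functions comes from an element of the minimal domain, to which the adjoint relation
      applies.\<close>
    fix a assume a: "\<And>j. cinner a (green_class x j) = 0"
    obtain f f' where f: "(f, f') \<in> free_hamiltonian" "f' - (- 1) *\<^sub>C f = a"
      by (rule free_hamiltonian_surjective[OF minus_1_not_nonneg])
    then have "(f, f') \<in> minimal_hamiltonian x" using a by (simp add: minimal_hamiltonian_iff_green_class)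
    then have "cinner f' g = cinner f h" using gh unfolding adjoint_op_iff by blast
    then have "cinner a g = cinner f (h + g)" using f(2) by (auto simp: cinner_add_left cinner_add_right)
    also have "\<dots> = cinner f w' + cinner f w" unfolding w(2)[symmetric] by (simp add: cinner_add_right)
    also have "\<dots> = cinner a w" using free_hamiltonian_symmetric[OF f(1) w(1)] f(2) by (auto simp: cinner_add_left)
    finally show "cinner a (g - w) = 0" by (simp add: cinner_diff_right)
  qed
  have "g = w + (\<Sum>j\<in>UNIV. c $ j *\<^sub>C green_class x j)" using c by (simp add: algebra_simps)
  moreover have "h = w' - (\<Sum>j\<in>UNIV. c $ j *\<^sub>C green_class x j)" using c w(2) by (simp add: algebra_simps)
  ultimately show "\<exists>w w' (c :: complex ^ 'm). (w, w') \<in> free_hamiltonian \<and>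
       g = w + (\<Sum>j\<in>UNIV. c $ j *\<^sub>C green_class x j) \<and> h = w' - (\<Sum>j\<in>UNIV. c $ j *\<^sub>C green_class x j)" using w(1) by blast
next
  assume "\<exists>w w' (c :: complex ^ 'm). (w, w') \<in> free_hamiltonian \<and>
       g = w + (\<Sum>j\<in>UNIV. c $ j *\<^sub>C green_class x j) \<and> h = w' - (\<Sum>j\<in>UNIV. c $ j *\<^sub>C green_class x j)"
  then obtain w w' and c :: "complex ^ 'm" where w: "(w, w') \<in> free_hamiltonian"
    "g = w + (\<Sum>j\<in>UNIV. c $ j *\<^sub>C green_class x j)" "h = w' - (\<Sum>j\<in>UNIV. c $ j *\<^sub>C green_class x j)" by blast
  show "(g, h) \<in> adjoint_op (minimal_hamiltonian x)"
    unfolding adjoint_op_iff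
  proof (intro allI impI)
    fix f f' assume "(f, f') \<in> minimal_hamiltonian x"
    then have f: "(f, f') \<in> free_hamiltonian" "\<And>j. cinner (f' + f) (green_class x j) = 0" by (simp_all add: minimal_hamiltonian_iff_green_class)
    have "cinner f' (\<Sum>j\<in>UNIV. c $ j *\<^sub>C green_class x j) + cinner f (\<Sum>j\<in>UNIV. c $ j *\<^sub>C green_class x j) = cinner (f' + f) (\<Sum>j\<in>UNIV. c $ j *\<^sub>C green_class x j)"
      by (simp add: cinner_add_left)
    also have "\<dots> = 0" unfolding cinner_sum_right cinner_scaleC_right f(2) by simp
    finally show "cinner f' g = cinner f h"
      using free_hamiltonian_symmetric[OF f(1) w(1)] unfolding w(2,3) by (simp add: cinner_add_right cinner_diff_right add_eq_0_iff)
  qed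
qed

lemma free_hamiltonian_single_valued:
  "(f, g) \<in> free_hamiltonian \<Longrightarrow> (f, h) \<in> free_hamiltonian \<Longrightarrow> g = h"
  by (auto simp: free_hamiltonian_def)

lemma free_hamiltonian_scale: "(f, h) \<in> free_hamiltonian \<Longrightarrow> (a *\<^sub>C f, a *\<^sub>C h) \<in> free_hamiltonian"
  and free_hamiltonian_add: "(f, h) \<in> free_hamiltonian \<Longrightarrow> (g, k) \<in> free_hamiltonian \<Longrightarrow> (f + g, h + k) \<in> free_hamiltonian"
  and free_hamiltonian_zero: "(0, 0) \<in> free_hamiltonian"
  using linear_relation_free_hamiltonian unfolding linear_relation_def by blast+

lemma free_hamiltonian_sum:
  "(\<And>i. i \<in> I \<Longrightarrow> (f i, h i) \<in> free_hamiltonian) \<Longrightarrow> ((\<Sum>i\<in>I. f i), (\<Sum>i\<in>I. h i)) \<in> free_hamiltonian"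
  by (induction I rule: infinite_finite_induct) (auto intro: free_hamiltonian_zero free_hamiltonian_add)

text \<open>The sum of the free domain and the span of the Green functions is direct, because
  elements of the former have continuous representatives.\<close>

lemma free_hamiltonian_add_green_unique:
  fixes x :: "'m::finite \<Rightarrow> real ^ 3" and c d :: "complex ^ 'm"
  assumes x: "inj x" and w: "(w, w') \<in> free_hamiltonian" and v: "(v, v') \<in> free_hamiltonian"
    and eq: "w + (\<Sum>j\<in>UNIV. c $ j *\<^sub>C green_class x j) = v + (\<Sum>j\<in>UNIV. d $ j *\<^sub>C green_class x j)"
  shows "c = d" "w = v" "w' = v'"
proof -
  have wv: "(w - v, w' - v') \<in> free_hamiltonian" by (rule linear_relation_diff[OF linear_relation_free_hamiltonian w v])
  obtain u where u: "L2_represents u (w - v)" "continuous_on UNIV u"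
    by (rule free_hamiltonian_continuous_rep_exists[OF wv])
  have "(w - v) + (\<Sum>j\<in>UNIV. (c - d) $ j *\<^sub>C L2_class (green 1 (x j))) = 0"
    using eq by (simp add: green_class_def cvec.scale_left_diff_distrib sum_subtractf algebra_simps)
  then have "c - d = 0" by (intro green_sum_coefficients_zero[OF x _ u]) simp_all
  then show "c = d" by simp
  then show "w = v" using eq by simp
  then show "w' = v'" using free_hamiltonian_single_valued w v by blast
qed

lemma linear_relation_minimal: "linear_relation (minimal_hamiltonian x)"
  unfolding linear_relation_def minimal_hamiltonian_iff_green_class
proof (intro conjI allI impI)
  fix f f' g g' :: "(real ^ 3) L2" and j
  assume "((f, f') \<in> free_hamiltonian \<and> (\<forall>j. cinner (f' + f) (green_class x j) = 0)) \<and> (g, g') \<in> free_hamiltonian \<and> (\<forall>j. cinner (g' + g) (green_class x j) = 0)"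
  moreover have "cinner (f' + g' + (f + g)) (green_class x j) = cinner (f' + f) (green_class x j) + cinner (g' + g) (green_class x j)"
    by (simp add: cinner_add_left)
  ultimately show "(f + g, f' + g') \<in> free_hamiltonian" "cinner (f' + g' + (f + g)) (green_class x j) = 0"
    by (simp_all add: free_hamiltonian_add)
next
  fix a and f f' :: "(real ^ 3) L2" and j
  assume "(f, f') \<in> free_hamiltonian \<and> (\<forall>j. cinner (f' + f) (green_class x j) = 0)"
  then show "(a *\<^sub>C f, a *\<^sub>C f') \<in> free_hamiltonian" "cinner (a *\<^sub>C f' + a *\<^sub>C f) (green_class x j) = 0"
    by (auto intro: free_hamiltonian_scale simp: cinner_scaleC_left simp flip: scaleC_add_right)
qed (auto intro: free_hamiltonian_zero)

lemma closed_minimal: "closed (minimal_hamiltonian x)"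
  unfolding closed_sequential_limits
proof (intro allI impI, elim conjE)
  fix r l assume r: "\<forall>n. r n \<in> minimal_hamiltonian x" "r \<longlonglongrightarrow> l"
  have l: "l \<in> free_hamiltonian"
    using closed_sequentially[OF free_hamiltonian_closed _ r(2)] r(1) minimal_hamiltonian_subset by blast
  have "cinner (snd l + fst l) (green_class x j) = 0" for j
  proof (rule LIMSEQ_unique)
    show "(\<lambda>n. cinner (snd (r n) + fst (r n)) (green_class x j)) \<longlonglongrightarrow> cinner (snd l + fst l) (green_class x j)"
      by (intro tendsto_cinner tendsto_add tendsto_fst[OF r(2)] tendsto_snd[OF r(2)] tendsto_const)
    have "cinner (snd (r n) + fst (r n)) (green_class x j) = 0" for n
      using r(1)[rule_format, of n] minimal_hamiltonian_iff_green_class[of "fst (r n)" "snd (r n)" x] by simp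
    then show "(\<lambda>n. cinner (snd (r n) + fst (r n)) (green_class x j)) \<longlonglongrightarrow> 0" by simp
  qed
  then have "(fst l, snd l) \<in> minimal_hamiltonian x" unfolding minimal_hamiltonian_iff_green_class using l by simp
  then show "l \<in> minimal_hamiltonian x" by simp
qed

text \<open>A vector \<open>v\<close> orthogonal to the domain gives a pair (0, v) in the adjoint;
  the unique decomposition of 0 forces v = 0. The adjoint is a relation here, so the argument makes
  sense before density is known.\<close>

lemma dense_minimal:
  fixes x :: "'m::finite \<Rightarrow> real ^ 3"
  assumes x: "inj x"
  shows "closure (Domain (minimal_hamiltonian x)) = UNIV"
proof (rule ccontr)
  let ?D = "Domain (minimal_hamiltonian x)"
  note lin = linear_relation_minimal[of x, unfolded linear_relation_def]
  assume "closure ?D \<noteq> UNIV"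
  then obtain y where y: "y \<notin> closure ?D" by blast
  have zero: "0 \<in> closure ?D" using lin closure_subset[of ?D] by (auto intro!: subsetD[OF closure_subset])
  have Dadd: "a + b \<in> ?D" if ab: "a \<in> ?D" "b \<in> ?D" for a b
  proof -
    from ab obtain a' b' where "(a, a') \<in> minimal_hamiltonian x" "(b, b') \<in> minimal_hamiltonian x" by auto
    then have "(a + b, a' + b') \<in> minimal_hamiltonian x" using lin by simp
    then show ?thesis by (rule DomainI)
  qed
  have Dscale: "t *\<^sub>C a \<in> ?D" if a: "a \<in> ?D" for t a
  proof -
    from a obtain a' where "(a, a') \<in> minimal_hamiltonian x" by auto
    then have "(t *\<^sub>C a, t *\<^sub>C a') \<in> minimal_hamiltonian x" using lin by simp
    then show ?thesis by (rule DomainI)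
  qed
  have add: "a + b \<in> closure ?D" if "a \<in> closure ?D" "b \<in> closure ?D" for a b
  proof -
    obtain r s where r: "\<forall>n. r n \<in> ?D" "r \<longlonglongrightarrow> a" and s: "\<forall>n. s n \<in> ?D" "s \<longlonglongrightarrow> b"
      using \<open>a \<in> closure ?D\<close> \<open>b \<in> closure ?D\<close> unfolding closure_sequential by blast
    have "\<forall>n. r n + s n \<in> ?D" using r(1) s(1) Dadd by simp
    then show ?thesis unfolding closure_sequential using tendsto_add[OF r(2) s(2)] by (intro exI[of _ "\<lambda>n. r n + s n"]) simp
  qed
  have scale: "t *\<^sub>C a \<in> closure ?D" if "a \<in> closure ?D" for t a
  proof -
    obtain r where r: "\<forall>n. r n \<in> ?D" "r \<longlonglongrightarrow> a" using \<open>a \<in> closure ?D\<close> unfolding closure_sequential by blast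
    have "\<forall>n. t *\<^sub>C r n \<in> ?D" using r(1) Dscale by simp
    then show ?thesis unfolding closure_sequential using tendsto_scaleC[OF r(2)] by (intro exI[of _ "\<lambda>n. t *\<^sub>C r n"]) simp
  qed
  show False
  proof (rule orthogonal_vector_exists[OF closed_closure zero add scale y])
    fix v assume v: "v \<noteq> 0" "\<And>u. u \<in> closure ?D \<Longrightarrow> cinner u v = 0"
    have "(0, v) \<in> adjoint_op (minimal_hamiltonian x)"
      unfolding adjoint_op_iff using v(2) closure_subset[of ?D] by (auto simp: Domain.simps subset_iff)
    then obtain w w' and c :: "complex ^ 'm" where w: "(w, w') \<in> free_hamiltonian"
      "0 = w + (\<Sum>j\<in>UNIV. c $ j *\<^sub>C green_class x j)" "v = w' - (\<Sum>j\<in>UNIV. c $ j *\<^sub>C green_class x j)"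
      unfolding adjoint_minimal_iff[OF x] by blast
    have "w + (\<Sum>j\<in>UNIV. c $ j *\<^sub>C green_class x j) = 0 + (\<Sum>j\<in>UNIV. (0 :: complex ^ 'm) $ j *\<^sub>C green_class x j)" using w(2) by simp
    from free_hamiltonian_add_green_unique[OF x w(1) free_hamiltonian_zero this] w(3) v(1) show False by simp
  qed
qed

lemma symmetric_minimal:
  fixes x :: "'m::finite \<Rightarrow> real ^ 3"
  assumes x: "inj x"
  shows "symmetric_operator (minimal_hamiltonian x)"
proof -
  have "single_valued (minimal_hamiltonian x)"
    by (auto simp: single_valued_def minimal_hamiltonian_def)
  moreover have "cinner f' g = cinner f g'" if "(f, f') \<in> minimal_hamiltonian x" "(g, g') \<in> minimal_hamiltonian x" for f f' g g'
    using free_hamiltonian_symmetric that minimal_hamiltonian_subset by blast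
  ultimately show ?thesis
    using linear_relation_minimal[of x] dense_minimal[OF x]
    unfolding symmetric_operator_def linear_operator_def linear_relation_def by blast
qed

section \<open>Defect subspaces\<close>

text \<open>A defect element at z is orthogonal to the range of the minimal operator minus
  \<open>cnj z\<close>. Since the free operator minus \<open>cnj z\<close> is onto, that range is
  exactly the orthogonal complement of the Green functions with k^2 = - z.\<close>

lemma defect_subspace_minimal:
  fixes x :: "'m::finite \<Rightarrow> real ^ 3"
  assumes x: "inj x" and z: "z \<notin> complex_of_real ` {0..}"
  shows "defect_subspace (minimal_hamiltonian x) z
    = {\<Sum>j\<in>UNIV. c $ j *\<^sub>C L2_class (green (- \<i> * sqrt_up z) (x j)) | c :: complex ^ 'm. True}"
proof -
  define k where "k = - \<i> * sqrt_up z"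
  have k: "Re k > 0" unfolding k_def using Im_sqrt_up_pos[OF z] by simp
  have k2: "k\<^sup>2 = - z" by (simp add: k_def power_mult_distrib sqrt_up_square)
  have ck: "Re (cnj k) > 0" using k by simp
  have ck2: "(cnj k)\<^sup>2 = - cnj z" using arg_cong[OF k2, of cnj] by simp
  note z' = cnj_not_nonneg[OF z]
  let ?g = "\<lambda>j. L2_class (green k (x j))"
  \<comment> \<open>The general description conjugates its parameter: applied with
    \<open>cnj k\<close>, it produces the Green functions for \<open>k\<close> and the factor
    \<open>cnj z\<close>.\<close>
  have H: "(f, h) \<in> minimal_hamiltonian x \<longleftrightarrow> (f, h) \<in> free_hamiltonian \<and> (\<forall>j. cinner (h - cnj z *\<^sub>C f) (?g j) = 0)" for f h
    unfolding minimal_hamiltonian_iff[OF ck] ck2 by simp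
  have "f \<in> defect_subspace (minimal_hamiltonian x) z \<longleftrightarrow> (\<exists>c :: complex ^ 'm. f = (\<Sum>j\<in>UNIV. c $ j *\<^sub>C ?g j))" for f
  proof
    assume "f \<in> defect_subspace (minimal_hamiltonian x) z"
    then have f: "(f, z *\<^sub>C f) \<in> adjoint_op (minimal_hamiltonian x)" by (simp add: defect_subspace_def)
    have "cinner a f = 0" if a: "\<And>j. cinner a (?g j) = 0" for a
    proof -
      obtain b b' where b: "(b, b') \<in> free_hamiltonian" "b' - cnj z *\<^sub>C b = a"
        by (rule free_hamiltonian_surjective[OF z'])
      then have "(b, b') \<in> minimal_hamiltonian x" unfolding H using a by simp
      then have "cinner b' f = cinner b (z *\<^sub>C f)" using f unfolding adjoint_op_iff by blast
      then show ?thesis unfolding b(2)[symmetric] by (simp add: cinner_diff_left cinner_scaleC_left cinner_scaleC_right)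
    qed
    from orthogonal_to_annihilator[OF clin_indep_green[OF x k] this]
    show "\<exists>c :: complex ^ 'm. f = (\<Sum>j\<in>UNIV. c $ j *\<^sub>C ?g j)" by blast
  next
    assume "\<exists>c :: complex ^ 'm. f = (\<Sum>j\<in>UNIV. c $ j *\<^sub>C ?g j)"
    then obtain c :: "complex ^ 'm" where f: "f = (\<Sum>j\<in>UNIV. c $ j *\<^sub>C ?g j)" by blast
    have "cinner b' f = cinner b (z *\<^sub>C f)" if "(b, b') \<in> minimal_hamiltonian x" for b b'
    proof -
      have "cinner (b' - cnj z *\<^sub>C b) (?g j) = 0" for j using that unfolding H by blast
      then have "cinner (b' - cnj z *\<^sub>C b) f = 0" unfolding f cinner_sum_right cinner_scaleC_right by simp
      then show ?thesis by (simp add: cinner_diff_left cinner_scaleC_left cinner_scaleC_right)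
    qed
    then show "f \<in> defect_subspace (minimal_hamiltonian x) z" unfolding defect_subspace_def adjoint_op_iff by blast
  qed
  then show ?thesis unfolding k_def by blast
qed

lemma cdim_defect_subspace:
  fixes x :: "'m::finite \<Rightarrow> real ^ 3"
  assumes "inj x" "z \<notin> complex_of_real ` {0..}"
  shows "cdim (defect_subspace (minimal_hamiltonian x) z) = enat CARD('m)"
  unfolding defect_subspace_minimal[OF assms]
  by (rule cdim_combinations[OF clin_indep_green[OF assms(1)]]) (use Im_sqrt_up_pos[OF assms(2)] in simp)

section \<open>Boundary values and the boundary triplet\<close>

lemma off_points_rep_eq:
  fixes x :: "'m::finite \<Rightarrow> real ^ 3"
  assumes "L2_represents v f" "continuous_on (- range x) v"
  shows "L2_represents (off_points_rep x f) f" "continuous_on (- range x) (off_points_rep x f)"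
    "y \<notin> range x \<Longrightarrow> off_points_rep x f y = v y"
proof -
  have "L2_represents (off_points_rep x f) f \<and> continuous_on (- range x) (off_points_rep x f)"
    unfolding off_points_rep_def by (rule someI[of "\<lambda>u. L2_represents u f \<and> continuous_on (- range x) u" v]) (simp add: assms)
  then show 1: "L2_represents (off_points_rep x f) f" "continuous_on (- range x) (off_points_rep x f)" by simp_all
  have "open (- range x)" by (intro open_Compl finite_imp_closed) simp
  from L2_represents_unique[OF 1(1) assms(1) this 1(2) assms(2)]
  show "y \<notin> range x \<Longrightarrow> off_points_rep x f y = v y" by simp
qed

text \<open>In the decomposition into \<open>w\<close> and Green functions the limits become
  algebra: \<open>Gamma0\<close> reads the coefficients, \<open>Gamma1\<close> the value of
  \<open>w\<close> at the centre plus a fixed matrix applied to them.\<close>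

lemma boundary_values:
  fixes x :: "'m::finite \<Rightarrow> real ^ 3" and c :: "complex ^ 'm"
  assumes x: "inj x" and w: "(w, w') \<in> free_hamiltonian"
  defines "f \<equiv> w + (\<Sum>j\<in>UNIV. c $ j *\<^sub>C green_class x j)"
  shows "L2_represents (off_points_rep x f) f" "continuous_on (- range x) (off_points_rep x f)"
    "((\<lambda>y. off_points_rep x f y * of_real (norm (y - x j))) \<longlongrightarrow> c $ j / of_real (4 * pi)) (at (x j))"
    "((\<lambda>y. off_points_rep x f y - c $ j / of_real (4 * pi) / of_real (norm (y - x j))) \<longlongrightarrow> Gamma1 x f $ j) (at (x j))"
    "Gamma0 x f = c"
    "Gamma1 x f $ j = cinner (w' + w) (green_class x j) + (\<Sum>i\<in>UNIV. c $ i * of_real (green_regular_part x i j))"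
proof -
  obtain u where u: "L2_represents u w" "continuous_on UNIV u"
    by (rule free_hamiltonian_continuous_rep_exists[OF w])
  let ?v = "\<lambda>y. u y + (\<Sum>i\<in>UNIV. c $ i * green 1 (x i) y)"
  have v: "L2_represents ?v f" "continuous_on (- range x) ?v"
    using L2_represents_add_green[OF _ u, where k=1 and c=c and x=x] by (simp_all add: f_def green_class_def)
  note off = off_points_rep_eq[OF v]
  show "L2_represents (off_points_rep x f) f" "continuous_on (- range x) (off_points_rep x f)" by (rule off)+
  have ev: "\<forall>\<^sub>F y in at (x j). ?v y = off_points_rep x f y" for j
    using eventually_off_points[of x j] by eventually_elim (simp add: off(3))
  have uj: "u (x j) = cinner (w' + w) (green_class x j)" for j
    using free_hamiltonian_value[OF w u, of 1 "x j"] by (simp add: green_class_def)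
  have 1: "((\<lambda>y. off_points_rep x f y * of_real (norm (y - x j))) \<longlongrightarrow> c $ j / of_real (4 * pi)) (at (x j))" for j
    by (rule Lim_transform_eventually[OF singular_tendsto(1)[OF x u(2), where k=1]]) (use ev[of j] in \<open>eventually_elim, simp\<close>)
  have 2: "((\<lambda>y. off_points_rep x f y - c $ j / of_real (4 * pi) / of_real (norm (y - x j)))
      \<longlongrightarrow> cinner (w' + w) (green_class x j) + (\<Sum>i\<in>UNIV. c $ i * of_real (green_regular_part x i j))) (at (x j))" for j
    unfolding uj[symmetric]
    by (rule Lim_transform_eventually[OF singular_tendsto(2)[OF x u(2)]]) (use ev[of j] in \<open>eventually_elim, simp\<close>)
  have s: "singular_coeff x f j = c $ j / of_real (4 * pi)" for j
    unfolding singular_coeff_def by (rule tendsto_Lim[OF at_neq_bot 1])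
  show "((\<lambda>y. off_points_rep x f y * of_real (norm (y - x j))) \<longlongrightarrow> c $ j / of_real (4 * pi)) (at (x j))" by (rule 1)
  show g1: "Gamma1 x f $ j = cinner (w' + w) (green_class x j) + (\<Sum>i\<in>UNIV. c $ i * of_real (green_regular_part x i j))"
    unfolding Gamma1_def vec_lambda_beta s by (rule tendsto_Lim[OF at_neq_bot 2])
  show "((\<lambda>y. off_points_rep x f y - c $ j / of_real (4 * pi) / of_real (norm (y - x j))) \<longlongrightarrow> Gamma1 x f $ j) (at (x j))"
    unfolding g1 by (rule 2)
  show "Gamma0 x f = c"
    by (simp add: Gamma0_def s vec_eq_iff)
qed

lemma boundary_triplet_minimal:
  fixes x :: "'m::finite \<Rightarrow> real ^ 3"
  assumes x: "inj x"
  shows "boundary_triplet (minimal_hamiltonian x) (Gamma0 x) (Gamma1 x)"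
proof -
  let ?A = "adjoint_op (minimal_hamiltonian x)"
  let ?S = "\<lambda>c :: complex ^ 'm. \<Sum>j\<in>UNIV. c $ j *\<^sub>C green_class x j"
  note bv = boundary_values(5,6)[OF x]
  have lin: "\<Gamma> (f + g) = \<Gamma> f + \<Gamma> g \<and> \<Gamma> (a *\<^sub>C f) = a *\<^sub>C \<Gamma> f"
    if \<Gamma>: "\<Gamma> \<in> {Gamma0 x, Gamma1 x}" and f: "f \<in> Domain ?A" and g: "g \<in> Domain ?A" for \<Gamma> f g a
  proof -
    from f obtain w w' c where w: "(w, w') \<in> free_hamiltonian" and f: "f = w + ?S c"
      by (auto simp: adjoint_minimal_iff[OF x])
    from g obtain v v' d where v: "(v, v') \<in> free_hamiltonian" and g: "g = v + ?S d"
      by (auto simp: adjoint_minimal_iff[OF x])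
    have fg: "f + g = (w + v) + ?S (c + d)"
      unfolding f g by (simp add: scaleC_add_left sum.distrib algebra_simps)
    have af: "a *\<^sub>C f = a *\<^sub>C w + ?S (a *\<^sub>C c)"
      unfolding f by (simp add: scaleC_add_right scaleC_vec_def scaleC_complex_def cvec.scale_sum_right)
    note wv = free_hamiltonian_add[OF w v] and aw = free_hamiltonian_scale[OF w, of a]
    have "Gamma0 x (f + g) = Gamma0 x f + Gamma0 x g" "Gamma0 x (a *\<^sub>C f) = a *\<^sub>C Gamma0 x f"
      unfolding fg af bv(1)[OF wv] bv(1)[OF aw] unfolding f g bv(1)[OF w] bv(1)[OF v] by (rule refl)+
    moreover have "Gamma1 x (f + g) = Gamma1 x f + Gamma1 x g"
    proof -
      have "Gamma1 x (f + g) $ i = Gamma1 x f $ i + Gamma1 x g $ i" for i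
        unfolding fg bv(2)[OF wv] unfolding f g bv(2)[OF w] bv(2)[OF v]
        by (simp add: cinner_add_left sum.distrib algebra_simps)
      then show ?thesis by (simp add: vec_eq_iff)
    qed
    moreover have "Gamma1 x (a *\<^sub>C f) = a *\<^sub>C Gamma1 x f"
    proof -
      have "Gamma1 x (a *\<^sub>C f) $ i = a * Gamma1 x f $ i" for i
        unfolding af bv(2)[OF aw] unfolding f bv(2)[OF w]
        by (simp add: scaleC_vec_def scaleC_complex_def cinner_scaleC_left cinner_add_left sum_distrib_left algebra_simps)
      then show ?thesis by (simp add: vec_eq_iff scaleC_vec_def scaleC_complex_def)
    qed
    ultimately show ?thesis using \<Gamma> by auto
  qed
  have green: "cinner f' g - cinner f g' = cinner (Gamma1 x f) (Gamma0 x g) - cinner (Gamma0 x f) (Gamma1 x g)"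
    if f: "(f, f') \<in> ?A" and g: "(g, g') \<in> ?A" for f f' g g'
  proof -
    from f obtain w w' c where w: "(w, w') \<in> free_hamiltonian" and f: "f = w + ?S c" "f' = w' - ?S c"
      unfolding adjoint_minimal_iff[OF x] by blast
    from g obtain v v' d where v: "(v, v') \<in> free_hamiltonian" and g: "g = v + ?S d" "g' = v' - ?S d"
      unfolding adjoint_minimal_iff[OF x] by blast
    \<comment> \<open>The free parts cancel by symmetry, and the products of the two Green sums
      cancel because the adjoint maps such a sum to its negative.\<close>
    have "cinner f' g - cinner f g' = cinner (w' + w) (?S d) - cinner (?S c) (v' + v)"
      unfolding f g using free_hamiltonian_symmetric[OF w v]
      by (simp add: cinner_add_left cinner_add_right cinner_diff_left cinner_diff_right)
    also have "cinner (w' + w) (?S d) = (\<Sum>j\<in>UNIV. cinner (w' + w) (green_class x j) * cnj (d $ j))"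
      by (simp add: cinner_sum_right cinner_scaleC_right mult.commute)
    also have "cinner (?S c) (v' + v) = (\<Sum>j\<in>UNIV. c $ j * cnj (cinner (v' + v) (green_class x j)))"
      unfolding cinner_sum_left cinner_scaleC_left by (simp only: cinner_commute[of "green_class x _"])
    finally have 1: "cinner f' g - cinner f g' = (\<Sum>j\<in>UNIV. cinner (w' + w) (green_class x j) * cnj (d $ j)) - (\<Sum>j\<in>UNIV. c $ j * cnj (cinner (v' + v) (green_class x j)))" .
    \<comment> \<open>The matrix of regular parts is real and symmetric, so it drops out of the
      boundary form.\<close>
    have "(\<Sum>j\<in>UNIV. (\<Sum>i\<in>UNIV. c $ i * of_real (green_regular_part x i j)) * cnj (d $ j)) = (\<Sum>j\<in>UNIV. c $ j * cnj (\<Sum>i\<in>UNIV. d $ i * of_real (green_regular_part x i j)))"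
    proof -
      have "(\<Sum>j\<in>UNIV. (\<Sum>i\<in>UNIV. c $ i * of_real (green_regular_part x i j)) * cnj (d $ j)) = (\<Sum>j\<in>UNIV. \<Sum>i\<in>UNIV. c $ i * (cnj (d $ j) * of_real (green_regular_part x j i)))"
        unfolding sum_distrib_right by (intro sum.cong refl) (simp add: green_regular_part_commute mult_ac)
      also have "\<dots> = (\<Sum>i\<in>UNIV. \<Sum>j\<in>UNIV. c $ i * (cnj (d $ j) * of_real (green_regular_part x j i)))" by (rule sum.swap)
      finally show ?thesis by (simp add: sum_distrib_left)
    qed
    then have "cinner (Gamma1 x f) (Gamma0 x g) - cinner (Gamma0 x f) (Gamma1 x g)
      = (\<Sum>j\<in>UNIV. cinner (w' + w) (green_class x j) * cnj (d $ j)) - (\<Sum>j\<in>UNIV. c $ j * cnj (cinner (v' + v) (green_class x j)))"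
      unfolding cinner_vec_def cinner_complex_def f(1) g(1) bv[OF w] bv[OF v]
      by (simp add: distrib_left distrib_right sum.distrib)
    with 1 show ?thesis by (simp only:)
  qed
  have "(a, b) \<in> (\<lambda>f. (Gamma0 x f, Gamma1 x f)) ` Domain ?A" for a b
  proof -
    \<comment> \<open>The values that the continuous part must take at the centres once
      \<open>a\<close> fixes the coefficients. Looking for w' + w in the span of the Green functions
      turns this into a Gram system.\<close>
    let ?d = "\<chi> j. b $ j - (\<Sum>i\<in>UNIV. a $ i * of_real (green_regular_part x i j))"
    obtain e :: "complex ^ 'm" where e: "\<And>j. cinner (\<Sum>i\<in>UNIV. e $ i *\<^sub>C green_class x i) (green_class x j) = ?d $ j"
      using gram_interpolation[OF clin_indep_green_class[OF x], of ?d] by blast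
    obtain w w' where w: "(w, w') \<in> free_hamiltonian" "w' - (- 1) *\<^sub>C w = ?S e"
      by (rule free_hamiltonian_surjective[OF minus_1_not_nonneg])
    have we: "w' + w = ?S e" using w(2) by simp
    have "w + ?S a \<in> Domain ?A" using w(1) by (auto simp: adjoint_minimal_iff[OF x] Domain_iff)
    moreover have "Gamma0 x (w + ?S a) = a" by (rule bv(1)[OF w(1)])
    moreover have "Gamma1 x (w + ?S a) = b"
      unfolding vec_eq_iff bv(2)[OF w(1)] we e by simp
    ultimately show ?thesis by (metis (mono_tags, lifting) image_eqI)
  qed
  then have "(\<lambda>f. (Gamma0 x f, Gamma1 x f)) ` Domain ?A = UNIV" by (auto simp: set_eq_iff)
  then show ?thesis
    unfolding boundary_triplet_def
    using closed_minimal symmetric_minimal[OF x] lin green by blast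
qed

section \<open>The explicit decomposition with exponentials\<close>

text \<open>exp (- r) / r is 4 \<pi> times the Green function for k = 1, which rescales the
  coefficients; the exponentials go to the free part.\<close>

lemma L2_class_explicit:
  fixes x :: "'m::finite \<Rightarrow> real ^ 3" and \<xi>\<^sub>0 \<xi>\<^sub>1 :: "complex ^ 'm"
  shows "L2_class (\<lambda>y. \<Sum>j\<in>UNIV. \<xi>\<^sub>0 $ j * of_real (exp (- norm (y - x j)) / norm (y - x j)) + \<xi>\<^sub>1 $ j * of_real (exp (- norm (y - x j))))
    = (\<Sum>j\<in>UNIV. \<xi>\<^sub>1 $ j *\<^sub>C L2_class (\<lambda>y. complex_of_real (exp (- norm (y - x j))))) + (\<Sum>j\<in>UNIV. (\<chi> j. 4 * of_real pi * \<xi>\<^sub>0 $ j) $ j *\<^sub>C green_class x j)"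
proof -
  have d: "complex_of_real (exp (- norm (y - x j)) / norm (y - x j)) = (4 * of_real pi) * green 1 (x j) y" for y j
    by (simp add: green_def exp_of_real[symmetric] del: exp_of_real)
  have sq: "square_integrable (\<lambda>y. \<xi>\<^sub>0 $ j * of_real (exp (- norm (y - x j)) / norm (y - x j)))"
    "square_integrable (\<lambda>y. \<xi>\<^sub>1 $ j * of_real (exp (- norm (y - x j))))" for j
    by (intro square_integrable_scale square_integrable_exp_div_norm square_integrable_exp_norm)+
  have "L2_class (\<lambda>y. \<xi>\<^sub>0 $ j * of_real (exp (- norm (y - x j)) / norm (y - x j))) = (4 * of_real pi * \<xi>\<^sub>0 $ j) *\<^sub>C green_class x j" for j
    unfolding d green_class_def by (subst L2_class_scaleC) (simp_all add: square_integrable_green mult_ac)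
  moreover have "L2_class (\<lambda>y. \<xi>\<^sub>1 $ j * of_real (exp (- norm (y - x j)))) = \<xi>\<^sub>1 $ j *\<^sub>C L2_class (\<lambda>y. complex_of_real (exp (- norm (y - x j))))" for j
    by (rule L2_class_scaleC[symmetric]) (rule square_integrable_exp_norm)
  ultimately have L: "L2_class (\<lambda>y. \<xi>\<^sub>0 $ j * of_real (exp (- norm (y - x j)) / norm (y - x j)) + \<xi>\<^sub>1 $ j * of_real (exp (- norm (y - x j))))
    = \<xi>\<^sub>1 $ j *\<^sub>C L2_class (\<lambda>y. complex_of_real (exp (- norm (y - x j)))) + (4 * of_real pi * \<xi>\<^sub>0 $ j) *\<^sub>C green_class x j" for j
    using L2_class_add[OF sq(1)[of j] sq(2)[of j]] by (simp only: add.commute)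
  show ?thesis
    by (subst L2_class_sum, intro square_integrable_add sq) (simp only: L sum.distrib vec_lambda_beta)
qed

lemma exp_sum_in_free_hamiltonian:
  fixes x :: "'m::finite \<Rightarrow> real ^ 3" and \<xi> :: "complex ^ 'm"
  defines "E \<equiv> \<lambda>j. L2_class (\<lambda>y. complex_of_real (exp (- norm (y - x j))))"
  assumes "(f, h) \<in> free_hamiltonian"
  shows "((\<Sum>j\<in>UNIV. \<xi> $ j *\<^sub>C E j) + f, (\<Sum>j\<in>UNIV. \<xi> $ j *\<^sub>C ((8 * of_real pi) *\<^sub>C green_class x j - E j)) + h) \<in> free_hamiltonian"
  using assms(2) exp_norm_in_free_hamiltonian unfolding E_def green_class_def
  by (intro free_hamiltonian_add free_hamiltonian_sum free_hamiltonian_scale)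

lemma minimal_part_exists:
  fixes x :: "'m::finite \<Rightarrow> real ^ 3"
  assumes x: "inj x" and w: "(w, w') \<in> free_hamiltonian"
  obtains \<xi> :: "complex ^ 'm" and f where "f \<in> Domain (minimal_hamiltonian x)"
    "w = (\<Sum>j\<in>UNIV. \<xi> $ j *\<^sub>C L2_class (\<lambda>y. complex_of_real (exp (- norm (y - x j))))) + f"
proof -
  let ?E = "\<lambda>j. L2_class (\<lambda>y. complex_of_real (exp (- norm (y - x j))))"
  obtain c :: "complex ^ 'm" where c: "\<And>j. cinner (\<Sum>i\<in>UNIV. c $ i *\<^sub>C green_class x i) (green_class x j) = (\<chi> j. cinner (w' + w) (green_class x j)) $ j"
    using gram_interpolation[OF clin_indep_green_class[OF x], of "\<chi> j. cinner (w' + w) (green_class x j)"] by blast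
  \<comment> \<open>The free operator plus 1 sends the j-th exponential to 8 \<pi> times the j-th
    Green function, so \<open>c\<close> has to be divided by 8 \<pi>.\<close>
  let ?\<xi> = "\<chi> j. c $ j / (8 * of_real pi)"
  let ?e = "\<Sum>j\<in>UNIV. ?\<xi> $ j *\<^sub>C ?E j" and ?e' = "\<Sum>j\<in>UNIV. ?\<xi> $ j *\<^sub>C ((8 * of_real pi) *\<^sub>C green_class x j - ?E j)"
  have e: "(?e, ?e') \<in> free_hamiltonian"
    using exp_sum_in_free_hamiltonian[OF free_hamiltonian_zero, of ?\<xi> x] by simp
  have "?e' + ?e = (\<Sum>j\<in>UNIV. c $ j *\<^sub>C green_class x j)"
    by (simp add: sum.distrib[symmetric] scaleC_add_right[symmetric])
  then have "cinner ((w' - ?e') + (w - ?e)) (green_class x j) = 0" for j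
    using c[of j] by (simp add: cinner_diff_left cinner_add_left algebra_simps)
  then have "(w - ?e, w' - ?e') \<in> minimal_hamiltonian x"
    using linear_relation_diff[OF linear_relation_free_hamiltonian w e] unfolding minimal_hamiltonian_iff_green_class by blast
  then show ?thesis by (intro that[of "w - ?e" ?\<xi>]) auto
qed

lemma L2_class_explicit_image:
  fixes x :: "'m::finite \<Rightarrow> real ^ 3" and \<xi>\<^sub>0 \<xi>\<^sub>1 :: "complex ^ 'm"
  defines "E \<equiv> \<lambda>j. L2_class (\<lambda>y. complex_of_real (exp (- norm (y - x j))))"
  shows "- L2_class (\<lambda>y. \<Sum>j\<in>UNIV. \<xi>\<^sub>0 $ j * of_real (exp (- norm (y - x j)) / norm (y - x j)) +
      \<xi>\<^sub>1 $ j * of_real (exp (- norm (y - x j)) - 2 * exp (- norm (y - x j)) / norm (y - x j)))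
    = (\<Sum>j\<in>UNIV. \<xi>\<^sub>1 $ j *\<^sub>C ((8 * of_real pi) *\<^sub>C green_class x j - E j)) - (\<Sum>j\<in>UNIV. (\<chi> j. 4 * of_real pi * \<xi>\<^sub>0 $ j) $ j *\<^sub>C green_class x j)"
proof -
  \<comment> \<open>The term with - 2 exp (- r) / r is moved to the first coefficient, which becomes
    \<open>\<xi>\<^sub>0 - 2 *\<^sub>C \<xi>\<^sub>1\<close>; then \<open>L2_class_explicit\<close>
    applies.\<close>
  have "L2_class (\<lambda>y. \<Sum>j\<in>UNIV. \<xi>\<^sub>0 $ j * of_real (exp (- norm (y - x j)) / norm (y - x j)) +
      \<xi>\<^sub>1 $ j * of_real (exp (- norm (y - x j)) - 2 * exp (- norm (y - x j)) / norm (y - x j)))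
    = L2_class (\<lambda>y. \<Sum>j\<in>UNIV. (\<xi>\<^sub>0 - 2 *\<^sub>C \<xi>\<^sub>1) $ j * of_real (exp (- norm (y - x j)) / norm (y - x j)) + \<xi>\<^sub>1 $ j * of_real (exp (- norm (y - x j))))"
    by (rule arg_cong[of _ _ L2_class], rule ext, rule sum.cong)
      (simp_all add: scaleC_vec_def scaleC_complex_def algebra_simps diff_divide_distrib)
  then show ?thesis
    unfolding L2_class_explicit E_def
    by (simp add: scaleC_vec_def scaleC_complex_def cvec.scale_right_diff_distrib cvec.scale_left_diff_distrib
        sum_subtractf right_diff_distrib mult_ac)
qed

theorem proposition4p1:
  fixes x :: "'m::finite \<Rightarrow> real ^ 3"
  assumes "inj x"
  defines "H \<equiv> minimal_hamiltonian x"
  shows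
    "(closed H \<and> symmetric_operator H \<and>
      deficiency_index_plus H = enat CARD('m) \<and> deficiency_index_minus H = enat CARD('m) \<and>
      (\<forall>z. z \<notin> complex_of_real ` {0..} \<longrightarrow>
        defect_subspace H z =
          {L2_class (\<lambda>y. \<Sum>j\<in>UNIV. c $ j *
             (exp (\<i> * sqrt_up z * of_real (norm (y - x j))) / of_real (4 * pi * norm (y - x j)))) |
           c :: complex ^ 'm. True}))
     \<and>
     (Domain (adjoint_op H) =
        {L2_class (\<lambda>y. \<Sum>j\<in>UNIV.
            \<xi>\<^sub>0 $ j * of_real (exp (- norm (y - x j)) / norm (y - x j)) +
            \<xi>\<^sub>1 $ j * of_real (exp (- norm (y - x j)))) + f\<^sub>H |
         (\<xi>\<^sub>0 :: complex ^ 'm) (\<xi>\<^sub>1 :: complex ^ 'm) f\<^sub>H. f\<^sub>H \<in> Domain H} \<and>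
      single_valued (adjoint_op H) \<and>
      (\<forall>(\<xi>\<^sub>0 :: complex ^ 'm) (\<xi>\<^sub>1 :: complex ^ 'm). \<forall>f\<^sub>H \<in> Domain H.
        (L2_class (\<lambda>y. \<Sum>j\<in>UNIV.
            \<xi>\<^sub>0 $ j * of_real (exp (- norm (y - x j)) / norm (y - x j)) +
            \<xi>\<^sub>1 $ j * of_real (exp (- norm (y - x j)))) + f\<^sub>H,
         - L2_class (\<lambda>y. \<Sum>j\<in>UNIV.
            \<xi>\<^sub>0 $ j * of_real (exp (- norm (y - x j)) / norm (y - x j)) +
            \<xi>\<^sub>1 $ j * of_real (exp (- norm (y - x j)) - 2 * exp (- norm (y - x j)) / norm (y - x j)))
           - laplacian f\<^sub>H) \<in> adjoint_op H))
     \<and>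
     ((\<forall>(\<xi>\<^sub>0 :: complex ^ 'm) (\<xi>\<^sub>1 :: complex ^ 'm). \<forall>f\<^sub>H \<in> Domain H. \<forall>f.
        f = L2_class (\<lambda>y. \<Sum>j\<in>UNIV.
            \<xi>\<^sub>0 $ j * of_real (exp (- norm (y - x j)) / norm (y - x j)) +
            \<xi>\<^sub>1 $ j * of_real (exp (- norm (y - x j)))) + f\<^sub>H \<longrightarrow>
        L2_represents (off_points_rep x f) f \<and>
        continuous_on (- range x) (off_points_rep x f) \<and>
        Gamma0 x f = (\<chi> j. 4 * of_real pi * \<xi>\<^sub>0 $ j) \<and>
        (\<forall>j. ((\<lambda>y. off_points_rep x f y * of_real (norm (y - x j))) \<longlongrightarrow> \<xi>\<^sub>0 $ j) (at (x j)) \<and>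
             ((\<lambda>y. off_points_rep x f y - \<xi>\<^sub>0 $ j / of_real (norm (y - x j))) \<longlongrightarrow> Gamma1 x f $ j)
               (at (x j)))) \<and>
      boundary_triplet H (Gamma0 x) (Gamma1 x))
     \<and>
     (let H\<^sub>0 = {(f, g) \<in> adjoint_op H. Gamma0 x f = 0}
      in H\<^sub>0 = adjoint_op H\<^sub>0 \<and> H\<^sub>0 = free_hamiltonian \<and> Domain H\<^sub>0 = sobolev 2)"
proof -
  have H: "H = minimal_hamiltonian x" unfolding H_def ..
  note x = \<open>inj x\<close>
  let ?E = "\<lambda>j. L2_class (\<lambda>y. complex_of_real (exp (- norm (y - x j))))"
  have i_not: "\<i> \<notin> complex_of_real ` {0..}" "- \<i> \<notin> complex_of_real ` {0..}" by (auto simp: complex_eq_iff)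
  have defect: "defect_subspace H z = {L2_class (\<lambda>y. \<Sum>j\<in>UNIV. c $ j *
      (exp (\<i> * sqrt_up z * of_real (norm (y - x j))) / of_real (4 * pi * norm (y - x j)))) | c :: complex ^ 'm. True}"
    if z: "z \<notin> complex_of_real ` {0..}" for z
  proof -
    \<comment> \<open>For this k the exponential exp (- k r) is exp (\<i> sqrt z r).\<close>
    have "Re (- \<i> * sqrt_up z) > 0" using Im_sqrt_up_pos[OF z] by simp
    from L2_class_green_sum(2)[OF this, of _ x] show ?thesis
      unfolding H defect_subspace_minimal[OF x z] by (simp add: green_def)
  qed
  have free: "(f, - laplacian f) \<in> free_hamiltonian" if "f \<in> Domain H" for f
    using that unfolding H minimal_hamiltonian_def free_hamiltonian_def by auto
  have image: "(L2_class (\<lambda>y. \<Sum>j\<in>UNIV. \<xi>\<^sub>0 $ j * of_real (exp (- norm (y - x j)) / norm (y - x j)) +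
            \<xi>\<^sub>1 $ j * of_real (exp (- norm (y - x j)))) + f\<^sub>H,
         - L2_class (\<lambda>y. \<Sum>j\<in>UNIV. \<xi>\<^sub>0 $ j * of_real (exp (- norm (y - x j)) / norm (y - x j)) +
            \<xi>\<^sub>1 $ j * of_real (exp (- norm (y - x j)) - 2 * exp (- norm (y - x j)) / norm (y - x j)))
           - laplacian f\<^sub>H) \<in> adjoint_op H" if f: "f\<^sub>H \<in> Domain H" for \<xi>\<^sub>0 \<xi>\<^sub>1 :: "complex ^ 'm" and f\<^sub>H
    \<comment> \<open>The free component consists of the exponentials and \<open>f\<^sub>H\<close>;
      the coefficients of the Green functions are 4 \<pi> times
      \<open>\<xi>\<^sub>0\<close>.\<close>
    unfolding H adjoint_minimal_iff[OF x] L2_class_explicit L2_class_explicit_image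
    by (rule exI, rule exI, rule exI[of _ "\<chi> j. 4 * of_real pi * \<xi>\<^sub>0 $ j"],
        rule conjI[OF exp_sum_in_free_hamiltonian[OF free[OF f], of \<xi>\<^sub>1 x]]) (simp add: algebra_simps)
  have dom: "Domain (adjoint_op H) = {L2_class (\<lambda>y. \<Sum>j\<in>UNIV.
            \<xi>\<^sub>0 $ j * of_real (exp (- norm (y - x j)) / norm (y - x j)) +
            \<xi>\<^sub>1 $ j * of_real (exp (- norm (y - x j)))) + f\<^sub>H |
         (\<xi>\<^sub>0 :: complex ^ 'm) (\<xi>\<^sub>1 :: complex ^ 'm) f\<^sub>H. f\<^sub>H \<in> Domain H}" (is "_ = ?D")
  proof (intro equalityI subsetI)
    \<comment> \<open>The free component is split once more, into exponentials and an element of the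
      minimal domain, and the Green coefficients are divided by 4 \<pi>.\<close>
    fix g assume "g \<in> Domain (adjoint_op H)"
    then obtain w w' and c :: "complex ^ 'm" where w: "(w, w') \<in> free_hamiltonian" "g = w + (\<Sum>j\<in>UNIV. c $ j *\<^sub>C green_class x j)"
      unfolding H by (auto simp: adjoint_minimal_iff[OF x])
    obtain \<xi>\<^sub>1 :: "complex ^ 'm" and f where f: "f \<in> Domain H" "w = (\<Sum>j\<in>UNIV. \<xi>\<^sub>1 $ j *\<^sub>C ?E j) + f"
      unfolding H by (rule minimal_part_exists[OF x w(1)])
    let ?\<xi>\<^sub>0 = "\<chi> j. c $ j / (4 * of_real pi)"
    have "(\<chi> j. 4 * of_real pi * ?\<xi>\<^sub>0 $ j) = c" by (simp add: vec_eq_iff)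
    then have "g = L2_class (\<lambda>y. \<Sum>j\<in>UNIV. ?\<xi>\<^sub>0 $ j * of_real (exp (- norm (y - x j)) / norm (y - x j)) +
            \<xi>\<^sub>1 $ j * of_real (exp (- norm (y - x j)))) + f"
      unfolding L2_class_explicit w(2) f(2) by (simp only: add_ac)
    then show "g \<in> ?D" using f(1) by blast
  next
    fix g assume "g \<in> ?D"
    then show "g \<in> Domain (adjoint_op H)" using image by blast
  qed
  have single: "single_valued (adjoint_op H)"
    unfolding single_valued_def H
  proof (intro allI impI)
    fix g h k assume "(g, h) \<in> adjoint_op (minimal_hamiltonian x)" "(g, k) \<in> adjoint_op (minimal_hamiltonian x)"
    then obtain w w' v v' and c d :: "complex ^ 'm" where
      w: "(w, w') \<in> free_hamiltonian" "g = w + (\<Sum>j\<in>UNIV. c $ j *\<^sub>C green_class x j)" "h = w' - (\<Sum>j\<in>UNIV. c $ j *\<^sub>C green_class x j)" and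
      v: "(v, v') \<in> free_hamiltonian" "g = v + (\<Sum>j\<in>UNIV. d $ j *\<^sub>C green_class x j)" "k = v' - (\<Sum>j\<in>UNIV. d $ j *\<^sub>C green_class x j)"
      unfolding adjoint_minimal_iff[OF x] by blast
    from free_hamiltonian_add_green_unique[OF x w(1) v(1) trans[OF w(2)[symmetric] v(2)]]
    show "h = k" using w(3) v(3) by simp
  qed
  have limits: "L2_represents (off_points_rep x f) f \<and>
        continuous_on (- range x) (off_points_rep x f) \<and>
        Gamma0 x f = (\<chi> j. 4 * of_real pi * \<xi>\<^sub>0 $ j) \<and>
        (\<forall>j. ((\<lambda>y. off_points_rep x f y * of_real (norm (y - x j))) \<longlongrightarrow> \<xi>\<^sub>0 $ j) (at (x j)) \<and>
             ((\<lambda>y. off_points_rep x f y - \<xi>\<^sub>0 $ j / of_real (norm (y - x j))) \<longlongrightarrow> Gamma1 x f $ j)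
               (at (x j)))"
    if f: "f\<^sub>H \<in> Domain H" and f_eq: "f = L2_class (\<lambda>y. \<Sum>j\<in>UNIV.
            \<xi>\<^sub>0 $ j * of_real (exp (- norm (y - x j)) / norm (y - x j)) +
            \<xi>\<^sub>1 $ j * of_real (exp (- norm (y - x j)))) + f\<^sub>H" for \<xi>\<^sub>0 \<xi>\<^sub>1 :: "complex ^ 'm" and f\<^sub>H f
  proof -
    let ?c = "\<chi> j. 4 * of_real pi * \<xi>\<^sub>0 $ j"
    have "f = ((\<Sum>j\<in>UNIV. \<xi>\<^sub>1 $ j *\<^sub>C ?E j) + f\<^sub>H) + (\<Sum>j\<in>UNIV. ?c $ j *\<^sub>C green_class x j)"
      unfolding f_eq L2_class_explicit by (simp only: add_ac)
    note bv = boundary_values[OF x exp_sum_in_free_hamiltonian[OF free[OF f], of \<xi>\<^sub>1 x], of ?c, folded this]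
    have c: "?c $ j / of_real (4 * pi) = \<xi>\<^sub>0 $ j" for j by simp
    show ?thesis using bv(1,2,5) bv(3,4)[unfolded c] by blast
  qed
  have kernel: "{(f, g) \<in> adjoint_op H. Gamma0 x f = 0} = free_hamiltonian"
  proof (intro equalityI subrelI)
    fix f g assume "(f, g) \<in> {(f, g) \<in> adjoint_op H. Gamma0 x f = 0}"
    then obtain w w' and c :: "complex ^ 'm" where w: "(w, w') \<in> free_hamiltonian" "f = w + (\<Sum>j\<in>UNIV. c $ j *\<^sub>C green_class x j)"
      "g = w' - (\<Sum>j\<in>UNIV. c $ j *\<^sub>C green_class x j)" and 0: "Gamma0 x f = 0"
      unfolding H by (auto simp: adjoint_minimal_iff[OF x])
    \<comment> \<open>\<open>Gamma0\<close> returns exactly the coefficients of the Green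
      functions.\<close>
    have "c = 0" using boundary_values(5)[OF x w(1), of c] 0 w(2) by simp
    then show "(f, g) \<in> free_hamiltonian" using w by simp
  next
    fix f g assume fg: "(f, g) \<in> free_hamiltonian"
    have "(f, g) \<in> adjoint_op H"
      unfolding H adjoint_minimal_iff[OF x] using fg by (intro exI[of _ f] exI[of _ g] exI[of _ 0]) simp
    moreover have "Gamma0 x f = 0" using boundary_values(5)[OF x fg, of 0] by simp
    ultimately show "(f, g) \<in> {(f, g) \<in> adjoint_op H. Gamma0 x f = 0}" by simp
  qed
  have "Domain free_hamiltonian = sobolev 2" by (auto simp: free_hamiltonian_def)
  then have part_iv: "let H\<^sub>0 = {(f, g) \<in> adjoint_op H. Gamma0 x f = 0}
      in H\<^sub>0 = adjoint_op H\<^sub>0 \<and> H\<^sub>0 = free_hamiltonian \<and> Domain H\<^sub>0 = sobolev 2"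
    unfolding kernel Let_def by (simp add: adjoint_free_hamiltonian)
  have part_i: "closed H" "symmetric_operator H" "deficiency_index_plus H = enat CARD('m)" "deficiency_index_minus H = enat CARD('m)"
    unfolding H deficiency_index_plus_def deficiency_index_minus_def
    using closed_minimal symmetric_minimal[OF x] cdim_defect_subspace[OF x] i_not by simp_all
  have triplet: "boundary_triplet H (Gamma0 x) (Gamma1 x)" unfolding H by (rule boundary_triplet_minimal[OF x])
  show ?thesis
    apply (intro conjI allI impI ballI part_i triplet part_iv dom single)
    subgoal by (rule defect)
    subgoal by (rule image)
    subgoal by (rule limits[THEN conjunct1])
    subgoal by (rule limits[THEN conjunct2, THEN conjunct1])
    subgoal by (rule limits[THEN conjunct2, THEN conjunct2, THEN conjunct1])
    subgoal using limits by blast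
    subgoal using limits by blast
    done
qed

end
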